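(* Let $\Omega,\Omega'$ be domains in $\mathbb C$ and let $A\in M^{2\times 2}(\Omega)$. Then a homeomorphism $\varphi:\Omega\to\Omega'$ is an $A$-quasiconformal mapping if and only if $\varphi$ induces, by the composition rule $\varphi^{*}(f)=f\circ\varphi$, an isometry of the Sobolev spaces $L^{1,2}_A(\Omega)$ and $L^{1,2}(\Omega')$: $$\|\varphi^{*}(f)\,|\,L^{1,2}_A(\Omega)\|=\|f\,|\,L^{1,2}(\Omega')\|$$ for any $f\in L^{1,2}(\Omega')$.
   Context: $M^{2\times2}(\Omega)$ is the class of all $2\times 2$ symmetric matrix functions $A(z)=\{a_{kl}(z)\}$ on $\Omega$ with measurable (real) entries such that $\det A=1$ a.e. in $\Omega$ and, for some $1\le K<\infty$, $\frac1K|\xi|^2\le\langle A(z)\xi,\xi\rangle\le K|\xi|^2$ for a.e. $z\in\Omega$ and every $\xi\in\mathbb C\cong\mathbb R^2$. A homeomorphism $\varphi:\Omega\to\Omega'$ is $K$-quasiconformal ($1\le K<\infty$) if $\varphi\in W^{1,2}_{\mathrm{loc}}(\Omega)$ and $|D\varphi(z)|^2\le K|J(z,\varphi)|$ for a.e. $z\in\Omega$, where $|D\varphi|$ is the operator norm of the differential and $J$ the Jacobian determinant; it is quasiconformal if it is $K$-quasiconformal for some $K$. For $A\in M^{2\times2}(\Omega)$, an $A$-quasiconformal mapping is a quasiconformal mapping $\varphi$ of $\Omega$ satisfying the Beltrami equation $\varphi_{\overline z}(z)=\mu(z)\varphi_z(z)$ a.e. in $\Omega$ with complex dilatation $$\mu(z)=\frac{a_{22}(z)-a_{11}(z)-2ia_{12}(z)}{\det(I+A(z))},$$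 where $I$ is the identity matrix, $\varphi_z=\frac12(\varphi_x-i\varphi_y)$, $\varphi_{\overline z}=\frac12(\varphi_x+i\varphi_y)$. $L^{1,2}(\Omega')$ is the space of locally integrable weakly differentiable functions $f:\Omega'\to\mathbb R$ with finite seminorm $\|f\,|\,L^{1,2}(\Omega')\|=\left(\iint_{\Omega'}|\nabla f|^2\,du\,dv\right)^{1/2}$. $L^{1,2}_A(\Omega)$ is the space of locally integrable weakly differentiable functions $f:\Omega\to\mathbb R$ with finite seminorm $\|f\,|\,L^{1,2}_A(\Omega)\|=\left(\iint_\Omega\langle A(z)\nabla f(z),\nabla f(z)\rangle\,dx\,dy\right)^{1/2}$.
   Formalization: In the "if" direction the homeomorphism is additionally assumed orientation-preserving; without this the claim fails, e.g. for A = I and complex conjugation on the plane, which preserves all Dirichlet seminorms but violates the Beltrami equation. *)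

theory Defs
  imports "HOL-Complex_Analysis.Complex_Analysis"
begin

section \<open>Weak gradients on planar open sets\<close>

text \<open>The complex plane is identified with \<open>\<real>\<^sup>2\<close> through \<open>z = x + \<i> y\<close>: the directions of
  \<open>\<partial>/\<partial>x\<close> and \<open>\<partial>/\<partial>y\<close> are \<open>1\<close> and \<open>\<i>\<close>, and gradients take values in \<^typ>\<open>real^2\<close>.
  Functions on \<open>\<Omega>\<close> are total HOL functions; every notion below depends only on their values
  on \<open>\<Omega>\<close>.\<close>

definition dir_deriv :: "complex \<Rightarrow> (complex \<Rightarrow> real) \<Rightarrow> complex \<Rightarrow> real" where
  "dir_deriv v f z = frechet_derivative f (at z) v"

primrec C_k :: "nat \<Rightarrow> (complex \<Rightarrow> real) \<Rightarrow> bool" where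
  "C_k 0 f \<longleftrightarrow> continuous_on UNIV f"
| "C_k (Suc k) f \<longleftrightarrow>
     (\<forall>z. f differentiable (at z)) \<and> C_k k (dir_deriv 1 f) \<and> C_k k (dir_deriv \<i> f)"

definition test_functions :: "complex set \<Rightarrow> (complex \<Rightarrow> real) set" where
  "test_functions \<Omega> =
     {\<eta>. (\<forall>k. C_k k \<eta>) \<and> compact (closure {z. \<eta> z \<noteq> 0}) \<and> closure {z. \<eta> z \<noteq> 0} \<subseteq> \<Omega>}"

definition locally_integrable :: "complex set \<Rightarrow> (complex \<Rightarrow> real) \<Rightarrow> bool" where
  "locally_integrable \<Omega> f \<longleftrightarrow> (\<forall>C. compact C \<and> C \<subseteq> \<Omega> \<longrightarrow> set_integrable lebesgue C f)"

definition is_weak_gradient ::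
    "complex set \<Rightarrow> (complex \<Rightarrow> real) \<Rightarrow> (complex \<Rightarrow> real^2) \<Rightarrow> bool" where
  "is_weak_gradient \<Omega> f G \<longleftrightarrow>
     (\<forall>i. locally_integrable \<Omega> (\<lambda>z. G z $ i)) \<and>
     (\<forall>\<eta>\<in>test_functions \<Omega>.
        (LINT z:\<Omega>|lebesgue. f z * dir_deriv 1 \<eta> z) = - (LINT z:\<Omega>|lebesgue. G z $ 1 * \<eta> z) \<and>
        (LINT z:\<Omega>|lebesgue. f z * dir_deriv \<i> \<eta> z) = - (LINT z:\<Omega>|lebesgue. G z $ 2 * \<eta> z))"

definition weakly_differentiable :: "complex set \<Rightarrow> (complex \<Rightarrow> real) \<Rightarrow> bool" where
  "weakly_differentiable \<Omega> f \<longleftrightarrow> locally_integrable \<Omega> f \<and> (\<exists>G. is_weak_gradient \<Omega> f G)"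

text \<open>The weak gradient is determined only up to null sets; all uses below are insensitive to
  the representative that is picked.\<close>

definition weak_gradient :: "complex set \<Rightarrow> (complex \<Rightarrow> real) \<Rightarrow> complex \<Rightarrow> real^2" where
  "weak_gradient \<Omega> f = (SOME G. is_weak_gradient \<Omega> f G)"


section \<open>The Sobolev spaces and the matrix class\<close>

definition L12 :: "complex set \<Rightarrow> (complex \<Rightarrow> real) set" where
  "L12 \<Omega> = {f. weakly_differentiable \<Omega> f \<and>
               set_integrable lebesgue \<Omega> (\<lambda>z. (norm (weak_gradient \<Omega> f z))\<^sup>2)}"

definition L12_seminorm :: "complex set \<Rightarrow> (complex \<Rightarrow> real) \<Rightarrow> real" where
  "L12_seminorm \<Omega> f = sqrt (LINT z:\<Omega>|lebesgue. (norm (weak_gradient \<Omega> f z))\<^sup>2)"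

definition L12A :: "(complex \<Rightarrow> real^2^2) \<Rightarrow> complex set \<Rightarrow> (complex \<Rightarrow> real) set" where
  "L12A A \<Omega> = {f. weakly_differentiable \<Omega> f \<and>
     set_integrable lebesgue \<Omega> (\<lambda>z. (A z *v weak_gradient \<Omega> f z) \<bullet> weak_gradient \<Omega> f z)}"

definition L12A_seminorm ::
    "(complex \<Rightarrow> real^2^2) \<Rightarrow> complex set \<Rightarrow> (complex \<Rightarrow> real) \<Rightarrow> real" where
  "L12A_seminorm A \<Omega> f =
     sqrt (LINT z:\<Omega>|lebesgue. (A z *v weak_gradient \<Omega> f z) \<bullet> weak_gradient \<Omega> f z)"

definition W12_loc :: "complex set \<Rightarrow> (complex \<Rightarrow> real) set" where
  "W12_loc \<Omega> = {f. weakly_differentiable \<Omega> f \<and>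
     (\<forall>C. compact C \<and> C \<subseteq> \<Omega> \<longrightarrow>
        set_integrable lebesgue C (\<lambda>z. (f z)\<^sup>2) \<and>
        set_integrable lebesgue C (\<lambda>z. (norm (weak_gradient \<Omega> f z))\<^sup>2))}"

definition M22 :: "complex set \<Rightarrow> (complex \<Rightarrow> real^2^2) set" where
  "M22 \<Omega> = {A.
     (\<forall>z\<in>\<Omega>. transpose (A z) = A z) \<and>
     (\<forall>k l. (\<lambda>z. A z $ k $ l) \<in> borel_measurable (lebesgue_on \<Omega>)) \<and>
     (AE z in lebesgue_on \<Omega>. det (A z) = 1) \<and>
     (\<exists>K\<ge>1. AE z in lebesgue_on \<Omega>. \<forall>\<xi>.
        1 / K * (norm \<xi>)\<^sup>2 \<le> (A z *v \<xi>) \<bullet> \<xi> \<and> (A z *v \<xi>) \<bullet> \<xi> \<le> K * (norm \<xi>)\<^sup>2)}"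


section \<open>Quasiconformal mappings\<close>

text \<open>Rows of the weak differential are the weak gradients of the real and imaginary parts.\<close>

definition weak_differential :: "complex set \<Rightarrow> (complex \<Rightarrow> complex) \<Rightarrow> complex \<Rightarrow> real^2^2" where
  "weak_differential \<Omega> \<phi> z =
     vector [weak_gradient \<Omega> (\<lambda>w. Re (\<phi> w)) z, weak_gradient \<Omega> (\<lambda>w. Im (\<phi> w)) z]"

definition weak_dx :: "complex set \<Rightarrow> (complex \<Rightarrow> complex) \<Rightarrow> complex \<Rightarrow> complex" where
  "weak_dx \<Omega> \<phi> z = Complex (weak_differential \<Omega> \<phi> z $ 1 $ 1) (weak_differential \<Omega> \<phi> z $ 2 $ 1)"

definition weak_dy :: "complex set \<Rightarrow> (complex \<Rightarrow> complex) \<Rightarrow> complex \<Rightarrow> complex" where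
  "weak_dy \<Omega> \<phi> z = Complex (weak_differential \<Omega> \<phi> z $ 1 $ 2) (weak_differential \<Omega> \<phi> z $ 2 $ 2)"

definition weak_dz :: "complex set \<Rightarrow> (complex \<Rightarrow> complex) \<Rightarrow> complex \<Rightarrow> complex" where
  "weak_dz \<Omega> \<phi> z = 1 / 2 * (weak_dx \<Omega> \<phi> z - \<i> * weak_dy \<Omega> \<phi> z)"

definition weak_dzbar :: "complex set \<Rightarrow> (complex \<Rightarrow> complex) \<Rightarrow> complex \<Rightarrow> complex" where
  "weak_dzbar \<Omega> \<phi> z = 1 / 2 * (weak_dx \<Omega> \<phi> z + \<i> * weak_dy \<Omega> \<phi> z)"

definition K_quasiconformal ::
    "real \<Rightarrow> complex set \<Rightarrow> complex set \<Rightarrow> (complex \<Rightarrow> complex) \<Rightarrow> bool" where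
  "K_quasiconformal K \<Omega> \<Omega>' \<phi> \<longleftrightarrow>
     1 \<le> K \<and> (\<exists>\<psi>. homeomorphism \<Omega> \<Omega>' \<phi> \<psi>) \<and>
     (\<lambda>z. Re (\<phi> z)) \<in> W12_loc \<Omega> \<and> (\<lambda>z. Im (\<phi> z)) \<in> W12_loc \<Omega> \<and>
     (AE z in lebesgue_on \<Omega>.
        (onorm ((*v) (weak_differential \<Omega> \<phi> z)))\<^sup>2 \<le> K * \<bar>det (weak_differential \<Omega> \<phi> z)\<bar>)"

definition quasiconformal :: "complex set \<Rightarrow> complex set \<Rightarrow> (complex \<Rightarrow> complex) \<Rightarrow> bool" where
  "quasiconformal \<Omega> \<Omega>' \<phi> \<longleftrightarrow> (\<exists>K. K_quasiconformal K \<Omega> \<Omega>' \<phi>)"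

definition complex_dilatation :: "(complex \<Rightarrow> real^2^2) \<Rightarrow> complex \<Rightarrow> complex" where
  "complex_dilatation A z =
     (of_real (A z $ 2 $ 2) - of_real (A z $ 1 $ 1) - 2 * \<i> * of_real (A z $ 1 $ 2))
       / of_real (det (mat 1 + A z))"

definition A_quasiconformal ::
    "(complex \<Rightarrow> real^2^2) \<Rightarrow> complex set \<Rightarrow> complex set \<Rightarrow> (complex \<Rightarrow> complex) \<Rightarrow> bool" where
  "A_quasiconformal A \<Omega> \<Omega>' \<phi> \<longleftrightarrow>
     quasiconformal \<Omega> \<Omega>' \<phi> \<and>
     (AE z in lebesgue_on \<Omega>. weak_dzbar \<Omega> \<phi> z = complex_dilatation A z * weak_dz \<Omega> \<phi> z)"

definition induces_isometry ::
    "(complex \<Rightarrow> real^2^2) \<Rightarrow> complex set \<Rightarrow> complex set \<Rightarrow> (complex \<Rightarrow> complex) \<Rightarrow> bool" where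
  "induces_isometry A \<Omega> \<Omega>' \<phi> \<longleftrightarrow>
     (\<forall>f\<in>L12 \<Omega>'. f \<circ> \<phi> \<in> L12A A \<Omega> \<and> L12A_seminorm A \<Omega> (f \<circ> \<phi>) = L12_seminorm \<Omega>' f)"

text \<open>Topological orientation (no differentiability is presupposed): images of small circles
  wind once, positively, around the image of the centre. The Beltrami equation distinguishes
  \<open>\<phi>\<close> from its complex conjugate, whereas the two induce the same seminorms; so an isometry
  determines the Beltrami equation only for orientation-preserving homeomorphisms.\<close>

definition orientation_preserving :: "complex set \<Rightarrow> (complex \<Rightarrow> complex) \<Rightarrow> bool" where
  "orientation_preserving \<Omega> \<phi> \<longleftrightarrow>
     (\<forall>z r. 0 < r \<and> cball z r \<subseteq> \<Omega> \<longrightarrow> winding_number (\<phi> \<circ> circlepath z r) (\<phi> z) = 1)"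

end

theory Submission
  imports Defs
begin

text \<open>A homeomorphism \<open>\<phi>\<close> with components in \<open>W\<^sup>1\<^sup>,\<^sup>2\<close> and Jacobian \<open>J \<ge> 0\<close> pushes the measure \<open>J dz\<close>
  forward to Lebesgue measure: Stokes' theorem and mollification express integrals of \<open>J\<close> over
  rectangles by the winding numbers of the image of the boundary, and these are \<open>\<plusminus>1\<close>. If \<open>\<phi>\<close> is
  quasiconformal, integration by parts shows that \<open>\<phi>\<^sup>-\<^sup>1\<close> is in \<open>W\<^sup>1\<^sup>,\<^sup>2\<close> as well, so \<open>J > 0\<close> almost
  everywhere, null sets pull back to null sets, and composition with \<open>\<phi>\<close> preserves weak
  differentiability and obeys the chain rule. The Beltrami equation says \<open>D\<phi> A D\<phi>\<^sup>T = J I\<close>, hence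
  \<open>\<langle>A \<nabla>(f \<circ> \<phi>), \<nabla>(f \<circ> \<phi>)\<rangle> = J |\<nabla>f|\<^sup>2 \<circ> \<phi>\<close>, and the change of variables gives the isometry.

  Conversely, an isometry applied to cut-off coordinate functions yields \<open>\<phi> \<in> W\<^sup>1\<^sup>,\<^sup>2\<close> locally. Applied to
  \<open>j cos(\<xi> \<cdot> w)\<close> and \<open>j sin(\<xi> \<cdot> w)\<close> it shows that \<open>\<langle>D\<phi> A D\<phi>\<^sup>T \<xi>, \<xi>\<rangle> dz\<close> is pushed forward to \<open>|\<xi>|\<^sup>2\<close> times
  Lebesgue measure for every \<open>\<xi>\<close>, so that \<open>D\<phi> A D\<phi>\<^sup>T = \<lambda> I\<close> with \<open>\<lambda> = |J|\<close>. For orientation-preserving \<open>\<phi>\<close>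
  the degree formula gives \<open>J\<close> the same push-forward as \<open>\<lambda>\<close>, so \<open>J = \<lambda>\<close>, which is the Beltrami equation.\<close>


text \<open>Two obstacles shape the proof. A function in \<open>L12\<close> is only an
  almost-everywhere class and need not be continuous, so f \<circ> \<phi> makes sense only once
  preimages of null sets are known to be null; the inverse mapping is studied for this reason.
  Moreover J is not bounded below, so L1 convergence of mollifications of f does not carry over to
  X, whereas L2 convergence of their gradients does, because the squares of the entries of D\<phi>
  are at most K J. Hence a closure argument that starts from almost-everywhere convergence of the
  functions alone. The degree formula takes the place of the area formula: it asks neither for
  differentiability almost everywhere nor for Lusin's condition, only for L1 convergence of the
  Jacobians of mollified maps, and this is where square integrability in the plane is used. From the
  Beltrami equation the sign of J comes for free, through ellipticity; conversely the isometry
  determines only |J|, and topology must supply the sign.\<close>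

abbreviation Borel :: "('a::topological_space \<Rightarrow> 'b::topological_space) set" where
  "Borel \<equiv> borel_measurable borel"

abbreviation ind :: "'a set \<Rightarrow> 'a \<Rightarrow> 'b::zero_neq_one" where
  "ind \<equiv> indicator"

abbreviation nn_lborel :: "('a::euclidean_space \<Rightarrow> ennreal) \<Rightarrow> ennreal" (binder \<open>NNINT \<close> 60) where
  "nn_lborel f \<equiv> integral\<^sup>N lborel f"

section \<open>Smooth functions\<close>

definition smooth :: "(complex \<Rightarrow> real) \<Rightarrow> bool" where
  "smooth f \<longleftrightarrow> (\<forall>k. C_k k f)"

abbreviation dx :: "(complex \<Rightarrow> real) \<Rightarrow> complex \<Rightarrow> real" where "dx \<equiv> dir_deriv 1"
abbreviation dy :: "(complex \<Rightarrow> real) \<Rightarrow> complex \<Rightarrow> real" where "dy \<equiv> dir_deriv \<i>"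

lemma dir_deriv_eq:
  assumes "(f has_derivative D) (at z)"
  shows "dir_deriv v f z = D v"
  unfolding dir_deriv_def using frechet_derivative_at[OF assms] by simp

lemma has_derivative_dxdy:
  assumes "f differentiable (at z)"
  shows "(f has_derivative (\<lambda>h. Re h * dx f z + Im h * dy f z)) (at z)"
proof -
  let ?D = "frechet_derivative f (at z)"
  have D: "(f has_derivative ?D) (at z)" using assms frechet_derivative_works by blast
  then interpret bounded_linear ?D by (rule has_derivative_bounded_linear)
  have "?D h = Re h * dx f z + Im h * dy f z" for h
  proof -
    have "h = Re h *\<^sub>R 1 + Im h *\<^sub>R \<i>" by (simp add: complex_eq_iff)
    then have "?D h = ?D (Re h *\<^sub>R 1 + Im h *\<^sub>R \<i>)" by simp
    also have "\<dots> = Re h * ?D 1 + Im h * ?D \<i>" by (simp add: add scaleR)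
    finally show ?thesis by (simp add: dir_deriv_def)
  qed
  then show ?thesis using D by presburger
qed

lemma C_k_SucD: "C_k (Suc k) f \<Longrightarrow> C_k k f"
proof (induction k arbitrary: f)
  case 0
  then have "\<And>z. f differentiable (at z)" by simp
  from this[THEN differentiable_imp_continuous_within] show ?case
    by (simp add: continuous_on_eq_continuous_within)
next
  case (Suc k)
  then show ?case by (metis C_k.simps(2))
qed

lemma smooth_differentiable: "smooth f \<Longrightarrow> f differentiable (at z)"
  by (metis C_k.simps(2) smooth_def)

lemma smooth_dx: "smooth f \<Longrightarrow> smooth (dx f)"
  by (metis C_k.simps(2) smooth_def)

lemma smooth_dy: "smooth f \<Longrightarrow> smooth (dy f)"
  by (metis C_k.simps(2) smooth_def)

lemma smooth_continuous_on: "smooth f \<Longrightarrow> continuous_on S f"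
  by (metis C_k.simps(1) smooth_def continuous_on_subset subset_UNIV)

lemma smooth_borel: "smooth f \<Longrightarrow> f \<in> Borel"
  by (simp add: borel_measurable_continuous_onI smooth_continuous_on)

lemma smooth_has_derivative:
  "smooth f \<Longrightarrow> (f has_derivative (\<lambda>h. Re h * dx f z + Im h * dy f z)) (at z within S)"
  using has_derivative_at_withinI has_derivative_dxdy smooth_differentiable by blast

text \<open>Smoothness is a greatest fixed point: a class of differentiable functions that is stable
  under both partial derivatives contains only smooth ones. Families such as the convolutions with a
  fixed function can then be treated without counting derivatives.\<close>

lemma smooth_coinduct:
  assumes "P f"
    and "\<And>f z. P f \<Longrightarrow> f differentiable (at z)"
    and "\<And>f. P f \<Longrightarrow> P (dx f)"
    and "\<And>f. P f \<Longrightarrow> P (dy f)"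
  shows "smooth f"
proof -
  have "C_k k f" if "P f" for k f
    using that
  proof (induction k arbitrary: f)
    case 0
    then show ?case
      using assms(2)[THEN differentiable_imp_continuous_within]
      by (auto simp: continuous_on_eq_continuous_within)
  qed (use assms in auto)
  then show ?thesis using assms(1) by (auto simp: smooth_def)
qed

lemma dir_deriv_add:
  assumes "f differentiable (at z)" "g differentiable (at z)"
  shows "dir_deriv v (\<lambda>z. f z + g z) z = dir_deriv v f z + dir_deriv v g z"
  by (subst dir_deriv_eq[OF has_derivative_add[OF assms[unfolded frechet_derivative_works]]])
     (simp add: dir_deriv_def)

lemma dir_deriv_mult:
  assumes "f differentiable (at z)" "g differentiable (at z)"
  shows "dir_deriv v (\<lambda>z. f z * g z) z = f z * dir_deriv v g z + dir_deriv v f z * g z"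
  by (subst dir_deriv_eq[OF has_derivative_mult[OF assms[unfolded frechet_derivative_works]]])
     (simp add: dir_deriv_def)

lemma dir_deriv_const: "dir_deriv v (\<lambda>z. c) = (\<lambda>z. 0)"
  by (rule ext, subst dir_deriv_eq[OF has_derivative_const]) simp

lemma C_k_add: "C_k k f \<Longrightarrow> C_k k g \<Longrightarrow> C_k k (\<lambda>z. f z + g z)"
proof (induction k arbitrary: f g)
  case (Suc k)
  have "dir_deriv v (\<lambda>z. f z + g z) = (\<lambda>z. dir_deriv v f z + dir_deriv v g z)" for v
    using Suc.prems by (intro ext dir_deriv_add) auto
  then show ?case using Suc by (auto intro: differentiable_add)
qed (auto intro: continuous_intros)

lemma C_k_mult: "C_k k f \<Longrightarrow> C_k k g \<Longrightarrow> C_k k (\<lambda>z. f z * g z)"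
proof (induction k arbitrary: f g)
  case (Suc k)
  have "dir_deriv v (\<lambda>z. f z * g z) = (\<lambda>z. f z * dir_deriv v g z + dir_deriv v f z * g z)" for v
    using Suc.prems by (intro ext dir_deriv_mult) auto
  moreover have "C_k k f" "C_k k g" using Suc.prems C_k_SucD by blast+
  ultimately show ?case using Suc by (auto intro: differentiable_mult C_k_add)
qed (auto intro: continuous_intros)

lemma smooth_add: "smooth f \<Longrightarrow> smooth g \<Longrightarrow> smooth (\<lambda>z. f z + g z)"
  using C_k_add smooth_def by auto

lemma smooth_mult: "smooth f \<Longrightarrow> smooth g \<Longrightarrow> smooth (\<lambda>z. f z * g z)"
  using C_k_mult smooth_def by auto

lemma smooth_const: "smooth (\<lambda>z. c)"
  by (rule smooth_coinduct[where P = "\<lambda>f. \<exists>c. f = (\<lambda>z. c)"]) (auto simp: dir_deriv_const)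

lemma smooth_cmult: "smooth f \<Longrightarrow> smooth (\<lambda>z. c * f z)"
  using smooth_mult smooth_const by blast

lemma smooth_uminus: "smooth f \<Longrightarrow> smooth (\<lambda>z. - f z)"
  using smooth_cmult[of f "-1"] by simp

lemma smooth_diff: "smooth f \<Longrightarrow> smooth g \<Longrightarrow> smooth (\<lambda>z. f z - g z)"
  using smooth_add[of f "\<lambda>z. - g z"] smooth_uminus by simp

lemma dir_deriv_add_smooth:
  "smooth f \<Longrightarrow> smooth g \<Longrightarrow>
    dir_deriv v (\<lambda>z. f z + g z) = (\<lambda>z. dir_deriv v f z + dir_deriv v g z)"
  by (intro ext dir_deriv_add) (auto simp: smooth_differentiable)

lemma dir_deriv_mult_smooth:
  "smooth f \<Longrightarrow> smooth g \<Longrightarrow>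
    dir_deriv v (\<lambda>z. f z * g z) = (\<lambda>z. f z * dir_deriv v g z + dir_deriv v f z * g z)"
  by (intro ext dir_deriv_mult) (auto simp: smooth_differentiable)

lemma dir_deriv_cmult_smooth:
  "smooth f \<Longrightarrow> dir_deriv v (\<lambda>z. c * f z) = (\<lambda>z. c * dir_deriv v f z)"
  using dir_deriv_mult_smooth[OF smooth_const, of f v c] by (simp add: dir_deriv_const)

lemma has_derivative_ridge:
  assumes "(s has_real_derivative d) (at (a * Re z + b * Im z + c))"
  shows "((\<lambda>z. s (a * Re z + b * Im z + c)) has_derivative (\<lambda>h. (a * Re h + b * Im h) * d)) (at z)"
proof -
  have "((\<lambda>z. a * Re z + b * Im z + c) has_derivative (\<lambda>h. a * Re h + b * Im h)) (at z)"
    by (auto intro!: derivative_eq_intros)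
  from has_derivative_compose[OF this assms[unfolded has_field_derivative_def]]
  show ?thesis by (simp add: mult.commute)
qed

lemma dir_deriv_ridge:
  assumes "\<And>x. (s has_real_derivative d x) (at x)"
  shows "dir_deriv v (\<lambda>z. s (a * Re z + b * Im z + c))
    = (\<lambda>z. (a * Re v + b * Im v) * d (a * Re z + b * Im z + c))"
  by (rule ext, rule dir_deriv_eq, rule has_derivative_ridge, rule assms)

text \<open>A sequence in which each function is the derivative of its predecessor holds all
  derivatives on the line; a partial derivative of the ridge function only multiplies by a constant
  and raises the index. Coordinates, plane waves and the bump all arise this way.\<close>

lemma smooth_ridge:
  assumes D: "\<And>n x. (D n has_real_derivative D (Suc n) x) (at x)"
  shows "smooth (\<lambda>z. D n (a * Re z + b * Im z + c))"
proof -
  have diff: "(\<lambda>z. D n (a * Re z + b * Im z + c)) differentiable (at z)" for n z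
    unfolding differentiable_def using has_derivative_ridge[OF D] by blast
  have c: "C_k k f \<Longrightarrow> C_k k (\<lambda>z. r * f z)" for k r f
    using C_k_mult smooth_const smooth_def by blast
  have "C_k k (\<lambda>z. D n (a * Re z + b * Im z + c))" for k n
  proof (induction k arbitrary: n)
    case 0
    show ?case using diff[THEN differentiable_imp_continuous_within]
      by (simp add: continuous_on_eq_continuous_within)
  next
    case (Suc k)
    then show ?case using diff dir_deriv_ridge[OF D] c by auto
  qed
  then show ?thesis by (simp add: smooth_def)
qed

lemma smooth_cos_ridge: "smooth (\<lambda>z. cos (a * Re z + b * Im z))"
  and smooth_sin_ridge: "smooth (\<lambda>z. sin (a * Re z + b * Im z))"
proof -
  \<comment> \<open>Differentiation advances the phase by pi / 2, so index 0 is the cosine and index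
    1 is minus the sine.\<close>
  define D where "D n x = (cos (x + real n * (pi / 2)))" for n x
  have *: "cos (x + real (Suc n) * (pi / 2)) = - sin (x + real n * (pi / 2))" for n x
  proof -
    have "x + real (Suc n) * (pi / 2) = (x + real n * (pi / 2)) + pi / 2" by (simp add: field_simps)
    then show ?thesis by (simp only: cos_add cos_pi_half sin_pi_half)
  qed
  have D: "(D n has_real_derivative D (Suc n) x) (at x)" for n x
    unfolding D_def * by (auto intro!: derivative_eq_intros)
  show "smooth (\<lambda>z. cos (a * Re z + b * Im z))"
    using smooth_ridge[of D 0 a b 0, OF D] by (simp add: D_def)
  show "smooth (\<lambda>z. sin (a * Re z + b * Im z))"
    using smooth_uminus[OF smooth_ridge[of D 1 a b 0, OF D]] *[of _ 0] by (simp add: D_def)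
qed

lemma smooth_Re: "smooth Re" and smooth_Im: "smooth Im"
proof -
  define D where "D n = (if n = 0 then (\<lambda>x::real. x) else if n = 1 then (\<lambda>x. 1) else (\<lambda>x. 0))" for n :: nat
  have D: "(D n has_real_derivative D (Suc n) x) (at x)" for n x
    unfolding D_def by (auto intro!: derivative_eq_intros)
  show "smooth Re" using smooth_ridge[of D 0 1 0 0, OF D] by (simp add: D_def)
  show "smooth Im" using smooth_ridge[of D 0 0 1 0, OF D] by (simp add: D_def)
qed

lemma dx_Re [simp]: "dx Re = (\<lambda>z. 1)" and dy_Re [simp]: "dy Re = (\<lambda>z. 0)"
  and dx_Im [simp]: "dx Im = (\<lambda>z. 0)" and dy_Im [simp]: "dy Im = (\<lambda>z. 1)"
  using dir_deriv_eq[OF bounded_linear_imp_has_derivative[OF bounded_linear_Re]]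
    dir_deriv_eq[OF bounded_linear_imp_has_derivative[OF bounded_linear_Im]] by auto

section \<open>A smooth bump with compact support\<close>

primrec bump_poly :: "nat \<Rightarrow> real poly" where
  "bump_poly 0 = 1"
| "bump_poly (Suc n) = monom 1 2 * (bump_poly n - pderiv (bump_poly n))"

text \<open>The nth derivative of exp(-1/x), extended by 0 to the left. Differentiating p(1/x)
  exp(-1/x) gives x^-2 (p - p')(1/x) exp(-1/x), which is the recursion of \<open>bump_poly\<close>
  in the variable 1/x.\<close>

definition bump_fun :: "nat \<Rightarrow> real \<Rightarrow> real" where
  "bump_fun n x = (if x > 0 then poly (bump_poly n) (1 / x) * exp (- 1 / x) else 0)"

lemma poly_exp_minus_tendsto_0: "((\<lambda>t::real. poly p t * exp (- t)) \<longlongrightarrow> 0) at_top"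
proof -
  have "((\<lambda>t. \<Sum>i\<le>degree p. coeff p i * (t ^ i / exp t)) \<longlongrightarrow> (\<Sum>i\<le>degree p. coeff p i * 0)) at_top"
    by (intro tendsto_intros tendsto_power_div_exp_0)
  moreover have "(\<Sum>i\<le>degree p. coeff p i * (t ^ i / exp t)) = poly p t * exp (- t)" for t
    by (simp add: poly_altdef exp_minus sum_distrib_right divide_inverse mult.assoc)
  ultimately show ?thesis by simp
qed

lemma bump_fun_deriv: "(bump_fun n has_real_derivative bump_fun (Suc n) x) (at x)"
proof -
  consider "x > 0" | "x < 0" | "x = 0" by linarith
  then show ?thesis
  proof cases
    case 1
    have "((\<lambda>x. poly (bump_poly n) (1 / x) * exp (- 1 / x)) has_real_derivative bump_fun (Suc n) x) (at x)"
      using 1 by (auto intro!: derivative_eq_intros DERIV_chain2[OF poly_DERIV]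
          simp: bump_fun_def poly_monom field_simps power2_eq_square)
    then show ?thesis
      by (rule has_field_derivative_transform_within_open[where S = "{0<..}"])
         (use 1 in \<open>auto simp: bump_fun_def\<close>)
  next
    case 2
    have "((\<lambda>x. 0) has_real_derivative bump_fun (Suc n) x) (at x)"
      using 2 by (simp add: bump_fun_def)
    then show ?thesis
      by (rule has_field_derivative_transform_within_open[where S = "{..<0}"])
         (use 2 in \<open>auto simp: bump_fun_def\<close>)
  next
    case 3
    \<comment> \<open>In t = 1/h the difference quotient at 0 is t p(t) exp(-t);
      \<open>pCons 0\<close> is the extra factor t.\<close>
    have "((\<lambda>h. poly (pCons 0 (bump_poly n)) (inverse h) * exp (- inverse h)) \<longlongrightarrow> 0) (at_right 0)"
      by (rule filterlim_compose[OF poly_exp_minus_tendsto_0 filterlim_inverse_at_top_right])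
    then have "((\<lambda>h. bump_fun n h / h) \<longlongrightarrow> 0) (at_right 0)"
      by (rule Lim_transform_eventually)
         (auto simp: bump_fun_def eventually_at_filter field_simps)
    moreover have "((\<lambda>h. bump_fun n h / h) \<longlongrightarrow> 0) (at_left 0)"
      by (rule Lim_transform_eventually[OF tendsto_const])
         (auto simp: bump_fun_def eventually_at_filter)
    ultimately have "((\<lambda>h. bump_fun n h / h) \<longlongrightarrow> 0) (at 0)"
      by (simp add: filterlim_at_split)
    then show ?thesis
      using 3 by (simp add: DERIV_def) (simp add: bump_fun_def)
  qed
qed

text \<open>The symmetry of second derivatives is evident for the mollifiers and passes to convolutions; this
  spares a proof of Schwarz's theorem.\<close>

definition sym_smooth :: "(complex \<Rightarrow> real) \<Rightarrow> bool" where
  "sym_smooth f \<longleftrightarrow> smooth f \<and> dx (dy f) = dy (dx f)"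

lemma sym_smooth_mult:
  assumes "sym_smooth f" "sym_smooth g"
  shows "sym_smooth (\<lambda>z. f z * g z)"
proof -
  have s: "smooth f" "smooth g" "smooth (dx f)" "smooth (dx g)" "smooth (dy f)" "smooth (dy g)"
    and e: "dx (dy f) = dy (dx f)" "dx (dy g) = dy (dx g)"
    using assms by (auto simp: sym_smooth_def smooth_dx smooth_dy)
  show ?thesis
    unfolding sym_smooth_def
    by (auto simp: s e smooth_mult dir_deriv_mult_smooth dir_deriv_add_smooth algebra_simps)
qed

definition unit_bump :: "real \<Rightarrow> real" where
  "unit_bump x = bump_fun 0 (1 + x) * bump_fun 0 (1 - x)"

lemma unit_bump_nonneg: "unit_bump x \<ge> 0"
  and unit_bump_pos: "\<bar>x\<bar> < 1 \<Longrightarrow> unit_bump x > 0"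
  and unit_bump_eq_0: "\<bar>x\<bar> \<ge> 1 \<Longrightarrow> unit_bump x = 0"
  by (auto simp: unit_bump_def bump_fun_def abs_if split: if_splits)

text \<open>A product of functions of linear forms instead of a radial bump: the equality of mixed
  second derivatives is then immediate. For r > 0 the support is a square with half side
  1/r.\<close>

definition bump :: "real \<Rightarrow> complex \<Rightarrow> real" where
  "bump r z = unit_bump (r * Re z) * unit_bump (r * Im z)"

lemma bump_nonneg: "bump r z \<ge> 0"
  by (simp add: bump_def unit_bump_nonneg)

lemma sym_smooth_ridge:
  assumes D: "\<And>n x. (D n has_real_derivative D (Suc n) x) (at x)"
  shows "sym_smooth (\<lambda>z. D n (a * Re z + b * Im z + c))"
proof -
  have s: "smooth (\<lambda>z. D m (a * Re z + b * Im z + c))" for m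
    by (rule smooth_ridge[of D, OF D])
  show ?thesis
    unfolding sym_smooth_def dir_deriv_ridge[of "D m" "D (Suc m)" for m, OF D]
      dir_deriv_cmult_smooth[OF s]
    using s by auto
qed

lemma sym_smooth_bump: "sym_smooth (bump r)"
proof -
  have "sym_smooth (\<lambda>z. bump_fun 0 (a * Re z + b * Im z + 1))" for a b
    by (rule sym_smooth_ridge[of bump_fun, OF bump_fun_deriv])
  from sym_smooth_mult[OF sym_smooth_mult[OF this[of r 0] this[of "-r" 0]]
      sym_smooth_mult[OF this[of 0 r] this[of 0 "-r"]]]
  show ?thesis unfolding bump_def[abs_def] unit_bump_def by (simp add: algebra_simps)
qed

text \<open>The square of half side 1/r lies in the disc of radius 2/r. This 2 reappears in the
  radius \<open>2 / real (Suc n)\<close> of the mollifiers.\<close>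

lemma bump_eq_0:
  assumes "r > 0" "norm z \<ge> 2 / r"
  shows "bump r z = 0"
proof -
  have "2 / r \<le> \<bar>Re z\<bar> + \<bar>Im z\<bar>" using assms cmod_le[of z] by linarith
  then have "\<bar>r * Re z\<bar> + \<bar>r * Im z\<bar> \<ge> 2" using assms(1) by (simp add: abs_mult field_simps)
  then have "\<bar>r * Re z\<bar> \<ge> 1 \<or> \<bar>r * Im z\<bar> \<ge> 1" by linarith
  then show ?thesis by (auto simp: bump_def unit_bump_eq_0)
qed

lemma bump_pos:
  assumes "r > 0" "norm z < 1 / r"
  shows "bump r z > 0"
proof -
  have "\<bar>Re z\<bar> < 1 / r" "\<bar>Im z\<bar> < 1 / r"
    using assms abs_Re_le_cmod[of z] abs_Im_le_cmod[of z] by linarith+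
  then have "\<bar>r * Re z\<bar> < 1" "\<bar>r * Im z\<bar> < 1"
    using assms(1) by (simp_all add: abs_mult field_simps)
  then show ?thesis by (auto simp: bump_def unit_bump_pos)
qed

section \<open>Mollification\<close>

lemma test_functions_iff:
  "\<eta> \<in> test_functions X \<longleftrightarrow>
    smooth \<eta> \<and> (\<exists>S. compact S \<and> S \<subseteq> X \<and> (\<forall>z. z \<notin> S \<longrightarrow> \<eta> z = 0))"
proof safe
  assume "\<eta> \<in> test_functions X"
  then have "compact (closure {z. \<eta> z \<noteq> 0})" "closure {z. \<eta> z \<noteq> 0} \<subseteq> X"
    by (auto simp: test_functions_def)
  moreover have "\<forall>z. z \<notin> closure {z. \<eta> z \<noteq> 0} \<longrightarrow> \<eta> z = 0"
    using closure_subset[of "{z. \<eta> z \<noteq> 0}"] by blast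
  ultimately show "\<exists>S. compact S \<and> S \<subseteq> X \<and> (\<forall>z. z \<notin> S \<longrightarrow> \<eta> z = 0)" by blast
  show "smooth \<eta>" using \<open>\<eta> \<in> test_functions X\<close> unfolding test_functions_def smooth_def by blast
next
  fix S assume S: "smooth \<eta>" "compact S" "S \<subseteq> X" "\<forall>z. z \<notin> S \<longrightarrow> \<eta> z = 0"
  then have "closure {z. \<eta> z \<noteq> 0} \<subseteq> S"
    by (intro closure_minimal) (auto simp: compact_imp_closed)
  then show "\<eta> \<in> test_functions X"
    using S compact_Int_closed[of S "closure {z. \<eta> z \<noteq> 0}"]
    by (simp add: test_functions_def smooth_def Int_absorb1 subset_trans[of _ S X])
qed

lemma dir_deriv_eq_0_outside:
  assumes "closed S" "\<forall>z. z \<notin> S \<longrightarrow> f z = 0"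
  shows "\<forall>z. z \<notin> S \<longrightarrow> dir_deriv v f z = 0"
proof (intro allI impI)
  fix z assume "z \<notin> S"
  have "((\<lambda>z. 0) has_derivative (\<lambda>h. 0)) (at z)" by simp
  then have "(f has_derivative (\<lambda>h. 0)) (at z)"
    by (rule has_derivative_transform_within_open[where s = "- S"]) (use assms \<open>z \<notin> S\<close> in auto)
  then show "dir_deriv v f z = 0" by (simp add: dir_deriv_eq)
qed

lemma integrable_compact_support:
  fixes f :: "complex \<Rightarrow> real"
  assumes "compact S" "continuous_on S f" "\<forall>z. z \<notin> S \<longrightarrow> f z = 0"
  shows "integrable lborel f"
proof -
  have "(\<lambda>z. ind S z *\<^sub>R f z) = f" using assms(3) by (intro ext) (auto simp: indicator_def)
  then show ?thesis using borel_integrable_compact[OF assms(1,2)] by simp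
qed

lemma lborel_reflect: "distr lborel borel (\<lambda>w::complex. t - w) = lborel"
proof -
  have "lborel = density (distr lborel borel (\<lambda>x::complex. t + (-1) *\<^sub>R x)) (\<lambda>_. \<bar>-1::real\<bar> ^ DIM(complex))"
    by (rule lborel_affine) simp
  then show ?thesis by (simp add: density_1)
qed

lemma lborel_translate: "distr lborel borel (\<lambda>w::complex. w + t) = lborel"
proof -
  have "lborel = density (distr lborel borel (\<lambda>x::complex. t + 1 *\<^sub>R x)) (\<lambda>_. \<bar>1::real\<bar> ^ DIM(complex))"
    by (rule lborel_affine) simp
  then show ?thesis by (simp add: density_1 add.commute)
qed

lemma nn_integral_reflect:
  fixes f :: "complex \<Rightarrow> ennreal"
  shows "f \<in> Borel \<Longrightarrow> (NNINT w. f (t - w)) = (NNINT w. f w)"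
  by (subst (2) lborel_reflect[symmetric, of t]) (simp add: nn_integral_distr)

lemma nn_integral_translate:
  fixes f :: "complex \<Rightarrow> ennreal"
  shows "f \<in> Borel \<Longrightarrow> (NNINT w. f (w + t)) = (NNINT w. f w)"
  by (subst (2) lborel_translate[symmetric, of t]) (simp add: nn_integral_distr)

lemma integral_reflect:
  fixes f :: "complex \<Rightarrow> real"
  shows "f \<in> Borel \<Longrightarrow> (LBINT w. f (t - w)) = (LBINT w. f w)"
  by (subst (2) lborel_reflect[symmetric, of t]) (simp add: integral_distr)

definition conv :: "(complex \<Rightarrow> real) \<Rightarrow> (complex \<Rightarrow> real) \<Rightarrow> complex \<Rightarrow> real" where
  "conv F k z = (LBINT w. F w * k (z - w))"

lemma bounded_of_compact_support:
  fixes k :: "complex \<Rightarrow> real"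
  assumes "continuous_on UNIV k" "compact S" "\<forall>z. z \<notin> S \<longrightarrow> k z = 0"
  shows "\<exists>M\<ge>0. \<forall>z. \<bar>k z\<bar> \<le> M"
proof -
  have "compact (k ` S)" using assms(1,2) compact_continuous_image continuous_on_subset by blast
  then obtain M where "\<forall>y\<in>k ` S. norm y \<le> M" by (meson compact_imp_bounded bounded_iff)
  then have "\<bar>k z\<bar> \<le> max 0 M" for z using assms(3) by (cases "z \<in> S") auto
  then show ?thesis by (intro exI[of _ "max 0 M"]) auto
qed

lemma conv_integrable:
  fixes F k :: "complex \<Rightarrow> real"
  assumes F: "integrable lborel F" and k: "continuous_on UNIV k" "\<And>z. \<bar>k z\<bar> \<le> M"
  shows "integrable lborel (\<lambda>w. F w * k (z - w))"
proof -
  have [measurable]: "k \<in> Borel" by (rule borel_measurable_continuous_onI) fact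
  have [measurable]: "F \<in> Borel" using F by simp
  show ?thesis
  proof (rule Bochner_Integration.integrable_bound[where f = "\<lambda>w. M * F w"])
    show "AE w in lborel. norm (F w * k (z - w)) \<le> norm (M * F w)"
    proof (rule AE_I2)
      fix w
      have "\<bar>k (z - w)\<bar> \<le> \<bar>M\<bar>" using k(2)[of "z - w"] by linarith
      then show "norm (F w * k (z - w)) \<le> norm (M * F w)"
        by (simp add: abs_mult mult.commute[of "\<bar>M\<bar>"] mult_left_mono)
    qed
  qed (use F in auto)
qed

lemma uniformly_continuous_compact_support:
  fixes k :: "complex \<Rightarrow> real"
  assumes "continuous_on UNIV k" "compact S" "\<forall>z. z \<notin> S \<longrightarrow> k z = 0"
  shows "uniformly_continuous_on UNIV k"
proof -
  obtain R where R: "S \<subseteq> cball 0 R" using compact_imp_bounded[OF assms(2)]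
    by (metis bounded_iff mem_cball_0 subsetI)
  have "uniformly_continuous_on (cball 0 (R + 1)) k"
    by (intro compact_uniformly_continuous) (use assms(1) continuous_on_subset in auto)
  then have u: "\<exists>d>0. \<forall>x\<in>cball 0 (R + 1). \<forall>y\<in>cball 0 (R + 1). dist y x < d \<longrightarrow> dist (k y) (k x) < e"
    if "e > 0" for e using that by (auto simp: uniformly_continuous_on_def)
  show ?thesis unfolding uniformly_continuous_on_def
  proof safe
    fix e :: real assume "e > 0"
    from u[OF this] obtain d where d: "d > 0"
      "\<And>x y. x \<in> cball 0 (R + 1) \<Longrightarrow> y \<in> cball 0 (R + 1) \<Longrightarrow> dist y x < d \<Longrightarrow> dist (k y) (k x) < e"
      by blast
    \<comment> \<open>A step below 1 cannot lead from outside the disc of radius R + 1 into the disc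
      of radius R, off which k vanishes.\<close>
    have "dist (k y) (k x) < e" if "dist y x < min d 1" for x y
    proof (cases "x \<in> cball 0 (R + 1) \<and> y \<in> cball 0 (R + 1)")
      case True then show ?thesis using d(2) that by auto
    next
      case False
      have "norm x \<le> norm y + dist y x" "norm y \<le> norm x + dist y x"
        by (metis add.commute dist_commute dist_norm norm_triangle_sub)+
      then have "norm x > R \<and> norm y > R" using False that by auto
      then have "x \<notin> S" "y \<notin> S" using R by auto
      then show ?thesis using assms(3) \<open>e > 0\<close> by simp
    qed
    then show "\<exists>d>0. \<forall>x\<in>UNIV. \<forall>y\<in>UNIV. dist y x < d \<longrightarrow> dist (k y) (k x) < e"
      using d(1) by (intro exI[of _ "min d 1"]) auto
  qed
qed

text \<open>The remainder is uniform in z, as differentiation under the integral against a merely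
  integrable function requires. The partial derivatives are uniformly continuous, and the mean value
  inequality does the rest.\<close>

lemma uniform_linearization:
  assumes k: "smooth k" "compact S" "\<forall>z. z \<notin> S \<longrightarrow> k z = 0" and "e > 0"
  shows "\<exists>d>0. \<forall>z h. norm h < d \<longrightarrow>
    \<bar>k (z + h) - k z - (Re h * dx k z + Im h * dy k z)\<bar> \<le> e * norm h"
proof -
  have z: "\<forall>z. z \<notin> S \<longrightarrow> dir_deriv v k z = 0" for v
    using dir_deriv_eq_0_outside[OF compact_imp_closed[OF k(2)] k(3)] .
  have ux: "uniformly_continuous_on UNIV (dx k)" and uy: "uniformly_continuous_on UNIV (dy k)"
    by (auto intro!: uniformly_continuous_compact_support[OF _ k(2)] smooth_continuous_on
        smooth_dx smooth_dy k(1) z)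
  have "e / 2 > 0" using \<open>e > 0\<close> by simp
  from ux[unfolded uniformly_continuous_on_def, rule_format, OF this]
    uy[unfolded uniformly_continuous_on_def, rule_format, OF this]
  obtain d1 d2 where d: "d1 > 0" "d2 > 0"
    "\<And>x y. dist y x < d1 \<Longrightarrow> dist (dx k y) (dx k x) < e / 2"
    "\<And>x y. dist y x < d2 \<Longrightarrow> dist (dy k y) (dy k x) < e / 2" by auto
  have "\<bar>k (z + h) - k z - (Re h * dx k z + Im h * dy k z)\<bar> \<le> e * norm h"
    if h: "norm h < min d1 d2" for z h
  proof -
    let ?f' = "\<lambda>x h. Re h * dx k x + Im h * dy k x"
    have "norm (k (z + h) - k z - ?f' z (z + h - z)) \<le> norm (z + h - z) * e"
    proof (rule differentiable_bound_linearization[where S = "ball z (min d1 d2)"])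
      show "z + t *\<^sub>R (z + h - z) \<in> ball z (min d1 d2)" if "t \<in> {0..1}" for t
      proof -
        have "norm (t *\<^sub>R h) \<le> norm h" using that by (simp add: mult_left_le_one_le)
        then show ?thesis using h by (simp add: dist_norm)
      qed
      show "(k has_derivative ?f' x) (at x within ball z (min d1 d2))" for x
        by (rule smooth_has_derivative[OF k(1)])
      show "onorm (?f' x - ?f' z) \<le> e" if "x \<in> ball z (min d1 d2)" for x
      proof (rule onorm_le)
        fix v
        have *: "\<bar>dx k x - dx k z\<bar> \<le> e / 2" "\<bar>dy k x - dy k z\<bar> \<le> e / 2"
          using d(3)[of x z] d(4)[of x z] that by (auto simp: dist_real_def dist_commute)
        have "norm ((?f' x - ?f' z) v) = \<bar>Re v * (dx k x - dx k z) + Im v * (dy k x - dy k z)\<bar>"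
          by (simp add: algebra_simps)
        also have "\<dots> \<le> \<bar>Re v\<bar> * \<bar>dx k x - dx k z\<bar> + \<bar>Im v\<bar> * \<bar>dy k x - dy k z\<bar>"
          by (metis abs_mult abs_triangle_ineq)
        also have "\<dots> \<le> norm v * (e / 2) + norm v * (e / 2)"
          by (intro add_mono mult_mono * abs_Re_le_cmod abs_Im_le_cmod) auto
        finally show "norm ((?f' x - ?f' z) v) \<le> e * norm v" by (simp add: mult.commute)
      qed
      show "z \<in> ball z (min d1 d2)" using d by simp
    qed
    then show ?thesis by (simp add: mult.commute)
  qed
  then show ?thesis using d by (intro exI[of _ "min d1 d2"]) auto
qed

lemma conv_has_derivative:
  assumes F: "integrable lborel F"
    and k: "smooth k" "compact S" "\<forall>z. z \<notin> S \<longrightarrow> k z = 0"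
  shows "(conv F k has_derivative (\<lambda>h. Re h * conv F (dx k) z + Im h * conv F (dy k) z)) (at z)"
proof -
  have zz: "\<forall>z. z \<notin> S \<longrightarrow> dir_deriv v k z = 0" for v
    using dir_deriv_eq_0_outside[OF compact_imp_closed[OF k(2)] k(3)] .
  have i: "integrable lborel (\<lambda>w. F w * k (z - w))" "integrable lborel (\<lambda>w. F w * dx k (z - w))"
    "integrable lborel (\<lambda>w. F w * dy k (z - w))" for z
    using bounded_of_compact_support[OF smooth_continuous_on[OF k(1)] k(2,3)]
      bounded_of_compact_support[OF smooth_continuous_on[OF smooth_dx[OF k(1)]] k(2) zz]
      bounded_of_compact_support[OF smooth_continuous_on[OF smooth_dy[OF k(1)]] k(2) zz]
    by (blast intro: conv_integrable[OF F] smooth_continuous_on smooth_dx smooth_dy k(1))+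
  define A where "A = (LBINT w. \<bar>F w\<bar>)"
  have "A \<ge> 0" by (simp add: A_def)
  show ?thesis unfolding has_derivative_at_alt
  proof (intro conjI allI impI)
    show "bounded_linear (\<lambda>h. Re h * conv F (dx k) z + Im h * conv F (dy k) z)"
      by (intro bounded_linear_add bounded_linear_compose[OF bounded_linear_mult_left]
          bounded_linear_Re bounded_linear_Im)
    fix e :: real assume "e > 0"
    \<comment> \<open>Integration multiplies the remainder by the L1 norm A of F; A + 1 avoids a
      division by 0.\<close>
    then have "e / (A + 1) > 0" using \<open>A \<ge> 0\<close> by simp
    from uniform_linearization[OF k this] obtain d where d: "d > 0"
      "\<And>z h. norm h < d \<Longrightarrow> \<bar>k (z + h) - k z - (Re h * dx k z + Im h * dy k z)\<bar> \<le> e / (A + 1) * norm h"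
      by blast
    have "norm (conv F k y - conv F k z - (Re (y - z) * conv F (dx k) z + Im (y - z) * conv F (dy k) z))
        \<le> e * norm (y - z)" if "norm (y - z) < d" for y
    proof -
      let ?h = "y - z"
      let ?R = "\<lambda>w. k (y - w) - k (z - w) - (Re ?h * dx k (z - w) + Im ?h * dy k (z - w))"
      have R: "\<bar>?R w\<bar> \<le> e / (A + 1) * norm ?h" for w
        using d(2)[OF that, of "z - w"] by simp
      have e: "(\<lambda>w. F w * k (y - w) - F w * k (z - w) - (Re ?h * (F w * dx k (z - w)) + Im ?h * (F w * dy k (z - w))))
          = (\<lambda>w. F w * ?R w)"
        by (rule ext) (simp only: right_diff_distrib distrib_left mult.left_commute)
      have "conv F k y - conv F k z - (Re ?h * conv F (dx k) z + Im ?h * conv F (dy k) z)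
          = (LBINT w. F w * ?R w)"
        unfolding e[symmetric] by (simp add: conv_def i)
      then have "norm (conv F k y - conv F k z - (Re ?h * conv F (dx k) z + Im ?h * conv F (dy k) z))
          = norm (LBINT w. F w * ?R w)" by (rule arg_cong)
      also have "\<dots> \<le> (LBINT w. \<bar>F w\<bar> * (e / (A + 1) * norm ?h))"
      proof (rule Bochner_Integration.integral_norm_bound_integral)
        have "integrable lborel (\<lambda>w. F w * k (y - w) - F w * k (z - w) - (Re ?h * (F w * dx k (z - w)) + Im ?h * (F w * dy k (z - w))))"
          by (simp add: i)
        then show "integrable lborel (\<lambda>w. F w * ?R w)" unfolding e .
        show "norm (F w * ?R w) \<le> \<bar>F w\<bar> * (e / (A + 1) * norm ?h)" for w
          unfolding real_norm_def abs_mult by (intro mult_left_mono R abs_ge_zero)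
        show "integrable lborel (\<lambda>w. \<bar>F w\<bar> * (e / (A + 1) * norm ?h))"
          using F by (intro integrable_mult_left integrable_abs)
      qed
      also have "\<dots> = A * (e / (A + 1) * norm ?h)"
        unfolding A_def by (rule integral_mult_left_zero)
      also have "\<dots> \<le> e * norm ?h"
      proof -
        have "A / (A + 1) \<le> 1" using \<open>A \<ge> 0\<close> by simp
        then have "A / (A + 1) * (e * norm ?h) \<le> 1 * (e * norm ?h)"
          using \<open>e > 0\<close> by (intro mult_right_mono) auto
        then show ?thesis by (simp add: algebra_simps)
      qed
      finally show ?thesis .
    qed
    then show "\<exists>d>0. \<forall>y. norm (y - z) < d \<longrightarrow>
        norm (conv F k y - conv F k z - (Re (y - z) * conv F (dx k) z + Im (y - z) * conv F (dy k) z))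
        \<le> e * norm (y - z)"
      using d(1) by blast
  qed
qed

lemma dir_deriv_conv:
  assumes "integrable lborel F"
    and "smooth k" "compact S" "\<forall>z. z \<notin> S \<longrightarrow> k z = 0"
  shows "dx (conv F k) = conv F (dx k)" "dy (conv F k) = conv F (dy k)"
  using dir_deriv_eq[OF conv_has_derivative[OF assms]] by auto

text \<open>Derivatives fall on the kernel, whose support stays inside S, so the convolutions of F
  with such kernels form a class to which \<open>smooth_coinduct\<close> applies.\<close>

lemma smooth_conv:
  assumes F: "integrable lborel F"
    and k: "smooth k" "compact S" "\<forall>z. z \<notin> S \<longrightarrow> k z = 0"
  shows "smooth (conv F k)"
proof (rule smooth_coinduct[where P = "\<lambda>f. \<exists>k. f = conv F k \<and> smooth k \<and> (\<forall>z. z \<notin> S \<longrightarrow> k z = 0)"])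
  show "\<exists>k'. conv F k = conv F k' \<and> smooth k' \<and> (\<forall>z. z \<notin> S \<longrightarrow> k' z = 0)" using k by blast
next
  fix f z assume "\<exists>k. f = conv F k \<and> smooth k \<and> (\<forall>z. z \<notin> S \<longrightarrow> k z = 0)"
  then show "f differentiable (at z)"
    using conv_has_derivative[OF F _ k(2)] unfolding differentiable_def by blast
next
  fix f assume "\<exists>k. f = conv F k \<and> smooth k \<and> (\<forall>z. z \<notin> S \<longrightarrow> k z = 0)"
  then obtain k where k': "f = conv F k" "smooth k" "\<forall>z. z \<notin> S \<longrightarrow> k z = 0" by blast
  note z = dir_deriv_eq_0_outside[OF compact_imp_closed[OF k(2)] k'(3)]
  show "\<exists>k. dx f = conv F k \<and> smooth k \<and> (\<forall>z. z \<notin> S \<longrightarrow> k z = 0)"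
    unfolding k'(1) dir_deriv_conv(1)[OF F k'(2) k(2) k'(3)]
    by (intro exI[of _ "dx k"] conjI z smooth_dx k'(2) refl) 
  show "\<exists>k. dy f = conv F k \<and> smooth k \<and> (\<forall>z. z \<notin> S \<longrightarrow> k z = 0)"
    unfolding k'(1) dir_deriv_conv(2)[OF F k'(2) k(2) k'(3)]
    by (intro exI[of _ "dy k"] conjI z smooth_dy k'(2) refl)
qed

lemma sym_smooth_conv:
  assumes F: "integrable lborel F"
    and k: "sym_smooth k" "compact S" "\<forall>z. z \<notin> S \<longrightarrow> k z = 0"
  shows "sym_smooth (conv F k)"
proof -
  have s: "smooth k" "dx (dy k) = dy (dx k)" using k(1) by (auto simp: sym_smooth_def)
  note z = dir_deriv_eq_0_outside[OF compact_imp_closed[OF k(2)] k(3)]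
  have "dx (dy (conv F k)) = dy (dx (conv F k))"
    by (simp only: dir_deriv_conv[OF F s(1) k(2,3)] s(2) dir_deriv_conv[OF F smooth_dx[OF s(1)] k(2) z]
      dir_deriv_conv[OF F smooth_dy[OF s(1)] k(2) z])
  then show ?thesis using smooth_conv[OF F s(1) k(2,3)] by (simp add: sym_smooth_def)
qed

text \<open>\<open>Suc n\<close> keeps the scale positive at n = 0. By \<open>bump_eq_0\<close> the
  support lies in the disc of radius \<open>2 / real (Suc n)\<close>; the division makes the mass
  1.\<close>

definition kern :: "nat \<Rightarrow> complex \<Rightarrow> real" where
  "kern n z = bump (real (Suc n)) z / (LBINT w. bump (real (Suc n)) w)"

lemma bump_integrable: "r > 0 \<Longrightarrow> integrable lborel (bump r)"
  using sym_smooth_bump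
  by (intro integrable_compact_support[of "cball 0 (2 / r)"] smooth_continuous_on)
     (auto simp: sym_smooth_def bump_eq_0)

lemma bump_integral_pos: "r > 0 \<Longrightarrow> (LBINT w. bump r w) > 0"
proof -
  assume r: "r > 0"
  have "(LBINT w. bump r w) \<noteq> 0"
  proof
    assume "(LBINT w. bump r w) = 0"
    then have "AE w in lborel. bump r w = 0"
      using integral_nonneg_eq_0_iff_AE[OF bump_integrable[OF r]] bump_nonneg by auto
    then have "AE w in lborel. w \<notin> ball (0::complex) (1 / r)"
    proof eventually_elim
      case (elim w)
      then show ?case using bump_pos[OF r, of w] by auto
    qed
    then have "emeasure lborel (ball (0::complex) (1 / r)) = 0"
      by (subst (asm) AE_iff_measurable[OF _ refl]) (auto simp: ball_def)
    then show False
      using r by (auto simp: emeasure_ball unit_ball_vol_2)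
  qed
  then show ?thesis using bump_nonneg by (simp add: less_le)
qed

lemma kern_nonneg: "kern n z \<ge> 0"
  by (simp add: kern_def bump_nonneg)

lemma kern_eq_0: "norm z \<ge> 2 / real (Suc n) \<Longrightarrow> kern n z = 0"
  unfolding kern_def by (simp add: bump_eq_0 del: of_nat_Suc)

lemma sym_smooth_kern: "sym_smooth (kern n)"
proof -
  have "sym_smooth (\<lambda>z. bump (real (Suc n)) z * c)" for c
    by (rule sym_smooth_mult[OF sym_smooth_bump]) (simp add: sym_smooth_def smooth_const dir_deriv_const)
  then show ?thesis unfolding kern_def[abs_def] divide_inverse by blast
qed

lemma smooth_kern: "smooth (kern n)"
  using sym_smooth_kern by (auto simp: sym_smooth_def)

lemma kern_integrable: "integrable lborel (kern n)"
  unfolding kern_def[abs_def] by (intro integrable_divide bump_integrable) auto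

lemma kern_integral: "(LBINT w. kern n w) = 1"
  unfolding kern_def[abs_def] using bump_integral_pos[of "real (Suc n)"] by simp

lemma kern_cball: "\<forall>z. z \<notin> cball 0 (2 / real (Suc n)) \<longrightarrow> kern n z = 0"
  using kern_eq_0 by simp

text \<open>The pth power of the L^p norm, with no root taken. Only p = 1 and p = 2 matter; the
  triangle inequality becomes \<open>pnorm_add_le\<close>, at the price of a factor 2.\<close>

definition pnorm :: "nat \<Rightarrow> (complex \<Rightarrow> real) \<Rightarrow> ennreal" where
  "pnorm p F = (NNINT z. ennreal (\<bar>F z\<bar> ^ p))"

lemma pnorm_cong: "AE z in lborel. F z = G z \<Longrightarrow> pnorm p F = pnorm p G"
  unfolding pnorm_def by (rule nn_integral_cong_AE) auto

lemma abs_power_add_le: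
  fixes a b :: real
  assumes "p = 1 \<or> p = 2"
  shows "\<bar>a + b\<bar> ^ p \<le> 2 * \<bar>a\<bar> ^ p + 2 * \<bar>b\<bar> ^ p"
  using assms
proof
  assume "p = 2"
  have "(a + b)\<^sup>2 + (a - b)\<^sup>2 = 2 * a\<^sup>2 + 2 * b\<^sup>2" by (simp add: power2_eq_square algebra_simps)
  then have "(a + b)\<^sup>2 \<le> 2 * a\<^sup>2 + 2 * b\<^sup>2" using zero_le_power2[of "a - b"] by linarith
  then show ?thesis using \<open>p = 2\<close> by simp
qed auto

lemma pnorm_add_le:
  assumes p: "p = 1 \<or> p = 2" and [measurable]: "F \<in> Borel" "G \<in> Borel"
  shows "pnorm p (\<lambda>z. F z + G z) \<le> 2 * pnorm p F + 2 * pnorm p G"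
proof -
  have "pnorm p (\<lambda>z. F z + G z) \<le> (NNINT z. 2 * ennreal (\<bar>F z\<bar> ^ p) + 2 * ennreal (\<bar>G z\<bar> ^ p))"
    unfolding pnorm_def
  proof (rule nn_integral_mono)
    fix z
    have "ennreal (\<bar>F z + G z\<bar> ^ p) \<le> ennreal (2 * \<bar>F z\<bar> ^ p + 2 * \<bar>G z\<bar> ^ p)"
      by (intro ennreal_leI abs_power_add_le p)
    then show "ennreal (\<bar>F z + G z\<bar> ^ p) \<le> 2 * ennreal (\<bar>F z\<bar> ^ p) + 2 * ennreal (\<bar>G z\<bar> ^ p)"
      by (simp add: ennreal_plus ennreal_mult)
  qed
  also have "\<dots> = 2 * pnorm p F + 2 * pnorm p G"
    unfolding pnorm_def by (subst nn_integral_add) (auto simp: nn_integral_cmult)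
  finally show ?thesis .
qed

lemma nn_integral_kern: "(NNINT w. ennreal (kern n w)) = 1"
  by (subst nn_integral_eq_integral) (auto simp: kern_integrable kern_nonneg kern_integral)

text \<open>Young's inequality for a probability kernel. Pointwise it is Jensen's inequality for the
  density \<open>kern n (z - w)\<close>; for p = 2 this is Cauchy-Schwarz after splitting the kernel
  into two square roots.\<close>

lemma pnorm_conv_le:
  assumes p: "p = 1 \<or> p = 2" and F: "F \<in> Borel"
  shows "pnorm p (conv F (kern n)) \<le> pnorm p F"
proof -
  note [measurable] = F borel_measurable_integrable[OF kern_integrable, of n, simplified]
  have conv: "(ennreal \<bar>conv F (kern n) z\<bar>) ^ p \<le> (NNINT w. ennreal (\<bar>F w\<bar> ^ p) * ennreal (kern n (z - w)))" for z
  proof -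
    have k1: "(NNINT w. ennreal (kern n (z - w))) = 1"
      using nn_integral_reflect[of "\<lambda>w. ennreal (kern n w)" z] nn_integral_kern by simp
    have *: "ennreal \<bar>conv F (kern n) z\<bar> \<le> (NNINT w. ennreal \<bar>F w\<bar> * ennreal (kern n (z - w)))"
    proof (cases "integrable lborel (\<lambda>w. F w * kern n (z - w))")
      case True
      have "ennreal (norm (conv F (kern n) z)) \<le> (NNINT w. ennreal (norm (F w * kern n (z - w))))"
        unfolding conv_def by (rule integral_norm_bound_ennreal[OF True])
      then show ?thesis by (simp add: abs_mult kern_nonneg ennreal_mult)
    next
      \<comment> \<open>The Bochner integral of a non-integrable function is 0, so the bound is
        trivial here.\<close>
      case False
      then show ?thesis by (simp add: conv_def not_integrable_integral_eq)
    qed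
    from p show ?thesis
    proof
      assume "p = 2"
      let ?a = "\<lambda>w. ennreal (\<bar>F w\<bar> * sqrt (kern n (z - w)))" and ?b = "\<lambda>w. ennreal (sqrt (kern n (z - w)))"
      have e: "ennreal \<bar>F w\<bar> * ennreal (kern n (z - w)) = ?a w * ?b w" for w
        by (subst (1 2) ennreal_mult[symmetric]) (auto simp: kern_nonneg)
      have "(ennreal \<bar>conv F (kern n) z\<bar>)\<^sup>2 \<le> (NNINT w. ?a w * ?b w)\<^sup>2"
        using * unfolding e by (intro power_mono) auto
      also have "\<dots> \<le> (NNINT w. (?a w)\<^sup>2) * (NNINT w. (?b w)\<^sup>2)"
        by (rule Cauchy_Schwarz_nn_integral) measurable
      also have "(NNINT w. (?b w)\<^sup>2) = 1"
        using k1 by (simp add: ennreal_power kern_nonneg)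
      also have "(NNINT w. (?a w)\<^sup>2) = (NNINT w. ennreal (\<bar>F w\<bar> ^ p) * ennreal (kern n (z - w)))"
        using \<open>p = 2\<close> by (intro nn_integral_cong, subst ennreal_mult[symmetric])
          (auto simp: ennreal_power kern_nonneg power_mult_distrib)
      finally show ?thesis using \<open>p = 2\<close> by simp
    qed (use * in simp)
  qed
  have "pnorm p (conv F (kern n)) = (NNINT z. (ennreal \<bar>conv F (kern n) z\<bar>) ^ p)"
    unfolding pnorm_def by (simp add: ennreal_power)
  also have "\<dots> \<le> (NNINT z. (NNINT w. ennreal (\<bar>F w\<bar> ^ p) * ennreal (kern n (z - w))))"
    by (intro nn_integral_mono conv)
  also have "\<dots> = (NNINT w. (NNINT z. ennreal (\<bar>F w\<bar> ^ p) * ennreal (kern n (z - w))))"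
    by (rule lborel_pair.Fubini') measurable
  also have "\<dots> = (NNINT w. ennreal (\<bar>F w\<bar> ^ p))"
  proof (rule nn_integral_cong)
    fix w :: complex
    have "(NNINT z. ennreal (kern n (z - w))) = 1"
      using nn_integral_translate[of "\<lambda>w. ennreal (kern n w)" "- w"] nn_integral_kern by simp
    then show "(NNINT z. ennreal (\<bar>F w\<bar> ^ p) * ennreal (kern n (z - w))) = ennreal (\<bar>F w\<bar> ^ p)"
      by (simp add: nn_integral_cmult)
  qed
  finally show ?thesis by (simp add: pnorm_def)
qed

section \<open>Density of continuous functions and convergence of mollifications\<close>

lemma pnorm_dominated:
  assumes [measurable]: "\<And>i. u i \<in> Borel"
    and "AE z in lborel. (\<lambda>i. u i z) \<longlonglongrightarrow> 0"
    and "\<And>i. AE z in lborel. \<bar>u i z\<bar> \<le> w z" and [measurable]: "w \<in> Borel"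
    and "pnorm p w < \<infinity>" and "p > 0"
  shows "(\<lambda>i. pnorm p (u i)) \<longlonglongrightarrow> 0"
proof -
  have "(\<lambda>i. NNINT z. ennreal (\<bar>u i z\<bar> ^ p)) \<longlonglongrightarrow> integral\<^sup>N lborel (\<lambda>z::complex. ennreal (\<bar>0::real\<bar> ^ p))"
  proof (rule nn_integral_dominated_convergence[where w = "\<lambda>z. ennreal (\<bar>w z\<bar> ^ p)" and u' = "\<lambda>_::complex. ennreal (\<bar>0::real\<bar> ^ p)"])
    show "AE z in lborel. ennreal (\<bar>u j z\<bar> ^ p) \<le> ennreal (\<bar>w z\<bar> ^ p)" for j
      using assms(3)[of j] by eventually_elim (auto intro!: ennreal_leI power_mono intro: order_trans)
    show "AE z in lborel. (\<lambda>i. ennreal (\<bar>u i z\<bar> ^ p)) \<longlonglongrightarrow> ennreal (\<bar>0\<bar> ^ p)"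
      using assms(2) by eventually_elim (intro tendsto_intros, auto)
  qed (use assms(5) in \<open>auto simp: pnorm_def\<close>)
  then show ?thesis using \<open>p > 0\<close> by (simp add: pnorm_def zero_power)
qed

text \<open>A measurable function is an almost-everywhere limit of continuous ones. Clipping their
  values to [-m, m] and multiplying by a cut-off that is 1 on the disc of radius R provides a
  dominating function and leaves the limit unchanged, since F obeys both restrictions.\<close>

lemma continuous_approx_bounded:
  assumes F: "F \<in> Borel" and m: "m \<ge> 0" "\<And>z. \<bar>F z\<bar> \<le> m"
    and S: "\<And>z. z \<notin> cball 0 R \<Longrightarrow> F z = 0" and "p > 0"
  shows "\<exists>g. (\<forall>i. continuous_on UNIV (g i) \<and> (\<forall>z. z \<notin> cball 0 (R + 1) \<longrightarrow> g i z = 0)) \<and>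
    (\<lambda>i. pnorm p (\<lambda>z. g i z - F z)) \<longlonglongrightarrow> 0"
proof -
  have "F measurable_on UNIV"
    by (rule lebesgue_measurable_imp_measurable_on_real) (use F in \<open>auto intro: measurable_completion\<close>)
  then obtain N g where N: "negligible N" "\<And>n. continuous_on UNIV (g n)"
    "\<And>z. z \<notin> N \<Longrightarrow> (\<lambda>n. g n z) \<longlonglongrightarrow> F z"
    unfolding measurable_on_def by auto
  define h where "h n z = max (- m) (min m (g n z)) * max 0 (min 1 (R + 1 - norm z))" for n z
  have cont: "continuous_on UNIV (h n)" for n
    unfolding h_def by (intro continuous_intros N)
  then have [measurable]: "h n \<in> Borel" for n
    by (rule borel_measurable_continuous_onI)
  have supp: "z \<notin> cball 0 (R + 1) \<Longrightarrow> h n z = 0" for n z by (simp add: h_def)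
  have lim: "(\<lambda>n. h n z - F z) \<longlonglongrightarrow> 0" if "z \<notin> N" for z
  proof -
    have "(\<lambda>n. h n z - F z) \<longlonglongrightarrow> max (- m) (min m (F z)) * max 0 (min 1 (R + 1 - norm z)) - F z"
      unfolding h_def by (intro tendsto_intros N that)
    moreover have "max (- m) (min m (F z)) = F z" using m(2)[of z] by auto
    moreover have "F z * max 0 (min 1 (R + 1 - norm z)) = F z"
      using S[of z] by (cases "norm z \<le> R") auto
    ultimately show ?thesis by simp
  qed
  have "(\<lambda>i. pnorm p (\<lambda>z. h i z - F z)) \<longlonglongrightarrow> 0"
  proof (rule pnorm_dominated[where w = "\<lambda>z. 2 * m * ind (cball 0 (R + 1)) z"])
    have "negligible N \<longleftrightarrow> N \<in> null_sets lebesgue" by (rule negligible_iff_null_sets)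
    then have "AE z in lebesgue. z \<notin> N" using N(1) by (auto intro: AE_not_in)
    then have "AE z in lborel. z \<notin> N" by (simp add: AE_completion_iff)
    then show "AE z in lborel. (\<lambda>i. h i z - F z) \<longlonglongrightarrow> 0"
      by eventually_elim (rule lim)
    show "AE z in lborel. \<bar>h i z - F z\<bar> \<le> 2 * m * ind (cball 0 (R + 1)) z" for i
    proof (rule AE_I2)
      fix z :: complex
      have "\<bar>h i z\<bar> \<le> m * 1"
        unfolding h_def abs_mult by (intro mult_mono) (use m in auto)
      then show "\<bar>h i z - F z\<bar> \<le> 2 * m * ind (cball 0 (R + 1)) z"
        using m(2)[of z] supp[of z i] S[of z] by (cases "z \<in> cball 0 (R + 1)") auto
    qed
    have "pnorm p (\<lambda>z. 2 * m * ind (cball 0 (R + 1)) z)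
        = (NNINT z. ennreal ((2 * m) ^ p) * ind (cball (0::complex) (R + 1)) z)"
      unfolding pnorm_def using \<open>p > 0\<close> m(1) by (intro nn_integral_cong) (auto simp: indicator_def)
    also have "\<dots> < \<infinity>"
      using emeasure_lborel_cball_finite[of "0::complex" "R + 1"]
      by (simp add: nn_integral_cmult_indicator ennreal_mult_less_top)
    finally show "pnorm p (\<lambda>z. 2 * m * ind (cball 0 (R + 1)) z) < \<infinity>" .
  qed (use \<open>p > 0\<close> F in \<open>auto intro!: borel_measurable_times borel_measurable_indicator\<close>)
  then show ?thesis using cont supp by blast
qed

lemma continuous_dense_pnorm:
  assumes p: "p = 1 \<or> p = 2" and F: "F \<in> Borel" "pnorm p F < \<infinity>" and "(e::real) > 0"
  shows "\<exists>g R. continuous_on UNIV g \<and> (\<forall>z. z \<notin> cball 0 R \<longrightarrow> g z = 0) \<and> pnorm p (\<lambda>z. g z - F z) < e"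
proof -
  note [measurable] = F(1)
  have "p > 0" using p by auto
  define T where "T n z = max (- real n) (min (real n) (F z)) * ind (cball 0 (real n)) z" for n z
  have [measurable]: "T n \<in> Borel" for n
    unfolding T_def by (intro borel_measurable_times borel_measurable_indicator) auto
  have "(\<lambda>n. pnorm p (\<lambda>z. T n z - F z)) \<longlonglongrightarrow> 0"
  proof (rule pnorm_dominated[where w = "\<lambda>z. \<bar>F z\<bar>"])
    show "AE z in lborel. (\<lambda>n. T n z - F z) \<longlonglongrightarrow> 0"
    proof (rule AE_I2)
      fix z
      obtain N where N: "real N \<ge> max \<bar>F z\<bar> (norm z)" using real_arch_simple by blast
      have "T n z - F z = 0" if "n \<ge> N" for n
      proof -
        have "real n \<ge> \<bar>F z\<bar>" "real n \<ge> norm z" using that N by auto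
        then show ?thesis by (auto simp: T_def)
      qed
      then show "(\<lambda>n. T n z - F z) \<longlonglongrightarrow> 0"
        by (intro tendsto_eventually) (auto simp: eventually_sequentially)
    qed
    show "AE z in lborel. \<bar>T i z - F z\<bar> \<le> \<bar>F z\<bar>" for i
      by (rule AE_I2) (auto simp: T_def indicator_def)
  qed (use F \<open>p > 0\<close> in \<open>auto simp: pnorm_def\<close>)
  \<comment> \<open>The factor 2 in \<open>pnorm_add_le\<close> turns two errors below e / 4 into
    one below e.\<close>
  moreover have "0 < ennreal (e / 4)" using \<open>e > 0\<close> by simp
  ultimately have "\<forall>\<^sub>F n in sequentially. pnorm p (\<lambda>z. T n z - F z) < ennreal (e / 4)"
    by (rule order_tendstoD(2))
  then obtain n where n: "pnorm p (\<lambda>z. T n z - F z) < ennreal (e / 4)"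
    by (meson eventually_sequentially order_refl)
  obtain g where g: "\<And>i. continuous_on UNIV (g i)" "\<And>i z. z \<notin> cball 0 (real n + 1) \<Longrightarrow> g i z = 0"
    "(\<lambda>i. pnorm p (\<lambda>z. g i z - T n z)) \<longlonglongrightarrow> 0"
    using continuous_approx_bounded[of "T n" "real n" "real n" p] \<open>p > 0\<close>
    by (fastforce simp: T_def indicator_def)
  have "\<forall>\<^sub>F i in sequentially. pnorm p (\<lambda>z. g i z - T n z) < ennreal (e / 4)"
    using \<open>0 < ennreal (e / 4)\<close> by (rule order_tendstoD(2)[OF g(3)])
  then obtain i where i: "pnorm p (\<lambda>z. g i z - T n z) < ennreal (e / 4)"
    by (meson eventually_sequentially order_refl)
  have [measurable]: "g i \<in> Borel"
    by (rule borel_measurable_continuous_onI[OF g(1)])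
  have "pnorm p (\<lambda>z. g i z - F z) = pnorm p (\<lambda>z. (g i z - T n z) + (T n z - F z))" by simp
  also have "\<dots> \<le> 2 * pnorm p (\<lambda>z. g i z - T n z) + 2 * pnorm p (\<lambda>z. T n z - F z)"
    by (rule pnorm_add_le[OF p]) measurable
  also have "\<dots> < 2 * ennreal (e / 4) + 2 * ennreal (e / 4)"
    by (intro add_strict_mono ennreal_mult_strict_left_mono i n) auto
  also have "\<dots> = ennreal e"
    using \<open>e > 0\<close> by (simp flip: ennreal_numeral ennreal_mult ennreal_plus)
  finally show ?thesis using g(1,2) by blast
qed

text \<open>The convolution at z averages F over a disc of radius \<open>2 / real (Suc n)\<close>
  with weights of total mass 1, so it inherits any bound on |F - c| there. Suitable choices of c
  give pointwise convergence (c = F z), vanishing (c = 0) and the plateau of a cut-off (c =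
  1).\<close>

lemma conv_near:
  assumes F: "integrable lborel F" and c: "\<And>w. norm (w - z) < 2 / real (Suc n) \<Longrightarrow> \<bar>F w - c\<bar> \<le> e"
  shows "\<bar>conv F (kern n) z - c\<bar> \<le> e"
proof -
  have k: "kern n \<in> Borel" using smooth_borel[OF smooth_kern] .
  obtain M where M: "\<And>z. \<bar>kern n z\<bar> \<le> M"
    using bounded_of_compact_support[OF smooth_continuous_on[OF smooth_kern] _ kern_cball] by auto
  have i1: "integrable lborel (\<lambda>w. F w * kern n (z - w))"
    by (rule conv_integrable[OF F smooth_continuous_on[OF smooth_kern] M])
  have i2: "integrable lborel (\<lambda>w. kern n (z - w))"
    using integrable_distr_eq[of "\<lambda>w. z - w" lborel borel "kern n"] kern_integrable k
    by (simp add: lborel_reflect)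
  have one: "(LBINT w. kern n (z - w)) = 1"
    using integral_reflect[OF k, of z] kern_integral by simp
  have "conv F (kern n) z - c = (LBINT w. F w * kern n (z - w)) - c * (LBINT w. kern n (z - w))"
    by (simp add: conv_def one)
  also have "\<dots> = (LBINT w. (F w - c) * kern n (z - w))"
    using i1 i2 by (simp add: left_diff_distrib)
  finally have "\<bar>conv F (kern n) z - c\<bar> = norm (LBINT w. (F w - c) * kern n (z - w))" by simp
  also have "\<dots> \<le> (LBINT w. e * kern n (z - w))"
  proof (rule Bochner_Integration.integral_norm_bound_integral)
    show "integrable lborel (\<lambda>w. (F w - c) * kern n (z - w))"
      using i1 i2 by (simp add: left_diff_distrib)
    show "norm ((F w - c) * kern n (z - w)) \<le> e * kern n (z - w)" for w
    proof (cases "norm (w - z) < 2 / real (Suc n)")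
      case True
      then show ?thesis using c[OF True] kern_nonneg[of n "z - w"]
        by (simp add: abs_mult mult_right_mono)
    next
      case False
      then have "kern n (z - w) = 0" by (intro kern_eq_0) (simp add: norm_minus_commute)
      then show ?thesis by simp
    qed
  qed (use i2 in simp)
  also have "\<dots> = e" by (simp add: one)
  finally show ?thesis .
qed

lemma conv_borel [measurable]: "F \<in> Borel \<Longrightarrow> conv F (kern n) \<in> Borel"
proof -
  assume [measurable]: "F \<in> Borel"
  have [measurable]: "kern n \<in> Borel" using smooth_borel[OF smooth_kern] .
  show ?thesis unfolding conv_def[abs_def] by measurable
qed

lemma two_div_Suc_small: "(d::real) > 0 \<Longrightarrow> \<forall>\<^sub>F n in sequentially. 2 / real (Suc n) < d"
  by real_asymp

lemma conv_continuous_tendsto: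
  assumes F: "integrable lborel F" and "isCont F z"
  shows "(\<lambda>n. conv F (kern n) z) \<longlonglongrightarrow> F z"
proof (rule LIMSEQ_I)
  fix r :: real assume "r > 0"
  then obtain d where d: "d > 0" "\<And>w. dist w z < d \<Longrightarrow> dist (F w) (F z) < r / 2"
    using assms(2) unfolding continuous_at_eps_delta by (meson half_gt_zero)
  from two_div_Suc_small[OF d(1)] have "\<forall>\<^sub>F n in sequentially. \<bar>conv F (kern n) z - F z\<bar> < r"
  proof eventually_elim
    case (elim n)
    have "\<bar>conv F (kern n) z - F z\<bar> \<le> r / 2"
      using d(2) elim by (intro conv_near[OF F]) (force simp: dist_norm intro: less_imp_le)
    then show ?case using \<open>r > 0\<close> by simp
  qed
  then show "\<exists>no. \<forall>n\<ge>no. norm (conv F (kern n) z - F z) < r"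
    by (auto simp: eventually_sequentially)
qed

lemma conv_pnorm_continuous:
  assumes "continuous_on UNIV g" "\<forall>z. z \<notin> cball 0 R \<longrightarrow> g z = 0" "p > 0"
  shows "(\<lambda>n. pnorm p (\<lambda>z. conv g (kern n) z - g z)) \<longlonglongrightarrow> 0"
proof -
  have ig: "integrable lborel g"
    using integrable_compact_support[OF compact_cball continuous_on_subset[OF assms(1)] assms(2)] by auto
  obtain M where M: "M \<ge> 0" "\<And>z. \<bar>g z\<bar> \<le> M"
    using bounded_of_compact_support[OF assms(1) compact_cball assms(2)] by auto
  have [measurable]: "g \<in> Borel" using ig by auto
  show ?thesis
  proof (rule pnorm_dominated[where w = "\<lambda>z. 2 * M * ind (cball 0 (R + 2)) z"])
    have "isCont g z" for z
      using assms(1) continuous_on_eq_continuous_at open_UNIV by auto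
    then have "(\<lambda>i. conv g (kern i) z - g z) \<longlonglongrightarrow> 0" for z
      using conv_continuous_tendsto[OF ig, of z] by (simp add: LIM_zero_iff)
    then show "AE z in lborel. (\<lambda>i. conv g (kern i) z - g z) \<longlonglongrightarrow> 0" by simp
    show "AE z in lborel. \<bar>conv g (kern i) z - g z\<bar> \<le> 2 * M * ind (cball 0 (R + 2)) z" for i
    proof (rule AE_I2)
      fix z :: complex
      have b: "\<bar>conv g (kern i) z - 0\<bar> \<le> M" by (rule conv_near[OF ig]) (simp add: M)
      show "\<bar>conv g (kern i) z - g z\<bar> \<le> 2 * M * ind (cball 0 (R + 2)) z"
      proof (cases "z \<in> cball 0 (R + 2)")
        case True
        then show ?thesis using b M(2)[of z] by simp
      next
        case False
        have "\<bar>conv g (kern i) z - 0\<bar> \<le> 0"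
        proof (rule conv_near[OF ig])
          fix w assume w: "cmod (w - z) < 2 / real (Suc i)"
          also have "\<dots> \<le> 2" by (simp add: field_simps)
          finally have "w \<notin> cball 0 R"
            using False norm_triangle_ineq2[of z w] by (auto simp: norm_minus_commute)
          then show "\<bar>g w - 0\<bar> \<le> 0" using assms(2) by simp
        qed
        moreover have "g z = 0" using False assms(2) by auto
        ultimately show ?thesis using M(1) by simp
      qed
    qed
    have "pnorm p (\<lambda>z. 2 * M * ind (cball 0 (R + 2)) z)
        = (NNINT z. ennreal ((2 * M) ^ p) * ind (cball (0::complex) (R + 2)) z)"
      unfolding pnorm_def using \<open>p > 0\<close> M(1) by (intro nn_integral_cong) (auto simp: indicator_def)
    also have "\<dots> < \<infinity>"
      using emeasure_lborel_cball_finite[of "0::complex" "R + 2"]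
      by (simp add: nn_integral_cmult_indicator ennreal_mult_less_top)
    finally show "pnorm p (\<lambda>z. 2 * M * ind (cball 0 (R + 2)) z) < \<infinity>" .
  qed (use \<open>p > 0\<close> in \<open>auto intro!: borel_measurable_times borel_measurable_indicator borel_measurable_diff conv_borel\<close>)
qed

lemma conv_add:
  assumes "integrable lborel F" "integrable lborel G"
  shows "conv (\<lambda>z. F z + G z) (kern n) z = conv F (kern n) z + conv G (kern n) z"
proof -
  obtain M where M: "\<And>z. \<bar>kern n z\<bar> \<le> M"
    using bounded_of_compact_support[OF smooth_continuous_on[OF smooth_kern] _ kern_cball] by auto
  show ?thesis
    unfolding conv_def distrib_right
    by (intro Bochner_Integration.integral_add conv_integrable[OF _ smooth_continuous_on[OF smooth_kern] M] assms)
qed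

lemma conv_pnorm_tendsto:
  assumes p: "p = 1 \<or> p = 2" and F: "integrable lborel F" "pnorm p F < \<infinity>"
  shows "(\<lambda>n. pnorm p (\<lambda>z. conv F (kern n) z - F z)) \<longlonglongrightarrow> 0"
proof (rule tendsto_zero_ennreal)
  fix e :: real assume e: "e > 0"
  have [measurable]: "F \<in> Borel" using F by auto
  \<comment> \<open>Two uses of \<open>pnorm_add_le\<close> weight the three errors by 2, 4 and 4,
    and 10 / 12 < 1.\<close>
  obtain g R where g: "continuous_on UNIV g" "\<forall>z. z \<notin> cball 0 R \<longrightarrow> g z = 0"
    and gF: "pnorm p (\<lambda>z. g z - F z) < ennreal (e / 12)"
    using continuous_dense_pnorm[OF p _ F(2), of "e / 12"] e by auto
  have ig: "integrable lborel g"
    using integrable_compact_support[OF compact_cball continuous_on_subset[OF g(1)] g(2)] by auto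
  then have [measurable]: "g \<in> Borel" by auto
  have p0: "p > 0" using p by auto
  have eq: "conv F (kern n) z - F z = conv (\<lambda>z. F z - g z) (kern n) z + ((conv g (kern n) z - g z) + (g z - F z))" for n z
    using conv_add[of "\<lambda>z. F z - g z" g n z] F(1) ig by simp
  have "pnorm p (\<lambda>z. conv (\<lambda>z. F z - g z) (kern n) z) \<le> pnorm p (\<lambda>z. g z - F z)" for n
    using pnorm_conv_le[OF p, of "\<lambda>z. F z - g z" n] by (simp add: pnorm_def abs_minus_commute)
  then have a: "pnorm p (\<lambda>z. conv (\<lambda>z. F z - g z) (kern n) z) < ennreal (e / 12)" for n
    using gF by (rule le_less_trans)
  have "\<forall>\<^sub>F n in sequentially. pnorm p (\<lambda>z. conv g (kern n) z - g z) < ennreal (e / 12)"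
    using order_tendstoD(2)[OF conv_pnorm_continuous[OF g p0]] e by simp
  then show "\<forall>\<^sub>F n in sequentially. pnorm p (\<lambda>z. conv F (kern n) z - F z) < ennreal e"
  proof eventually_elim
    case (elim n)
    have "pnorm p (\<lambda>z. conv F (kern n) z - F z) \<le> 2 * pnorm p (\<lambda>z. conv (\<lambda>z. F z - g z) (kern n) z) +
        2 * pnorm p (\<lambda>z. (conv g (kern n) z - g z) + (g z - F z))"
      unfolding eq by (rule pnorm_add_le[OF p]) measurable
    also have "\<dots> \<le> 2 * pnorm p (\<lambda>z. conv (\<lambda>z. F z - g z) (kern n) z) +
        2 * (2 * pnorm p (\<lambda>z. conv g (kern n) z - g z) + 2 * pnorm p (\<lambda>z. g z - F z))"
      by (intro add_left_mono mult_left_mono pnorm_add_le[OF p]) auto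
    also have "\<dots> \<le> 2 * ennreal (e / 12) + 2 * (2 * ennreal (e / 12) + 2 * ennreal (e / 12))"
      by (intro add_mono mult_left_mono less_imp_le a elim gF) auto
    also have "\<dots> = ennreal (10 * e / 12)"
      using e by (simp flip: ennreal_numeral ennreal_mult ennreal_plus)
    also have "\<dots> < ennreal e" using e by (simp add: ennreal_less_iff)
    finally show ?case .
  qed
qed

section \<open>Local convergence in Lebesgue spaces\<close>

definition Lp :: "nat \<Rightarrow> complex set \<Rightarrow> (complex \<Rightarrow> real) \<Rightarrow> bool" where
  "Lp p C v \<longleftrightarrow> v \<in> Borel \<and> pnorm p (\<lambda>z. ind C z * v z) < \<infinity>"

text \<open>Convergence in L^p on C. The limit itself need not be p-integrable; where this matters
  it is a separate \<open>Lp\<close> assumption.\<close>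

definition plim :: "nat \<Rightarrow> complex set \<Rightarrow> (nat \<Rightarrow> complex \<Rightarrow> real) \<Rightarrow> (complex \<Rightarrow> real) \<Rightarrow> bool" where
  "plim p C u v \<longleftrightarrow> (\<forall>n. u n \<in> Borel) \<and> v \<in> Borel \<and>
    (\<lambda>n. pnorm p (\<lambda>z. ind C z * (u n z - v z))) \<longlonglongrightarrow> 0"

lemma indicator_borel_times:
  "C \<in> sets borel \<Longrightarrow> v \<in> Borel \<Longrightarrow>
    (\<lambda>z. ind C z * v z :: real) \<in> Borel"
  by (intro borel_measurable_times borel_measurable_indicator)

lemma pnorm_mono:
  "(\<And>z. \<bar>F z\<bar> \<le> \<bar>G z\<bar>) \<Longrightarrow> pnorm p F \<le> pnorm p G"
  unfolding pnorm_def by (intro nn_integral_mono ennreal_leI power_mono) auto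

lemma pnorm_cmult:
  assumes "F \<in> Borel"
  shows "pnorm p (\<lambda>z. c * F z) = ennreal (\<bar>c\<bar> ^ p) * pnorm p F"
  unfolding pnorm_def using assms
  by (simp add: abs_mult power_mult_distrib ennreal_mult nn_integral_cmult)

lemma pnorm_mult_squared_le:
  assumes [measurable]: "F \<in> Borel" "G \<in> Borel"
  shows "(pnorm 1 (\<lambda>z. F z * G z))\<^sup>2 \<le> pnorm 2 F * pnorm 2 G"
proof -
  have "(NNINT z. ennreal \<bar>F z\<bar> * ennreal \<bar>G z\<bar>)\<^sup>2
      \<le> (NNINT z. (ennreal \<bar>F z\<bar>)\<^sup>2) * (NNINT z. (ennreal \<bar>G z\<bar>)\<^sup>2)"
    by (rule Cauchy_Schwarz_nn_integral) measurable
  then show ?thesis by (simp add: pnorm_def abs_mult ennreal_mult ennreal_power)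
qed

lemma ennreal_square_tendsto_0:
  fixes f :: "nat \<Rightarrow> ennreal"
  assumes "(\<lambda>n. (f n)\<^sup>2) \<longlonglongrightarrow> 0"
  shows "f \<longlonglongrightarrow> 0"
proof (rule tendsto_zero_ennreal)
  fix r :: real assume r: "0 < r"
  then have "\<forall>\<^sub>F n in sequentially. (f n)\<^sup>2 < ennreal (r\<^sup>2)"
    by (intro order_tendstoD(2)[OF assms]) auto
  then show "\<forall>\<^sub>F n in sequentially. f n < ennreal r"
  proof eventually_elim
    case (elim n)
    show ?case
    proof (rule ccontr)
      assume "\<not> f n < ennreal r"
      then have "(ennreal r)\<^sup>2 \<le> (f n)\<^sup>2" by (intro power_mono) auto
      then show False using elim r by (simp add: ennreal_power)
    qed
  qed
qed

lemma Lp_borel: "Lp p C v \<Longrightarrow> v \<in> Borel"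
  and plim_borel: "plim p C u v \<Longrightarrow> u n \<in> Borel"
  and plim_borel': "plim p C u v \<Longrightarrow> v \<in> Borel"
  by (auto simp: Lp_def plim_def)

lemma Lp_subset:
  assumes "Lp p C v" "D \<subseteq> C"
  shows "Lp p D v"
proof -
  have "pnorm p (\<lambda>z. ind D z * v z) \<le> pnorm p (\<lambda>z. ind C z * v z)"
    by (rule pnorm_mono) (use assms(2) in \<open>auto simp: indicator_def\<close>)
  then show ?thesis using assms(1) by (auto simp: Lp_def elim: le_less_trans)
qed

lemma plim_subset:
  assumes "plim p C u v" "D \<subseteq> C"
  shows "plim p D u v"
proof -
  have le: "pnorm p (\<lambda>z. ind D z * (u n z - v z)) \<le> pnorm p (\<lambda>z. ind C z * (u n z - v z))" for n
    by (rule pnorm_mono) (use assms(2) in \<open>auto simp: indicator_def\<close>)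
  have lim: "(\<lambda>n. pnorm p (\<lambda>z. ind C z * (u n z - v z))) \<longlonglongrightarrow> 0"
    using assms(1) unfolding plim_def by blast
  have "(\<lambda>n. pnorm p (\<lambda>z. ind D z * (u n z - v z))) \<longlonglongrightarrow> 0"
    by (rule tendsto_sandwich[OF _ _ tendsto_const lim]) (auto simp: le)
  then show ?thesis using assms(1) unfolding plim_def by auto
qed

lemma Lp_add:
  assumes p: "p = 1 \<or> p = 2" and "C \<in> sets borel" "Lp p C u" "Lp p C v"
  shows "Lp p C (\<lambda>z. u z + v z)"
proof -
  have "pnorm p (\<lambda>z. ind C z * (u z + v z)) = pnorm p (\<lambda>z. ind C z * u z + ind C z * v z)"
    by (simp add: distrib_left)
  also have "\<dots> \<le> 2 * pnorm p (\<lambda>z. ind C z * u z) + 2 * pnorm p (\<lambda>z. ind C z * v z)"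
    using assms by (intro pnorm_add_le p indicator_borel_times) (auto simp: Lp_def)
  also have "\<dots> < \<infinity>" using assms(3,4) by (auto simp: Lp_def ennreal_mult_less_top)
  finally show ?thesis using assms by (auto simp: Lp_def)
qed

lemma Lp_cmult:
  assumes "C \<in> sets borel" "Lp p C u"
  shows "Lp p C (\<lambda>z. c * u z)"
proof -
  have "pnorm p (\<lambda>z. ind C z * (c * u z)) = ennreal (\<bar>c\<bar> ^ p) * pnorm p (\<lambda>z. ind C z * u z)"
    using assms by (subst pnorm_cmult[symmetric])
      (auto simp: Lp_def mult.left_commute intro!: indicator_borel_times)
  then show ?thesis using assms by (auto simp: Lp_def ennreal_mult_less_top)
qed

lemma Lp_uminus: "C \<in> sets borel \<Longrightarrow> Lp p C u \<Longrightarrow> Lp p C (\<lambda>z. - u z)"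
  using Lp_cmult[of C p u "-1"] by simp

lemma Lp_diff:
  assumes "p = 1 \<or> p = 2" "C \<in> sets borel" "Lp p C u" "Lp p C v"
  shows "Lp p C (\<lambda>z. u z - v z)"
  using Lp_add[OF assms(1-3) Lp_uminus[OF assms(2,4)]] by simp

lemma Lp_mult:
  assumes "C \<in> sets borel" "Lp 2 C u" "Lp 2 C v"
  shows "Lp 1 C (\<lambda>z. u z * v z)"
proof -
  have "(pnorm 1 (\<lambda>z. (ind C z * u z) * (ind C z * v z)))\<^sup>2
      \<le> pnorm 2 (\<lambda>z. ind C z * u z) * pnorm 2 (\<lambda>z. ind C z * v z)"
    using assms by (intro pnorm_mult_squared_le indicator_borel_times) (auto simp: Lp_def)
  also have "\<dots> < \<infinity>" using assms by (auto simp: Lp_def ennreal_mult_less_top)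
  finally have "pnorm 1 (\<lambda>z. (ind C z * u z) * (ind C z * v z)) < \<infinity>"
    by (auto simp: less_top[symmetric] power2_eq_square ennreal_mult_eq_top_iff)
  moreover have "(\<lambda>z. (ind C z * u z) * (ind C z * v z)) = (\<lambda>z. ind C z * (u z * v z))"
    by (auto simp: indicator_def)
  ultimately show ?thesis using assms by (auto simp: Lp_def)
qed

lemma Lp_bounded_mult:
  assumes C: "C \<in> sets borel" and u: "u \<in> Borel" "\<And>z. z \<in> C \<Longrightarrow> \<bar>u z\<bar> \<le> M" and v: "Lp p C v"
  shows "Lp p C (\<lambda>z. u z * v z)"
proof -
  have "pnorm p (\<lambda>z. ind C z * (u z * v z)) \<le> pnorm p (\<lambda>z. M * (ind C z * v z))"
  proof (rule pnorm_mono)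
    fix z
    show "\<bar>ind C z * (u z * v z)\<bar> \<le> \<bar>M * (ind C z * v z)\<bar>"
    proof (cases "z \<in> C")
      case True
      then have "\<bar>u z\<bar> \<le> \<bar>M\<bar>" using u(2)[of z] by linarith
      then show ?thesis using True by (simp add: abs_mult mult_right_mono)
    qed simp
  qed
  also have "\<dots> < \<infinity>"
    using v C by (subst pnorm_cmult) (auto simp: Lp_def ennreal_mult_less_top intro!: indicator_borel_times)
  finally show ?thesis using u v by (auto simp: Lp_def)
qed

lemma Lp1_integrable:
  assumes "C \<in> sets borel"
  shows "Lp 1 C v \<longleftrightarrow> v \<in> Borel \<and> integrable lborel (\<lambda>z. ind C z * v z)"
  using assms indicator_borel_times[OF assms, of v]
  by (auto simp: Lp_def pnorm_def integrable_iff_bounded)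

lemma Lp2_integrable:
  assumes "C \<in> sets borel"
  shows "Lp 2 C v \<longleftrightarrow> v \<in> Borel \<and> integrable lborel (\<lambda>z. ind C z * (v z)\<^sup>2)"
proof -
  have "(\<bar>ind C z * v z\<bar>)\<^sup>2 = \<bar>ind C z * (v z)\<^sup>2\<bar>" for z
    by (auto simp: indicator_def)
  then show ?thesis
    using assms indicator_borel_times[OF assms, of "\<lambda>z. (v z)\<^sup>2"]
    by (auto simp: Lp_def pnorm_def integrable_iff_bounded)
qed

lemma Lp_bounded:
  assumes C: "compact C" and u: "u \<in> Borel" "\<And>z. z \<in> C \<Longrightarrow> \<bar>u z\<bar> \<le> M" and "p > 0"
  shows "Lp p C u"
proof -
  have [measurable]: "C \<in> sets borel" using C by (simp add: borel_compact)
  have "pnorm p (\<lambda>z. ind C z * u z) \<le> (NNINT z. ennreal (\<bar>M\<bar> ^ p) * ind C z)"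
    unfolding pnorm_def
  proof (rule nn_integral_mono)
    fix z
    show "ennreal (\<bar>ind C z * u z\<bar> ^ p) \<le> ennreal (\<bar>M\<bar> ^ p) * ind C z"
      using u(2)[of z] \<open>p > 0\<close> by (cases "z \<in> C") (auto intro!: ennreal_leI power_mono)
  qed
  also have "\<dots> < \<infinity>"
    using emeasure_compact_finite[OF C] by (simp add: nn_integral_cmult_indicator ennreal_mult_less_top)
  finally show ?thesis using u by (auto simp: Lp_def)
qed

lemma Lp_continuous:
  assumes C: "compact C" "continuous_on C u" "u \<in> Borel" "p > 0"
  shows "Lp p C u"
proof -
  have "bounded (u ` C)" using C compact_continuous_image compact_imp_bounded by blast
  then obtain M where "\<And>z. z \<in> C \<Longrightarrow> \<bar>u z\<bar> \<le> M" by (auto simp: bounded_iff)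
  then show ?thesis using Lp_bounded C by blast
qed

lemma Lp2_imp_Lp1:
  assumes "compact C" "Lp 2 C v"
  shows "Lp 1 C v"
proof -
  have "Lp 2 C (\<lambda>z. 1)" by (rule Lp_bounded[OF assms(1), where M = 1]) auto
  from Lp_mult[OF borel_compact[OF assms(1)] assms(2) this] show ?thesis by simp
qed

lemma plim_add:
  assumes p: "p = 1 \<or> p = 2" and C: "C \<in> sets borel" and u: "plim p C u u'" "plim p C v v'"
  shows "plim p C (\<lambda>n z. u n z + v n z) (\<lambda>z. u' z + v' z)"
proof -
  note [measurable] = plim_borel[OF u(1)] plim_borel[OF u(2)] plim_borel'[OF u(1)] plim_borel'[OF u(2)]
  have "(\<lambda>n. 2 * pnorm p (\<lambda>z. ind C z * (u n z - u' z)) + 2 * pnorm p (\<lambda>z. ind C z * (v n z - v' z)))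
      \<longlonglongrightarrow> 2 * 0 + 2 * 0"
    using u by (intro tendsto_add ennreal_tendsto_cmult) (auto simp: plim_def)
  then have lim: "(\<lambda>n. 2 * pnorm p (\<lambda>z. ind C z * (u n z - u' z)) + 2 * pnorm p (\<lambda>z. ind C z * (v n z - v' z)))
      \<longlonglongrightarrow> 0" by simp
  have "pnorm p (\<lambda>z. ind C z * (u n z + v n z - (u' z + v' z)))
      \<le> 2 * pnorm p (\<lambda>z. ind C z * (u n z - u' z)) + 2 * pnorm p (\<lambda>z. ind C z * (v n z - v' z))" for n
  proof -
    have "(\<lambda>z. ind C z * (u n z + v n z - (u' z + v' z)))
        = (\<lambda>z. ind C z * (u n z - u' z) + ind C z * (v n z - v' z))"
      by (auto simp: algebra_simps)
    then show ?thesis by (simp only:) (intro pnorm_add_le p indicator_borel_times C; measurable)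
  qed
  then have "(\<lambda>n. pnorm p (\<lambda>z. ind C z * (u n z + v n z - (u' z + v' z)))) \<longlonglongrightarrow> 0"
    by (intro tendsto_sandwich[OF _ _ tendsto_const lim]) auto
  then show ?thesis unfolding plim_def by auto
qed

lemma plim_const: "v \<in> Borel \<Longrightarrow> p > 0 \<Longrightarrow> plim p C (\<lambda>n. v) v"
  by (simp add: plim_def pnorm_def zero_power)

text \<open>Split u_n v_n - u v into u_n (v_n - v) + (u_n - u) v. Eventually |u_n| is at most |M| +
  1 on C, and |u_n - u| is uniformly small there.\<close>

lemma plim_mult_unif:
  assumes p: "p = 1 \<or> p = 2" and C: "C \<in> sets borel"
    and u: "uniform_limit C u u' sequentially" "\<And>z. z \<in> C \<Longrightarrow> \<bar>u' z\<bar> \<le> M"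
      "\<And>n. u n \<in> Borel" "u' \<in> Borel"
    and v: "plim p C v v'" "Lp p C v'"
  shows "plim p C (\<lambda>n z. u n z * v n z) (\<lambda>z. u' z * v' z)"
proof -
  note [measurable] = u(3,4) plim_borel[OF v(1)] plim_borel'[OF v(1)]
  have p0: "p > 0" using p by auto
  have "(\<lambda>n. pnorm p (\<lambda>z. ind C z * (u n z * v n z - u' z * v' z))) \<longlonglongrightarrow> 0"
  proof (rule tendsto_zero_ennreal)
    fix r :: real assume r: "r > 0"
    define V where "V = enn2real (pnorm p (\<lambda>z. ind C z * v' z))"
    have V: "pnorm p (\<lambda>z. ind C z * v' z) = ennreal V"
      using v(2) by (simp add: V_def Lp_def)
    have "V \<ge> 0" by (simp add: V_def)
    define M' where "M' = \<bar>M\<bar> + 1"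
    have M': "M' > 0" by (simp add: M'_def)
    \<comment> \<open>Being at most 1 makes e ^ p <= e for both exponents; with the 8, the two
      doubled errors add up to at most r / 2.\<close>
    define e where "e = min 1 (r / (8 * (V + 1)))"
    have e: "e > 0" "e \<le> 1" "e * V \<le> r / 8"
    proof -
      show "e > 0" "e \<le> 1" using r \<open>V \<ge> 0\<close> by (auto simp: e_def)
      have "e * V \<le> r / (8 * (V + 1)) * (V + 1)"
        using r \<open>V \<ge> 0\<close> \<open>e > 0\<close> by (intro mult_mono) (auto simp: e_def)
      also have "\<dots> = r / 8" using \<open>V \<ge> 0\<close> by (simp add: field_simps)
      finally show "e * V \<le> r / 8" .
    qed
    have ep: "e ^ p \<le> e" using p e by (auto simp: power2_eq_square mult_left_le)
    have ev1: "\<forall>\<^sub>F n in sequentially. \<forall>z\<in>C. dist (u n z) (u' z) < e"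
      using u(1) e(1) by (auto simp: uniform_limit_iff)
    define s where "s = r / (8 * M' ^ p)"
    have s: "s > 0" "M' ^ p * s = r / 8" using r M' by (auto simp: s_def)
    have ev2: "\<forall>\<^sub>F n in sequentially. pnorm p (\<lambda>z. ind C z * (v n z - v' z)) < ennreal s"
      using v(1) s(1) by (auto simp: plim_def intro: order_tendstoD(2))
    from ev1 ev2 show "\<forall>\<^sub>F n in sequentially.
        pnorm p (\<lambda>z. ind C z * (u n z * v n z - u' z * v' z)) < ennreal r"
    proof eventually_elim
      case (elim n)
      have "pnorm p (\<lambda>z. ind C z * (u n z * v n z - u' z * v' z))
          = pnorm p (\<lambda>z. ind C z * (u n z * (v n z - v' z)) + ind C z * ((u n z - u' z) * v' z))"
        by (simp add: algebra_simps)
      also have "\<dots> \<le> 2 * pnorm p (\<lambda>z. ind C z * (u n z * (v n z - v' z))) +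
          2 * pnorm p (\<lambda>z. ind C z * ((u n z - u' z) * v' z))"
        using C by (intro pnorm_add_le p indicator_borel_times; measurable)
      also have "\<dots> \<le> 2 * pnorm p (\<lambda>z. M' * (ind C z * (v n z - v' z))) +
          2 * pnorm p (\<lambda>z. e * (ind C z * v' z))"
      proof (intro add_mono mult_left_mono pnorm_mono)
        fix z
        show "\<bar>ind C z * (u n z * (v n z - v' z))\<bar> \<le> \<bar>M' * (ind C z * (v n z - v' z))\<bar>"
        proof (cases "z \<in> C")
          case True
          then have "\<bar>u n z - u' z\<bar> < 1" using elim(1) e(2) by (auto simp: dist_real_def)
          then have "\<bar>u n z\<bar> \<le> \<bar>M'\<bar>" using u(2)[OF True] by (auto simp: M'_def)
          then show ?thesis by (simp add: abs_mult indicator_def mult_right_mono)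
        qed simp
        show "\<bar>ind C z * ((u n z - u' z) * v' z)\<bar> \<le> \<bar>e * (ind C z * v' z)\<bar>"
        proof (cases "z \<in> C")
          case True
          then have "\<bar>u n z - u' z\<bar> \<le> \<bar>e\<bar>" using elim(1) e(1) by (auto simp: dist_real_def)
          then show ?thesis by (simp add: abs_mult indicator_def mult_right_mono)
        qed simp
      qed auto
      also have "\<dots> = 2 * (ennreal (M' ^ p) * pnorm p (\<lambda>z. ind C z * (v n z - v' z))) +
          2 * (ennreal (e ^ p) * ennreal V)"
        using C M' e(1) by (subst (1 2) pnorm_cmult) (auto intro!: indicator_borel_times simp: V)
      also have "\<dots> \<le> 2 * (ennreal (M' ^ p) * ennreal s) + 2 * (ennreal e * ennreal V)"
        using elim(2) ep by (intro add_mono mult_left_mono mult_right_mono ennreal_leI) auto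
      also have "\<dots> = ennreal (2 * (M' ^ p * s) + 2 * (e * V))"
        using M' s(1) e(1) \<open>V \<ge> 0\<close> by (simp flip: ennreal_numeral ennreal_mult ennreal_plus)
      also have "\<dots> < ennreal r"
      proof (rule ennreal_lessI[OF r])
        show "2 * (M' ^ p * s) + 2 * (e * V) < r" using s(2) e(3) r by linarith
      qed
      finally show ?case .
    qed
  qed
  then show ?thesis unfolding plim_def by auto
qed

lemma plim_cmult:
  assumes "p = 1 \<or> p = 2" "C \<in> sets borel" "plim p C v v'"
  shows "plim p C (\<lambda>n z. c * v n z) (\<lambda>z. c * v' z)"
proof -
  note [measurable] = plim_borel[OF assms(3)] plim_borel'[OF assms(3)]
  have "pnorm p (\<lambda>z. ind C z * (c * v n z - c * v' z))
      = ennreal (\<bar>c\<bar> ^ p) * pnorm p (\<lambda>z. ind C z * (v n z - v' z))" for n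
    using assms(2) by (subst pnorm_cmult[symmetric])
      (auto simp: algebra_simps intro!: indicator_borel_times)
  moreover have "(\<lambda>n. ennreal (\<bar>c\<bar> ^ p) * pnorm p (\<lambda>z. ind C z * (v n z - v' z))) \<longlonglongrightarrow> ennreal (\<bar>c\<bar> ^ p) * 0"
    using assms(3) by (intro ennreal_tendsto_cmult) (auto simp: plim_def)
  ultimately show ?thesis unfolding plim_def by auto
qed

lemma plim_diff:
  assumes p: "p = 1 \<or> p = 2" and C: "C \<in> sets borel" and u: "plim p C u u'" "plim p C v v'"
  shows "plim p C (\<lambda>n z. u n z - v n z) (\<lambda>z. u' z - v' z)"
  using plim_add[OF p C u(1) plim_cmult[OF p C u(2), of "-1"]] by simp

text \<open>Expanding around the limits leaves three products, each with one factor tending to 0 in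
  L2 and the other bounded there, so Cauchy-Schwarz applies. This is why mollified Jacobians of maps
  with square integrable gradient converge in L1.\<close>

lemma plim_mult:
  assumes C: "C \<in> sets borel" and u: "plim 2 C u u'" "Lp 2 C u'" and v: "plim 2 C v v'" "Lp 2 C v'"
  shows "plim 1 C (\<lambda>n z. u n z * v n z) (\<lambda>z. u' z * v' z)"
proof -
  note [measurable] = plim_borel[OF u(1)] plim_borel'[OF u(1)] plim_borel[OF v(1)] plim_borel'[OF v(1)]
  have a: "plim 1 C (\<lambda>n z. a n z * b n z) (\<lambda>z. 0)"
    if a: "plim 2 C a (\<lambda>z. 0)" and b: "\<And>n. b n \<in> Borel"
      "\<And>n. pnorm 2 (\<lambda>z. ind C z * b n z) \<le> B n" "(B \<longlongrightarrow> B') sequentially" "B' < \<infinity>" for a b B B'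
  proof -
    note [measurable] = plim_borel[OF a] b(1)
    have "(\<lambda>n. pnorm 2 (\<lambda>z. ind C z * a n z) * B n) \<longlonglongrightarrow> 0 * B'"
      using a b(3,4) by (intro tendsto_mult_ennreal) (auto simp: plim_def)
    then have lim: "(\<lambda>n. pnorm 2 (\<lambda>z. ind C z * a n z) * B n) \<longlonglongrightarrow> 0" by simp
    have "(pnorm 1 (\<lambda>z. ind C z * (a n z * b n z)))\<^sup>2 \<le> pnorm 2 (\<lambda>z. ind C z * a n z) * B n" for n
    proof -
      have "(\<lambda>z. ind C z * (a n z * b n z)) = (\<lambda>z. (ind C z * a n z) * (ind C z * b n z))"
        by (auto simp: indicator_def)
      then have "(pnorm 1 (\<lambda>z. ind C z * (a n z * b n z)))\<^sup>2
          \<le> pnorm 2 (\<lambda>z. ind C z * a n z) * pnorm 2 (\<lambda>z. ind C z * b n z)"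
        by (simp only:) (intro pnorm_mult_squared_le indicator_borel_times C; measurable)
      also have "\<dots> \<le> pnorm 2 (\<lambda>z. ind C z * a n z) * B n"
        by (intro mult_left_mono b) auto
      finally show ?thesis .
    qed
    then have "(\<lambda>n. (pnorm 1 (\<lambda>z. ind C z * (a n z * b n z)))\<^sup>2) \<longlonglongrightarrow> 0"
      by (intro tendsto_sandwich[OF _ _ tendsto_const lim]) auto
    then have "(\<lambda>n. pnorm 1 (\<lambda>z. ind C z * (a n z * b n z))) \<longlonglongrightarrow> 0"
      by (rule ennreal_square_tendsto_0)
    then show ?thesis by (auto simp: plim_def)
  qed
  have du: "plim 2 C (\<lambda>n z. u n z - u' z) (\<lambda>z. 0)" and dv: "plim 2 C (\<lambda>n z. v n z - v' z) (\<lambda>z. 0)"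
    using u v by (auto simp: plim_def)
  have 1: "plim 1 C (\<lambda>n z. (u n z - u' z) * (v n z - v' z)) (\<lambda>z. 0)"
    by (rule a[OF du, where B = "\<lambda>n. pnorm 2 (\<lambda>z. ind C z * (v n z - v' z))" and B' = 0])
       (use dv in \<open>auto simp: plim_def\<close>)
  have 2: "plim 1 C (\<lambda>n z. (u n z - u' z) * v' z) (\<lambda>z. 0)"
    by (rule a[OF du, where B = "\<lambda>n. pnorm 2 (\<lambda>z. ind C z * v' z)"
          and B' = "pnorm 2 (\<lambda>z. ind C z * v' z)"]) (use v in \<open>auto simp: Lp_def\<close>)
  have 3: "plim 1 C (\<lambda>n z. (v n z - v' z) * u' z) (\<lambda>z. 0)"
    by (rule a[OF dv, where B = "\<lambda>n. pnorm 2 (\<lambda>z. ind C z * u' z)"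
          and B' = "pnorm 2 (\<lambda>z. ind C z * u' z)"]) (use u in \<open>auto simp: Lp_def\<close>)
  have 4: "plim 1 C (\<lambda>n z. u' z * v' z) (\<lambda>z. u' z * v' z)" by (rule plim_const) auto
  have "plim 1 C (\<lambda>n z. (((u n z - u' z) * (v n z - v' z) + (u n z - u' z) * v' z) + (v n z - v' z) * u' z) + u' z * v' z)
      (\<lambda>z. ((0 + 0) + 0) + u' z * v' z)"
    by (intro plim_add C 1 2 3 4) auto
  then show ?thesis by (simp add: algebra_simps)
qed

lemma plim_integral:
  assumes C: "C \<in> sets borel" and u: "plim 1 C u u'" "\<And>n. Lp 1 C (u n)" "Lp 1 C u'"
  shows "(\<lambda>n. LBINT z. ind C z * u n z) \<longlonglongrightarrow> (LBINT z. ind C z * u' z)"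
proof (rule tendsto_L1_int)
  show "integrable lborel (\<lambda>z. ind C z * u n z)" for n
    using u(2)[of n] unfolding Lp1_integrable[OF C] by blast
  show "integrable lborel (\<lambda>z. ind C z * u' z)"
    using u(3) unfolding Lp1_integrable[OF C] by blast
qed (use u(1) in \<open>auto simp: plim_def pnorm_def right_diff_distrib\<close>)

section \<open>Weak gradients\<close>

definition Lploc :: "nat \<Rightarrow> complex set \<Rightarrow> (complex \<Rightarrow> real) \<Rightarrow> bool" where
  "Lploc p X f \<longleftrightarrow> f \<in> Borel \<and> (\<forall>C. compact C \<and> C \<subseteq> X \<longrightarrow> Lp p C f)"

text \<open>The Borel form of \<open>is_weak_gradient\<close>, with the two components kept apart.
  Integrals extend over the plane because test functions vanish off X.\<close>

definition wgrad :: "complex set \<Rightarrow> (complex \<Rightarrow> real) \<Rightarrow> (complex \<Rightarrow> real) \<Rightarrow> (complex \<Rightarrow> real) \<Rightarrow> bool" where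
  "wgrad X f g h \<longleftrightarrow> Lploc 1 X f \<and> Lploc 1 X g \<and> Lploc 1 X h \<and>
    (\<forall>\<eta>\<in>test_functions X.
       (LBINT z. f z * dx \<eta> z) = - (LBINT z. g z * \<eta> z) \<and>
       (LBINT z. f z * dy \<eta> z) = - (LBINT z. h z * \<eta> z))"

text \<open>The room d around C is what mollification with a small kernel consumes.\<close>

lemma compact_nbhd:
  fixes C :: "complex set"
  assumes "compact C" "open X" "C \<subseteq> X"
  obtains d D where "d > 0" "compact D" "D \<subseteq> X" "\<And>z w. z \<in> C \<Longrightarrow> dist z w < d \<Longrightarrow> w \<in> D" "C \<subseteq> interior D"
proof -
  obtain e where e: "e > 0" "(\<Union>x\<in>C. ball x e) \<subseteq> X"
    using compact_subset_open_imp_ball_epsilon_subset[OF assms] by metis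
  define D where "D = (\<Union>x\<in>C. \<Union>y\<in>cball 0 (e / 2). {x + y})"
  have "compact D" unfolding D_def by (rule compact_sums'[OF assms(1) compact_cball])
  moreover have "D \<subseteq> (\<Union>x\<in>C. ball x e)"
    using e(1) unfolding D_def by (force simp: dist_norm)
  moreover have D: "w \<in> D" if "z \<in> C" "dist z w < e / 2" for z w
    unfolding D_def using that
    by (intro UN_I[of z] UN_I[of "w - z"]) (auto simp: dist_norm norm_minus_commute)
  moreover have "C \<subseteq> interior D"
  proof
    fix z assume "z \<in> C"
    then have "ball z (e / 2) \<subseteq> D" using D by auto
    then show "z \<in> interior D"
      using e(1) by (metis centre_in_ball half_gt_zero interior_maximal open_ball subsetD)
  qed
  ultimately show ?thesis using that[of "e / 2" D] e by auto
qed

lemma smooth_reflect: "smooth k \<Longrightarrow> smooth (\<lambda>w. k (z - w))"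
  and dir_deriv_reflect: "smooth k \<Longrightarrow> dir_deriv v (\<lambda>w. k (z - w)) = (\<lambda>w. - dir_deriv v k (z - w))"
proof -
  have d: "((\<lambda>w. k (z - w)) has_derivative (\<lambda>h. Re (- h) * dx k (z - w) + Im (- h) * dy k (z - w))) (at w)"
    if "smooth k" for k w
  proof -
    have "((\<lambda>w. z - w) has_derivative (\<lambda>h. - h)) (at w)" by (auto intro!: derivative_eq_intros)
    from has_derivative_compose[OF this smooth_has_derivative[OF that]] show ?thesis .
  qed
  have e: "dir_deriv v (\<lambda>w. k (z - w)) = (\<lambda>w. - dir_deriv v k (z - w))" if "smooth k" for k v
    using dir_deriv_eq[OF d[OF that], of v] dir_deriv_eq[OF smooth_has_derivative[OF that], of v]
    by (auto simp: fun_eq_iff)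
  show "smooth k \<Longrightarrow> smooth (\<lambda>w. k (z - w))"
  proof (rule smooth_coinduct[where P = "\<lambda>f. \<exists>k. smooth k \<and> f = (\<lambda>w. k (z - w))"])
    show "\<And>f w. \<exists>k. smooth k \<and> f = (\<lambda>w. k (z - w)) \<Longrightarrow> f differentiable (at w)"
      using d by (auto simp: differentiable_def)
    show "\<And>f. \<exists>k. smooth k \<and> f = (\<lambda>w. k (z - w)) \<Longrightarrow> \<exists>k. smooth k \<and> dx f = (\<lambda>w. k (z - w))"
    proof -
      fix f assume "\<exists>k. smooth k \<and> f = (\<lambda>w. k (z - w))"
      then obtain k where "smooth k" "f = (\<lambda>w. k (z - w))" by blast
      then show "\<exists>k. smooth k \<and> dx f = (\<lambda>w. k (z - w))"
        by (intro exI[of _ "\<lambda>w. - dx k w"]) (simp add: e smooth_uminus smooth_dx)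
    qed
    show "\<And>f. \<exists>k. smooth k \<and> f = (\<lambda>w. k (z - w)) \<Longrightarrow> \<exists>k. smooth k \<and> dy f = (\<lambda>w. k (z - w))"
    proof -
      fix f assume "\<exists>k. smooth k \<and> f = (\<lambda>w. k (z - w))"
      then obtain k where "smooth k" "f = (\<lambda>w. k (z - w))" by blast
      then show "\<exists>k. smooth k \<and> dy f = (\<lambda>w. k (z - w))"
        by (intro exI[of _ "\<lambda>w. - dy k w"]) (simp add: e smooth_uminus smooth_dy)
    qed
  qed blast
  show "smooth k \<Longrightarrow> dir_deriv v (\<lambda>w. k (z - w)) = (\<lambda>w. - dir_deriv v k (z - w))"
    by (rule e)
qed

lemma kern_test:
  assumes "cball z (2 / real (Suc n)) \<subseteq> X"
  shows "(\<lambda>w. kern n (z - w)) \<in> test_functions X"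
proof -
  have "kern n (z - w) = 0" if "w \<notin> cball z (2 / real (Suc n))" for w
    using that by (intro kern_eq_0) (simp add: dist_norm)
  then show ?thesis
    unfolding test_functions_iff
    by (intro conjI exI[of _ "cball z (2 / real (Suc n))"] smooth_reflect[OF smooth_kern] compact_cball assms) blast
qed

text \<open>The indicator of D makes a locally integrable function integrable on the plane; at
  points whose kernel reaches only into D, the convolution does not notice it.\<close>

lemma conv_restrict:
  assumes "cball z r \<subseteq> D" "\<forall>w. w \<notin> cball 0 r \<longrightarrow> k w = 0"
  shows "conv (\<lambda>w. ind D w * f w) k z = (LBINT w. f w * k (z - w))"
  unfolding conv_def
proof (rule Bochner_Integration.integral_cong[OF refl])
  fix w
  show "ind D w * f w * k (z - w) = f w * k (z - w)"
    using assms by (cases "w \<in> cball z r") (auto simp: dist_norm)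
qed

lemma Lploc_indicator_integrable:
  assumes "Lploc 1 X f" "compact D" "D \<subseteq> X"
  shows "integrable lborel (\<lambda>w. ind D w * f w)"
  using assms unfolding Lploc_def Lp1_integrable[OF borel_compact[OF assms(2)]]
  using Lp1_integrable[OF borel_compact[OF assms(2)]] by blast

lemma conv_plim:
  assumes p: "p = 1 \<or> p = 2" and F: "integrable lborel F" "pnorm p F < \<infinity>"
  shows "plim p UNIV (\<lambda>n. conv F (kern n)) F"
  unfolding plim_def using conv_pnorm_tendsto[OF assms] F(1) by (auto intro!: conv_borel)

lemma null_of_null_on_compacts:
  assumes "open X" "\<And>C. compact C \<Longrightarrow> C \<subseteq> X \<Longrightarrow> AE z\<in>C in M. P z"
  shows "AE z in M. z \<in> (X::complex set) \<longrightarrow> P z"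
proof -
  obtain C where C: "\<And>n::nat. compact (C n)" "\<And>n. C n \<subseteq> X" "\<Union>(range C) = X"
    using open_Union_compact_subsets[OF assms(1)] by metis
  have "AE z in M. \<forall>n. z \<in> C n \<longrightarrow> P z"
    unfolding AE_all_countable using assms(2)[OF C(1,2)] by blast
  then show ?thesis by eventually_elim (use C(3) in blast)
qed

text \<open>The fundamental lemma of the calculus of variations. Reflected and translated mollifiers
  are test functions, so the mollifications of f vanish on C once the kernel is small, while they
  converge to f in L1.\<close>

lemma weak_zero:
  assumes X: "open X" and f: "Lploc 1 X f"
    and z: "\<And>\<eta>. \<eta> \<in> test_functions X \<Longrightarrow> (LBINT z. f z * \<eta> z) = 0"
  shows "AE z\<in>X in lborel. f z = 0"
proof (rule null_of_null_on_compacts[OF X])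
  fix C assume C: "compact C" "C \<subseteq> X"
  obtain d D where D: "d > 0" "compact D" "D \<subseteq> X" "\<And>z w. z \<in> C \<Longrightarrow> dist z w < d \<Longrightarrow> w \<in> D"
    using compact_nbhd[OF C(1) X C(2)] by metis
  let ?F = "\<lambda>w. ind D w * f w"
  have iF: "integrable lborel ?F" by (rule Lploc_indicator_integrable[OF f D(2,3)])
  then have "pnorm 1 ?F < \<infinity>" by (simp add: pnorm_def integrable_iff_bounded)
  then have "plim 1 UNIV (\<lambda>n. conv ?F (kern n)) ?F" using conv_plim[OF _ iF] by blast
  then have lim: "plim 1 C (\<lambda>n. conv ?F (kern n)) ?F" by (rule plim_subset) simp
  have "\<forall>\<^sub>F n in sequentially. pnorm 1 (\<lambda>z. ind C z * (conv ?F (kern n) z - ?F z)) = pnorm 1 (\<lambda>z. ind C z * ?F z)"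
    using two_div_Suc_small[OF D(1)]
  proof eventually_elim
    case (elim n)
    have "ind C z * conv ?F (kern n) z = 0" for z
    proof (cases "z \<in> C")
      case True
      have cD: "cball z (2 / real (Suc n)) \<subseteq> D"
      proof
        fix w assume "w \<in> cball z (2 / real (Suc n))"
        then have "dist z w < d" using elim by simp
        then show "w \<in> D" using D(4) True by blast
      qed
      then have "cball z (2 / real (Suc n)) \<subseteq> X" using D(3) by blast
      then have "(LBINT w. f w * kern n (z - w)) = 0" using z kern_test by blast
      moreover have "conv ?F (kern n) z = (LBINT w. f w * kern n (z - w))"
        by (rule conv_restrict[OF cD kern_cball])
      ultimately show ?thesis by simp
    qed simp
    then have "\<bar>ind C z * (conv ?F (kern n) z - ?F z)\<bar> = \<bar>ind C z * ?F z\<bar>" for z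
      by (simp only: right_diff_distrib)
    then show ?case by (simp add: pnorm_def)
  qed
  moreover have "(\<lambda>n. pnorm 1 (\<lambda>z. ind C z * (conv ?F (kern n) z - ?F z))) \<longlonglongrightarrow> 0"
    using lim by (simp add: plim_def)
  ultimately have "(\<lambda>n::nat. pnorm 1 (\<lambda>z. ind C z * ?F z)) \<longlonglongrightarrow> 0"
    by (rule Lim_transform_eventually[rotated])
  then have "pnorm 1 (\<lambda>z. ind C z * ?F z) = 0"
    by (simp add: LIMSEQ_const_iff)
  then have "AE z in lborel. ennreal \<bar>ind C z * ?F z\<bar> = 0"
    unfolding pnorm_def using indicator_borel_times[OF borel_compact[OF C(1)] borel_measurable_integrable[OF iF, simplified]]
    by (subst (asm) nn_integral_0_iff_AE) auto
  then show "AE z\<in>C in lborel. f z = 0"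
  proof eventually_elim
    case (elim z)
    show ?case
    proof
      assume "z \<in> C"
      moreover have "z \<in> D" using D(1) D(4)[OF \<open>z \<in> C\<close>, of z] by simp
      ultimately show "f z = 0" using elim by simp
    qed
  qed
qed

lemma Lp_cong:
  assumes "Lp p C f" "g \<in> Borel" "AE z\<in>C in lborel. f z = g z"
  shows "Lp p C g"
proof -
  have "pnorm p (\<lambda>z. ind C z * f z) = pnorm p (\<lambda>z. ind C z * g z)"
    by (rule pnorm_cong) (use assms(3) in \<open>eventually_elim, auto simp: indicator_def\<close>)
  then show ?thesis using assms by (auto simp: Lp_def)
qed

lemma Lploc_cong:
  assumes "Lploc p X f" "g \<in> Borel" "AE z\<in>X in lborel. f z = g z"
  shows "Lploc p X g"
  unfolding Lploc_def
proof (intro conjI allI impI)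
  fix C assume C: "compact C \<and> C \<subseteq> X"
  have "AE z\<in>C in lborel. f z = g z" using assms(3) by eventually_elim (use C in auto)
  then show "Lp p C g" using assms(1,2) C by (auto simp: Lploc_def intro: Lp_cong)
qed fact

lemma Lploc_subset: "Lploc p X f \<Longrightarrow> U \<subseteq> X \<Longrightarrow> Lploc p U f"
  by (auto simp: Lploc_def)

lemma Lploc_borel: "Lploc p X f \<Longrightarrow> f \<in> Borel"
  by (auto simp: Lploc_def)

lemma Lploc_Lp: "Lploc p X f \<Longrightarrow> compact C \<Longrightarrow> C \<subseteq> X \<Longrightarrow> Lp p C f"
  by (auto simp: Lploc_def)

lemma Lploc_2_1: "Lploc 2 X f \<Longrightarrow> Lploc 1 X f"
  unfolding Lploc_def using Lp2_imp_Lp1 by blast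

lemma Lploc_diff:
  assumes "p = 1 \<or> p = 2" "Lploc p X f" "Lploc p X g" shows "Lploc p X (\<lambda>z. f z - g z)"
  unfolding Lploc_def
proof (intro conjI allI impI)
  fix C assume C: "compact C \<and> C \<subseteq> X"
  then show "Lp p C (\<lambda>z. f z - g z)"
    by (intro Lp_diff assms(1) borel_compact Lploc_Lp[OF assms(2)] Lploc_Lp[OF assms(3)]) auto
qed (use assms in \<open>auto simp: Lploc_def\<close>)

lemma Lploc_add:
  assumes "p = 1 \<or> p = 2" "Lploc p X f" "Lploc p X g" shows "Lploc p X (\<lambda>z. f z + g z)"
  unfolding Lploc_def
proof (intro conjI allI impI)
  fix C assume C: "compact C \<and> C \<subseteq> X"
  then show "Lp p C (\<lambda>z. f z + g z)"
    by (intro Lp_add assms(1) borel_compact Lploc_Lp[OF assms(2)] Lploc_Lp[OF assms(3)]) auto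
qed (use assms in \<open>auto simp: Lploc_def\<close>)

lemma Lploc_bounded_mult:
  assumes u: "u \<in> Borel" "continuous_on X u" and v: "Lploc p X v"
  shows "Lploc p X (\<lambda>z. u z * v z)"
  unfolding Lploc_def
proof (intro conjI allI impI)
  show "(\<lambda>z. u z * v z) \<in> Borel" using u v by (auto simp: Lploc_def)
  fix C assume C: "compact C \<and> C \<subseteq> X"
  have "bounded (u ` C)"
    using C u(2) compact_continuous_image compact_imp_bounded continuous_on_subset by metis
  then obtain M where "\<And>z. z \<in> C \<Longrightarrow> \<bar>u z\<bar> \<le> M" by (auto simp: bounded_iff)
  then show "Lp p C (\<lambda>z. u z * v z)"
    using C v u by (intro Lp_bounded_mult borel_compact) (auto simp: Lploc_def)
qed

lemma Lploc_continuous: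
  assumes u: "u \<in> Borel" "continuous_on X u" "p > 0"
  shows "Lploc p X u"
  unfolding Lploc_def using u Lp_continuous continuous_on_subset by blast

lemma test_integrable:
  assumes f: "Lploc 1 X f" and "\<eta> \<in> Borel" "continuous_on UNIV \<eta>"
    "compact S" "S \<subseteq> X" "\<forall>z. z \<notin> S \<longrightarrow> \<eta> z = 0"
  shows "integrable lborel (\<lambda>z. f z * \<eta> z)"
proof -
  obtain M where M: "\<And>z. \<bar>\<eta> z\<bar> \<le> M" using bounded_of_compact_support[OF assms(3,4,6)] by blast
  have "Lp 1 S (\<lambda>z. \<eta> z * f z)"
    using M by (intro Lp_bounded_mult borel_compact assms Lploc_Lp[OF f]) auto
  then have "integrable lborel (\<lambda>z. ind S z * (\<eta> z * f z))"
    unfolding Lp1_integrable[OF borel_compact[OF assms(4)]] by blast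
  moreover have "(\<lambda>z. ind S z * (\<eta> z * f z)) = (\<lambda>z. f z * \<eta> z)"
    using assms(6) by (intro ext) (auto simp: indicator_def)
  ultimately show ?thesis by simp
qed

lemma test_integrable_test:
  assumes "Lploc 1 X f" "\<eta> \<in> test_functions X"
  shows "integrable lborel (\<lambda>z. f z * \<eta> z)" "integrable lborel (\<lambda>z. f z * dir_deriv v \<eta> z)"
proof -
  obtain S where S: "smooth \<eta>" "compact S" "S \<subseteq> X" "\<forall>z. z \<notin> S \<longrightarrow> \<eta> z = 0"
    using assms(2) by (auto simp: test_functions_iff)
  show "integrable lborel (\<lambda>z. f z * \<eta> z)"
    by (rule test_integrable[OF assms(1) smooth_borel[OF S(1)] smooth_continuous_on[OF S(1)] S(2-4)])
  have "(\<lambda>z. dir_deriv v \<eta> z) = (\<lambda>z. Re v * dx \<eta> z + Im v * dy \<eta> z)"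
    using dir_deriv_eq[OF smooth_has_derivative[OF S(1)], of v] by auto
  then have sv: "smooth (dir_deriv v \<eta>)"
    using S(1) by (auto intro!: smooth_add smooth_cmult smooth_dx smooth_dy)
  show "integrable lborel (\<lambda>z. f z * dir_deriv v \<eta> z)"
    by (rule test_integrable[OF assms(1) smooth_borel[OF sv] smooth_continuous_on[OF sv] S(2,3)
        dir_deriv_eq_0_outside[OF compact_imp_closed[OF S(2)] S(4)]])
qed

lemma wgrad_unique:
  assumes X: "open X" and w: "wgrad X f g h" "wgrad X f' g' h'"
    and eq: "AE z\<in>X in lborel. f z = f' z"
  shows "AE z\<in>X in lborel. g z = g' z \<and> h z = h' z"
proof -
  have same: "(LBINT z. f z * dir_deriv v \<eta> z) = (LBINT z. f' z * dir_deriv v \<eta> z)"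
    if t: "\<eta> \<in> test_functions X" for \<eta> v
  proof (rule integral_cong_AE)
    obtain S where S: "smooth \<eta>" "compact S" "S \<subseteq> X" "\<forall>z. z \<notin> S \<longrightarrow> \<eta> z = 0"
      using t by (auto simp: test_functions_iff)
    have z: "z \<notin> X \<Longrightarrow> dir_deriv v \<eta> z = 0" for z
      using dir_deriv_eq_0_outside[OF compact_imp_closed[OF S(2)] S(4)] S(3) by blast
    show "AE z in lborel. f z * dir_deriv v \<eta> z = f' z * dir_deriv v \<eta> z"
      using eq by eventually_elim (use z in force)
  qed (use test_integrable_test[OF _ t] w in \<open>auto simp: wgrad_def\<close>)
  have L: "Lploc 1 X g" "Lploc 1 X g'" "Lploc 1 X h" "Lploc 1 X h'" using w by (auto simp: wgrad_def)
  have "AE z\<in>X in lborel. g z - g' z = 0"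
  proof (rule weak_zero[OF X Lploc_diff[OF _ L(1,2)]])
    fix \<eta> assume \<eta>: "\<eta> \<in> test_functions X"
    have "(LBINT z. (g z - g' z) * \<eta> z) = (LBINT z. g z * \<eta> z) - (LBINT z. g' z * \<eta> z)"
      by (simp add: left_diff_distrib test_integrable_test[OF L(1) \<eta>] test_integrable_test[OF L(2) \<eta>])
    also have "\<dots> = 0" using w \<eta> same[OF \<eta>, of 1] by (simp add: wgrad_def)
    finally show "(LBINT z. (g z - g' z) * \<eta> z) = 0" .
  qed simp
  moreover have "AE z\<in>X in lborel. h z - h' z = 0"
  proof (rule weak_zero[OF X Lploc_diff[OF _ L(3,4)]])
    fix \<eta> assume \<eta>: "\<eta> \<in> test_functions X"
    have "(LBINT z. (h z - h' z) * \<eta> z) = (LBINT z. h z * \<eta> z) - (LBINT z. h' z * \<eta> z)"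
      by (simp add: left_diff_distrib test_integrable_test[OF L(3) \<eta>] test_integrable_test[OF L(4) \<eta>])
    also have "\<dots> = 0" using w \<eta> same[OF \<eta>, of \<i>] by (simp add: wgrad_def)
    finally show "(LBINT z. (h z - h' z) * \<eta> z) = 0" .
  qed simp
  ultimately show ?thesis by eventually_elim auto
qed

lemma wgrad_ibp:
  assumes "wgrad X f g h" "\<eta> \<in> test_functions X"
  shows "(LBINT z. f z * dx \<eta> z) = - (LBINT z. g z * \<eta> z)"
    and "(LBINT z. f z * dy \<eta> z) = - (LBINT z. h z * \<eta> z)"
  using assms by (auto simp only: wgrad_def)

lemma wgrad_Lploc:
  assumes "wgrad X f g h"
  shows "Lploc 1 X f" "Lploc 1 X g" "Lploc 1 X h"
  using assms by (auto simp only: wgrad_def)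

lemma test_functions_mono: "U \<subseteq> X \<Longrightarrow> \<eta> \<in> test_functions U \<Longrightarrow> \<eta> \<in> test_functions X"
  by (auto simp: test_functions_def)

lemma wgrad_subset: "wgrad X f g h \<Longrightarrow> U \<subseteq> X \<Longrightarrow> wgrad U f g h"
  using Lploc_subset test_functions_mono unfolding wgrad_def by blast

text \<open>Only the gradient is locally square integrable; the function itself is just locally
  integrable, which is what members of \<open>L12\<close> provide.\<close>

definition W12 :: "complex set \<Rightarrow> (complex \<Rightarrow> real) \<Rightarrow> (complex \<Rightarrow> real) \<Rightarrow> (complex \<Rightarrow> real) \<Rightarrow> bool" where
  "W12 X f g h \<longleftrightarrow> wgrad X f g h \<and> Lploc 2 X g \<and> Lploc 2 X h"

lemma W12_subset: "W12 X f g h \<Longrightarrow> U \<subseteq> X \<Longrightarrow> W12 U f g h"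
  using Lploc_subset wgrad_subset unfolding W12_def by blast

text \<open>The kernel centred at z is itself a test function of w. The sign from the reflected
  variable cancels the one from integration by parts.\<close>

lemma wgrad_conv_deriv:
  assumes w: "wgrad X f g h" and D: "compact D" "D \<subseteq> X" and c: "cball z (2 / real (Suc n)) \<subseteq> D"
  shows "dx (conv (\<lambda>w. ind D w * f w) (kern n)) z = conv (\<lambda>w. ind D w * g w) (kern n) z"
    and "dy (conv (\<lambda>w. ind D w * f w) (kern n)) z = conv (\<lambda>w. ind D w * h w) (kern n) z"
proof -
  have f: "Lploc 1 X f" using w by (simp add: wgrad_def)
  have t: "(\<lambda>w. kern n (z - w)) \<in> test_functions X" using c D(2) by (intro kern_test) auto
  note k = dir_deriv_eq_0_outside[OF closed_cball kern_cball]
  have iF: "integrable lborel (\<lambda>w. ind D w * f w)" by (rule Lploc_indicator_integrable[OF f D])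
  have dk: "dir_deriv v (\<lambda>w. kern n (z - w)) = (\<lambda>w. - dir_deriv v (kern n) (z - w))" for v
    by (rule dir_deriv_reflect[OF smooth_kern])
  note dc = dir_deriv_conv[OF iF smooth_kern compact_cball kern_cball]
  have "dx (conv (\<lambda>w. ind D w * f w) (kern n)) z = (LBINT w. f w * dx (kern n) (z - w))"
    unfolding dc by (rule conv_restrict[OF c k])
  also have "\<dots> = (LBINT w. g w * kern n (z - w))"
    using wgrad_ibp(1)[OF w t] by (simp add: dk)
  also have "\<dots> = conv (\<lambda>w. ind D w * g w) (kern n) z"
    by (rule conv_restrict[OF c kern_cball, symmetric])
  finally show "dx (conv (\<lambda>w. ind D w * f w) (kern n)) z = conv (\<lambda>w. ind D w * g w) (kern n) z" .
  have "dy (conv (\<lambda>w. ind D w * f w) (kern n)) z = (LBINT w. f w * dy (kern n) (z - w))"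
    unfolding dc by (rule conv_restrict[OF c k])
  also have "\<dots> = (LBINT w. h w * kern n (z - w))"
    using wgrad_ibp(2)[OF w t] by (simp add: dk)
  also have "\<dots> = conv (\<lambda>w. ind D w * h w) (kern n) z"
    by (rule conv_restrict[OF c kern_cball, symmetric])
  finally show "dy (conv (\<lambda>w. ind D w * f w) (kern n)) z = conv (\<lambda>w. ind D w * h w) (kern n) z" .
qed


lemma plim_restrict_cong:
  assumes "\<And>n z. z \<in> C \<Longrightarrow> u n z = u' n z" "\<And>z. z \<in> C \<Longrightarrow> v z = v' z"
    and "\<And>n. u' n \<in> Borel" "v' \<in> Borel" "plim p C u v"
  shows "plim p C u' v'"
proof -
  have "(\<lambda>z. ind C z * (u n z - v z)) = (\<lambda>z. ind C z * (u' n z - v' z))" for n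
    using assms(1,2) by (intro ext) (auto simp: indicator_def)
  then show ?thesis using assms(3-5) by (auto simp: plim_def)
qed

lemma conv_plim_local:
  assumes p: "p = 1 \<or> p = 2" and f: "Lp p D f" and D: "compact D"
    and u: "\<And>n z. z \<in> C \<Longrightarrow> u n z = conv (\<lambda>w. ind D w * f w) (kern (n + N)) z"
    and b: "\<And>n. u n \<in> Borel" and C: "C \<subseteq> D"
  shows "plim p C u f"
proof -
  let ?F = "\<lambda>w. ind D w * f w"
  have "Lp 1 D f" using p f Lp2_imp_Lp1[OF D] by auto
  then have iF: "integrable lborel ?F"
    using Lp1_integrable[OF borel_compact[OF D]] by blast
  have "pnorm p ?F < \<infinity>" using f by (simp add: Lp_def)
  then have "plim p UNIV (\<lambda>n. conv ?F (kern n)) ?F" using conv_plim[OF p iF] by blast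
  then have "plim p C (\<lambda>n. conv ?F (kern n)) ?F" by (rule plim_subset) simp
  then have "plim p C (\<lambda>n. conv ?F (kern (n + N))) ?F"
    unfolding plim_def using LIMSEQ_ignore_initial_segment[of _ 0 N] by auto
  then show ?thesis
    by (rule plim_restrict_cong[rotated -1]) (use u b C Lp_borel[OF f] in auto)
qed

text \<open>One sequence of mollifications converges in all these modes at once; later limits
  combine uniform convergence of the functions with L1 or L2 convergence of their
  derivatives.\<close>

lemma wgrad_approx:
  assumes X: "open X" and w: "wgrad X f g h" and C: "compact C" "C \<subseteq> X"
  shows "\<exists>F. (\<forall>n. sym_smooth (F n)) \<and> plim 1 C F f \<and>
    plim 1 C (\<lambda>n. dx (F n)) g \<and> plim 1 C (\<lambda>n. dy (F n)) h \<and>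
    (Lploc 2 X g \<longrightarrow> plim 2 C (\<lambda>n. dx (F n)) g) \<and>
    (Lploc 2 X h \<longrightarrow> plim 2 C (\<lambda>n. dy (F n)) h) \<and>
    (continuous_on X f \<longrightarrow> uniform_limit C F f sequentially)"
proof -
  obtain d D where D: "d > 0" "compact D" "D \<subseteq> X" "\<And>z w. z \<in> C \<Longrightarrow> dist z w < d \<Longrightarrow> w \<in> D"
    "C \<subseteq> interior D"
    using compact_nbhd[OF C(1) X C(2)] by metis
  have CD: "C \<subseteq> D" using D(5) interior_subset by blast
  obtain N where N: "\<And>n. n \<ge> N \<Longrightarrow> 2 / real (Suc n) < d"
    using two_div_Suc_small[OF D(1)] by (auto simp: eventually_sequentially)
  have c: "cball z (2 / real (Suc (n + N))) \<subseteq> D" if "z \<in> C" for n z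
  proof
    fix w assume "w \<in> cball z (2 / real (Suc (n + N)))"
    then have "dist z w < d" using N[of "n + N"] by simp
    then show "w \<in> D" using D(4) that by blast
  qed
  let ?F = "\<lambda>w. ind D w * f w"
  note L = wgrad_Lploc[OF w]
  have iF: "integrable lborel ?F" by (rule Lploc_indicator_integrable[OF L(1) D(2,3)])
  \<comment> \<open>The shift by N makes every kernel, from n = 0 on, so small that discs around
    points of C stay inside D.\<close>
  define F where "F n = conv ?F (kern (n + N))" for n
  have sF: "sym_smooth (F n)" for n
    unfolding F_def by (rule sym_smooth_conv[OF iF sym_smooth_kern compact_cball kern_cball])
  then have smF: "smooth (F n)" for n by (simp add: sym_smooth_def)
  have 1: "plim 1 C F f"
    by (rule conv_plim_local[OF _ Lploc_Lp[OF L(1) D(2,3)] D(2) _ _ CD, where N = N])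
       (auto simp: F_def smooth_borel[OF smF[unfolded F_def]])
  have 2: "plim p C (\<lambda>n. dx (F n)) g" if "p = 1 \<or> p = 2" "Lploc p X g" for p
    by (rule conv_plim_local[OF that(1) Lploc_Lp[OF that(2) D(2,3)] D(2) _ _ CD, where N = N])
       (simp_all only: F_def wgrad_conv_deriv[OF w D(2,3) c] smooth_borel[OF smooth_dx[OF smF[unfolded F_def]]])
  have 3: "plim p C (\<lambda>n. dy (F n)) h" if "p = 1 \<or> p = 2" "Lploc p X h" for p
    by (rule conv_plim_local[OF that(1) Lploc_Lp[OF that(2) D(2,3)] D(2) _ _ CD, where N = N])
       (simp_all only: F_def wgrad_conv_deriv[OF w D(2,3) c] smooth_borel[OF smooth_dy[OF smF[unfolded F_def]]])
  have 4: "uniform_limit C F f sequentially" if "continuous_on X f"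
    unfolding uniform_limit_iff
  proof safe
    fix e :: real assume e: "e > 0"
    have "uniformly_continuous_on D f"
      using that D(2,3) by (intro compact_uniformly_continuous) (auto intro: continuous_on_subset)
    then obtain r where r: "r > 0" "\<And>x y. x \<in> D \<Longrightarrow> y \<in> D \<Longrightarrow> dist y x < r \<Longrightarrow> dist (f y) (f x) < e / 2"
      using e unfolding uniformly_continuous_on_def by (meson half_gt_zero)
    obtain N' where N': "\<And>n. n \<ge> N' \<Longrightarrow> 2 / real (Suc n) < r"
      using two_div_Suc_small[OF r(1)] by (auto simp: eventually_sequentially)
    have "dist (F n z) (f z) < e" if n: "n \<ge> N'" and z: "z \<in> C" for n z
    proof -
      have "\<bar>F n z - f z\<bar> \<le> e / 2"
        unfolding F_def
      proof (rule conv_near[OF iF])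
        fix w assume wz: "norm (w - z) < 2 / real (Suc (n + N))"
        then have "w \<in> cball z (2 / real (Suc (n + N)))" by (simp add: dist_norm norm_minus_commute)
        then have "w \<in> D" using c[OF z] by blast
        moreover have "dist w z < r" using wz N'[of "n + N"] n by (simp add: dist_norm)
        ultimately show "\<bar>ind D w * f w - f z\<bar> \<le> e / 2"
          using r(2)[of z w] z CD by (auto simp: dist_real_def)
      qed
      then show ?thesis using e by (simp add: dist_real_def)
    qed
    then show "\<forall>\<^sub>F n in sequentially. \<forall>z\<in>C. dist (F n z) (f z) < e"
      by (auto simp: eventually_sequentially)
  qed
  show ?thesis
    by (rule exI[of _ F]) (use sF 1 2[OF _ L(2)] 3[OF _ L(3)] 2[of 2] 3[of 2] 4 in blast)
qed

section \<open>The chain rule and integration of Jacobians\<close>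

text \<open>By translation invariance the convolution of k with the indicator of a large disc is
  constant near 0, and its derivative there is the integral of the derivative of k.\<close>

lemma integral_dir_deriv_eq_0:
  assumes k: "smooth k" "compact S" "\<forall>z. z \<notin> S \<longrightarrow> k z = 0"
  shows "(LBINT z. dx k z) = 0" "(LBINT z. dy k z) = 0"
proof -
  obtain R where R: "R > 0" "S \<subseteq> cball 0 R"
    using compact_imp_bounded[OF k(2)] by (metis bounded_pos mem_cball_0 subsetI)
  define F :: "complex \<Rightarrow> real" where "F = ind (cball 0 (R + 1))"
  have F: "integrable lborel F"
    unfolding F_def using emeasure_lborel_cball_finite[of "0::complex" "R + 1"] by simp
  have *: "(LBINT w. F w * g (z - w)) = (LBINT w. g w)"
    if g: "smooth g" "\<forall>z. z \<notin> S \<longrightarrow> g z = 0" and z: "norm z < 1" for g z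
  proof -
    have "(\<lambda>w. F w * g (z - w)) = (\<lambda>w. g (z - w))"
    proof
      fix w
      show "F w * g (z - w) = g (z - w)"
      proof (cases "w \<in> cball 0 (R + 1)")
        case False
        then have "norm (z - w) > R" using norm_triangle_ineq2[of w z] z by (simp add: norm_minus_commute)
        then have "z - w \<notin> S" using R(2) by auto
        then show ?thesis using g(2) by simp
      qed (simp add: F_def)
    qed
    then show ?thesis using integral_reflect[OF smooth_borel[OF g(1)], of z] by simp
  qed
  have "conv F k z = (LBINT w. k w)" if "norm z < 1" for z
    unfolding conv_def by (rule *[OF k(1,3) that])
  then have "((\<lambda>z. (LBINT w. k w)) has_derivative (\<lambda>h. Re h * conv F (dx k) 0 + Im h * conv F (dy k) 0)) (at 0)"
    by (intro has_derivative_transform_within_open[OF conv_has_derivative[OF F k] open_ball[of 0 1]]) auto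
  then have z: "(\<lambda>h::complex. Re h * conv F (dx k) 0 + Im h * conv F (dy k) 0) = (\<lambda>h. 0)"
    by (rule has_derivative_unique) (rule has_derivative_const)
  note o = dir_deriv_eq_0_outside[OF compact_imp_closed[OF k(2)] k(3)]
  have "conv F (dx k) 0 = (LBINT z. dx k z)" "conv F (dy k) 0 = (LBINT z. dy k z)"
    unfolding conv_def using *[OF smooth_dx[OF k(1)] o, of 0] *[OF smooth_dy[OF k(1)] o, of 0] by auto
  then show "(LBINT z. dx k z) = 0" "(LBINT z. dy k z) = 0"
    using fun_cong[OF z, of 1] fun_cong[OF z, of \<i>] by auto
qed

lemma Lploc_smooth: "smooth f \<Longrightarrow> p > 0 \<Longrightarrow> Lploc p X f"
  by (intro Lploc_continuous smooth_borel smooth_continuous_on)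

lemma wgrad_smooth:
  assumes "smooth f"
  shows "wgrad UNIV f (dx f) (dy f)"
  unfolding wgrad_def
proof (intro conjI ballI)
  fix \<eta> assume t: "\<eta> \<in> test_functions UNIV"
  then obtain S where S: "smooth \<eta>" "compact S" "\<forall>z. z \<notin> S \<longrightarrow> \<eta> z = 0"
    by (auto simp: test_functions_iff)
  have sm: "smooth (\<lambda>z. f z * \<eta> z)" "\<forall>z. z \<notin> S \<longrightarrow> f z * \<eta> z = 0"
    using S assms by (auto intro: smooth_mult)
  note L = Lploc_smooth[OF assms, of 1] Lploc_smooth[OF smooth_dx[OF assms], of 1]
    Lploc_smooth[OF smooth_dy[OF assms], of 1]
  note i = test_integrable_test[OF L(1) t] test_integrable_test[OF L(2) t] test_integrable_test[OF L(3) t]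
  have "0 = (LBINT z. f z * dx \<eta> z + dx f z * \<eta> z)"
    using integral_dir_deriv_eq_0(1)[OF sm(1) S(2) sm(2)] by (simp add: dir_deriv_mult_smooth[OF assms S(1)])
  also have "\<dots> = (LBINT z. f z * dx \<eta> z) + (LBINT z. dx f z * \<eta> z)"
    by (intro Bochner_Integration.integral_add i) auto
  finally show "(LBINT z. f z * dx \<eta> z) = - (LBINT z. dx f z * \<eta> z)" by linarith
  have "0 = (LBINT z. f z * dy \<eta> z + dy f z * \<eta> z)"
    using integral_dir_deriv_eq_0(2)[OF sm(1) S(2) sm(2)] by (simp add: dir_deriv_mult_smooth[OF assms S(1)])
  also have "\<dots> = (LBINT z. f z * dy \<eta> z) + (LBINT z. dy f z * \<eta> z)"
    by (intro Bochner_Integration.integral_add i) auto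
  finally show "(LBINT z. f z * dy \<eta> z) = - (LBINT z. dy f z * \<eta> z)" by linarith
qed (auto intro!: Lploc_smooth smooth_dx smooth_dy assms)

text \<open>The composite of f with a + \<i> b, given through real components so that the weak
  gradients of a and b can be used directly.\<close>

definition comp2 :: "(complex \<Rightarrow> real) \<Rightarrow> (complex \<Rightarrow> real) \<Rightarrow> (complex \<Rightarrow> real) \<Rightarrow> complex \<Rightarrow> real" where
  "comp2 f a b z = f (Complex (a z) (b z))"

lemma has_derivative_comp2:
  assumes f: "smooth f" and a: "(a has_derivative A) (at z within S)" and b: "(b has_derivative B) (at z within S)"
  shows "(comp2 f a b has_derivative (\<lambda>h. A h * comp2 (dx f) a b z + B h * comp2 (dy f) a b z)) (at z within S)"
proof -
  have "((\<lambda>z. Complex (a z) (b z)) has_derivative (\<lambda>h. Complex (A h) (B h))) (at z within S)"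
    unfolding Complex_eq
    by (intro has_derivative_add has_derivative_mult_right has_derivative_of_real a b)
  from has_derivative_compose[OF this smooth_has_derivative[OF f]]
  show ?thesis by (simp add: comp2_def[abs_def])
qed

lemma dir_deriv_comp2:
  assumes "smooth f" "a differentiable (at z)" "b differentiable (at z)"
  shows "dir_deriv v (comp2 f a b) z = dir_deriv v a z * comp2 (dx f) a b z + dir_deriv v b z * comp2 (dy f) a b z"
proof -
  note d = assms(2,3)[unfolded frechet_derivative_works]
  show ?thesis
    using dir_deriv_eq[OF has_derivative_comp2[OF assms(1) d], of v] by (simp add: dir_deriv_def)
qed

lemma smooth_comp2:
  assumes "smooth f" "smooth a" "smooth b"
  shows "smooth (comp2 f a b)"
proof -
  have "C_k k (comp2 f a b)" if "smooth f" for k f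
    using that
  proof (induction k arbitrary: f)
    case 0
    have "continuous_on UNIV (\<lambda>z. Complex (a z) (b z))"
      unfolding Complex_eq by (intro continuous_intros smooth_continuous_on assms)
    from continuous_on_compose2[OF smooth_continuous_on[OF 0, of UNIV] this]
    show ?case by (simp add: comp2_def[abs_def])
  next
    case (Suc k)
    have d: "comp2 f a b differentiable (at z)" for z
      using has_derivative_comp2[OF Suc.prems smooth_has_derivative[OF assms(2)] smooth_has_derivative[OF assms(3)]]
      by (auto simp: differentiable_def)
    have e: "dir_deriv v (comp2 f a b) = (\<lambda>z. dir_deriv v a z * comp2 (dx f) a b z + dir_deriv v b z * comp2 (dy f) a b z)" for v
      by (intro ext dir_deriv_comp2 Suc.prems smooth_differentiable assms)
    have "C_k k (dx a)" "C_k k (dy a)" "C_k k (dx b)" "C_k k (dy b)"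
      using smooth_dx[OF assms(2)] smooth_dy[OF assms(2)] smooth_dx[OF assms(3)] smooth_dy[OF assms(3)]
      by (simp_all add: smooth_def)
    then show ?case
      unfolding C_k.simps e using d Suc.IH smooth_dx[OF Suc.prems] smooth_dy[OF Suc.prems]
      by (intro conjI allI C_k_add C_k_mult) auto
  qed
  then show ?thesis using assms(1) by (simp add: smooth_def)
qed

lemma comp2_borel:
  assumes "f \<in> Borel" "a \<in> Borel" "b \<in> Borel"
  shows "comp2 f a b \<in> Borel"
proof -
  note [measurable] = assms
  have [measurable]: "(\<lambda>z. Complex (a z) (b z)) \<in> Borel"
    unfolding Complex_eq by measurable
  show ?thesis unfolding comp2_def[abs_def] by measurable
qed

lemma comp2_continuous_on:
  assumes "continuous_on UNIV f" "continuous_on S a" "continuous_on S b"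
  shows "continuous_on S (comp2 f a b)"
proof -
  have "continuous_on S (\<lambda>z. Complex (a z) (b z))"
    unfolding Complex_eq by (intro continuous_intros assms)
  from continuous_on_compose2[OF assms(1) this] show ?thesis by (simp add: comp2_def[abs_def])
qed

lemma uniform_limit_comp2:
  assumes S: "compact S" and f: "continuous_on UNIV f" and ab: "continuous_on S a" "continuous_on S b"
    and u: "uniform_limit S u a sequentially" "uniform_limit S v b sequentially"
  shows "uniform_limit S (\<lambda>n. comp2 f (u n) (v n)) (comp2 f a b) sequentially"
proof -
  have "bounded (a ` S)" "bounded (b ` S)"
    using S ab compact_continuous_image compact_imp_bounded by blast+
  then obtain A B where AB: "\<And>z. z \<in> S \<Longrightarrow> \<bar>a z\<bar> \<le> A" "\<And>z. z \<in> S \<Longrightarrow> \<bar>b z\<bar> \<le> B"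
    by (auto simp: bounded_iff)
  \<comment> \<open>Each coordinate of an approximant eventually differs from its limit by less than
    1, so this disc holds the values of both.\<close>
  let ?K = "cball (0::complex) (A + B + 2)"
  have uc: "uniformly_continuous_on ?K f"
    by (intro compact_uniformly_continuous continuous_on_subset[OF f]) auto
  show ?thesis unfolding uniform_limit_iff
  proof safe
    fix e :: real assume "e > 0"
    then obtain d where d: "d > 0" "\<And>x y. x \<in> ?K \<Longrightarrow> y \<in> ?K \<Longrightarrow> dist y x < d \<Longrightarrow> dist (f y) (f x) < e"
      using uc unfolding uniformly_continuous_on_def by blast
    define r where "r = min 1 (d / 2)"
    have r: "r > 0" "r \<le> 1" "2 * r \<le> d" using d(1) by (auto simp: r_def)
    from u r(1) have "\<forall>\<^sub>F n in sequentially. \<forall>x\<in>S. dist (u n x) (a x) < r"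
      "\<forall>\<^sub>F n in sequentially. \<forall>x\<in>S. dist (v n x) (b x) < r"
      by (auto simp: uniform_limit_iff)
    then show "\<forall>\<^sub>F n in sequentially. \<forall>x\<in>S. dist (comp2 f (u n) (v n) x) (comp2 f a b x) < e"
    proof eventually_elim
      case (elim n)
      show ?case
      proof
        fix x assume x: "x \<in> S"
        have 1: "\<bar>u n x - a x\<bar> < r" "\<bar>v n x - b x\<bar> < r" using elim x by (auto simp: dist_real_def)
        have "norm (Complex (a x) (b x)) \<le> A + B"
          using cmod_le[of "Complex (a x) (b x)"] AB[OF x] by simp
        moreover have "norm (Complex (u n x) (v n x)) \<le> A + B + 2"
          using cmod_le[of "Complex (u n x) (v n x)"] AB[OF x] 1 r(2) by simp
        moreover have "dist (Complex (u n x) (v n x)) (Complex (a x) (b x)) < d"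
          using cmod_le[of "Complex (u n x) (v n x) - Complex (a x) (b x)"] 1 r(3) by (simp add: dist_norm)
        ultimately show "dist (comp2 f (u n) (v n) x) (comp2 f a b x) < e"
          unfolding comp2_def by (intro d(2)) auto
      qed
    qed
  qed
qed

lemma bounded_on_compact:
  fixes u :: "complex \<Rightarrow> real"
  assumes "compact S" "continuous_on S u"
  obtains M where "\<And>z. z \<in> S \<Longrightarrow> \<bar>u z\<bar> \<le> M"
proof -
  have "bounded (u ` S)" using assms compact_continuous_image compact_imp_bounded by blast
  then show ?thesis using that by (auto simp: bounded_iff)
qed

lemma plim_cont_mult:
  assumes p: "p = 1 \<or> p = 2" and S: "compact S" and c: "continuous_on S c" "c \<in> Borel"
    and v: "plim p S v v'" "Lp p S v'"
  shows "plim p S (\<lambda>n z. v n z * c z) (\<lambda>z. v' z * c z)"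
proof -
  obtain M where "\<And>z. z \<in> S \<Longrightarrow> \<bar>c z\<bar> \<le> M" using bounded_on_compact[OF S c(1)] by blast
  then have "plim p S (\<lambda>n z. c z * v n z) (\<lambda>z. c z * v' z)"
    by (intro plim_mult_unif p borel_compact S uniform_limit_const c v) auto
  then show ?thesis by (simp add: mult.commute)
qed

lemma Lp_cont_mult:
  assumes "compact S" "continuous_on S c" "c \<in> Borel" "Lp p S v"
  shows "Lp p S (\<lambda>z. v z * c z)"
proof -
  obtain M where "\<And>z. z \<in> S \<Longrightarrow> \<bar>c z\<bar> \<le> M" using bounded_on_compact[OF assms(1,2)] by blast
  then have "Lp p S (\<lambda>z. c z * v z)"
    by (intro Lp_bounded_mult borel_compact assms) auto
  then show ?thesis by (simp add: mult.commute)
qed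

lemma integral_indicator_absorb:
  assumes "\<forall>z. z \<notin> S \<longrightarrow> k z = (0::real)"
  shows "(LBINT z. ind S z * (f z * k z)) = (LBINT z. f z * k z)"
  by (rule Bochner_Integration.integral_cong) (use assms in \<open>auto simp: indicator_def\<close>)

lemma plim_test_integral:
  assumes S: "compact S" and k: "continuous_on S k" "k \<in> Borel" "\<forall>z. z \<notin> S \<longrightarrow> k z = 0"
    and u: "plim 1 S u u'" "\<And>n. Lp 1 S (u n)" "Lp 1 S u'"
  shows "(\<lambda>n. LBINT z. u n z * k z) \<longlonglongrightarrow> (LBINT z. u' z * k z)"
proof -
  have "(\<lambda>n. LBINT z. ind S z * (u n z * k z)) \<longlonglongrightarrow> (LBINT z. ind S z * (u' z * k z))"
    by (intro plim_integral borel_compact plim_cont_mult Lp_cont_mult S k u) auto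
  then show ?thesis by (simp add: integral_indicator_absorb[OF k(3)])
qed

lemma Lp_smooth: "smooth f \<Longrightarrow> compact S \<Longrightarrow> p > 0 \<Longrightarrow> Lp p S f"
  by (intro Lp_continuous smooth_continuous_on smooth_borel)

lemma smooth_dir_deriv: "smooth f \<Longrightarrow> smooth (dir_deriv v f)"
proof -
  assume f: "smooth f"
  have "dir_deriv v f = (\<lambda>z. Re v * dx f z + Im v * dy f z)"
    using dir_deriv_eq[OF smooth_has_derivative[OF f], of v] by auto
  then show ?thesis using f by (simp add: smooth_add smooth_cmult smooth_dx smooth_dy)
qed

text \<open>For smooth inner functions the rule is classical. Continuity of a and b makes their
  mollifications converge uniformly on the support of the test function, hence also the outer
  derivatives, which multiply inner derivatives that converge in L1.\<close>

lemma wgrad_chain: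
  assumes X: "open X" and f: "smooth f"
    and a: "wgrad X a ax ay" "continuous_on X a" and b: "wgrad X b bx by'" "continuous_on X b"
  shows "wgrad X (comp2 f a b) (\<lambda>z. comp2 (dx f) a b z * ax z + comp2 (dy f) a b z * bx z)
    (\<lambda>z. comp2 (dx f) a b z * ay z + comp2 (dy f) a b z * by' z)"
proof -
  note La = wgrad_Lploc[OF a(1)] and Lb = wgrad_Lploc[OF b(1)]
  note bo = Lploc_borel[OF La(1)] Lploc_borel[OF Lb(1)]
  have cb: "comp2 g a b \<in> Borel" if "smooth g" for g
    by (intro comp2_borel smooth_borel that bo)
  have cc: "continuous_on X (comp2 g a b)" if "smooth g" for g
    by (intro comp2_continuous_on smooth_continuous_on that a b)
  have Lx: "Lploc 1 X (\<lambda>z. comp2 (dx f) a b z * ax z + comp2 (dy f) a b z * bx z)"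
    by (intro Lploc_add Lploc_bounded_mult cb cc smooth_dx smooth_dy f La Lb) auto
  have Ly: "Lploc 1 X (\<lambda>z. comp2 (dx f) a b z * ay z + comp2 (dy f) a b z * by' z)"
    by (intro Lploc_add Lploc_bounded_mult cb cc smooth_dx smooth_dy f La Lb) auto
  have L0: "Lploc 1 X (comp2 f a b)" by (intro Lploc_continuous cb cc f) auto
  have main: "(LBINT z. comp2 f a b z * dx \<eta> z) = - (LBINT z. (comp2 (dx f) a b z * ax z + comp2 (dy f) a b z * bx z) * \<eta> z)
    \<and> (LBINT z. comp2 f a b z * dy \<eta> z) = - (LBINT z. (comp2 (dx f) a b z * ay z + comp2 (dy f) a b z * by' z) * \<eta> z)"
    if t: "\<eta> \<in> test_functions X" for \<eta>
  proof -
    obtain S where S: "smooth \<eta>" "compact S" "S \<subseteq> X" "\<forall>z. z \<notin> S \<longrightarrow> \<eta> z = 0"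
      using t by (auto simp: test_functions_iff)
    note o = dir_deriv_eq_0_outside[OF compact_imp_closed[OF S(2)] S(4)]
    obtain u where u: "\<And>n. smooth (u n)" "plim 1 S (\<lambda>n. dx (u n)) ax" "plim 1 S (\<lambda>n. dy (u n)) ay"
      "uniform_limit S u a sequentially"
      using wgrad_approx[OF X a(1) S(2,3)] a(2) unfolding sym_smooth_def by blast
    obtain v where v: "\<And>n. smooth (v n)" "plim 1 S (\<lambda>n. dx (v n)) bx" "plim 1 S (\<lambda>n. dy (v n)) by'"
      "uniform_limit S v b sequentially"
      using wgrad_approx[OF X b(1) S(2,3)] b(2) unfolding sym_smooth_def by blast
    have scomp: "smooth (comp2 g (u n) (v n))" if "smooth g" for g n by (intro smooth_comp2 that u v)
    have cS: "continuous_on S a" "continuous_on S b" using a b S(3) continuous_on_subset by blast+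
    have ul: "uniform_limit S (\<lambda>n. comp2 g (u n) (v n)) (comp2 g a b) sequentially" if "smooth g" for g
      by (intro uniform_limit_comp2 S smooth_continuous_on that cS u v)
    have pl: "plim 1 S (\<lambda>n z. comp2 g (u n) (v n) z * r n z) (\<lambda>z. comp2 g a b z * r' z)"
      if g: "smooth g" and r: "plim 1 S r r'" "Lp 1 S r'" for g r r'
    proof -
      have "continuous_on S (comp2 g a b)" using cc[OF g] S(3) continuous_on_subset by blast
      then obtain M where M: "\<And>z. z \<in> S \<Longrightarrow> \<bar>comp2 g a b z\<bar> \<le> M" using bounded_on_compact[OF S(2)] by blast
      show ?thesis
        by (rule plim_mult_unif[OF _ borel_compact[OF S(2)] ul[OF g] M smooth_borel[OF scomp[OF g]] cb[OF g] r]) auto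
    qed
    have LS: "Lp 1 S ax" "Lp 1 S ay" "Lp 1 S bx" "Lp 1 S by'"
      using La Lb S Lploc_Lp by blast+
    have eq: "(LBINT z. comp2 f (u n) (v n) z * dir_deriv d \<eta> z)
        = - (LBINT z. (comp2 (dx f) (u n) (v n) z * dir_deriv d (u n) z + comp2 (dy f) (u n) (v n) z * dir_deriv d (v n) z) * \<eta> z)"
      if "d = 1 \<or> d = \<i>" for n d
    proof -
      have t': "\<eta> \<in> test_functions UNIV" by (rule test_functions_mono[OF subset_UNIV t])
      have "(LBINT z. comp2 f (u n) (v n) z * dir_deriv d \<eta> z) = - (LBINT z. dir_deriv d (comp2 f (u n) (v n)) z * \<eta> z)"
        using wgrad_ibp[OF wgrad_smooth[OF scomp[OF f]] t'] that by blast
      also have "dir_deriv d (comp2 f (u n) (v n)) =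
          (\<lambda>z. comp2 (dx f) (u n) (v n) z * dir_deriv d (u n) z + comp2 (dy f) (u n) (v n) z * dir_deriv d (v n) z)"
        by (rule ext, subst dir_deriv_comp2) (auto simp: f u v smooth_differentiable)
      finally show ?thesis .
    qed
    have l0: "(\<lambda>n. LBINT z. comp2 f (u n) (v n) z * dir_deriv d \<eta> z) \<longlonglongrightarrow> (LBINT z. comp2 f a b z * dir_deriv d \<eta> z)" for d
    proof (rule plim_test_integral[OF S(2) smooth_continuous_on smooth_borel o])
      show "plim 1 S (\<lambda>n. comp2 f (u n) (v n)) (comp2 f a b)"
        using pl[OF f plim_const[of "\<lambda>z. 1" 1 S]] Lp_bounded[OF S(2), of "\<lambda>z. 1" 1 1] by simp
      show "Lp 1 S (comp2 f (u n) (v n))" for n by (intro Lp_smooth scomp f S) auto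
      show "Lp 1 S (comp2 f a b)" using Lploc_Lp[OF L0 S(2,3)] .
    qed (intro smooth_dir_deriv S)+
    have l1: "(\<lambda>n. LBINT z. (comp2 (dx f) (u n) (v n) z * dir_deriv d (u n) z + comp2 (dy f) (u n) (v n) z * dir_deriv d (v n) z) * \<eta> z)
        \<longlonglongrightarrow> (LBINT z. (comp2 (dx f) a b z * a' z + comp2 (dy f) a b z * b' z) * \<eta> z)"
      if ab: "plim 1 S (\<lambda>n. dir_deriv d (u n)) a'" "Lp 1 S a'" "plim 1 S (\<lambda>n. dir_deriv d (v n)) b'" "Lp 1 S b'"
        and L: "Lp 1 S (\<lambda>z. comp2 (dx f) a b z * a' z + comp2 (dy f) a b z * b' z)" for d a' b'
    proof (rule plim_test_integral[OF S(2) smooth_continuous_on[OF S(1)] smooth_borel[OF S(1)] S(4)])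
      show "plim 1 S (\<lambda>n z. comp2 (dx f) (u n) (v n) z * dir_deriv d (u n) z + comp2 (dy f) (u n) (v n) z * dir_deriv d (v n) z)
          (\<lambda>z. comp2 (dx f) a b z * a' z + comp2 (dy f) a b z * b' z)"
        by (intro plim_add borel_compact S pl smooth_dx smooth_dy f ab) auto
      show "Lp 1 S (\<lambda>z. comp2 (dx f) (u n) (v n) z * dir_deriv d (u n) z + comp2 (dy f) (u n) (v n) z * dir_deriv d (v n) z)" for n
        by (intro Lp_smooth smooth_add smooth_mult scomp smooth_dx smooth_dy smooth_dir_deriv f u v S) auto
    qed (rule L)
    have "(LBINT z. comp2 f a b z * dx \<eta> z) = - (LBINT z. (comp2 (dx f) a b z * ax z + comp2 (dy f) a b z * bx z) * \<eta> z)"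
      using LIMSEQ_unique[OF l0[of 1, unfolded eq[of 1, simplified]] tendsto_minus[OF l1[OF u(2) LS(1) v(2) LS(3) Lploc_Lp[OF Lx S(2,3)]]]] .
    moreover have "(LBINT z. comp2 f a b z * dy \<eta> z) = - (LBINT z. (comp2 (dx f) a b z * ay z + comp2 (dy f) a b z * by' z) * \<eta> z)"
      using LIMSEQ_unique[OF l0[of \<i>, unfolded eq[of \<i>, simplified]] tendsto_minus[OF l1[OF u(3) LS(2) v(3) LS(4) Lploc_Lp[OF Ly S(2,3)]]]] .
    ultimately show ?thesis by blast
  qed
  show ?thesis unfolding wgrad_def using L0 Lx Ly main by blast
qed

lemma W12_chain:
  assumes X: "open X" and f: "smooth f"
    and a: "W12 X a ax ay" "continuous_on X a" and b: "W12 X b bx by'" "continuous_on X b"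
  shows "W12 X (comp2 f a b) (\<lambda>z. comp2 (dx f) a b z * ax z + comp2 (dy f) a b z * bx z)
    (\<lambda>z. comp2 (dx f) a b z * ay z + comp2 (dy f) a b z * by' z)"
proof -
  have w: "wgrad X a ax ay" "wgrad X b bx by'" using a b by (auto simp only: W12_def)
  note bo = Lploc_borel[OF wgrad_Lploc(1)[OF w(1)]] Lploc_borel[OF wgrad_Lploc(1)[OF w(2)]]
  have L: "Lploc 2 X ax" "Lploc 2 X ay" "Lploc 2 X bx" "Lploc 2 X by'" using a b by (auto simp only: W12_def)
  have "Lploc 2 X (\<lambda>z. comp2 (dx f) a b z * r z + comp2 (dy f) a b z * s z)"
    if "Lploc 2 X r" "Lploc 2 X s" for r s
    by (intro Lploc_add Lploc_bounded_mult comp2_borel comp2_continuous_on smooth_borel smooth_continuous_on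
        smooth_dx smooth_dy f a b bo that) auto
  then show ?thesis unfolding W12_def using wgrad_chain[OF X f w(1) a(2) w(2) b(2)] L by blast
qed

text \<open>The Jacobian is the divergence of (f g_y, - f g_x): the second derivatives of g cancel
  because the mixed ones are equal, which is where \<open>sym_smooth\<close> is needed.\<close>

lemma jac_ibp_smooth:
  assumes k: "smooth k" "compact S" "\<forall>z. z \<notin> S \<longrightarrow> k z = 0"
    and f: "smooth f" and g: "sym_smooth g"
  shows "(LBINT z. (dx f z * dy g z - dy f z * dx g z) * k z)
    = - (LBINT z. f z * dy g z * dx k z) + (LBINT z. f z * dx g z * dy k z)"
proof -
  have g': "smooth g" "dx (dy g) = dy (dx g)" using g by (auto simp: sym_smooth_def)
  have t: "k \<in> test_functions UNIV" using k by (auto simp: test_functions_iff)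
  note s = f g'(1) smooth_mult[OF f smooth_dy[OF g'(1)]] smooth_mult[OF f smooth_dx[OF g'(1)]]
    smooth_dx[OF g'(1)] smooth_dy[OF g'(1)]
  have 1: "(LBINT z. f z * dy g z * dx k z) = - (LBINT z. (f z * dx (dy g) z + dx f z * dy g z) * k z)"
    using wgrad_ibp(1)[OF wgrad_smooth[OF s(3)] t] by (simp add: dir_deriv_mult_smooth s)
  have 2: "(LBINT z. f z * dx g z * dy k z) = - (LBINT z. (f z * dy (dx g) z + dy f z * dx g z) * k z)"
    using wgrad_ibp(2)[OF wgrad_smooth[OF s(4)] t] by (simp add: dir_deriv_mult_smooth s)
  have i: "integrable lborel (\<lambda>z. F z * k z)" if "smooth F" for F
    by (rule test_integrable_test(1)[OF Lploc_smooth[OF that, of 1] t]) simp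
  have "- (LBINT z. f z * dy g z * dx k z) + (LBINT z. f z * dx g z * dy k z)
      = (LBINT z. (f z * dx (dy g) z + dx f z * dy g z) * k z - (f z * dy (dx g) z + dy f z * dx g z) * k z)"
    unfolding 1 2
    by (subst Bochner_Integration.integral_diff)
       (auto intro!: i smooth_add smooth_mult smooth_dx smooth_dy f g')
  also have "\<dots> = (LBINT z. (dx f z * dy g z - dy f z * dx g z) * k z)"
    unfolding g'(2) by (simp add: algebra_simps)
  finally show ?thesis by simp
qed

text \<open>Only first derivatives occur in the identity, and each product in it is either of two
  L2-convergent sequences or of a uniformly convergent one with an L2-convergent one, so it passes
  to the limit.\<close>

lemma jac_ibp:
  assumes X: "open X" and f: "W12 X f fx fy" "continuous_on X f" and g: "W12 X g gx gy"
    and t: "k \<in> test_functions X"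
  shows "(LBINT z. (fx z * gy z - fy z * gx z) * k z)
    = - (LBINT z. f z * gy z * dx k z) + (LBINT z. f z * gx z * dy k z)"
proof -
  obtain S where S: "smooth k" "compact S" "S \<subseteq> X" "\<forall>z. z \<notin> S \<longrightarrow> k z = 0"
    using t by (auto simp: test_functions_iff)
  note o = dir_deriv_eq_0_outside[OF compact_imp_closed[OF S(2)] S(4)]
  have W: "wgrad X f fx fy" "wgrad X g gx gy" using f g by (auto simp only: W12_def)
  have L: "Lploc 2 X fx" "Lploc 2 X fy" "Lploc 2 X gx" "Lploc 2 X gy"
    using f g by (auto simp only: W12_def)
  have LS: "Lp 2 S fx" "Lp 2 S fy" "Lp 2 S gx" "Lp 2 S gy" using L S Lploc_Lp by blast+
  obtain u where u: "\<And>n. smooth (u n)" "plim 2 S (\<lambda>n. dx (u n)) fx" "plim 2 S (\<lambda>n. dy (u n)) fy"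
    "uniform_limit S u f sequentially"
    using wgrad_approx[OF X W(1) S(2,3)] f(2) L(1,2) unfolding sym_smooth_def by blast
  obtain v where v: "\<And>n. sym_smooth (v n)" "plim 2 S (\<lambda>n. dx (v n)) gx" "plim 2 S (\<lambda>n. dy (v n)) gy"
    using wgrad_approx[OF X W(2) S(2,3)] L(3,4) by blast
  have sv: "smooth (v n)" for n using v(1) by (simp add: sym_smooth_def)
  have bS: "S \<in> sets borel" using S(2) by (rule borel_compact)
  have fb: "f \<in> Borel" using Lploc_borel[OF wgrad_Lploc(1)[OF W(1)]] .
  have cS: "continuous_on S f" using f(2) S(3) continuous_on_subset by blast
  then obtain M where M: "\<And>z. z \<in> S \<Longrightarrow> \<bar>f z\<bar> \<le> M" using bounded_on_compact[OF S(2)] by blast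
  have L1: "Lp 1 S (\<lambda>z. fx z * gy z - fy z * gx z)"
    by (intro Lp_diff Lp_mult bS LS) auto
  have a: "(\<lambda>n. LBINT z. (dx (u n) z * dy (v n) z - dy (u n) z * dx (v n) z) * k z)
      \<longlonglongrightarrow> (LBINT z. (fx z * gy z - fy z * gx z) * k z)"
    by (intro plim_test_integral[OF S(2) smooth_continuous_on[OF S(1)] smooth_borel[OF S(1)] S(4)] L1
        plim_diff plim_mult bS u v LS Lp_smooth S smooth_diff smooth_mult smooth_dx smooth_dy sv) auto
  have b: "(\<lambda>n. LBINT z. u n z * r n z * dir_deriv d k z) \<longlonglongrightarrow> (LBINT z. f z * r' z * dir_deriv d k z)"
    if r: "plim 2 S r r'" "Lp 2 S r'" "\<And>n. smooth (r n)" for r r' d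
  proof (rule plim_test_integral[OF S(2) smooth_continuous_on smooth_borel o])
    have "plim 2 S (\<lambda>n z. u n z * r n z) (\<lambda>z. f z * r' z)"
      by (rule plim_mult_unif[OF _ bS u(4) M smooth_borel[OF u(1)] fb r(1,2)]) auto
    moreover have "Lp 2 S (\<lambda>z. f z * r' z)"
      using Lp_bounded_mult[OF bS fb M r(2)] by blast
    ultimately have "plim 1 S (\<lambda>n z. (u n z * r n z) * 1) (\<lambda>z. (f z * r' z) * 1)"
      by (intro plim_mult bS plim_const Lp_bounded[OF S(2), of "\<lambda>z. 1" 1]) auto
    then show "plim 1 S (\<lambda>n z. u n z * r n z) (\<lambda>z. f z * r' z)" by simp
    show "Lp 1 S (\<lambda>z. u n z * r n z)" for n by (intro Lp_smooth smooth_mult u r S) auto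
    show "Lp 1 S (\<lambda>z. f z * r' z)"
      using Lp_bounded_mult[OF bS fb M Lp2_imp_Lp1[OF S(2) r(2)]] by blast
  qed (intro smooth_dir_deriv S)+
  have "(\<lambda>n. - (LBINT z. u n z * dy (v n) z * dx k z) + (LBINT z. u n z * dx (v n) z * dy k z))
      \<longlonglongrightarrow> - (LBINT z. f z * gy z * dx k z) + (LBINT z. f z * gx z * dy k z)"
    by (intro tendsto_add tendsto_minus b v LS smooth_dx smooth_dy sv)
  then show ?thesis
    using LIMSEQ_unique[OF a[unfolded jac_ibp_smooth[OF S(1,2,4) u(1) v(1)]]] by blast
qed

section \<open>The degree formula\<close>

lemma Complex_borel_pair [measurable]:
  "(\<lambda>(x, y). Complex x y) \<in> borel_measurable (lborel \<Otimes>\<^sub>M lborel)"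
  unfolding case_prod_beta Complex_eq by measurable

lemma lborel_complex: "lborel = distr (lborel \<Otimes>\<^sub>M lborel) borel (\<lambda>(x, y). Complex x y)"
proof (rule lborel_eqI)
  fix l u :: complex assume lu: "\<And>b. b \<in> Basis \<Longrightarrow> l \<bullet> b \<le> u \<bullet> b"
  have le: "Re l \<le> Re u" "Im l \<le> Im u" using lu[of 1] lu[of \<i>] by (auto simp: Basis_complex_def)
  have "emeasure (distr (lborel \<Otimes>\<^sub>M lborel) borel (\<lambda>(x, y). Complex x y)) (box l u)
      = emeasure (lborel \<Otimes>\<^sub>M lborel) ({Re l<..<Re u} \<times> {Im l<..<Im u})"
    by (subst emeasure_distr) (auto simp: in_box_complex_iff space_pair_measure intro!: arg_cong2[where f = emeasure])
  also have "\<dots> = emeasure lborel {Re l<..<Re u} * emeasure lborel {Im l<..<Im u}"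
    by (rule lborel.emeasure_pair_measure_Times) auto
  also have "\<dots> = ennreal (\<Prod>b\<in>Basis. (u - l) \<bullet> b)"
    using le by (simp add: Basis_complex_def ennreal_mult)
  finally show "emeasure (distr (lborel \<Otimes>\<^sub>M lborel) borel (\<lambda>(x, y). Complex x y)) (box l u) = (\<Prod>b\<in>Basis. (u - l) \<bullet> b)" .
qed simp

lemma integral_complex_pair:
  fixes f :: "complex \<Rightarrow> real"
  assumes "f \<in> Borel"
  shows "(LBINT z. f z) = (\<integral>p. f (Complex (fst p) (snd p)) \<partial>(lborel \<Otimes>\<^sub>M lborel))"
  by (subst lborel_complex, subst integral_distr) (use assms in \<open>auto simp: case_prod_beta\<close>)

lemma integrable_complex_pair:
  fixes f :: "complex \<Rightarrow> real"
  assumes "integrable lborel f"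
  shows "integrable (lborel \<Otimes>\<^sub>M lborel) (\<lambda>p. f (Complex (fst p) (snd p)))"
  using assms by (subst (asm) lborel_complex, subst (asm) integrable_distr_eq) (auto simp: case_prod_beta)

abbreviation rect :: "real \<Rightarrow> real \<Rightarrow> real \<Rightarrow> real \<Rightarrow> complex set" where
  "rect x0 x1 y0 y1 \<equiv> cbox (Complex x0 y0) (Complex x1 y1)"

lemma indicator_rect:
  "ind (rect x0 x1 y0 y1) (Complex x y) = (ind {x0..x1} x * ind {y0..y1} y :: real)"
  by (auto simp: indicator_def in_cbox_complex_iff)

lemma rect_FTC:
  fixes F :: "complex \<Rightarrow> real"
  assumes F: "\<And>z. (F has_derivative D z) (at z)" and xy: "x0 \<le> x1" "y0 \<le> y1"
  shows rect_FTC_x: "continuous_on UNIV (\<lambda>z. D z 1) \<Longrightarrow>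
      (LBINT z. ind (rect x0 x1 y0 y1) z * D z 1)
        = (LBINT y. ind {y0..y1} y * (F (Complex x1 y) - F (Complex x0 y)))"
    and rect_FTC_y: "continuous_on UNIV (\<lambda>z. D z \<i>) \<Longrightarrow>
      (LBINT z. ind (rect x0 x1 y0 y1) z * D z \<i>)
        = (LBINT x. ind {x0..x1} x * (F (Complex x y1) - F (Complex x y0)))"
proof -
  have int: "integrable lborel (\<lambda>z. ind (rect x0 x1 y0 y1) z * G z)"
    if "continuous_on UNIV G" for G :: "complex \<Rightarrow> real"
    using borel_integrable_compact[OF compact_cbox continuous_on_subset[OF that subset_UNIV], of "Complex x0 y0" "Complex x1 y1"]
    by simp
  have Cx: "((\<lambda>t. Complex t y) has_derivative (\<lambda>h. h *\<^sub>R 1)) (at x)" for x y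
    unfolding Complex_eq by (auto intro!: derivative_eq_intros simp: scaleR_conv_of_real)
  have Cy: "((\<lambda>t. Complex x t) has_derivative (\<lambda>h. h *\<^sub>R \<i>)) (at y)" for x y
    unfolding Complex_eq by (auto intro!: derivative_eq_intros simp: scaleR_conv_of_real)
  have lin: "D z (h *\<^sub>R v) = h * D z v" for z h v
    using bounded_linear.linear[OF has_derivative_bounded_linear[OF F]] by (simp add: linear_cmul)
  have dx: "((\<lambda>t. F (Complex t y)) has_real_derivative D (Complex x y) 1) (at x)" for x y
    using has_derivative_compose[OF Cx F] by (simp add: has_field_derivative_def lin mult_commute_abs)
  have dy: "((\<lambda>t. F (Complex x t)) has_real_derivative D (Complex x y) \<i>) (at y)" for x y
    using has_derivative_compose[OF Cy F] by (simp add: has_field_derivative_def lin mult_commute_abs)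
  have contx: "isCont (\<lambda>t. G (Complex t y)) x" if "continuous_on UNIV G" for G :: "complex \<Rightarrow> real" and x y
    using isCont_o2[OF has_derivative_continuous[OF Cx], where g = G] that
    by (simp add: continuous_on_eq_continuous_at)
  have conty: "isCont (\<lambda>t. G (Complex x t)) y" if "continuous_on UNIV G" for G :: "complex \<Rightarrow> real" and x y
    using isCont_o2[OF has_derivative_continuous[OF Cy], where g = G] that
    by (simp add: continuous_on_eq_continuous_at)
  {
    assume c: "continuous_on UNIV (\<lambda>z. D z 1)"
    have i: "integrable (lborel \<Otimes>\<^sub>M lborel) (\<lambda>(x, y). ind {x0..x1} x * ind {y0..y1} y * D (Complex x y) 1)"
      using integrable_complex_pair[OF int[OF c]] by (simp add: indicator_rect split_beta')
    have "(LBINT z. ind (rect x0 x1 y0 y1) z * D z 1)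
        = (\<integral>(x, y). ind {x0..x1} x * ind {y0..y1} y * D (Complex x y) 1 \<partial>(lborel \<Otimes>\<^sub>M lborel))"
      using int[OF c] by (subst integral_complex_pair) (auto simp: indicator_rect split_beta')
    also have "\<dots> = (LBINT y. (LBINT x. ind {x0..x1} x * ind {y0..y1} y * D (Complex x y) 1))"
      by (rule lborel_pair.integral_snd[symmetric, OF i])
    also have "\<dots> = (LBINT y. ind {y0..y1} y * (F (Complex x1 y) - F (Complex x0 y)))"
    proof (rule Bochner_Integration.integral_cong[OF refl])
      fix y
      have "(LBINT x. D (Complex x y) 1 * ind {x0..x1} x) = F (Complex x1 y) - F (Complex x0 y)"
        by (rule integral_FTC_Icc_real[OF xy(1) dx contx[OF c]])
      then show "(LBINT x. ind {x0..x1} x * ind {y0..y1} y * D (Complex x y) 1)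
          = ind {y0..y1} y * (F (Complex x1 y) - F (Complex x0 y))"
        by (simp add: mult.commute mult.left_commute indicator_def)
    qed
    finally show "(LBINT z. ind (rect x0 x1 y0 y1) z * D z 1)
        = (LBINT y. ind {y0..y1} y * (F (Complex x1 y) - F (Complex x0 y)))" .
  }
  {
    assume c: "continuous_on UNIV (\<lambda>z. D z \<i>)"
    have i: "integrable (lborel \<Otimes>\<^sub>M lborel) (\<lambda>(x, y). ind {x0..x1} x * ind {y0..y1} y * D (Complex x y) \<i>)"
      using integrable_complex_pair[OF int[OF c]] by (simp add: indicator_rect split_beta')
    have "(LBINT z. ind (rect x0 x1 y0 y1) z * D z \<i>)
        = (\<integral>(x, y). ind {x0..x1} x * ind {y0..y1} y * D (Complex x y) \<i> \<partial>(lborel \<Otimes>\<^sub>M lborel))"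
      using int[OF c] by (subst integral_complex_pair) (auto simp: indicator_rect split_beta')
    also have "\<dots> = (LBINT x. (LBINT y. ind {x0..x1} x * ind {y0..y1} y * D (Complex x y) \<i>))"
      by (rule lborel_pair.integral_fst[symmetric, OF i])
    also have "\<dots> = (LBINT x. ind {x0..x1} x * (F (Complex x y1) - F (Complex x y0)))"
    proof (rule Bochner_Integration.integral_cong[OF refl])
      fix x
      have "(LBINT y. D (Complex x y) \<i> * ind {y0..y1} y) = F (Complex x y1) - F (Complex x y0)"
        by (rule integral_FTC_Icc_real[OF xy(2) dy conty[OF c]])
      then show "(LBINT y. ind {x0..x1} x * ind {y0..y1} y * D (Complex x y) \<i>)
          = ind {x0..x1} x * (F (Complex x y1) - F (Complex x y0))"
        by (simp add: mult.commute mult.left_commute indicator_def)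
    qed
    finally show "(LBINT z. ind (rect x0 x1 y0 y1) z * D z \<i>)
        = (LBINT x. ind {x0..x1} x * (F (Complex x y1) - F (Complex x y0)))" .
  }
qed

subsection \<open>Radial kernels and winding numbers\<close>

text \<open>With s = u^2 + v^2 the form (u dv - v du) / s is the angular form. Inside the disc of
  radius d the factor 1/s is continued by its tangent line at s = d^2, which removes the pole and
  keeps the factor continuously differentiable.\<close>

definition radial :: "real \<Rightarrow> real \<Rightarrow> real" where
  "radial d s = (if s \<ge> d\<^sup>2 then 1 / s else (2 - s / d\<^sup>2) / d\<^sup>2)"

definition radial' :: "real \<Rightarrow> real \<Rightarrow> real" where
  "radial' d s = (if s \<ge> d\<^sup>2 then - 1 / s\<^sup>2 else - 1 / d ^ 4)"

text \<open>A paraboloid cap on the disc of radius d, obtained from \<open>radial\<close> by the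
  identity \<open>radial_parab\<close>. Its mass is 1, see \<open>parab_integral\<close>.\<close>

definition parab :: "real \<Rightarrow> complex \<Rightarrow> real" where
  "parab d w = 2 / (pi * d\<^sup>2) * max 0 (1 - (norm w)\<^sup>2 / d\<^sup>2)"

lemma DERIV_If:
  fixes f g :: "real \<Rightarrow> real"
  assumes "(f has_real_derivative D) (at x)" "(g has_real_derivative D) (at x)" "f x = g x"
  shows "((\<lambda>x. if P x then f x else g x) has_real_derivative D) (at x)"
proof -
  have "((\<lambda>h. if P (x + h) then (f (x + h) - f x) / h else (g (x + h) - g x) / h) \<longlongrightarrow> D) (at 0)"
    using assms(1,2) unfolding DERIV_def
    by (intro filterlim_If) (auto intro: filterlim_mono[OF _ order_refl inf_le1])
  also have "(\<lambda>h. if P (x + h) then (f (x + h) - f x) / h else (g (x + h) - g x) / h)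
      = (\<lambda>h. ((if P (x + h) then f (x + h) else g (x + h)) - (if P x then f x else g x)) / h)"
    using assms(3) by auto
  finally show ?thesis by (simp add: DERIV_def)
qed

lemma radial_deriv:
  assumes d: "d > 0"
  shows "(radial d has_real_derivative radial' d s) (at s)"
proof -
  have l: "((\<lambda>s. (2 - s / d\<^sup>2) / d\<^sup>2) has_real_derivative - 1 / d ^ 4) (at s)" for s
    using d by (auto intro!: derivative_eq_intros simp: field_simps power_numeral_reduce)
  have r: "((\<lambda>s. 1 / s) has_real_derivative - 1 / s\<^sup>2) (at s)" if "s > 0" for s :: real
    using that by (auto intro!: derivative_eq_intros simp: field_simps power2_eq_square)
  have d2: "d\<^sup>2 > 0" using d by simp
  consider "s > d\<^sup>2" | "s < d\<^sup>2" | "s = d\<^sup>2" by linarith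
  then show ?thesis
  proof cases
    case 1
    have "((\<lambda>s. 1 / s) has_real_derivative radial' d s) (at s)"
      using r[of s] 1 d2 by (simp add: radial'_def)
    then show ?thesis
      by (rule has_field_derivative_transform_within_open[where S = "{d\<^sup>2<..}"]) (use 1 in \<open>auto simp: radial_def\<close>)
  next
    case 2
    have "((\<lambda>s. (2 - s / d\<^sup>2) / d\<^sup>2) has_real_derivative radial' d s) (at s)"
      using l[of s] 2 by (simp add: radial'_def)
    then show ?thesis
      by (rule has_field_derivative_transform_within_open[where S = "{..<d\<^sup>2}"]) (use 2 in \<open>auto simp: radial_def\<close>)
  next
    case 3
    have e: "- 1 / s\<^sup>2 = - 1 / d ^ 4" using 3 by (simp flip: power_mult)
    have "((\<lambda>s. if s \<ge> d\<^sup>2 then 1 / s else (2 - s / d\<^sup>2) / d\<^sup>2) has_real_derivative - 1 / d ^ 4) (at s)"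
      using r[of s] l[of s] d2 unfolding e using 3 by (intro DERIV_If) auto
    then show ?thesis using 3 e by (simp add: radial_def[abs_def] radial'_def)
  qed
qed

lemma radial'_continuous:
  assumes d: "d > 0"
  shows "continuous_on UNIV (radial' d)"
proof -
  have "continuous_on ({d\<^sup>2..} \<union> {..d\<^sup>2}) (\<lambda>s. if s \<ge> d\<^sup>2 then - 1 / s\<^sup>2 else - 1 / d ^ 4)"
  proof (rule continuous_on_cases)
    have "d\<^sup>2 > 0" using d by simp
    then show "continuous_on {d\<^sup>2..} (\<lambda>s. - 1 / s\<^sup>2)" by (intro continuous_intros) force
    show "\<forall>x. x \<in> {d\<^sup>2..} \<and> \<not> d\<^sup>2 \<le> x \<or> x \<in> {..d\<^sup>2} \<and> d\<^sup>2 \<le> x \<longrightarrow> - 1 / x\<^sup>2 = - 1 / d ^ 4"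
      by (auto simp flip: power_mult)
  qed auto
  moreover have "{d\<^sup>2..} \<union> {..d\<^sup>2} = UNIV" by auto
  ultimately show ?thesis by (simp add: radial'_def[abs_def])
qed

lemma radial_parab:
  assumes "d > 0"
  shows "radial d ((norm w)\<^sup>2) + (norm w)\<^sup>2 * radial' d ((norm w)\<^sup>2) = pi * parab d w"
proof (cases "(norm w)\<^sup>2 \<ge> d\<^sup>2")
  case True
  then have "(norm w)\<^sup>2 > 0" using assms by (smt (verit) zero_less_power)
  then show ?thesis
    using True assms by (auto simp: radial_def radial'_def parab_def field_simps power2_eq_square max_def)
next
  case False
  define s where "s = (norm w)\<^sup>2"
  define q where "q = d\<^sup>2"
  have q: "q > 0" "d ^ 4 = q * q" using assms by (auto simp: q_def power2_eq_square power_numeral_reduce)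
  have "s / q < 1" using False q by (simp add: s_def q_def)
  then have 1: "parab d w = 2 / (pi * q) * (1 - s / q)" by (simp add: parab_def s_def q_def)
  have 2: "radial d s = (2 - s / q) / q" "radial' d s = - 1 / (q * q)"
    using False q(2) by (auto simp: radial_def radial'_def s_def q_def)
  show ?thesis unfolding s_def[symmetric] 1 2 using q(1) by (simp add: field_simps)
qed

lemma contour_integral_linepath_same_Im:
  assumes "Im z = c" "Im z' = c" "Re z = a" "Re z' = b" "a < b"
  shows "contour_integral (linepath z z') f = integral {a..b} (\<lambda>x. f (Complex x c))"
proof -
  have zz': "z = Complex a c" "z' = Complex b c" using assms by (auto simp: complex_eq_iff)
  have l: "linepath z z' t = linepath (of_real a) (of_real b) t + \<i> * of_real c" for t
    by (simp add: linepath_def zz' Complex_eq scaleR_conv_of_real algebra_simps)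
  have "contour_integral (linepath z z') f
      = contour_integral (linepath (of_real a) (of_real b)) (\<lambda>w. f (w + \<i> * of_real c))"
    unfolding contour_integral_integral by (simp add: l) (simp add: zz' Complex_eq)
  also have "\<dots> = integral {a..b} (\<lambda>x. f (of_real x + \<i> * of_real c))"
    using contour_integral_linepath_Reals_eq[of "of_real a" "of_real b"] assms(5) by simp
  finally show ?thesis by (simp add: Complex_eq)
qed

text \<open>The real part of the winding number is the integral of the angular form divided by 2 pi;
  \<open>q d\<close> is the pull-back of that form in direction d. The upper and left edges are
  traversed against their coordinate, whence the minus signs.\<close>

lemma winding_number_smooth_rectpath:
  assumes a: "smooth a" and b: "smooth b" and xy: "x0 < x1" "y0 < y1"
    and w: "w \<notin> (\<lambda>z. Complex (a z) (b z)) ` path_image (rectpath (Complex x0 y0) (Complex x1 y1))"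
  defines "q \<equiv> \<lambda>d z. ((a z - Re w) * dir_deriv d b z - (b z - Im w) * dir_deriv d a z) / ((a z - Re w)\<^sup>2 + (b z - Im w)\<^sup>2)"
  shows "Re (winding_number ((\<lambda>z. Complex (a z) (b z)) \<circ> rectpath (Complex x0 y0) (Complex x1 y1)) w) =
    (integral {x0..x1} (\<lambda>x. q 1 (Complex x y0)) + integral {y0..y1} (\<lambda>y. q \<i> (Complex x1 y))
     - integral {x0..x1} (\<lambda>x. q 1 (Complex x y1)) - integral {y0..y1} (\<lambda>y. q \<i> (Complex x0 y))) / (2 * pi)"
proof -
  define \<Phi> where "\<Phi> z = Complex (a z) (b z)" for z
  define D where "D d z = Complex (dir_deriv d a z) (dir_deriv d b z)" for d z
  have c\<Phi>: "continuous_on S \<Phi>" for S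
    unfolding \<Phi>_def Complex_eq by (intro continuous_intros smooth_continuous_on a b)
  have cD: "continuous_on S (D d)" for S d
    unfolding D_def Complex_eq by (intro continuous_intros smooth_continuous_on smooth_dir_deriv a b)
  have line: "((\<lambda>t. \<Phi> (linepath p p' t)) has_vector_derivative D (p' - p) (linepath p p' t)) (at t)" for p p' t
  proof -
    have l: "(linepath p p' has_derivative (\<lambda>h. h *\<^sub>R (p' - p))) (at t)"
      using has_vector_derivative_linepath_within[of p p' t UNIV] by (simp add: has_vector_derivative_def)
    have "((\<lambda>t. f (linepath p p' t)) has_derivative (\<lambda>h. h * dir_deriv (p' - p) f (linepath p p' t))) (at t)" if "smooth f" for f
    proof -
      have e: "dir_deriv v f z = Re v * dx f z + Im v * dy f z" for v z
        by (rule dir_deriv_eq[OF smooth_has_derivative[OF that]])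
      show ?thesis
        using has_derivative_compose[OF l smooth_has_derivative[OF that, of "linepath p p' t" UNIV]]
        by (simp add: e[of "p' - p"] algebra_simps)
    qed
    from has_derivative_add[OF has_derivative_of_real[OF this[OF a]]
        has_derivative_mult_right[OF has_derivative_of_real[OF this[OF b]], of \<i>]]
    show ?thesis
      unfolding has_vector_derivative_def \<Phi>_def D_def Complex_eq
      by (rule has_derivative_eq_rhs) (simp add: fun_eq_iff scaleR_conv_of_real distrib_left mult.left_commute)
  qed
  have vp: "valid_path (\<Phi> \<circ> linepath p p')" for p p'
    unfolding valid_path_def
  proof (rule C1_differentiable_imp_piecewise)
    have "continuous_on {0..1} (\<lambda>t. D (p' - p) (linepath p p' t))"
      by (rule continuous_on_compose2[OF cD[of UNIV]]) auto
    then show "\<Phi> \<circ> linepath p p' C1_differentiable_on {0..1}"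
      unfolding C1_differentiable_on_def comp_def
      by (intro exI[of _ "\<lambda>t. D (p' - p) (linepath p p' t)"] conjI ballI line)
  qed
  let ?p1 = "Complex x0 y0" and ?p2 = "Complex x1 y0" and ?p3 = "Complex x1 y1" and ?p4 = "Complex x0 y1"
  have R: "rectpath ?p1 ?p3 = linepath ?p1 ?p2 +++ linepath ?p2 ?p3 +++ linepath ?p3 ?p4 +++ linepath ?p4 ?p1"
    by (simp add: rectpath_def Let_def)
  have comp: "\<Phi> \<circ> rectpath ?p1 ?p3 = (\<Phi> \<circ> linepath ?p1 ?p2) +++ (\<Phi> \<circ> linepath ?p2 ?p3) +++ (\<Phi> \<circ> linepath ?p3 ?p4) +++ (\<Phi> \<circ> linepath ?p4 ?p1)"
    by (simp add: R path_compose_join)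
  have pf: "pathfinish (\<Phi> \<circ> linepath p p') = \<Phi> p'" "pathstart (\<Phi> \<circ> linepath p p') = \<Phi> p" for p p'
    by (simp_all add: pathfinish_compose pathstart_compose)
  have "path_image (rectpath ?p1 ?p3) = path_image (linepath ?p1 ?p2) \<union> (path_image (linepath ?p2 ?p3) \<union> (path_image (linepath ?p3 ?p4) \<union> path_image (linepath ?p4 ?p1)))"
    unfolding R by (simp add: path_image_join)
  then have nw: "w \<notin> path_image (\<Phi> \<circ> linepath ?p1 ?p2)" "w \<notin> path_image (\<Phi> \<circ> linepath ?p2 ?p3)"
    "w \<notin> path_image (\<Phi> \<circ> linepath ?p3 ?p4)" "w \<notin> path_image (\<Phi> \<circ> linepath ?p4 ?p1)"
    using w by (auto simp: \<Phi>_def[abs_def] path_image_compose)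
  let ?f = "\<lambda>\<zeta>. 1 / (\<zeta> - w)"
  have ci: "?f contour_integrable_on (\<Phi> \<circ> linepath p p')" if "w \<notin> path_image (\<Phi> \<circ> linepath p p')" for p p'
    by (rule contour_integrable_inversediff[OF vp that])
  have "winding_number (\<Phi> \<circ> rectpath ?p1 ?p3) w = 1 / (2 * pi * \<i>) * contour_integral (\<Phi> \<circ> rectpath ?p1 ?p3) ?f"
  proof (rule winding_number_valid_path)
    show "valid_path (\<Phi> \<circ> rectpath ?p1 ?p3)"
      unfolding comp by (intro valid_path_join vp) (auto simp: pf)
    show "w \<notin> path_image (\<Phi> \<circ> rectpath ?p1 ?p3)"
      using w by (simp add: \<Phi>_def[abs_def] path_image_compose)
  qed
  also have "contour_integral (\<Phi> \<circ> rectpath ?p1 ?p3) ?f =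
      contour_integral (\<Phi> \<circ> linepath ?p1 ?p2) ?f + contour_integral (\<Phi> \<circ> linepath ?p2 ?p3) ?f
      + contour_integral (\<Phi> \<circ> linepath ?p3 ?p4) ?f + contour_integral (\<Phi> \<circ> linepath ?p4 ?p1) ?f"
    unfolding comp using nw by (simp add: ci vp pf valid_path_join contour_integrable_joinI)
  finally have W: "winding_number (\<Phi> \<circ> rectpath ?p1 ?p3) w = 1 / (2 * pi * \<i>) *
      (contour_integral (\<Phi> \<circ> linepath ?p1 ?p2) ?f + contour_integral (\<Phi> \<circ> linepath ?p2 ?p3) ?f
      + contour_integral (\<Phi> \<circ> linepath ?p3 ?p4) ?f + contour_integral (\<Phi> \<circ> linepath ?p4 ?p1) ?f)" .
  have Dlin: "D (c *\<^sub>R d) z = c *\<^sub>R D d z" for c d z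
  proof -
    have e: "dir_deriv (c *\<^sub>R d) f z = c * dir_deriv d f z" if "smooth f" for f
      unfolding dir_deriv_eq[OF smooth_has_derivative[OF that], of "c *\<^sub>R d"]
        dir_deriv_eq[OF smooth_has_derivative[OF that], of d] by (simp add: algebra_simps)
    show ?thesis by (simp add: D_def e[OF a] e[OF b] complex_eq_iff)
  qed
  \<comment> \<open>Dividing out the direction d turns an edge into a real integral in its
    coordinate. On vertical edges d = \<i> cancels the factor that the parametrization
    produces.\<close>
  have seg: "contour_integral (\<Phi> \<circ> linepath p p') ?f = contour_integral (linepath p p') (\<lambda>z. D d z / (d * (\<Phi> z - w)))"
    if "p' - p = c *\<^sub>R d" "d \<noteq> 0" for p p' c d
  proof -
    have "contour_integral (\<Phi> \<circ> linepath p p') ?f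
        = integral {0..1} (\<lambda>t. 1 / (\<Phi> (linepath p p' t) - w) * D (p' - p) (linepath p p' t))"
      unfolding contour_integral_integral using vector_derivative_at[OF line] by (simp add: comp_def)
    also have "\<dots> = integral {0..1} (\<lambda>t. D d (linepath p p' t) / (d * (\<Phi> (linepath p p' t) - w)) * (p' - p))"
    proof (rule integral_cong)
      fix t
      have "X * (of_real c * Y) = Y / (d * (1 / X)) * (of_real c * d)" for X Y :: complex
        using that(2) by (simp add: field_simps)
      then show "1 / (\<Phi> (linepath p p' t) - w) * D (p' - p) (linepath p p' t)
          = D d (linepath p p' t) / (d * (\<Phi> (linepath p p' t) - w)) * (p' - p)"
        unfolding that(1) Dlin by (simp add: scaleR_conv_of_real)
    qed
    also have "\<dots> = contour_integral (linepath p p') (\<lambda>z. D d z / (d * (\<Phi> z - w)))"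
      by (simp add: contour_integral_integral)
    finally show ?thesis .
  qed
  have i: "integral {l..u} (\<lambda>t. D d (\<gamma> t) / (\<Phi> (\<gamma> t) - w)) = Complex r s \<Longrightarrow> s = integral {l..u} (\<lambda>t. q d (\<gamma> t))"
    if "continuous_on {l..u} \<gamma>" "\<And>t. t \<in> {l..u} \<Longrightarrow> \<Phi> (\<gamma> t) \<noteq> w" for l u r s :: real and d \<gamma>
  proof -
    assume I: "integral {l..u} (\<lambda>t. D d (\<gamma> t) / (\<Phi> (\<gamma> t) - w)) = Complex r s"
    have "continuous_on {l..u} (\<lambda>t. D d (\<gamma> t) / (\<Phi> (\<gamma> t) - w))"
      using that by (intro continuous_intros continuous_on_compose2[OF cD[of UNIV] that(1)]
          continuous_on_compose2[OF c\<Phi>[of UNIV] that(1)]) auto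
    then have "(\<lambda>t. D d (\<gamma> t) / (\<Phi> (\<gamma> t) - w)) integrable_on {l..u}"
      by (rule integrable_continuous_real)
    from integral_linear[OF this bounded_linear_Im]
    have "s = integral {l..u} (Im \<circ> (\<lambda>t. D d (\<gamma> t) / (\<Phi> (\<gamma> t) - w)))" using I by simp
    also have "\<dots> = integral {l..u} (\<lambda>t. q d (\<gamma> t))"
      by (rule integral_cong) (simp add: Im_divide D_def \<Phi>_def q_def algebra_simps)
    finally show ?thesis .
  qed
  have rev: "contour_integral (linepath p p') g = - contour_integral (linepath p' p) g" for p p' g
    using contour_integral_reversepath[of "linepath p' p" g] by simp
  have h1: "contour_integral (\<Phi> \<circ> linepath ?p1 ?p2) ?f = integral {x0..x1} (\<lambda>x. D 1 (Complex x y0) / (\<Phi> (Complex x y0) - w))"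
    using seg[of ?p2 ?p1 "x1 - x0" 1] contour_integral_linepath_same_Im[of ?p1 y0 ?p2 x0 x1] xy
    by (simp add: complex_eq_iff)
  have h3: "contour_integral (\<Phi> \<circ> linepath ?p3 ?p4) ?f = - integral {x0..x1} (\<lambda>x. D 1 (Complex x y1) / (\<Phi> (Complex x y1) - w))"
    using seg[of ?p4 ?p3 "x0 - x1" 1] contour_integral_linepath_same_Im[of ?p4 y1 ?p3 x0 x1] xy rev[of ?p3 ?p4]
    by (simp add: complex_eq_iff)
  have v2: "contour_integral (\<Phi> \<circ> linepath ?p2 ?p3) ?f = integral {y0..y1} (\<lambda>y. D \<i> (Complex x1 y) / (\<Phi> (Complex x1 y) - w))"
  proof -
    have "contour_integral (\<Phi> \<circ> linepath ?p2 ?p3) ?f = \<i> * integral {y0..y1} (\<lambda>y. D \<i> (Complex x1 y) / (\<i> * (\<Phi> (Complex x1 y) - w)))"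
      using seg[of ?p3 ?p2 "y1 - y0" \<i>] contour_integral_linepath_same_Re[of ?p2 x1 ?p3 y0 y1] xy
      by (simp add: complex_eq_iff)
    also have "\<dots> = integral {y0..y1} (\<lambda>y. D \<i> (Complex x1 y) / (\<Phi> (Complex x1 y) - w))"
      unfolding integral_mult_right[symmetric] by simp
    finally show ?thesis .
  qed
  have v4: "contour_integral (\<Phi> \<circ> linepath ?p4 ?p1) ?f = - integral {y0..y1} (\<lambda>y. D \<i> (Complex x0 y) / (\<Phi> (Complex x0 y) - w))"
  proof -
    have "contour_integral (\<Phi> \<circ> linepath ?p4 ?p1) ?f = - (\<i> * integral {y0..y1} (\<lambda>y. D \<i> (Complex x0 y) / (\<i> * (\<Phi> (Complex x0 y) - w))))"
      using seg[of ?p1 ?p4 "y0 - y1" \<i>] contour_integral_linepath_same_Re[of ?p1 x0 ?p4 y0 y1] xy rev[of ?p4 ?p1]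
      by (simp add: complex_eq_iff)
    also have "\<i> * integral {y0..y1} (\<lambda>y. D \<i> (Complex x0 y) / (\<i> * (\<Phi> (Complex x0 y) - w))) = integral {y0..y1} (\<lambda>y. D \<i> (Complex x0 y) / (\<Phi> (Complex x0 y) - w))"
      unfolding integral_mult_right[symmetric] by simp
    finally show ?thesis .
  qed
  have onpath: "\<Phi> z \<noteq> w" if "z \<in> path_image (rectpath ?p1 ?p3)" for z
    using w that by (auto simp: \<Phi>_def)
  note pim = path_image_rectpath[of ?p1 ?p3]
  have cont: "continuous_on {l..u} (\<lambda>x. Complex x y)" "continuous_on {l..u} (\<lambda>y. Complex x y)" for l u x y
    unfolding Complex_eq by (intro continuous_intros)+
  have Imq: "Im (integral {l..u} (\<lambda>t. D d (\<gamma> t) / (\<Phi> (\<gamma> t) - w))) = integral {l..u} (\<lambda>t. q d (\<gamma> t))"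
    if "continuous_on {l..u} \<gamma>" "\<And>t. t \<in> {l..u} \<Longrightarrow> \<Phi> (\<gamma> t) \<noteq> w" for l u :: real and d \<gamma>
    using i[OF that, of d "Re (integral {l..u} (\<lambda>t. D d (\<gamma> t) / (\<Phi> (\<gamma> t) - w)))" "Im (integral {l..u} (\<lambda>t. D d (\<gamma> t) / (\<Phi> (\<gamma> t) - w)))"]
    by simp
  have Re_div: "Re (1 / (2 * pi * \<i>) * z) = Im z / (2 * pi)" for z
    by (simp add: Re_divide Im_divide power2_eq_square)
  have "Re (winding_number (\<Phi> \<circ> rectpath ?p1 ?p3) w) =
    (integral {x0..x1} (\<lambda>x. q 1 (Complex x y0)) + integral {y0..y1} (\<lambda>y. q \<i> (Complex x1 y))
     - integral {x0..x1} (\<lambda>x. q 1 (Complex x y1)) - integral {y0..y1} (\<lambda>y. q \<i> (Complex x0 y))) / (2 * pi)"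
  proof -
    have on: "x \<in> {x0..x1} \<Longrightarrow> \<Phi> (Complex x y0) \<noteq> w" "x \<in> {x0..x1} \<Longrightarrow> \<Phi> (Complex x y1) \<noteq> w"
      "y \<in> {y0..y1} \<Longrightarrow> \<Phi> (Complex x0 y) \<noteq> w" "y \<in> {y0..y1} \<Longrightarrow> \<Phi> (Complex x1 y) \<noteq> w" for x y
      by (rule onpath; use xy pim in simp)+
    have "Im (integral {x0..x1} (\<lambda>x. D 1 (Complex x y0) / (\<Phi> (Complex x y0) - w))) = integral {x0..x1} (\<lambda>x. q 1 (Complex x y0))"
      "Im (integral {x0..x1} (\<lambda>x. D 1 (Complex x y1) / (\<Phi> (Complex x y1) - w))) = integral {x0..x1} (\<lambda>x. q 1 (Complex x y1))"
      by (intro Imq cont on; assumption)+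
    moreover have "Im (integral {y0..y1} (\<lambda>y. D \<i> (Complex x0 y) / (\<Phi> (Complex x0 y) - w))) = integral {y0..y1} (\<lambda>y. q \<i> (Complex x0 y))"
      "Im (integral {y0..y1} (\<lambda>y. D \<i> (Complex x1 y) / (\<Phi> (Complex x1 y) - w))) = integral {y0..y1} (\<lambda>y. q \<i> (Complex x1 y))"
      by (intro Imq cont on; assumption)+
    ultimately show ?thesis
      unfolding W Re_div h1 h3 v2 v4 by simp
  qed
  then show ?thesis by (simp add: \<Phi>_def[abs_def])
qed

lemma parab_nonneg: "parab d w \<ge> 0"
  by (simp add: parab_def)

lemma parab_eq_0: "d > 0 \<Longrightarrow> norm w \<ge> d \<Longrightarrow> parab d w = 0"
proof -
  assume d: "d > 0" "norm w \<ge> d"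
  then have "d\<^sup>2 \<le> (norm w)\<^sup>2" by (intro power_mono) auto
  then have "1 \<le> (norm w)\<^sup>2 / d\<^sup>2" using d(1) by (simp add: field_simps)
  then show ?thesis by (simp add: parab_def)
qed

lemma parab_continuous: "d > 0 \<Longrightarrow> continuous_on S (parab d)"
  unfolding parab_def by (intro continuous_intros) auto

text \<open>Stokes' theorem: the bump \<open>parab d\<close> is the exterior derivative of a form that agrees with the
  angular form \<open>d\<theta> / 2\<pi>\<close> outside the disc of radius \<open>d\<close>.\<close>

lemma degree_smooth:
  assumes a: "sym_smooth a" and b: "sym_smooth b" and xy: "x0 < x1" "y0 < y1" and d: "d > 0"
    and w: "\<And>z. z \<in> path_image (rectpath (Complex x0 y0) (Complex x1 y1)) \<Longrightarrow> norm (Complex (a z) (b z) - w) \<ge> d"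
  shows "(LBINT z. ind (rect x0 x1 y0 y1) z * (parab d (Complex (a z) (b z) - w) * (dx a z * dy b z - dy a z * dx b z)))
    = Re (winding_number ((\<lambda>z. Complex (a z) (b z)) \<circ> rectpath (Complex x0 y0) (Complex x1 y1)) w)"
proof -
  have sa: "smooth a" "dx (dy a) = dy (dx a)" and sb: "smooth b" "dx (dy b) = dy (dx b)"
    using a b by (auto simp: sym_smooth_def)
  define u where "u z = a z - Re w" for z
  define v where "v z = b z - Im w" for z
  have su: "smooth u" and sv: "smooth v" unfolding u_def v_def by (intro smooth_diff sa sb smooth_const)+
  have du: "dir_deriv e u = dir_deriv e a" and dv: "dir_deriv e v = dir_deriv e b" for e
  proof -
    have "dir_deriv e u = (\<lambda>z. dir_deriv e a z + dir_deriv e (\<lambda>z. - Re w) z)"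
      unfolding u_def diff_conv_add_uminus by (intro dir_deriv_add_smooth sa smooth_const)
    then show "dir_deriv e u = dir_deriv e a" by (simp add: dir_deriv_const)
    have "dir_deriv e v = (\<lambda>z. dir_deriv e b z + dir_deriv e (\<lambda>z. - Im w) z)"
      unfolding v_def diff_conv_add_uminus by (intro dir_deriv_add_smooth sb smooth_const)
    then show "dir_deriv e v = dir_deriv e b" by (simp add: dir_deriv_const)
  qed
  define s where "s z = (u z)\<^sup>2 + (v z)\<^sup>2" for z
  have ss: "smooth s" unfolding s_def power2_eq_square by (intro smooth_add smooth_mult su sv)
  have ds: "dir_deriv e s z = 2 * (u z * dir_deriv e a z + v z * dir_deriv e b z)" for e z
  proof -
    have "dir_deriv e s = (\<lambda>z. (u z * dir_deriv e u z + dir_deriv e u z * u z) + (v z * dir_deriv e v z + dir_deriv e v z * v z))"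
      unfolding s_def power2_eq_square
      by (simp add: dir_deriv_add_smooth dir_deriv_mult_smooth smooth_mult su sv)
    then show ?thesis by (simp add: du dv algebra_simps)
  qed
  have s_norm: "s z = (norm (Complex (a z) (b z) - w))\<^sup>2" for z
    by (simp add: s_def u_def v_def cmod_power2)
  define m where "m e z = u z * dir_deriv e b z - v z * dir_deriv e a z" for e z
  have sm: "smooth (m e)" for e
    unfolding m_def by (intro smooth_diff smooth_mult su sv smooth_dir_deriv sa sb)
  have dm: "dir_deriv e' (m e) z = u z * dir_deriv e' (dir_deriv e b) z + dir_deriv e' a z * dir_deriv e b z
      - (v z * dir_deriv e' (dir_deriv e a) z + dir_deriv e' b z * dir_deriv e a z)" for e e' z
  proof -
    have "dir_deriv e' (m e) = (\<lambda>z. (u z * dir_deriv e' (dir_deriv e b) z + dir_deriv e' u z * dir_deriv e b z)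
        + (- 1) * (v z * dir_deriv e' (dir_deriv e a) z + dir_deriv e' v z * dir_deriv e a z))"
    proof -
      have "m e = (\<lambda>z. u z * dir_deriv e b z + (- 1) * (v z * dir_deriv e a z))" by (rule ext) (simp add: m_def)
      then show ?thesis
        by (simp only: dir_deriv_add_smooth dir_deriv_mult_smooth dir_deriv_cmult_smooth smooth_mult smooth_cmult
            su sv smooth_dir_deriv sa sb)
    qed
    then show ?thesis by (simp add: du dv)
  qed
  \<comment> \<open>\<open>\<omega> e\<close> is the 1-form \<open>radial d s\<close> (u dv - v du)
    applied to e, and \<open>D\<omega> e z h\<close> is its derivative in direction h.\<close>
  define \<omega> where "\<omega> e z = radial d (s z) * m e z" for e z
  define D\<omega> where "D\<omega> e z h = radial d (s z) * dir_deriv h (m e) z + radial' d (s z) * dir_deriv h s z * m e z" for e z h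
  have der: "(\<omega> e has_derivative D\<omega> e z) (at z)" for e z
  proof -
    have f: "(f has_derivative (\<lambda>h. dir_deriv h f z)) (at z)" if "smooth f" for f
    proof -
      have "(\<lambda>h. dir_deriv h f z) = (\<lambda>h. Re h * dx f z + Im h * dy f z)"
        using dir_deriv_eq[OF smooth_has_derivative[OF that]] by blast
      then show ?thesis using smooth_has_derivative[OF that] by presburger
    qed
    have "((\<lambda>z. radial d (s z)) has_derivative (\<lambda>h. radial' d (s z) * dir_deriv h s z)) (at z)"
      by (rule has_derivative_compose[OF f[OF ss] radial_deriv[OF d, unfolded has_field_derivative_def]])
    from has_derivative_mult[OF this f[OF sm]] show ?thesis
      unfolding \<omega>_def D\<omega>_def[abs_def] by (simp add: mult.commute)
  qed
  have cs: "continuous_on UNIV s" by (rule smooth_continuous_on[OF ss])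
  have c1: "continuous_on UNIV (\<lambda>z. radial d (s z))" "continuous_on UNIV (\<lambda>z. radial' d (s z))"
  proof -
    have "continuous_on UNIV (radial d)"
      using radial_deriv[OF d] by (meson DERIV_isCont continuous_at_imp_continuous_on)
    then show "continuous_on UNIV (\<lambda>z. radial d (s z))" using continuous_on_compose2[OF _ cs] by blast
    show "continuous_on UNIV (\<lambda>z. radial' d (s z))"
      using continuous_on_compose2[OF radial'_continuous[OF d] cs] by blast
  qed
  have cD: "continuous_on UNIV (\<lambda>z. D\<omega> e z h)" for e h
    unfolding D\<omega>_def by (intro continuous_intros c1 smooth_continuous_on smooth_dir_deriv sm ss)
  have key: "D\<omega> \<i> z 1 - D\<omega> 1 z \<i> = 2 * pi * (parab d (Complex (a z) (b z) - w) * (dx a z * dy b z - dy a z * dx b z))" for z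
  proof -
    have "D\<omega> \<i> z 1 - D\<omega> 1 z \<i> = 2 * (radial d (s z) + s z * radial' d (s z)) * (dx a z * dy b z - dy a z * dx b z)"
      unfolding D\<omega>_def dm ds m_def sa(2) sb(2) s_def by (simp add: power2_eq_square algebra_simps)
    then show ?thesis unfolding s_norm radial_parab[OF d] by simp
  qed
  let ?Q = "rect x0 x1 y0 y1"
  have int: "integrable lborel (\<lambda>z. ind ?Q z * G z)" if "continuous_on UNIV G" for G :: "complex \<Rightarrow> real"
    using borel_integrable_compact[OF compact_cbox continuous_on_subset[OF that subset_UNIV], of "Complex x0 y0" "Complex x1 y1"]
    by simp
  have "2 * pi * (LBINT z. ind ?Q z * (parab d (Complex (a z) (b z) - w) * (dx a z * dy b z - dy a z * dx b z)))
      = (LBINT z. ind ?Q z * D\<omega> \<i> z 1 - ind ?Q z * D\<omega> 1 z \<i>)"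
    unfolding right_diff_distrib[symmetric] key
    by (subst integral_mult_right_zero[symmetric]) (simp add: mult.left_commute)
  also have "\<dots> = (LBINT z. ind ?Q z * D\<omega> \<i> z 1) - (LBINT z. ind ?Q z * D\<omega> 1 z \<i>)"
    by (intro Bochner_Integration.integral_diff int cD)
  also have "(LBINT z. ind ?Q z * D\<omega> \<i> z 1) = (LBINT y. ind {y0..y1} y * (\<omega> \<i> (Complex x1 y) - \<omega> \<i> (Complex x0 y)))"
    using xy by (intro rect_FTC_x der cD) auto
  also have "(LBINT z. ind ?Q z * D\<omega> 1 z \<i>) = (LBINT x. ind {x0..x1} x * (\<omega> 1 (Complex x y1) - \<omega> 1 (Complex x y0)))"
    using xy by (intro rect_FTC_y der cD) auto
  finally have I: "2 * pi * (LBINT z. ind ?Q z * (parab d (Complex (a z) (b z) - w) * (dx a z * dy b z - dy a z * dx b z)))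
      = (LBINT y. ind {y0..y1} y * (\<omega> \<i> (Complex x1 y) - \<omega> \<i> (Complex x0 y)))
      - (LBINT x. ind {x0..x1} x * (\<omega> 1 (Complex x y1) - \<omega> 1 (Complex x y0)))" .
  define q where "q e z = ((a z - Re w) * dir_deriv e b z - (b z - Im w) * dir_deriv e a z) / ((a z - Re w)\<^sup>2 + (b z - Im w)\<^sup>2)" for e z
  have onp: "\<omega> e z = q e z" if "z \<in> path_image (rectpath (Complex x0 y0) (Complex x1 y1))" for e z
  proof -
    have "s z \<ge> d\<^sup>2" unfolding s_norm using w[OF that] d by (intro power_mono) auto
    then show ?thesis by (simp add: \<omega>_def q_def m_def radial_def s_def u_def v_def)
  qed
  have c\<omega>: "continuous_on UNIV (\<omega> e)" for e
    unfolding \<omega>_def by (intro continuous_intros c1 smooth_continuous_on sm)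
  have split: "(LBINT t. ind {l..r} t * (\<omega> e (\<gamma> t) - \<omega> e (\<gamma>' t))) = integral {l..r} (\<lambda>t. \<omega> e (\<gamma> t)) - integral {l..r} (\<lambda>t. \<omega> e (\<gamma>' t))"
    if "continuous_on {l..r} \<gamma>" "continuous_on {l..r} \<gamma>'" for l r :: real and e \<gamma> \<gamma>'
  proof -
    have c: "continuous_on {l..r} (\<lambda>t. \<omega> e (\<gamma> t))" "continuous_on {l..r} (\<lambda>t. \<omega> e (\<gamma>' t))"
      using continuous_on_compose2[OF c\<omega> that(1)] continuous_on_compose2[OF c\<omega> that(2)] by auto
    then have i: "set_integrable lborel {l..r} (\<lambda>t. \<omega> e (\<gamma> t))" "set_integrable lborel {l..r} (\<lambda>t. \<omega> e (\<gamma>' t))"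
      unfolding set_integrable_def by (intro borel_integrable_compact; simp)+
    have "(LBINT t. ind {l..r} t * (\<omega> e (\<gamma> t) - \<omega> e (\<gamma>' t)))
        = (LINT t:{l..r}|lborel. \<omega> e (\<gamma> t)) - (LINT t:{l..r}|lborel. \<omega> e (\<gamma>' t))"
      using set_integral_diff(2)[OF i] by (simp add: set_lebesgue_integral_def)
    then show ?thesis using i by (simp add: set_borel_integral_eq_integral)
  qed
  have cont: "continuous_on {l..r} (\<lambda>x. Complex x y)" "continuous_on {l..r} (\<lambda>y. Complex x y)" for l r x y :: real
    unfolding Complex_eq by (intro continuous_intros)+
  note pim = path_image_rectpath[of "Complex x0 y0" "Complex x1 y1"]
  have iq: "integral {x0..x1} (\<lambda>x. \<omega> 1 (Complex x y1)) = integral {x0..x1} (\<lambda>x. q 1 (Complex x y1))"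
    "integral {x0..x1} (\<lambda>x. \<omega> 1 (Complex x y0)) = integral {x0..x1} (\<lambda>x. q 1 (Complex x y0))"
    "integral {y0..y1} (\<lambda>y. \<omega> \<i> (Complex x0 y)) = integral {y0..y1} (\<lambda>y. q \<i> (Complex x0 y))"
    "integral {y0..y1} (\<lambda>y. \<omega> \<i> (Complex x1 y)) = integral {y0..y1} (\<lambda>y. q \<i> (Complex x1 y))"
    by (intro integral_cong onp; use xy pim in simp)+
  have "w \<notin> (\<lambda>z. Complex (a z) (b z)) ` path_image (rectpath (Complex x0 y0) (Complex x1 y1))"
    using w d by force
  note W = winding_number_smooth_rectpath[OF sa(1) sb(1) xy this, folded q_def]
  have "2 * pi * (LBINT z. ind ?Q z * (parab d (Complex (a z) (b z) - w) * (dx a z * dy b z - dy a z * dx b z)))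
      = 2 * pi * Re (winding_number ((\<lambda>z. Complex (a z) (b z)) \<circ> rectpath (Complex x0 y0) (Complex x1 y1)) w)"
    unfolding I W split[OF cont(2) cont(2)] split[OF cont(1) cont(1)] iq by simp
  then show ?thesis by simp
qed

section \<open>The degree formula for Sobolev maps\<close>

lemma continuous_on_Complex:
  "continuous_on S f \<Longrightarrow> continuous_on S g \<Longrightarrow> continuous_on S (\<lambda>z. Complex (f z) (g z))"
  unfolding Complex_eq by (intro continuous_intros)

lemma plim_jac:
  assumes C: "C \<in> sets borel" and p: "plim 2 C u u'" "plim 2 C v v'" "plim 2 C s s'" "plim 2 C t t'"
    and L: "Lp 2 C u'" "Lp 2 C v'" "Lp 2 C s'" "Lp 2 C t'"
  shows "plim 1 C (\<lambda>n z. u n z * v n z - s n z * t n z) (\<lambda>z. u' z * v' z - s' z * t' z)"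
  by (intro plim_diff plim_mult C p L) auto

text \<open>The margin e keeps the mollified boundary curve at distance at least d from w, as
  \<open>degree_smooth\<close> requires, and so close to the limit curve that both have the same
  winding number. The integral converges because the Jacobians converge in L1 and the bump values
  uniformly.\<close>

lemma degree_W12:
  assumes X: "open X" and a: "W12 X a ax ay" "continuous_on X a" and b: "W12 X b bx by'" "continuous_on X b"
    and xy: "x0 < x1" "y0 < y1" and Q: "rect x0 x1 y0 y1 \<subseteq> X" and de: "d > 0" "e > 0"
    and w: "\<And>z. z \<in> path_image (rectpath (Complex x0 y0) (Complex x1 y1)) \<Longrightarrow> norm (Complex (a z) (b z) - w) \<ge> d + e"
  shows "(LBINT z. ind (rect x0 x1 y0 y1) z * (parab d (Complex (a z) (b z) - w) * (ax z * by' z - ay z * bx z)))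
    = Re (winding_number ((\<lambda>z. Complex (a z) (b z)) \<circ> rectpath (Complex x0 y0) (Complex x1 y1)) w)"
proof -
  let ?Q = "rect x0 x1 y0 y1" and ?r = "rectpath (Complex x0 y0) (Complex x1 y1)"
  have cQ: "compact ?Q" by (rule compact_cbox)
  have bQ: "?Q \<in> sets borel" by (rule borel_compact[OF cQ])
  have W: "wgrad X a ax ay" "wgrad X b bx by'" using a b by (auto simp only: W12_def)
  have L: "Lploc 2 X ax" "Lploc 2 X ay" "Lploc 2 X bx" "Lploc 2 X by'"
    using a b by (auto simp only: W12_def)
  have LS: "Lp 2 ?Q ax" "Lp 2 ?Q ay" "Lp 2 ?Q bx" "Lp 2 ?Q by'" using L Lploc_Lp[OF _ cQ Q] by blast+
  have ab: "a \<in> Borel" "b \<in> Borel"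
    using Lploc_borel wgrad_Lploc(1)[OF W(1)] wgrad_Lploc(1)[OF W(2)] by blast+
  have cab: "continuous_on ?Q a" "continuous_on ?Q b" using a(2) b(2) Q continuous_on_subset by blast+
  obtain u where u: "\<And>n. sym_smooth (u n)" "plim 2 ?Q (\<lambda>n. dx (u n)) ax" "plim 2 ?Q (\<lambda>n. dy (u n)) ay"
    "uniform_limit ?Q u a sequentially"
    using wgrad_approx[OF X W(1) cQ Q] a(2) L(1,2) by blast
  obtain v where v: "\<And>n. sym_smooth (v n)" "plim 2 ?Q (\<lambda>n. dx (v n)) bx" "plim 2 ?Q (\<lambda>n. dy (v n)) by'"
    "uniform_limit ?Q v b sequentially"
    using wgrad_approx[OF X W(2) cQ Q] b(2) L(3,4) by blast
  have su: "smooth (u n)" and sv: "smooth (v n)" for n using u(1) v(1) by (auto simp: sym_smooth_def)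
  define P where "P \<zeta> = parab d (\<zeta> - w)" for \<zeta>
  have cP: "continuous_on UNIV P"
    unfolding P_def by (rule continuous_on_compose2[OF parab_continuous[OF de(1), of UNIV]]) (auto intro!: continuous_intros)
  have bP: "P \<in> Borel" by (rule borel_measurable_continuous_onI[OF cP])
  have ul: "uniform_limit ?Q (\<lambda>n. comp2 P (u n) (v n)) (comp2 P a b) sequentially"
    by (rule uniform_limit_comp2[OF cQ cP cab u(4) v(4)])
  obtain M where M: "\<And>z. z \<in> ?Q \<Longrightarrow> \<bar>comp2 P a b z\<bar> \<le> M"
    using bounded_on_compact[OF cQ comp2_continuous_on[OF cP cab]] by blast
  have bPn: "comp2 P (u n) (v n) \<in> Borel" for n
    by (intro comp2_borel bP smooth_borel su sv)
  have J: "plim 1 ?Q (\<lambda>n z. dx (u n) z * dy (v n) z - dy (u n) z * dx (v n) z) (\<lambda>z. ax z * by' z - ay z * bx z)"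
    by (intro plim_jac bQ u v LS)
  have LJ: "Lp 1 ?Q (\<lambda>z. ax z * by' z - ay z * bx z)" by (intro Lp_diff Lp_mult bQ LS) auto
  have LJn: "Lp 1 ?Q (\<lambda>z. dx (u n) z * dy (v n) z - dy (u n) z * dx (v n) z)" for n
    by (intro Lp_smooth cQ smooth_diff smooth_mult smooth_dx smooth_dy su sv) auto
  have LPn: "Lp 1 ?Q (\<lambda>z. comp2 P (u n) (v n) z * (dx (u n) z * dy (v n) z - dy (u n) z * dx (v n) z))" for n
  proof -
    have "continuous_on ?Q (comp2 P (u n) (v n))" by (intro comp2_continuous_on cP smooth_continuous_on su sv)
    from Lp_cont_mult[OF cQ this bPn LJn] show ?thesis by (simp add: mult.commute)
  qed
  have lim: "(\<lambda>n. LBINT z. ind ?Q z * (comp2 P (u n) (v n) z * (dx (u n) z * dy (v n) z - dy (u n) z * dx (v n) z)))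
      \<longlonglongrightarrow> (LBINT z. ind ?Q z * (comp2 P a b z * (ax z * by' z - ay z * bx z)))"
  proof (rule plim_integral[OF bQ _ LPn])
    show "plim 1 ?Q (\<lambda>n z. comp2 P (u n) (v n) z * (dx (u n) z * dy (v n) z - dy (u n) z * dx (v n) z))
        (\<lambda>z. comp2 P a b z * (ax z * by' z - ay z * bx z))"
      by (rule plim_mult_unif[OF _ bQ ul M bPn comp2_borel[OF bP ab] J LJ]) auto
    show "Lp 1 ?Q (\<lambda>z. comp2 P a b z * (ax z * by' z - ay z * bx z))"
      by (rule Lp_bounded_mult[OF bQ comp2_borel[OF bP ab] M LJ])
  qed
  have rQ: "path_image ?r \<subseteq> ?Q" using path_image_rectpath_subset_cbox[of "Complex x0 y0" "Complex x1 y1"] xy by simp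
  have "e / 2 > 0" using de by simp
  with u(4) v(4) have "\<forall>\<^sub>F n in sequentially. \<forall>x\<in>?Q. dist (u n x) (a x) < e / 2"
    "\<forall>\<^sub>F n in sequentially. \<forall>x\<in>?Q. dist (v n x) (b x) < e / 2"
    unfolding uniform_limit_iff by blast+
  then have "\<forall>\<^sub>F n in sequentially. (LBINT z. ind ?Q z * (comp2 P (u n) (v n) z * (dx (u n) z * dy (v n) z - dy (u n) z * dx (v n) z)))
      = Re (winding_number ((\<lambda>z. Complex (a z) (b z)) \<circ> ?r) w)"
  proof eventually_elim
    case (elim n)
    have near: "norm (Complex (u n z) (v n z) - Complex (a z) (b z)) < e" if "z \<in> ?Q" for z
    proof -
      have "\<bar>u n z - a z\<bar> < e / 2" "\<bar>v n z - b z\<bar> < e / 2" using elim that by (auto simp: dist_real_def)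
      then show ?thesis using cmod_le[of "Complex (u n z) (v n z) - Complex (a z) (b z)"] by simp
    qed
    have "norm (Complex (u n z) (v n z) - w) \<ge> d" if "z \<in> path_image ?r" for z
    proof -
      have z: "z \<in> ?Q" using that rQ by blast
      have "norm (Complex (a z) (b z) - w) \<le> norm (Complex (u n z) (v n z) - w) + norm (Complex (u n z) (v n z) - Complex (a z) (b z))"
        using norm_triangle_ineq4[of "Complex (u n z) (v n z) - w" "Complex (u n z) (v n z) - Complex (a z) (b z)"] by simp
      then show ?thesis using near[OF z] w[OF that] by linarith
    qed
    from degree_smooth[OF u(1) v(1) xy de(1) this]
    have "(LBINT z. ind ?Q z * (comp2 P (u n) (v n) z * (dx (u n) z * dy (v n) z - dy (u n) z * dx (v n) z)))
        = Re (winding_number ((\<lambda>z. Complex (u n z) (v n z)) \<circ> ?r) w)"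
      by (simp add: comp2_def P_def)
    also have "winding_number ((\<lambda>z. Complex (u n z) (v n z)) \<circ> ?r) w = winding_number ((\<lambda>z. Complex (a z) (b z)) \<circ> ?r) w"
    proof (rule winding_number_nearby_loops_eq)
      show "path ((\<lambda>z. Complex (a z) (b z)) \<circ> ?r)"
        by (intro path_continuous_image continuous_on_Complex path_rectpath
            continuous_on_subset[OF cab(1) rQ] continuous_on_subset[OF cab(2) rQ])
      show "path ((\<lambda>z. Complex (u n z) (v n z)) \<circ> ?r)"
        by (intro path_continuous_image continuous_on_Complex path_rectpath smooth_continuous_on su sv)
      fix t :: real assume t: "t \<in> {0..1}"
      then have r: "?r t \<in> path_image ?r" by (auto simp: path_image_def)
      then show "norm (((\<lambda>z. Complex (u n z) (v n z)) \<circ> ?r) t - ((\<lambda>z. Complex (a z) (b z)) \<circ> ?r) t)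
          < norm (((\<lambda>z. Complex (a z) (b z)) \<circ> ?r) t - w)"
        using near[of "?r t"] w[OF r] rQ de by auto
    qed (simp_all add: pathfinish_compose pathstart_compose)
    finally show ?case .
  qed
  then have "(\<lambda>n. LBINT z. ind ?Q z * (comp2 P (u n) (v n) z * (dx (u n) z * dy (v n) z - dy (u n) z * dx (v n) z)))
      \<longlonglongrightarrow> Re (winding_number ((\<lambda>z. Complex (a z) (b z)) \<circ> ?r) w)"
    by (rule tendsto_eventually)
  from LIMSEQ_unique[OF lim this] show ?thesis by (simp add: comp2_def P_def)
qed

lemma sym_smooth_Re: "sym_smooth Re" and sym_smooth_Im: "sym_smooth Im"
  by (simp_all add: sym_smooth_def smooth_Re smooth_Im dir_deriv_const)

lemma parab_borel: "d > 0 \<Longrightarrow> parab d \<in> Borel"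
  by (intro borel_measurable_continuous_onI parab_continuous)

text \<open>The degree formula for the identity map gives the mass of the bump without polar
  coordinates.\<close>

lemma parab_integral:
  assumes d: "d > 0"
  shows "(LBINT w. parab d w) = 1" "integrable lborel (parab d)"
proof -
  have z: "\<forall>w. w \<notin> cball 0 d \<longrightarrow> parab d w = 0" using parab_eq_0[OF d] by simp
  show "integrable lborel (parab d)"
    by (rule integrable_compact_support[OF compact_cball parab_continuous[OF d] z])
  let ?r = "rectpath (Complex (- d) (- d)) (Complex d d)"
  have "norm (Complex (Re z) (Im z) - 0) \<ge> d" if "z \<in> path_image ?r" for z
  proof -
    have "\<bar>Re z\<bar> = d \<or> \<bar>Im z\<bar> = d" using that d path_image_rectpath[of "Complex (- d) (- d)" "Complex d d"] by auto
    then show ?thesis using abs_Re_le_cmod[of z] abs_Im_le_cmod[of z] by auto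
  qed
  from degree_smooth[OF sym_smooth_Re sym_smooth_Im _ _ d this]
  have "(LBINT z. ind (rect (- d) d (- d) d) z * parab d z) = Re (winding_number ((\<lambda>z. z) \<circ> ?r) 0)"
    using d by simp
  also have "(\<lambda>z. z) \<circ> ?r = ?r" by auto
  also have "winding_number ?r 0 = 1"
    by (rule winding_number_rectpath) (use d in \<open>simp add: in_box_complex_iff\<close>)
  also have "(LBINT z. ind (rect (- d) d (- d) d) z * parab d z) = (LBINT z. parab d z)"
  proof (rule Bochner_Integration.integral_cong[OF refl])
    fix z
    show "ind (rect (- d) d (- d) d) z * parab d z = parab d z"
    proof (cases "z \<in> rect (- d) d (- d) d")
      case False
      then have "d < \<bar>Re z\<bar> \<or> d < \<bar>Im z\<bar>" by (auto simp: in_cbox_complex_iff)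
      then have "norm z \<ge> d" using abs_Re_le_cmod[of z] abs_Im_le_cmod[of z] by auto
      then show ?thesis using parab_eq_0[OF d] by simp
    qed simp
  qed
  finally show "(LBINT w. parab d w) = 1" by simp
qed

lemma parab_bounded: "d > 0 \<Longrightarrow> \<bar>parab d w\<bar> \<le> 2 / (pi * d\<^sup>2)"
proof -
  assume d: "d > 0"
  have "max 0 (1 - (norm w)\<^sup>2 / d\<^sup>2) \<le> 1" by simp
  then have "2 / (pi * d\<^sup>2) * max 0 (1 - (norm w)\<^sup>2 / d\<^sup>2) \<le> 2 / (pi * d\<^sup>2) * 1"
    using d by (intro mult_left_mono) auto
  then show ?thesis using parab_nonneg[of d w] by (simp add: parab_def)
qed

lemma parab_average_near:
  assumes d: "d > 0" and h: "integrable lborel h" and c: "\<And>w. norm (w - \<zeta>) < d \<Longrightarrow> \<bar>h w - h \<zeta>\<bar> \<le> e" and "e \<ge> 0"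
  shows "\<bar>(LBINT w. h w * parab d (\<zeta> - w)) - h \<zeta>\<bar> \<le> e"
proof -
  have i1: "integrable lborel (\<lambda>w. h w * parab d (\<zeta> - w))"
    by (rule conv_integrable[OF h parab_continuous[OF d] parab_bounded[OF d]])
  have i2: "integrable lborel (\<lambda>w. parab d (\<zeta> - w))"
    using integrable_distr_eq[of "\<lambda>w. \<zeta> - w" lborel borel "parab d"] parab_integral(2)[OF d] parab_borel[OF d]
    by (simp add: lborel_reflect)
  have one: "(LBINT w. parab d (\<zeta> - w)) = 1"
    using integral_reflect[OF parab_borel[OF d], of \<zeta>] parab_integral(1)[OF d] by simp
  have "(LBINT w. h w * parab d (\<zeta> - w)) - h \<zeta> = (LBINT w. h w * parab d (\<zeta> - w)) - h \<zeta> * (LBINT w. parab d (\<zeta> - w))"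
    by (simp add: one)
  also have "\<dots> = (LBINT w. (h w - h \<zeta>) * parab d (\<zeta> - w))"
    using i1 i2 by (simp add: left_diff_distrib)
  finally have "\<bar>(LBINT w. h w * parab d (\<zeta> - w)) - h \<zeta>\<bar> = norm (LBINT w. (h w - h \<zeta>) * parab d (\<zeta> - w))" by simp
  also have "\<dots> \<le> (LBINT w. e * parab d (\<zeta> - w))"
  proof (rule Bochner_Integration.integral_norm_bound_integral)
    show "integrable lborel (\<lambda>w. (h w - h \<zeta>) * parab d (\<zeta> - w))"
      using i1 i2 by (simp add: left_diff_distrib)
    show "norm ((h w - h \<zeta>) * parab d (\<zeta> - w)) \<le> e * parab d (\<zeta> - w)" for w
    proof (cases "norm (w - \<zeta>) < d")
      case True
      then show ?thesis using c[OF True] parab_nonneg[of d "\<zeta> - w"]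
        by (simp add: abs_mult mult_right_mono)
    next
      case False
      then have "parab d (\<zeta> - w) = 0" by (intro parab_eq_0[OF d]) (simp add: norm_minus_commute)
      then show ?thesis by simp
    qed
  qed (use i2 in simp)
  also have "\<dots> = e" by (simp add: one)
  finally show ?thesis .
qed

lemma Fubini_dominated:
  fixes k :: "complex \<Rightarrow> complex \<Rightarrow> real"
  assumes h: "integrable lborel h" and g: "integrable lborel g"
    and k: "(\<lambda>p. k (fst p) (snd p)) \<in> borel_measurable (lborel \<Otimes>\<^sub>M lborel)" "\<And>w z. \<bar>k w z\<bar> \<le> M"
  shows "(LBINT w. h w * (LBINT z. k w z * g z)) = (LBINT z. (LBINT w. h w * k w z) * g z)"
proof -
  note [measurable] = borel_measurable_integrable[OF h] borel_measurable_integrable[OF g] k(1)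
  have prod: "integrable (lborel \<Otimes>\<^sub>M lborel) (\<lambda>p. h (fst p) * g (snd p))"
    using h g by (intro lborel_pair.Fubini_integrable) (auto simp: abs_mult)
  have i: "integrable (lborel \<Otimes>\<^sub>M lborel) (\<lambda>(w, z). h w * k w z * g z)"
  proof (rule Bochner_Integration.integrable_bound[OF integrable_mult_right[OF prod, of M]])
    show "(\<lambda>(w, z). h w * k w z * g z) \<in> borel_measurable (lborel \<Otimes>\<^sub>M lborel)"
      unfolding split_beta' by measurable
    have "\<bar>h w * k w z * g z\<bar> \<le> \<bar>M * (h w * g z)\<bar>" for w z
    proof -
      have "\<bar>k w z\<bar> \<le> \<bar>M\<bar>" using k(2)[of w z] by linarith
      then have "\<bar>k w z\<bar> * (\<bar>h w\<bar> * \<bar>g z\<bar>) \<le> \<bar>M\<bar> * (\<bar>h w\<bar> * \<bar>g z\<bar>)" by (intro mult_right_mono) auto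
      then show ?thesis by (simp add: abs_mult mult.left_commute mult.assoc)
    qed
    then show "AE p in lborel \<Otimes>\<^sub>M lborel. norm (case p of (w, z) \<Rightarrow> h w * k w z * g z) \<le> norm (M * (h (fst p) * g (snd p)))"
      by (intro AE_I2) (auto simp: split_beta')
  qed
  have "(LBINT w. h w * (LBINT z. k w z * g z)) = (LBINT w. (LBINT z. h w * k w z * g z))"
    by (simp add: mult.assoc)
  also have "\<dots> = (LBINT z. (LBINT w. h w * k w z * g z))"
    using lborel_pair.Fubini_integral[OF i] by simp
  finally show ?thesis by simp
qed

text \<open>Average the formula for bumps centred at w with the weight h w. Fubini's theorem
  produces the integral of J times the average G of h at scale d. As G is uniformly within e of h,
  the error is at most e times the integral of |J| over the rectangle.\<close>

lemma degree_continuous: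
  assumes X: "open X" and a: "W12 X a ax ay" "continuous_on X a" and b: "W12 X b bx by'" "continuous_on X b"
    and xy: "x0 < x1" "y0 < y1" and Q: "rect x0 x1 y0 y1 \<subseteq> X"
    and h: "continuous_on UNIV h" "compact K" "\<forall>w. w \<notin> K \<longrightarrow> h w = 0"
    and K: "K \<inter> (\<lambda>z. Complex (a z) (b z)) ` path_image (rectpath (Complex x0 y0) (Complex x1 y1)) = {}"
    and n: "\<And>w. w \<in> K \<Longrightarrow> Re (winding_number ((\<lambda>z. Complex (a z) (b z)) \<circ> rectpath (Complex x0 y0) (Complex x1 y1)) w) = n"
  shows "(LBINT z. ind (rect x0 x1 y0 y1) z * (h (Complex (a z) (b z)) * (ax z * by' z - ay z * bx z)))
    = n * (LBINT w. h w)"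
proof -
  let ?Q = "rect x0 x1 y0 y1" and ?r = "rectpath (Complex x0 y0) (Complex x1 y1)"
  let ?\<Phi> = "\<lambda>z. Complex (a z) (b z)"
  define J where "J z = ax z * by' z - ay z * bx z" for z
  have cQ: "compact ?Q" by (rule compact_cbox)
  have bQ: "?Q \<in> sets borel" by (rule borel_compact[OF cQ])
  have W: "wgrad X a ax ay" "wgrad X b bx by'" using a b by (auto simp only: W12_def)
  have L: "Lploc 2 X ax" "Lploc 2 X ay" "Lploc 2 X bx" "Lploc 2 X by'"
    using a b by (auto simp only: W12_def)
  have LS: "Lp 2 ?Q ax" "Lp 2 ?Q ay" "Lp 2 ?Q bx" "Lp 2 ?Q by'" using L Lploc_Lp[OF _ cQ Q] by blast+
  have "Lp 1 ?Q J" unfolding J_def by (intro Lp_diff Lp_mult bQ LS) auto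
  then have iJ: "integrable lborel (\<lambda>z. ind ?Q z * J z)"
    unfolding Lp1_integrable[OF bQ] by blast
  have [measurable]: "a \<in> Borel" "b \<in> Borel"
    using Lploc_borel wgrad_Lploc(1)[OF W(1)] wgrad_Lploc(1)[OF W(2)] by blast+
  have [measurable]: "?\<Phi> \<in> Borel" unfolding Complex_eq by measurable
  have rQ: "path_image ?r \<subseteq> ?Q" using path_image_rectpath_subset_cbox[of "Complex x0 y0" "Complex x1 y1"] xy by simp
  have "continuous_on (path_image ?r) ?\<Phi>"
    using a(2) b(2) subset_trans[OF rQ Q] by (intro continuous_on_Complex) (rule continuous_on_subset; assumption)+
  then have "closed (?\<Phi> ` path_image ?r)"
    by (intro compact_imp_closed compact_continuous_image) auto
  from separate_compact_closed[OF h(2) this K]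
  obtain r where r: "r > 0" "\<And>w z. w \<in> K \<Longrightarrow> z \<in> path_image ?r \<Longrightarrow> r \<le> dist w (?\<Phi> z)" by blast
  have ih: "integrable lborel h" by (rule integrable_compact_support[OF h(2) continuous_on_subset[OF h(1)] h(3)]) auto
  have [measurable]: "h \<in> Borel" by (rule borel_measurable_continuous_onI[OF h(1)])
  define A where "A = (LBINT z. \<bar>ind ?Q z * J z\<bar>)"
  have A: "A \<ge> 0" by (simp add: A_def)
  have est: "\<bar>(LBINT z. ind ?Q z * (h (?\<Phi> z) * J z)) - n * (LBINT w. h w)\<bar> \<le> e * A" if "e > 0" for e
  proof -
    have "uniformly_continuous_on UNIV h" by (rule uniformly_continuous_compact_support[OF h])
    then obtain d0 where d0: "d0 > 0" "\<And>x y. dist y x < d0 \<Longrightarrow> dist (h y) (h x) < e"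
      using \<open>e > 0\<close> unfolding uniformly_continuous_on_def by (metis UNIV_I)
    \<comment> \<open>At most half of the distance r from K to the boundary curve is the bump
      radius; the other half is the margin in \<open>degree_W12\<close>.\<close>
    define d where "d = min d0 (r / 2)"
    have d: "d > 0" "d \<le> d0" "d + r / 2 \<le> r" using d0 r by (auto simp: d_def)
    define G where "G \<zeta> = (LBINT w. h w * parab d (\<zeta> - w))" for \<zeta>
    have G: "\<bar>G \<zeta> - h \<zeta>\<bar> \<le> e" for \<zeta>
      unfolding G_def
    proof (rule parab_average_near[OF d(1) ih])
      fix w assume "norm (w - \<zeta>) < d"
      then show "\<bar>h w - h \<zeta>\<bar> \<le> e" using d0(2)[of w \<zeta>] d(2) by (simp add: dist_norm)
    qed (use \<open>e > 0\<close> in simp)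
    have [measurable]: "parab d \<in> Borel" by (rule parab_borel[OF d(1)])
    have [measurable]: "G \<in> Borel" unfolding G_def[abs_def] by measurable
    have deg: "(LBINT z. parab d (?\<Phi> z - w) * (ind ?Q z * J z)) = n" if "w \<in> K" for w
    proof -
      have "(LBINT z. ind ?Q z * (parab d (?\<Phi> z - w) * J z)) = Re (winding_number (?\<Phi> \<circ> ?r) w)"
        unfolding J_def
      proof (rule degree_W12[OF X a b xy Q d(1), where e = "r / 2"])
        show "norm (?\<Phi> z - w) \<ge> d + r / 2" if "z \<in> path_image ?r" for z
          using r(2)[OF \<open>w \<in> K\<close> that] d(3) by (simp add: dist_norm norm_minus_commute)
      qed (use r in simp)
      then show ?thesis using n[OF that] by (simp add: mult.left_commute)
    qed
    have "n * (LBINT w. h w) = (LBINT w. h w * (LBINT z. parab d (?\<Phi> z - w) * (ind ?Q z * J z)))"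
    proof -
      have "(\<lambda>w. h w * (LBINT z. parab d (?\<Phi> z - w) * (ind ?Q z * J z))) = (\<lambda>w. n * h w)"
      proof
        fix w
        show "h w * (LBINT z. parab d (?\<Phi> z - w) * (ind ?Q z * J z)) = n * h w"
          using deg[of w] h(3) by (cases "w \<in> K") auto
      qed
      then show ?thesis by simp
    qed
    also have "\<dots> = (LBINT z. (LBINT w. h w * parab d (?\<Phi> z - w)) * (ind ?Q z * J z))"
      by (rule Fubini_dominated[OF ih iJ _ parab_bounded[OF d(1)]]) measurable
    finally have nG: "n * (LBINT w. h w) = (LBINT z. G (?\<Phi> z) * (ind ?Q z * J z))" by (simp add: G_def)
    obtain H where H: "\<And>w. \<bar>h w\<bar> \<le> H" using bounded_of_compact_support[OF h] by blast
    have ib: "integrable lborel (\<lambda>z. F (?\<Phi> z) * (ind ?Q z * J z))"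
      if [measurable]: "F \<in> Borel" and F: "\<And>w. \<bar>F w\<bar> \<le> M" for F M
    proof (rule Bochner_Integration.integrable_bound[OF integrable_mult_right[OF iJ, of M]])
      show "(\<lambda>z. F (?\<Phi> z) * (ind ?Q z * J z)) \<in> borel_measurable lborel"
        using borel_measurable_integrable[OF iJ] by measurable
      show "AE z in lborel. norm (F (?\<Phi> z) * (ind ?Q z * J z)) \<le> norm (M * (ind ?Q z * J z))"
      proof (rule AE_I2)
        fix z
        have "\<bar>F (?\<Phi> z)\<bar> \<le> \<bar>M\<bar>" using F[of "?\<Phi> z"] by linarith
        then show "norm (F (?\<Phi> z) * (ind ?Q z * J z)) \<le> norm (M * (ind ?Q z * J z))"
          unfolding real_norm_def abs_mult[of "F _"] abs_mult[of M] by (intro mult_right_mono) auto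
      qed
    qed
    have bG: "\<bar>G w\<bar> \<le> H + e" for w using G[of w] H[of w] by linarith
    have i1: "integrable lborel (\<lambda>z. h (?\<Phi> z) * (ind ?Q z * J z))" by (rule ib[OF _ H]) measurable
    have i2: "integrable lborel (\<lambda>z. G (?\<Phi> z) * (ind ?Q z * J z))" by (rule ib[OF _ bG]) measurable
    have "(LBINT z. ind ?Q z * (h (?\<Phi> z) * J z)) - n * (LBINT w. h w)
        = (LBINT z. (h (?\<Phi> z) - G (?\<Phi> z)) * (ind ?Q z * J z))"
      unfolding nG mult.left_commute[of "ind ?Q _"] left_diff_distrib
      by (rule Bochner_Integration.integral_diff[OF i1 i2, symmetric])
    then have "\<bar>(LBINT z. ind ?Q z * (h (?\<Phi> z) * J z)) - n * (LBINT w. h w)\<bar>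
        = norm (LBINT z. (h (?\<Phi> z) - G (?\<Phi> z)) * (ind ?Q z * J z))" by simp
    also have "\<dots> \<le> (LBINT z. e * \<bar>ind ?Q z * J z\<bar>)"
    proof (rule Bochner_Integration.integral_norm_bound_integral)
      show "integrable lborel (\<lambda>z. (h (?\<Phi> z) - G (?\<Phi> z)) * (ind ?Q z * J z))"
        using i1 i2 by (simp add: left_diff_distrib)
      show "norm ((h (?\<Phi> z) - G (?\<Phi> z)) * (ind ?Q z * J z)) \<le> e * \<bar>ind ?Q z * J z\<bar>" for z
        unfolding real_norm_def abs_mult[of "_ - _"] using G[of "?\<Phi> z"] by (intro mult_right_mono) auto
    qed (use iJ in simp)
    also have "\<dots> = e * A" by (simp add: A_def)
    finally show ?thesis .
  qed
  have "\<bar>(LBINT z. ind ?Q z * (h (?\<Phi> z) * J z)) - n * (LBINT w. h w)\<bar> \<le> 0"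
  proof (rule field_le_epsilon)
    fix e :: real assume "e > 0"
    then have "e / (A + 1) * A \<le> e" using A by (simp add: field_simps)
    then show "\<bar>(LBINT z. ind ?Q z * (h (?\<Phi> z) * J z)) - n * (LBINT w. h w)\<bar> \<le> 0 + e"
      using est[of "e / (A + 1)"] \<open>e > 0\<close> A by simp
  qed
  then show ?thesis by (simp add: J_def)
qed

lemma degree_compact:
  assumes X: "open X" and a: "W12 X a ax ay" "continuous_on X a" and b: "W12 X b bx by'" "continuous_on X b"
    and xy: "x0 < x1" "y0 < y1" and Q: "rect x0 x1 y0 y1 \<subseteq> X"
    and K: "compact K" "K \<subseteq> V" and V: "open V"
      "V \<inter> (\<lambda>z. Complex (a z) (b z)) ` path_image (rectpath (Complex x0 y0) (Complex x1 y1)) = {}"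
    and n: "\<And>w. w \<in> V \<Longrightarrow> Re (winding_number ((\<lambda>z. Complex (a z) (b z)) \<circ> rectpath (Complex x0 y0) (Complex x1 y1)) w) = n"
  shows "(LBINT z. ind (rect x0 x1 y0 y1) z * (ind K (Complex (a z) (b z)) * (ax z * by' z - ay z * bx z)))
    = n * measure lborel K"
proof (cases "K = {}")
  case False
  let ?Q = "rect x0 x1 y0 y1" and ?\<Phi> = "\<lambda>z. Complex (a z) (b z)"
  define J where "J z = ax z * by' z - ay z * bx z" for z
  have bQ: "?Q \<in> sets borel" by (rule borel_compact[OF compact_cbox])
  have W: "wgrad X a ax ay" "wgrad X b bx by'" using a b by (auto simp only: W12_def)
  have L: "Lploc 2 X ax" "Lploc 2 X ay" "Lploc 2 X bx" "Lploc 2 X by'"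
    using a b by (auto simp only: W12_def)
  have LS: "Lp 2 ?Q ax" "Lp 2 ?Q ay" "Lp 2 ?Q bx" "Lp 2 ?Q by'" using L Lploc_Lp[OF _ compact_cbox Q] by blast+
  have "Lp 1 ?Q J" unfolding J_def by (intro Lp_diff Lp_mult bQ LS) auto
  then have iJ: "integrable lborel (\<lambda>z. ind ?Q z * J z)"
    unfolding Lp1_integrable[OF bQ] by blast
  have [measurable]: "a \<in> Borel" "b \<in> Borel"
    using Lploc_borel wgrad_Lploc(1)[OF W(1)] wgrad_Lploc(1)[OF W(2)] by blast+
  have [measurable]: "?\<Phi> \<in> Borel" unfolding Complex_eq by measurable
  have [measurable]: "(\<lambda>z. ind ?Q z * J z) \<in> Borel" using iJ by auto
  have [measurable]: "K \<in> sets borel" by (rule borel_compact[OF K(1)])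
  obtain d D where D: "d > 0" "compact D" "D \<subseteq> V" "\<And>z w. z \<in> K \<Longrightarrow> dist z w < d \<Longrightarrow> w \<in> D"
    using compact_nbhd[OF K(1) V(1) K(2)] by metis
  \<comment> \<open>The slope is at least 1/d, so every h m vanishes at distance d from K and hence
    off D; as m grows the functions fall to the indicator of K.\<close>
  define h where "h m w = max 0 (1 - (real m + 1 / d) * infdist w K)" for m :: nat and w
  have ch: "continuous_on UNIV (h m)" for m
    unfolding h_def by (intro continuous_intros continuous_on_infdist)
  have [measurable]: "h m \<in> Borel" for m by (rule borel_measurable_continuous_onI[OF ch])
  have h0: "h m w = 0" if "w \<notin> D" for m w
  proof -
    have "infdist w K \<ge> d"
    proof (rule ccontr)
      assume "\<not> infdist w K \<ge> d"
      moreover obtain k where k: "k \<in> K" "infdist w K = dist w k"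
        using infdist_attains_inf[OF compact_imp_closed[OF K(1)] False] by metis
      ultimately have "w \<in> D" using D(4)[of k w] by (simp add: dist_commute)
      then show False using that by simp
    qed
    then have "(real m + 1 / d) * infdist w K \<ge> (1 / d) * d" using D(1) by (intro mult_mono) auto
    then show ?thesis using D(1) by (simp add: h_def)
  qed
  have hb: "\<bar>h m w\<bar> \<le> ind D w" for m w
  proof (cases "w \<in> D")
    case True
    have "(real m + 1 / d) * infdist w K \<ge> 0" using D(1) by (simp add: infdist_nonneg)
    then show ?thesis using True by (simp add: h_def)
  qed (simp add: h0)
  have hlim: "(\<lambda>m. h m w) \<longlonglongrightarrow> ind K w" for w
  proof (cases "w \<in> K")
    case True
    then have "h m w = 1" for m by (simp add: h_def)
    then show ?thesis using True by simp
  next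
    case w: False
    then have pos: "infdist w K > 0"
      using infdist_pos_not_in_closed[OF compact_imp_closed[OF K(1)] False] by blast
    obtain N where N: "real N * infdist w K > 1" using reals_Archimedean3[OF pos] by blast
    have "h m w = 0" if "m \<ge> N" for m
    proof -
      have "real N * infdist w K \<le> (real m + 1 / d) * infdist w K"
        using that D(1) pos by (intro mult_right_mono) (auto intro: order_trans[of _ "real m"])
      then show ?thesis using N by (simp add: h_def)
    qed
    then show ?thesis using w by (intro tendsto_eventually) (auto simp: eventually_sequentially)
  qed
  have eq: "(LBINT z. ind ?Q z * (h m (?\<Phi> z) * J z)) = n * (LBINT w. h m w)" for m
    unfolding J_def
  proof (rule degree_continuous[OF X a b xy Q ch D(2)])
    show "\<forall>w. w \<notin> D \<longrightarrow> h m w = 0" using h0 by blast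
    show "D \<inter> ?\<Phi> ` path_image (rectpath (Complex x0 y0) (Complex x1 y1)) = {}" using D(3) V(2) by blast
    show "Re (winding_number (?\<Phi> \<circ> rectpath (Complex x0 y0) (Complex x1 y1)) w) = n" if "w \<in> D" for w
      using n D(3) that by blast
  qed
  have l1: "(\<lambda>m. LBINT z. h m (?\<Phi> z) * (ind ?Q z * J z)) \<longlonglongrightarrow> (LBINT z. ind K (?\<Phi> z) * (ind ?Q z * J z))"
  proof (rule integral_dominated_convergence[where w = "\<lambda>z. \<bar>ind ?Q z * J z\<bar>"])
    show "AE z in lborel. (\<lambda>m. h m (?\<Phi> z) * (ind ?Q z * J z)) \<longlonglongrightarrow> ind K (?\<Phi> z) * (ind ?Q z * J z)"
      by (intro AE_I2 tendsto_mult_right hlim)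
    show "AE z in lborel. norm (h m (?\<Phi> z) * (ind ?Q z * J z)) \<le> \<bar>ind ?Q z * J z\<bar>" for m
    proof (rule AE_I2)
      fix z
      have "\<bar>h m (?\<Phi> z)\<bar> \<le> 1" by (rule order_trans[OF hb]) (simp add: indicator_def)
      then show "norm (h m (?\<Phi> z) * (ind ?Q z * J z)) \<le> \<bar>ind ?Q z * J z\<bar>"
        unfolding real_norm_def abs_mult[of "h m _"] by (intro mult_left_le_one_le) auto
    qed
    show "integrable lborel (\<lambda>z. \<bar>ind ?Q z * J z\<bar>)" using iJ by simp
  qed measurable
  have iD: "integrable lborel (\<lambda>w. ind D w :: real)"
    using emeasure_compact_finite[OF D(2)] borel_compact[OF D(2)] by simp
  have l2: "(\<lambda>m. LBINT w. h m w) \<longlonglongrightarrow> (LBINT w. ind K w)"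
  proof (rule integral_dominated_convergence[where w = "ind D"])
    show "AE w in lborel. (\<lambda>m. h m w) \<longlonglongrightarrow> ind K w" by (intro AE_I2 hlim)
    show "AE w in lborel. norm (h m w) \<le> ind D w" for m using hb by (intro AE_I2) auto
  qed (use iD in measurable)
  have "(\<lambda>m. n * (LBINT w. h m w)) \<longlonglongrightarrow> n * (LBINT w. ind K w)"
    by (intro tendsto_mult_left l2)
  then have "(\<lambda>m. LBINT z. h m (?\<Phi> z) * (ind ?Q z * J z)) \<longlonglongrightarrow> n * (LBINT w. ind K w)"
    unfolding eq[symmetric] mult.left_commute[of "ind ?Q _"] .
  from LIMSEQ_unique[OF l1 this]
  have "(LBINT z. ind K (?\<Phi> z) * (ind ?Q z * J z)) = n * measure lborel K" by simp
  then show ?thesis unfolding J_def mult.left_commute[of "ind ?Q _"] .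
qed simp

section \<open>Winding numbers of homeomorphic images of rectangles\<close>

lemma homeomorphism_open_image:
  assumes "homeomorphism X X' \<phi> \<psi>" "open X'" "open U" "U \<subseteq> X"
  shows "open (\<phi> ` U)"
proof -
  have "openin (top_of_set X) U" using assms(3,4) by (auto simp: openin_open)
  then have "openin (top_of_set X') (\<phi> ` U)" using homeomorphism_imp_open_map[OF assms(1)] by blast
  then show ?thesis using assms(2) openin_open_trans by blast
qed

text \<open>The boundary goes to a Jordan curve that contains the frontier of the open set
  \<phi>(B). A component of the complement of the curve that meets \<phi>(B) thus stays within this
  bounded set, so \<phi>(B) lies inside the curve, where the winding number is constantly 1 or
  -1.\<close>

lemma winding_number_homeomorphism_rect:
  assumes \<phi>: "homeomorphism X X' \<phi> \<psi>" "open X'" and xy: "x0 < x1" "y0 < y1" and Q: "rect x0 x1 y0 y1 \<subseteq> X"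
  defines "r \<equiv> rectpath (Complex x0 y0) (Complex x1 y1)" and "B \<equiv> box (Complex x0 y0) (Complex x1 y1)"
  shows "\<phi> ` B \<inter> \<phi> ` path_image r = {}" "open (\<phi> ` B)"
    "\<exists>n\<in>{1, -1}. \<forall>w\<in>\<phi> ` B. winding_number (\<phi> \<circ> r) w = n"
proof -
  have \<phi>c: "continuous_on X \<phi>" and inj: "inj_on \<phi> X"
    using \<phi>(1) by (auto simp: homeomorphism_def intro: inj_on_inverseI)
  have BQ: "B \<subseteq> rect x0 x1 y0 y1" unfolding B_def by (rule box_subset_cbox)
  have rQ: "path_image r = rect x0 x1 y0 y1 - B"
    unfolding r_def B_def using xy by (intro path_image_rectpath_cbox_minus_box) auto
  have rX: "path_image r \<subseteq> X" using rQ Q by blast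
  show disj: "\<phi> ` B \<inter> \<phi> ` path_image r = {}"
    using inj_on_image_Int[OF inj, of B "path_image r"] BQ Q rQ by auto
  show op: "open (\<phi> ` B)"
    by (rule homeomorphism_open_image[OF \<phi>]) (use BQ Q in \<open>auto simp: B_def\<close>)
  have pim: "path_image (\<phi> \<circ> r) = \<phi> ` path_image r" by (simp add: path_image_compose)
  have simple: "simple_path (\<phi> \<circ> r)"
    unfolding r_def using xy rX[unfolded r_def]
    by (intro simple_path_continuous_image simple_path_rectpath continuous_on_subset[OF \<phi>c] inj_on_subset[OF inj]) auto
  have cQ: "compact (\<phi> ` rect x0 x1 y0 y1)"
    by (intro compact_continuous_image continuous_on_subset[OF \<phi>c Q] compact_cbox)
  have fr: "frontier (\<phi> ` B) \<subseteq> path_image (\<phi> \<circ> r)"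
  proof -
    have "closure (\<phi> ` B) \<subseteq> \<phi> ` rect x0 x1 y0 y1"
      by (intro closure_minimal image_mono BQ compact_imp_closed cQ)
    then show ?thesis unfolding frontier_def pim rQ using op by (auto simp: interior_open)
  qed
  have "\<phi> ` B \<subseteq> inside (path_image (\<phi> \<circ> r))"
  proof
    fix w assume w: "w \<in> \<phi> ` B"
    let ?C = "connected_component_set (- path_image (\<phi> \<circ> r)) w"
    have wn: "w \<notin> path_image (\<phi> \<circ> r)" using w disj pim by blast
    have "?C \<subseteq> \<phi> ` B"
    proof (rule ccontr)
      assume "\<not> ?C \<subseteq> \<phi> ` B"
      moreover have "w \<in> ?C" using wn by (simp add: connected_component_refl_eq)
      ultimately have "?C \<inter> frontier (\<phi> ` B) \<noteq> {}"
        using w by (intro connected_Int_frontier connected_connected_component) blast+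
      then obtain v where v: "v \<in> ?C" "v \<in> frontier (\<phi> ` B)" by blast
      moreover have "v \<notin> path_image (\<phi> \<circ> r)" using v(1) connected_component_in by fastforce
      ultimately show False using fr by blast
    qed
    moreover have "bounded (\<phi> ` B)" using bounded_subset[OF compact_imp_bounded[OF cQ]] BQ by blast
    ultimately show "w \<in> inside (path_image (\<phi> \<circ> r))"
      using wn bounded_subset unfolding inside_def by blast
  qed
  then show "\<exists>n\<in>{1, -1}. \<forall>w\<in>\<phi> ` B. winding_number (\<phi> \<circ> r) w = n"
    using simple_closed_path_winding_number_inside[OF simple] by (metis insertI1 insertI2 subsetD)
qed

text \<open>\<open>orientation_preserving\<close> speaks of circles only. Rectangle and circle are
  homotopic in the plane without z0; the radial retraction \<rho> onto the disc moves this homotopy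
  into the domain of \<phi> and fixes both curves.\<close>

lemma winding_number_orientation_rect:
  assumes \<phi>: "homeomorphism X X' \<phi> \<psi>" "open X'" and o: "orientation_preserving X \<phi>"
    and R: "R > 0" "cball z0 R \<subseteq> X" and xy: "x0 < x1" "y0 < y1"
    and Q: "rect x0 x1 y0 y1 \<subseteq> cball z0 R" and z0: "z0 \<in> box (Complex x0 y0) (Complex x1 y1)"
    and w: "w \<in> \<phi> ` box (Complex x0 y0) (Complex x1 y1)"
  shows "winding_number (\<phi> \<circ> rectpath (Complex x0 y0) (Complex x1 y1)) w = 1"
proof -
  let ?r = "rectpath (Complex x0 y0) (Complex x1 y1)" and ?B = "box (Complex x0 y0) (Complex x1 y1)"
  have \<phi>c: "continuous_on X \<phi>" and inj: "inj_on \<phi> X"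
    using \<phi>(1) by (auto simp: homeomorphism_def intro: inj_on_inverseI)
  have rQ: "path_image ?r = rect x0 x1 y0 y1 - ?B"
    using xy by (intro path_image_rectpath_cbox_minus_box) auto
  have zr: "z0 \<notin> path_image ?r" using z0 rQ by blast
  define \<rho> where "\<rho> z = z0 + of_real (R / max R (norm (z - z0))) * (z - z0)" for z
  have c\<rho>: "continuous_on S \<rho>" for S
    unfolding \<rho>_def by (intro continuous_intros) (use R in auto)
  have \<rho>id: "\<rho> z = z" if "z \<in> cball z0 R" for z
    using that R by (simp add: \<rho>_def dist_norm norm_minus_commute max_def)
  have \<rho>T: "\<rho> \<in> - {z0} \<rightarrow> cball z0 R - {z0}"
  proof
    fix z assume z: "z \<in> - {z0}"
    have "norm (\<rho> z - z0) = R / max R (norm (z - z0)) * norm (z - z0)"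
    proof -
      have "\<bar>R\<bar> = R" "\<bar>max R (norm (z - z0))\<bar> = max R (norm (z - z0))" using R by auto
      then show ?thesis by (simp add: \<rho>_def norm_mult norm_divide)
    qed
    also have "\<dots> \<le> R" using R by (simp add: field_simps max_def)
    finally have "\<rho> z \<in> cball z0 R" by (simp add: dist_norm norm_minus_commute)
    moreover have "\<rho> z \<noteq> z0" using z R by (auto simp: \<rho>_def)
    ultimately show "\<rho> z \<in> cball z0 R - {z0}" by blast
  qed
  let ?c = "circlepath z0 R"
  have "homotopic_loops (- {z0}) ?r ?c"
  proof -
    have "winding_number ?r z0 = winding_number ?c z0"
      using winding_number_rectpath[OF z0] winding_number_circlepath_centre[OF R(1), of z0] by simp
    moreover have "z0 \<notin> path_image ?c" using R by (simp add: path_image_circlepath)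
    ultimately show ?thesis using zr
      by (intro winding_number_homotopic_loops_eq[THEN iffD1]) auto
  qed
  then have "homotopic_loops (cball z0 R - {z0}) (\<rho> \<circ> ?r) (\<rho> \<circ> ?c)"
    by (rule homotopic_loops_continuous_image[OF _ c\<rho> \<rho>T])
  then have "homotopic_loops (- {\<phi> z0}) (\<phi> \<circ> (\<rho> \<circ> ?r)) (\<phi> \<circ> (\<rho> \<circ> ?c))"
  proof (rule homotopic_loops_continuous_image)
    show "continuous_on (cball z0 R - {z0}) \<phi>" using R(2) by (intro continuous_on_subset[OF \<phi>c]) auto
    show "\<phi> \<in> cball z0 R - {z0} \<rightarrow> - {\<phi> z0}"
    proof
      fix z assume z: "z \<in> cball z0 R - {z0}"
      have "z0 \<in> cball z0 R" using R(1) by simp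
      then have "z0 \<in> X" "z \<in> X" using z R(2) by blast+
      then show "\<phi> z \<in> - {\<phi> z0}" using z inj_onD[OF inj, of z z0] by auto
    qed
  qed
  then have "winding_number (\<phi> \<circ> (\<rho> \<circ> ?r)) (\<phi> z0) = winding_number (\<phi> \<circ> (\<rho> \<circ> ?c)) (\<phi> z0)"
    by (rule winding_number_homotopic_loops)
  also have "winding_number (\<phi> \<circ> (\<rho> \<circ> ?r)) (\<phi> z0) = winding_number (\<phi> \<circ> ?r) (\<phi> z0)"
  proof (rule winding_number_cong)
    fix t :: real assume "0 \<le> t" "t \<le> 1"
    then have "?r t \<in> path_image ?r" by (auto simp: path_image_def)
    then have "?r t \<in> cball z0 R" using rQ Q by blast
    then show "(\<phi> \<circ> (\<rho> \<circ> ?r)) t = (\<phi> \<circ> ?r) t" using \<rho>id by simp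
  qed
  also have "winding_number (\<phi> \<circ> (\<rho> \<circ> ?c)) (\<phi> z0) = winding_number (\<phi> \<circ> ?c) (\<phi> z0)"
  proof (rule winding_number_cong)
    fix t :: real assume "0 \<le> t" "t \<le> 1"
    then have "?c t \<in> path_image ?c" by (auto simp: path_image_def)
    then have "?c t \<in> cball z0 R" using R by (auto simp: path_image_circlepath)
    then show "(\<phi> \<circ> (\<rho> \<circ> ?c)) t = (\<phi> \<circ> ?c) t" using \<rho>id by simp
  qed
  also have "winding_number (\<phi> \<circ> ?c) (\<phi> z0) = 1"
    using o R unfolding orientation_preserving_def by blast
  finally have 1: "winding_number (\<phi> \<circ> ?r) (\<phi> z0) = 1" .
  obtain n where "\<forall>w\<in>\<phi> ` ?B. winding_number (\<phi> \<circ> ?r) w = n"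
    using winding_number_homeomorphism_rect(3)[OF \<phi> xy subset_trans[OF Q R(2)]] by blast
  then show ?thesis using 1 w z0 by (metis imageI)
qed

section \<open>Change of variables\<close>

text \<open>The measure J dz on X is pushed forward by \<Phi> to Lebesgue measure on X'.
  \<open>ennreal\<close> truncates negative values of J, so nonnegativity of J is a separate
  matter.\<close>

definition change_var :: "complex set \<Rightarrow> complex set \<Rightarrow> (complex \<Rightarrow> complex) \<Rightarrow> (complex \<Rightarrow> real) \<Rightarrow> bool" where
  "change_var X X' \<Phi> J \<longleftrightarrow> (\<forall>u\<in>borel_measurable borel.
     (NNINT z. ind X z * (u (\<Phi> z) * ennreal (J z))) = (NNINT w. ind X' w * u w))"

lemma open_rect_nbhd:
  assumes "open X" "z \<in> X"
  obtains x0 x1 y0 y1 where "x0 < x1" "y0 < y1" "rect x0 x1 y0 y1 \<subseteq> X" "z \<in> box (Complex x0 y0) (Complex x1 y1)"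
proof -
  obtain p q where pq: "cbox p q \<subseteq> X" "z \<in> box p q"
    using open_contains_cbox[OF assms] by metis
  then have "Re p < Re q" "Im p < Im q" by (auto simp: in_box_complex_iff)
  then show ?thesis using that[of "Re p" "Re q" "Im p" "Im q"] pq by simp
qed

text \<open>Finite Borel measures are inner regular, so compact sets determine them; restricting to
  U makes both measures finite.\<close>

lemma measure_eq_on_open:
  fixes M N :: "complex measure"
  assumes s: "sets M = sets borel" "sets N = sets borel" and U: "open U"
    and fin: "emeasure M U \<noteq> \<infinity>" "emeasure N U \<noteq> \<infinity>"
    and K: "\<And>K. compact K \<Longrightarrow> K \<subseteq> U \<Longrightarrow> emeasure M K = emeasure N K"
    and E: "E \<in> sets borel" "E \<subseteq> U"
  shows "emeasure M E = emeasure N E"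
proof -
  have reg: "emeasure L E = (SUP K\<in>{K. K \<subseteq> E \<and> compact K}. emeasure L K)"
    if L: "sets L = sets borel" "emeasure L U \<noteq> \<infinity>" for L :: "complex measure"
  proof -
    have [measurable]: "U \<in> sets L" using L U by simp
    let ?L = "density L (ind U)"
    have e: "emeasure ?L X = emeasure L X" if "X \<in> sets borel" "X \<subseteq> U" for X
    proof -
      have "(\<lambda>x. ind U x * ind X x) = (ind X :: complex \<Rightarrow> ennreal)"
        using that by (intro ext) (auto simp: indicator_def)
      then show ?thesis using that L(1) by (subst emeasure_density) auto
    qed
    have "emeasure ?L (space ?L) = emeasure L U"
      using L(1) by (subst emeasure_density) (auto simp: sets_eq_imp_space_eq[OF L(1)])
    then have "emeasure ?L E = (SUP K\<in>{K. K \<subseteq> E \<and> compact K}. emeasure ?L K)"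
      using L E by (intro inner_regular) auto
    also have "\<dots> = (SUP K\<in>{K. K \<subseteq> E \<and> compact K}. emeasure L K)"
      using E(2) by (intro SUP_cong refl e) (auto intro: borel_compact)
    finally show ?thesis using e[OF E] by simp
  qed
  have "(SUP K\<in>{K. K \<subseteq> E \<and> compact K}. emeasure M K) = (SUP K\<in>{K. K \<subseteq> E \<and> compact K}. emeasure N K)"
    using K E(2) by (intro SUP_cong refl) auto
  then show ?thesis using reg[OF s(1) fin(1)] reg[OF s(2) fin(2)] by simp
qed

text \<open>By Lindelof's theorem countably many of the sets U suffice, and disjointing them cuts E
  into pieces that each lie in one U.\<close>

lemma measure_eq_local:
  fixes M N :: "complex measure"
  assumes s: "sets M = sets borel" "sets N = sets borel"
    and loc: "\<And>w. w \<in> V \<Longrightarrow> \<exists>U. open U \<and> w \<in> U \<and> U \<subseteq> V \<and> (\<forall>E\<in>sets borel. E \<subseteq> U \<longrightarrow> emeasure M E = emeasure N E)"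
    and E: "E \<in> sets borel" "E \<subseteq> V"
  shows "emeasure M E = emeasure N E"
proof (cases "V = {}")
  case False
  let ?F = "{U. open U \<and> U \<subseteq> V \<and> (\<forall>E\<in>sets borel. E \<subseteq> U \<longrightarrow> emeasure M E = emeasure N E)}"
  have "\<And>S. S \<in> ?F \<Longrightarrow> open S" by (simp only: mem_Collect_eq)
  then obtain F' where F': "F' \<subseteq> ?F" "countable F'" "\<Union>F' = \<Union>?F"
    by (rule Lindelof)
  have "\<Union>?F = V"
  proof
    show "V \<subseteq> \<Union>?F"
    proof
      fix w assume "w \<in> V"
      from loc[OF this] obtain U where "U \<in> ?F" "w \<in> U" by (simp only: mem_Collect_eq) metis
      then show "w \<in> \<Union>?F" by (rule UnionI)
    qed
  qed (simp add: Sup_le_iff)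
  then have cover: "\<Union>F' = V" using F'(3) by simp
  then have ne: "F' \<noteq> {}" using False by blast
  define U where "U = from_nat_into F'"
  have U: "U n \<in> ?F" for n using from_nat_into[OF ne] F'(1) unfolding U_def by blast
  have UV: "(\<Union>n. U n) = V"
    using range_from_nat_into[OF ne F'(2)] cover unfolding U_def by simp
  have bU: "U n \<in> sets borel" for n using U[of n] by auto
  have bd: "disjointed U n \<in> sets borel" for n
    using bU sets.range_disjointed_sets[of U borel] by auto
  have dU: "E \<inter> disjointed U n \<subseteq> U n" for n using disjointed_subset[of U n] by blast
  have Eu: "E = (\<Union>n. E \<inter> disjointed U n)" using UN_disjointed_eq[of U] UV E(2) by blast
  have dj: "disjoint_family (\<lambda>n. E \<inter> disjointed U n)"
    using disjoint_family_disjointed[of U] by (auto simp: disjoint_family_on_def)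
  have sum: "emeasure L E = (\<Sum>n. emeasure L (E \<inter> disjointed U n))" if "sets L = sets borel" for L :: "complex measure"
    using E bd that by (subst Eu, subst suminf_emeasure[OF _ dj]) auto
  have "emeasure M (E \<inter> disjointed U n) = emeasure N (E \<inter> disjointed U n)" for n
    using U[of n] dU[of n] E(1) bd[of n] by blast
  then show ?thesis using sum[OF s(1)] sum[OF s(2)] by simp
qed (use E in auto)

text \<open>Equality is asked only for compact subsets of a small neighbourhood of each point,
  because that is what the degree formula and the isometry can supply; regularity and a countable
  cover do the rest.\<close>

lemma change_var_of_compact:
  assumes bor: "\<Phi> \<in> Borel" "J \<in> Borel"
    and X: "open X" "open X'" and onto: "\<Phi> ` X \<subseteq> X'"
    and loc: "\<And>w. w \<in> X' \<Longrightarrow> \<exists>U. open U \<and> bounded U \<and> w \<in> U \<and> U \<subseteq> X' \<and>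
      (NNINT z. ind X z * (ind U (\<Phi> z) * ennreal (J z))) < \<infinity> \<and>
      (\<forall>K. compact K \<and> K \<subseteq> U \<longrightarrow> (NNINT z. ind X z * (ind K (\<Phi> z) * ennreal (J z))) = emeasure lborel K)"
  shows "change_var X X' \<Phi> J"
proof -
  note [measurable] = bor
  have [measurable]: "X \<in> sets borel" "X' \<in> sets borel" using X by auto
  define M where "M = distr (density lborel (\<lambda>z. ind X z * ennreal (J z))) borel \<Phi>"
  define N where "N = density lborel (ind X')"
  have s: "sets M = sets borel" "sets N = sets borel" by (simp_all add: M_def N_def)
  have M: "emeasure M E = (NNINT z. ind X z * (ind E (\<Phi> z) * ennreal (J z)))" if "E \<in> sets borel" for E
  proof -
    have [measurable]: "\<Phi> -` E \<in> sets borel" using measurable_sets[OF bor(1) that] by simp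
    show ?thesis
      unfolding M_def using that
      by (subst emeasure_distr, simp, simp, subst emeasure_density)
         (auto intro!: nn_integral_cong simp: indicator_def)
  qed
  have N: "emeasure N E = emeasure lborel E" if "E \<in> sets borel" "E \<subseteq> X'" for E
  proof -
    have "(\<lambda>x. ind X' x * ind E x) = (ind E :: complex \<Rightarrow> ennreal)"
      using that by (intro ext) (auto simp: indicator_def)
    then show ?thesis unfolding N_def using that by (subst emeasure_density) auto
  qed
  have sub: "emeasure M E = emeasure N E" if E: "E \<in> sets borel" "E \<subseteq> X'" for E
  proof (rule measure_eq_local[OF s _ E])
    fix w assume "w \<in> X'"
    from loc[OF this] obtain U where U: "open U" "bounded U" "w \<in> U" "U \<subseteq> X'"
      "(NNINT z. ind X z * (ind U (\<Phi> z) * ennreal (J z))) < \<infinity>"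
      "\<And>K. compact K \<Longrightarrow> K \<subseteq> U \<Longrightarrow> (NNINT z. ind X z * (ind K (\<Phi> z) * ennreal (J z))) = emeasure lborel K"
      by blast
    have "emeasure M E = emeasure N E" if "E \<in> sets borel" "E \<subseteq> U" for E
    proof (rule measure_eq_on_open[OF s U(1) _ _ _ that])
      show "emeasure M U \<noteq> \<infinity>" using U(1,5) by (subst M) auto
      obtain a b where "U \<subseteq> cbox a b" using bounded_subset_cbox_symmetric[OF U(2)] by metis
      then have "emeasure lborel U \<le> emeasure lborel (cbox a b)" by (intro emeasure_mono) auto
      then have "emeasure lborel U < \<infinity>" using emeasure_lborel_cbox_finite by (rule le_less_trans)
      then show "emeasure N U \<noteq> \<infinity>" using U(1,4) by (subst N) auto
      fix K assume K: "compact K" "K \<subseteq> U"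
      then show "emeasure M K = emeasure N K"
        using U(4,6) by (subst M, simp add: borel_compact, subst N) (auto simp: borel_compact)
    qed
    then show "\<exists>U. open U \<and> w \<in> U \<and> U \<subseteq> X' \<and> (\<forall>E\<in>sets borel. E \<subseteq> U \<longrightarrow> emeasure M E = emeasure N E)"
      using U by blast
  qed
  have "M = N"
  proof (rule measure_eqI)
    fix E assume "E \<in> sets M"
    then have E: "E \<in> sets borel" by (simp add: s)
    have "emeasure M E = emeasure M (E \<inter> X')"
    proof -
      have "ind X z * (ind E (\<Phi> z) * ennreal (J z)) = ind X z * (ind (E \<inter> X') (\<Phi> z) * ennreal (J z))" for z
        using onto by (cases "z \<in> X") (auto simp: indicator_def image_subset_iff)
      then show ?thesis using M[OF E] M[of "E \<inter> X'"] E by simp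
    qed
    also have "\<dots> = emeasure N (E \<inter> X')" using E by (intro sub) auto
    also have "\<dots> = emeasure N E"
      unfolding N_def using E by (subst (1 2) emeasure_density) (auto intro!: nn_integral_cong simp: indicator_def)
    finally show "emeasure M E = emeasure N E" .
  qed (simp add: s)
  show ?thesis unfolding change_var_def
  proof
    fix u :: "complex \<Rightarrow> ennreal" assume [measurable]: "u \<in> Borel"
    have "(\<integral>\<^sup>+w. u w \<partial>M) = (NNINT z. ind X z * (u (\<Phi> z) * ennreal (J z)))"
      unfolding M_def by (subst nn_integral_distr, simp, simp, subst nn_integral_density) (auto simp: ac_simps)
    moreover have "(\<integral>\<^sup>+w. u w \<partial>N) = (NNINT w. ind X' w * u w)"
      unfolding N_def by (subst nn_integral_density) auto
    ultimately show "(NNINT z. ind X z * (u (\<Phi> z) * ennreal (J z))) = (NNINT w. ind X' w * u w)"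
      using \<open>M = N\<close> by simp
  qed
qed

text \<open>The degree of a homeomorphism is \<open>\<plusminus>1\<close>; a nonnegative Jacobian forces it to be \<open>1\<close>.\<close>

lemma change_var_W12:
  assumes \<phi>: "homeomorphism X X' \<phi> \<psi>" and X: "open X" "open X'"
    and a: "W12 X a ax ay" and b: "W12 X b bx by'"
    and ab: "\<And>z. z \<in> X \<Longrightarrow> \<phi> z = Complex (a z) (b z)"
    and J: "AE z\<in>X in lborel. ax z * by' z - ay z * bx z \<ge> 0"
  shows "change_var X X' (\<lambda>z. Complex (a z) (b z)) (\<lambda>z. ax z * by' z - ay z * bx z)"
proof -
  let ?\<Phi> = "\<lambda>z. Complex (a z) (b z)" and ?J = "\<lambda>z. ax z * by' z - ay z * bx z"
  have W: "wgrad X a ax ay" "wgrad X b bx by'" using a b by (auto simp only: W12_def)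
  have L: "Lploc 2 X ax" "Lploc 2 X ay" "Lploc 2 X bx" "Lploc 2 X by'"
    using a b by (auto simp only: W12_def)
  have [measurable]: "a \<in> Borel" "b \<in> Borel"
    using Lploc_borel wgrad_Lploc(1)[OF W(1)] wgrad_Lploc(1)[OF W(2)] by blast+
  have [measurable]: "ax \<in> Borel" "ay \<in> Borel"
      "bx \<in> Borel" "by' \<in> Borel"
    using L Lploc_borel by blast+
  have [measurable]: "?\<Phi> \<in> Borel" unfolding Complex_eq by measurable
  have [measurable]: "?J \<in> Borel" by measurable
  have \<phi>c: "continuous_on X \<phi>" and inj: "inj_on \<phi> X" and im: "\<phi> ` X = X'"
    using \<phi> by (auto simp: homeomorphism_def intro: inj_on_inverseI)
  have "continuous_on X (\<lambda>z. Re (\<phi> z))" "continuous_on X (\<lambda>z. Im (\<phi> z))"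
    by (intro continuous_intros \<phi>c)+
  moreover have "continuous_on X a \<longleftrightarrow> continuous_on X (\<lambda>z. Re (\<phi> z))" "continuous_on X b \<longleftrightarrow> continuous_on X (\<lambda>z. Im (\<phi> z))"
    by (intro continuous_on_cong refl; simp add: ab)+
  ultimately have ca: "continuous_on X a" and cb: "continuous_on X b" by auto
  show ?thesis
  proof (rule change_var_of_compact[OF _ _ X])
    show "?\<Phi> ` X \<subseteq> X'" using ab im by auto
    fix w assume "w \<in> X'"
    then have "w \<in> \<phi> ` X" using im by simp
    then obtain z where z: "z \<in> X" "w = \<phi> z" by (elim imageE)
    obtain x0 x1 y0 y1 where xy: "x0 < x1" "y0 < y1" and Q: "rect x0 x1 y0 y1 \<subseteq> X"
      and zB: "z \<in> box (Complex x0 y0) (Complex x1 y1)"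
      by (rule open_rect_nbhd[OF X(1) z(1)])
    let ?Q = "rect x0 x1 y0 y1" and ?B = "box (Complex x0 y0) (Complex x1 y1)" and ?r = "rectpath (Complex x0 y0) (Complex x1 y1)"
    have BQ: "?B \<subseteq> ?Q" by (rule box_subset_cbox)
    note wn = winding_number_homeomorphism_rect[OF \<phi> X(2) xy Q]
    obtain n where n: "n = 1 \<or> n = -1" "\<And>w. w \<in> \<phi> ` ?B \<Longrightarrow> winding_number (\<phi> \<circ> ?r) w = n"
      using wn(3) by (auto simp only: bex_simps ball_simps insert_iff)
    have rQ: "path_image ?r = ?Q - ?B"
      using xy by (intro path_image_rectpath_cbox_minus_box) auto
    have rX: "path_image ?r \<subseteq> X" using rQ Q by blast
    have same: "winding_number (?\<Phi> \<circ> ?r) w = winding_number (\<phi> \<circ> ?r) w" for w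
    proof (rule winding_number_cong)
      fix t :: real assume "0 \<le> t" "t \<le> 1"
      then have "?r t \<in> path_image ?r" by (auto simp: path_image_def)
      then show "(?\<Phi> \<circ> ?r) t = (\<phi> \<circ> ?r) t" using ab rX by auto
    qed
    have imr: "?\<Phi> ` path_image ?r = \<phi> ` path_image ?r" using ab rX by (intro image_cong refl) auto
    have deg: "(LBINT z. ind ?Q z * (ind K (?\<Phi> z) * ?J z)) = Re n * measure lborel K"
      if K: "compact K" "K \<subseteq> \<phi> ` ?B" for K
    proof (rule degree_compact[OF X(1) a ca b cb xy Q K wn(2)])
      show "\<phi> ` ?B \<inter> ?\<Phi> ` path_image ?r = {}" unfolding imr by (rule wn(1))
    qed (simp add: same n(2))
    have bQ: "?Q \<in> sets borel" by (rule borel_compact[OF compact_cbox])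
    have LS: "Lp 2 ?Q ax" "Lp 2 ?Q ay" "Lp 2 ?Q bx" "Lp 2 ?Q by'" using L Lploc_Lp[OF _ compact_cbox Q] by blast+
    have "Lp 1 ?Q ?J" by (intro Lp_diff Lp_mult bQ LS) auto
    then have iJ: "integrable lborel (\<lambda>z. ind ?Q z * ?J z)"
      unfolding Lp1_integrable[OF bQ] by blast
    have nnQ: "(NNINT z. ennreal (ind ?Q z * (ind K (?\<Phi> z) * ?J z)))
        = ennreal (LBINT z. ind ?Q z * (ind K (?\<Phi> z) * ?J z))"
      and pos: "0 \<le> (LBINT z. ind ?Q z * (ind K (?\<Phi> z) * ?J z))"
      if [measurable]: "K \<in> sets borel" for K
    proof -
      have i: "integrable lborel (\<lambda>z. ind ?Q z * (ind K (?\<Phi> z) * ?J z))"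
      proof (rule Bochner_Integration.integrable_bound[OF iJ])
        have [measurable]: "(\<lambda>z. ind K (?\<Phi> z) :: real) \<in> Borel"
          by (rule measurable_compose[OF _ borel_measurable_indicator[OF that]]) measurable
        show "(\<lambda>z. ind ?Q z * (ind K (?\<Phi> z) * ?J z)) \<in> borel_measurable lborel"
          using indicator_borel_times[OF bQ, of "\<lambda>z. ind K (?\<Phi> z) * ?J z"] by simp
      qed (auto simp: indicator_def)
      have p: "AE z in lborel. 0 \<le> ind ?Q z * (ind K (?\<Phi> z) * ?J z)"
        using J by eventually_elim (use Q in \<open>auto simp: indicator_def\<close>)
      show "(NNINT z. ennreal (ind ?Q z * (ind K (?\<Phi> z) * ?J z)))
        = ennreal (LBINT z. ind ?Q z * (ind K (?\<Phi> z) * ?J z))"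
        by (rule nn_integral_eq_integral[OF i p])
      show "0 \<le> (LBINT z. ind ?Q z * (ind K (?\<Phi> z) * ?J z))"
        by (rule integral_nonneg_AE[OF p])
    qed
    \<comment> \<open>With n = -1 the integral of the nonnegative J over the preimage of a small
      disc would be minus the area of that disc.\<close>
    have n1: "n = 1"
    proof -
      obtain r where r: "r > 0" "cball w r \<subseteq> \<phi> ` ?B"
        using wn(2) zB z(2) open_contains_cball by blast
      define m where "m = measure lborel (cball w r)"
      have "0 \<le> Re n * m"
        using pos[of "cball w r"] unfolding deg[OF compact_cball r(2)] m_def by simp
      moreover have "m > 0" unfolding m_def using r(1) by (simp add: content_cball_pos)
      ultimately show ?thesis using n(1) by auto
    qed
    have dom: "ind X z * (ind E (?\<Phi> z) * ennreal (?J z)) = ennreal (ind ?Q z * (ind E (?\<Phi> z) * ?J z))"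
      if E: "E \<subseteq> \<phi> ` ?B" for E z
    proof (cases "z \<in> X \<and> ?\<Phi> z \<in> E")
      case True
      then have "\<phi> z \<in> \<phi> ` ?B" using E ab by auto
      then have "z \<in> ?B" using True inj_onD[OF inj] BQ Q by blast
      then show ?thesis using True BQ by (auto simp: indicator_def)
    next
      case False
      then show ?thesis using Q by (auto simp: indicator_def)
    qed
    have bdd: "bounded (\<phi> ` ?B)"
    proof (rule bounded_subset)
      show "bounded (\<phi> ` ?Q)"
        by (intro compact_imp_bounded compact_continuous_image continuous_on_subset[OF \<phi>c Q] compact_cbox)
    qed (use BQ in blast)
    have "(NNINT z. ind X z * (ind (\<phi> ` ?B) (?\<Phi> z) * ennreal (?J z))) < \<infinity>"
      unfolding dom[OF subset_refl] using wn(2) by (subst nnQ) auto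
    moreover have "(NNINT z. ind X z * (ind K (?\<Phi> z) * ennreal (?J z))) = emeasure lborel K"
      if K: "compact K" "K \<subseteq> \<phi> ` ?B" for K
    proof -
      have "(NNINT z. ind X z * (ind K (?\<Phi> z) * ennreal (?J z))) = ennreal (measure lborel K)"
        unfolding dom[OF K(2)] using K by (subst nnQ) (auto simp: borel_compact deg n1)
      also have "\<dots> = emeasure lborel K"
        using emeasure_compact_finite[OF K(1)] by (intro emeasure_eq_ennreal_measure[symmetric]) auto
      finally show ?thesis .
    qed
    ultimately show "\<exists>U. open U \<and> bounded U \<and> w \<in> U \<and> U \<subseteq> X' \<and>
      (NNINT z. ind X z * (ind U (?\<Phi> z) * ennreal (?J z))) < \<infinity> \<and>
      (\<forall>K. compact K \<and> K \<subseteq> U \<longrightarrow> (NNINT z. ind X z * (ind K (?\<Phi> z) * ennreal (?J z))) = emeasure lborel K)"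
      using wn(2) bdd zB z(2) BQ Q im by (intro exI[of _ "\<phi> ` ?B"]) auto
  qed measurable
qed

section \<open>Quasiconformal homeomorphisms\<close>

text \<open>Mollify the indicator of D', which leaves room around D and has room inside D''.
  \<open>conv_near\<close> with c = 1 gives the plateau on D, and with c = 0 the vanishing off
  D''.\<close>

lemma smooth_cutoff:
  assumes X: "open X" and C: "compact C" "C \<subseteq> X"
  obtains k U where "k \<in> test_functions X" "open U" "C \<subseteq> U" "U \<subseteq> X" "\<And>z. z \<in> U \<Longrightarrow> k z = 1"
    "\<And>z. 0 \<le> k z \<and> k z \<le> 1"
proof -
  obtain d D where D0: "d > 0" "compact D" "D \<subseteq> X" "\<And>z w. z \<in> C \<Longrightarrow> dist z w < d \<Longrightarrow> w \<in> D" "C \<subseteq> interior D"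
    by (rule compact_nbhd[OF C(1) X C(2)]) blast
  note D = D0(1-3,5)
  obtain d' D' where D': "d' > 0" "compact D'" "D' \<subseteq> X" "\<And>z w. z \<in> D \<Longrightarrow> dist z w < d' \<Longrightarrow> w \<in> D'"
    using compact_nbhd[OF D(2) X D(3)] by metis
  obtain d'' D'' where D'': "d'' > 0" "compact D''" "D'' \<subseteq> X" "\<And>z w. z \<in> D' \<Longrightarrow> dist z w < d'' \<Longrightarrow> w \<in> D''"
    using compact_nbhd[OF D'(2) X D'(3)] by metis
  have "min d' d'' > 0" using D' D'' by simp
  then obtain n where n: "2 / real (Suc n) < min d' d''"
    using two_div_Suc_small[of "min d' d''"] by (auto simp: eventually_sequentially)
  define F :: "complex \<Rightarrow> real" where "F = ind D'"
  have iF: "integrable lborel F"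
    unfolding F_def using emeasure_compact_finite[OF D'(2)] borel_compact[OF D'(2)] by simp
  define k where "k = conv F (kern n)"
  have "smooth k" unfolding k_def by (rule smooth_conv[OF iF smooth_kern compact_cball kern_cball])
  moreover have "k z = 0" if "z \<notin> D''" for z
  proof -
    have "\<bar>k z - 0\<bar> \<le> 0"
      unfolding k_def
    proof (rule conv_near[OF iF])
      fix w assume w: "norm (w - z) < 2 / real (Suc n)"
      then have "dist w z < d''" using n by (simp add: dist_norm)
      then have "w \<notin> D'" using D''(4) that by blast
      then show "\<bar>F w - 0\<bar> \<le> 0" by (simp add: F_def)
    qed
    then show ?thesis by simp
  qed
  ultimately have t: "k \<in> test_functions X" using D''(2,3) by (auto simp: test_functions_iff)
  have one: "k z = 1" if "z \<in> D" for z
  proof -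
    have "\<bar>k z - 1\<bar> \<le> 0"
      unfolding k_def
    proof (rule conv_near[OF iF])
      fix w assume w: "norm (w - z) < 2 / real (Suc n)"
      then have "dist z w < d'" using n by (simp add: dist_norm norm_minus_commute)
      then have "w \<in> D'" using D'(4) that by blast
      then show "\<bar>F w - 1\<bar> \<le> 0" by (simp add: F_def)
    qed
    then show ?thesis by simp
  qed
  have bd: "0 \<le> k z \<and> k z \<le> 1" for z
  proof -
    \<comment> \<open>Both bounds at once: an indicator deviates from 1/2 by exactly 1/2
      everywhere.\<close>
    have "\<bar>k z - 1 / 2\<bar> \<le> 1 / 2"
      unfolding k_def by (rule conv_near[OF iF]) (simp add: F_def indicator_def)
    then show ?thesis unfolding abs_le_iff by linarith
  qed
  show ?thesis
  proof (rule that[OF t open_interior D(4) _ _ bd])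
    show "interior D \<subseteq> X" using interior_subset D(3) by blast
    show "k z = 1" if "z \<in> interior D" for z using one interior_subset that by blast
  qed
qed

lemma change_var_integral:
  assumes cv: "change_var X X' \<Phi> J" and X: "X \<in> sets borel" "X' \<in> sets borel"
    and bor: "\<Phi> \<in> Borel" "J \<in> Borel"
    and J: "AE z\<in>X in lborel. J z \<ge> 0" and f: "f \<in> Borel"
  shows "(LBINT z. ind X z * (f (\<Phi> z) * J z)) = (LBINT w. ind X' w * f w)" (is ?A)
    "integrable lborel (\<lambda>z. ind X z * (f (\<Phi> z) * J z)) \<longleftrightarrow> integrable lborel (\<lambda>w. ind X' w * f w)" (is ?B)
proof -
  note [measurable] = X bor f
  define g where "g z = ind X z * J z" for z
  define i where "i w = (ind X' w :: real)" for w
  have [measurable]: "g \<in> Borel" "i \<in> Borel"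
    unfolding g_def i_def by measurable
  have g: "AE z in lborel. g z \<ge> 0" using J by eventually_elim (auto simp: g_def indicator_def)
  have i: "AE w in lborel. i w \<ge> 0" by (simp add: i_def)
  have eq: "distr (density lborel (\<lambda>z. ennreal (g z))) borel \<Phi> = density lborel (\<lambda>w. ennreal (i w))"
  proof (rule measure_eqI)
    fix E assume "E \<in> sets (distr (density lborel (\<lambda>z. ennreal (g z))) borel \<Phi>)"
    then have E[measurable]: "E \<in> sets borel" by simp
    have [measurable]: "\<Phi> -` E \<in> sets borel" using measurable_sets[OF bor(1) E] by simp
    have "emeasure (distr (density lborel (\<lambda>z. ennreal (g z))) borel \<Phi>) E
        = (NNINT z. ennreal (g z) * ind (\<Phi> -` E) z)"
      by (subst emeasure_distr, simp, simp, subst emeasure_density) auto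
    also have "\<dots> = (NNINT z. ind X z * (ind E (\<Phi> z) * ennreal (J z)))"
      by (rule nn_integral_cong) (auto simp: g_def indicator_def)
    also have "\<dots> = (NNINT w. ind X' w * ind E w)"
      using cv unfolding change_var_def by (rule bspec) measurable
    also have "\<dots> = (NNINT w. ennreal (i w) * ind E w)"
      by (rule nn_integral_cong) (auto simp: i_def indicator_def)
    also have "\<dots> = emeasure (density lborel (\<lambda>w. ennreal (i w))) E"
      by (subst emeasure_density) auto
    finally show "emeasure (distr (density lborel (\<lambda>z. ennreal (g z))) borel \<Phi>) E = emeasure (density lborel (\<lambda>w. ennreal (i w))) E" .
  qed simp
  have e1: "(\<lambda>z. g z *\<^sub>R f (\<Phi> z)) = (\<lambda>z. ind X z * (f (\<Phi> z) * J z))" by (simp add: g_def ac_simps)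
  have e2: "(\<lambda>w. i w *\<^sub>R f w) = (\<lambda>w. ind X' w * f w)" by (simp add: i_def)
  have m: "\<Phi> \<in> density lborel (\<lambda>z. ennreal (g z)) \<rightarrow>\<^sub>M borel" "(\<lambda>z. f (\<Phi> z)) \<in> borel_measurable lborel" by simp_all
  have "integral\<^sup>L (distr (density lborel (\<lambda>z. ennreal (g z))) borel \<Phi>) f = (LBINT z. ind X z * (f (\<Phi> z) * J z))"
    unfolding integral_distr[OF m(1) f] integral_density[OF m(2) _ g, simplified] e1[symmetric] by simp
  moreover have "integral\<^sup>L (density lborel (\<lambda>w. ennreal (i w))) f = (LBINT w. ind X' w * f w)"
    using integral_density[of f lborel i] i by (simp flip: e2)
  ultimately show ?A unfolding eq by simp
  have "integrable (distr (density lborel (\<lambda>z. ennreal (g z))) borel \<Phi>) f \<longleftrightarrow> integrable lborel (\<lambda>z. ind X z * (f (\<Phi> z) * J z))"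
    unfolding integrable_distr_eq[OF m(1) f] using integrable_density[of "\<lambda>z. f (\<Phi> z)" lborel g] g by (simp flip: e1)
  moreover have "integrable (density lborel (\<lambda>w. ennreal (i w))) f \<longleftrightarrow> integrable lborel (\<lambda>w. ind X' w * f w)"
    using integrable_density[of f lborel i] i by (simp flip: e2)
  ultimately show ?B unfolding eq by simp
qed

lemma test_zero_outside:
  assumes "\<eta> \<in> test_functions U" "w \<notin> U"
  shows "\<eta> w = 0" "dir_deriv v \<eta> w = 0"
proof -
  obtain S where S: "smooth \<eta>" "compact S" "S \<subseteq> U" "\<forall>z. z \<notin> S \<longrightarrow> \<eta> z = 0"
    using assms(1) by (auto simp: test_functions_iff)
  show "\<eta> w = 0" "dir_deriv v \<eta> w = 0"
    using S(3,4) assms(2) dir_deriv_eq_0_outside[OF compact_imp_closed[OF S(2)] S(4)] by blast+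
qed

text \<open>The distortion inequality uses the signed Jacobian and the Hilbert-Schmidt norm. It
  contains J >= 0 almost everywhere, so no orientation has to be assumed.\<close>

locale qc_homeo =
  fixes X X' :: "complex set" and \<phi> \<psi> :: "complex \<Rightarrow> complex" and a a1 a2 b b1 b2 :: "complex \<Rightarrow> real" and K :: real
  assumes homeo: "homeomorphism X X' \<phi> \<psi>" and op: "open X" "open X'"
    and a: "W12 X a a1 a2" and b: "W12 X b b1 b2"
    and ab: "\<And>z. z \<in> X \<Longrightarrow> \<phi> z = Complex (a z) (b z)"
    and distortion: "AE z in lborel. z \<in> X \<longrightarrow>
      (a1 z)\<^sup>2 + (a2 z)\<^sup>2 + (b1 z)\<^sup>2 + (b2 z)\<^sup>2 \<le> K * (a1 z * b2 z - a2 z * b1 z)"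
    and K: "K \<ge> 1"
begin

definition J :: "complex \<Rightarrow> real" where "J z = a1 z * b2 z - a2 z * b1 z"

abbreviation \<Phi> :: "complex \<Rightarrow> complex" where "\<Phi> z \<equiv> Complex (a z) (b z)"

lemma wg: "wgrad X a a1 a2" "wgrad X b b1 b2"
  using a b by (auto simp only: W12_def)

lemma L2: "Lploc 2 X a1" "Lploc 2 X a2" "Lploc 2 X b1" "Lploc 2 X b2"
  using a b by (auto simp only: W12_def)

lemma borel_ab [measurable]: "a \<in> Borel" "b \<in> Borel"
  using Lploc_borel wgrad_Lploc(1)[OF wg(1)] wgrad_Lploc(1)[OF wg(2)] by blast+

lemma borel_grad [measurable]: "a1 \<in> Borel" "a2 \<in> Borel"
  "b1 \<in> Borel" "b2 \<in> Borel"
  using L2 Lploc_borel by blast+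

lemma borel_\<Phi> [measurable]: "\<Phi> \<in> Borel"
  unfolding Complex_eq by measurable

lemma borel_J [measurable]: "J \<in> Borel"
  unfolding J_def by measurable

lemma borel_X [measurable]: "X \<in> sets borel" "X' \<in> sets borel"
  using op by auto

lemma J_nonneg: "AE z\<in>X in lborel. J z \<ge> 0"
  using distortion
proof eventually_elim
  case (elim z)
  show ?case
  proof
    assume "z \<in> X"
    then have "0 \<le> K * J z"
      using elim zero_le_power2[of "a1 z"] zero_le_power2[of "a2 z"] zero_le_power2[of "b1 z"] zero_le_power2[of "b2 z"]
      unfolding J_def by linarith
    then show "J z \<ge> 0" using K by (simp add: zero_le_mult_iff)
  qed
qed

lemma \<phi>_cont: "continuous_on X \<phi>" and \<psi>_cont: "continuous_on X' \<psi>"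
  and \<phi>_im: "\<phi> ` X = X'" and \<psi>_im: "\<psi> ` X' = X"
  and \<psi>\<phi>: "z \<in> X \<Longrightarrow> \<psi> (\<phi> z) = z" and \<phi>\<psi>: "w \<in> X' \<Longrightarrow> \<phi> (\<psi> w) = w"
  using homeo by (auto simp: homeomorphism_def)

lemma \<phi>_in: "z \<in> X \<Longrightarrow> \<phi> z \<in> X'" and \<psi>_in: "w \<in> X' \<Longrightarrow> \<psi> w \<in> X"
  using \<phi>_im \<psi>_im by auto

lemma a_cont: "continuous_on X a" and b_cont: "continuous_on X b"
proof -
  have "continuous_on X (\<lambda>z. Re (\<phi> z))" "continuous_on X (\<lambda>z. Im (\<phi> z))"
    by (intro continuous_intros \<phi>_cont)+
  moreover have "continuous_on X a \<longleftrightarrow> continuous_on X (\<lambda>z. Re (\<phi> z))" "continuous_on X b \<longleftrightarrow> continuous_on X (\<lambda>z. Im (\<phi> z))"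
    by (intro continuous_on_cong refl; simp add: ab)+
  ultimately show "continuous_on X a" "continuous_on X b" by auto
qed

lemma cv: "change_var X X' \<Phi> J"
  unfolding J_def[abs_def]
  by (rule change_var_W12[OF homeo op a b ab J_nonneg[unfolded J_def]])

lemma cv_integral:
  assumes "f \<in> Borel"
  shows "(LBINT z. ind X z * (f (\<Phi> z) * J z)) = (LBINT w. ind X' w * f w)"
    "integrable lborel (\<lambda>z. ind X z * (f (\<Phi> z) * J z)) \<longleftrightarrow> integrable lborel (\<lambda>w. ind X' w * f w)"
  using change_var_integral[OF cv borel_X borel_\<Phi> borel_J J_nonneg assms] by auto

lemma cv_nn:
  assumes "u \<in> Borel"
  shows "(NNINT z. ind X z * (u (\<Phi> z) * ennreal (J z))) = (NNINT w. ind X' w * u w)"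
  using cv assms unfolding change_var_def by blast

section \<open>The inverse homeomorphism\<close>

definition p :: "complex \<Rightarrow> real" where "p w = ind X' w * Re (\<psi> w)"
definition q :: "complex \<Rightarrow> real" where "q w = ind X' w * Im (\<psi> w)"

lemma borel_pq [measurable]: "p \<in> Borel" "q \<in> Borel"
proof -
  have c: "continuous_on X' (\<lambda>w. Re (\<psi> w))" "continuous_on X' (\<lambda>w. Im (\<psi> w))"
    by (intro continuous_intros \<psi>_cont)+
  show "p \<in> Borel" "q \<in> Borel"
    using borel_measurable_continuous_on_indicator[OF borel_X(2) c(1)]
      borel_measurable_continuous_on_indicator[OF borel_X(2) c(2)]
    by (simp_all add: p_def[abs_def] q_def[abs_def])
qed

lemma pq: "w \<in> X' \<Longrightarrow> \<psi> w = Complex (p w) (q w)"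
  by (simp add: p_def q_def)

lemma pq_\<Phi>: "z \<in> X \<Longrightarrow> p (\<Phi> z) = Re z" "z \<in> X \<Longrightarrow> q (\<Phi> z) = Im z"
  using \<psi>\<phi>[of z] \<phi>_in[of z] ab[of z] by (auto simp: p_def q_def)

text \<open>The quotient f / J carried over to X'. For the entries of D\<phi> these are, up to sign
  and order, the entries of the inverse matrix at the preimage. Division by 0 gives 0, consistent
  with \<open>small_at_J_0\<close>.\<close>

definition pull :: "(complex \<Rightarrow> real) \<Rightarrow> complex \<Rightarrow> real" where
  "pull f w = ind X' w * (f (Complex (p w) (q w)) / J (Complex (p w) (q w)))"

lemma borel_\<Psi> [measurable]: "(\<lambda>w. Complex (p w) (q w)) \<in> Borel"
  unfolding Complex_eq by measurable

lemma borel_pull [measurable]: "f \<in> Borel \<Longrightarrow> pull f \<in> Borel"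
proof -
  assume f: "f \<in> Borel"
  note [measurable] = measurable_compose[OF borel_\<Psi> f] measurable_compose[OF borel_\<Psi> borel_J]
  show ?thesis unfolding pull_def by measurable
qed

lemma pull_\<Phi>: "z \<in> X \<Longrightarrow> pull f (\<Phi> z) = f z / J z"
  using pq_\<Phi>[of z] \<phi>_in[of z] ab[of z] by (simp add: pull_def)

lemma small_at_J_0:
  "AE z\<in>X in lborel. J z = 0 \<longrightarrow> a1 z = 0 \<and> a2 z = 0 \<and> b1 z = 0 \<and> b2 z = 0"
  using distortion
proof eventually_elim
  case (elim z)
  show ?case
  proof (intro impI)
    assume "z \<in> X" "J z = 0"
    then have "(a1 z)\<^sup>2 + (a2 z)\<^sup>2 + (b1 z)\<^sup>2 + (b2 z)\<^sup>2 \<le> 0" using elim by (simp add: J_def)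
    then show "a1 z = 0 \<and> a2 z = 0 \<and> b1 z = 0 \<and> b2 z = 0"
      by (metis add_nonneg_eq_0_iff add_nonneg_nonneg dual_order.antisym zero_eq_power2 zero_le_power2)
  qed
qed

text \<open>The change of variables turns the integral of (f / J)^2 over C into that of (f / J)^2 J
  over its preimage, where the integrand is at most K.\<close>

lemma pull_L2:
  assumes [measurable]: "f \<in> Borel"
    and f: "AE z\<in>X in lborel. (f z)\<^sup>2 \<le> K * J z"
  shows "Lploc 2 X' (pull f)"
  unfolding Lploc_def
proof (intro conjI allI impI)
  fix C assume C: "compact C \<and> C \<subseteq> X'"
  then have [measurable]: "C \<in> sets borel" by (simp add: borel_compact)
  have cC: "compact (\<psi> ` C)"
    using C by (intro compact_continuous_image continuous_on_subset[OF \<psi>_cont]) auto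
  then have [measurable]: "\<psi> ` C \<in> sets borel" by (simp add: borel_compact)
  have "pnorm 2 (\<lambda>w. ind C w * pull f w) = (NNINT w. ind X' w * ennreal ((ind C w * pull f w)\<^sup>2))"
    unfolding pnorm_def by (rule nn_integral_cong) (auto simp: pull_def indicator_def power_divide)
  also have "\<dots> = (NNINT z. ind X z * (ennreal ((ind C (\<Phi> z) * pull f (\<Phi> z))\<^sup>2) * ennreal (J z)))"
    by (subst cv_nn) auto
  also have "\<dots> \<le> (NNINT z. ennreal K * ind (\<psi> ` C) z)"
  proof (rule nn_integral_mono_AE)
    show "AE z in lborel. ind X z * (ennreal ((ind C (\<Phi> z) * pull f (\<Phi> z))\<^sup>2) * ennreal (J z))
        \<le> ennreal K * ind (\<psi> ` C) z"
      using f J_nonneg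
    proof eventually_elim
      case (elim z)
      show ?case
      proof (cases "z \<in> X \<and> \<Phi> z \<in> C")
        case True
        then have z: "z \<in> X" "\<phi> z \<in> C" using ab by auto
        then have zC: "z \<in> \<psi> ` C" using \<psi>\<phi> by (metis imageI)
        have J0: "J z \<ge> 0" and fz: "(f z)\<^sup>2 \<le> K * J z" using elim z by auto
        have "(f z / J z)\<^sup>2 * J z \<le> K"
        proof (cases "J z = 0")
          case False
          then have "(f z / J z)\<^sup>2 * J z = (f z)\<^sup>2 / J z" by (simp add: power2_eq_square)
          also have "\<dots> \<le> K" using fz J0 False by (simp add: field_simps)
          finally show ?thesis .
        qed (use K in simp)
        then show ?thesis
          using True zC J0 pull_\<Phi>[OF z(1), of f] by (simp flip: ennreal_mult add: ennreal_leI)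
      qed (auto simp: indicator_def)
    qed
  qed
  also have "\<dots> < \<infinity>"
    using emeasure_compact_finite[OF cC] by (simp add: nn_integral_cmult_indicator ennreal_mult_less_top)
  finally show "Lp 2 C (pull f)" by (simp add: Lp_def)
qed measurable

lemma pull_integral:
  assumes [measurable]: "f \<in> Borel" "\<eta> \<in> Borel"
    and \<eta>: "\<forall>w. w \<notin> X' \<longrightarrow> \<eta> w = 0"
    and f: "AE z\<in>X in lborel. J z = 0 \<longrightarrow> f z = 0"
  shows "(LBINT w. pull f w * \<eta> w) = (LBINT z. ind X z * (\<eta> (\<Phi> z) * f z))"
proof -
  have "(LBINT w. pull f w * \<eta> w) = (LBINT w. ind X' w * (pull f w * \<eta> w))"
    by (rule Bochner_Integration.integral_cong[OF refl]) (auto simp: pull_def indicator_def)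
  also have "\<dots> = (LBINT z. ind X z * ((pull f (\<Phi> z) * \<eta> (\<Phi> z)) * J z))"
    by (subst cv_integral(1)) auto
  also have "\<dots> = (LBINT z. ind X z * (\<eta> (\<Phi> z) * f z))"
  proof (rule integral_cong_AE)
    show "AE z in lborel. ind X z * ((pull f (\<Phi> z) * \<eta> (\<Phi> z)) * J z) = ind X z * (\<eta> (\<Phi> z) * f z)"
      using f
    proof eventually_elim
      case (elim z)
      then show ?case using pull_\<Phi>[of z f] by (cases "z \<in> X"; cases "J z = 0") auto
    qed
  qed measurable
  finally show ?thesis .
qed

text \<open>In \<open>jac_ibp\<close>, \<eta> \<circ> \<phi> paired with b has the Jacobian
  \<eta>_x(\<phi>) J, and paired with a it has - \<eta>_y(\<phi>) J. The cut-off k only turns l into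
  a test function; it is 1 near the preimage of the support of \<eta>.\<close>

lemma jacobian_test:
  assumes \<eta>: "\<eta> \<in> test_functions X'" and l: "smooth l"
  shows "(LBINT z. ind X z * ((dx \<eta> (\<Phi> z) * l z) * J z))
      = - (LBINT z. ind X z * (\<eta> (\<Phi> z) * (b2 z * dx l z)))
        + (LBINT z. ind X z * (\<eta> (\<Phi> z) * (b1 z * dy l z)))" (is ?A)
    and "(LBINT z. ind X z * ((dy \<eta> (\<Phi> z) * l z) * J z))
      = (LBINT z. ind X z * (\<eta> (\<Phi> z) * (a2 z * dx l z)))
        - (LBINT z. ind X z * (\<eta> (\<Phi> z) * (a1 z * dy l z)))" (is ?B)
proof -
  obtain S where S: "smooth \<eta>" "compact S" "S \<subseteq> X'" "\<forall>w. w \<notin> S \<longrightarrow> \<eta> w = 0"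
    using \<eta> by (auto simp: test_functions_iff)
  note o = dir_deriv_eq_0_outside[OF compact_imp_closed[OF S(2)] S(4)]
  have cC: "compact (\<psi> ` S)" by (intro compact_continuous_image continuous_on_subset[OF \<psi>_cont] S)
  have CX: "\<psi> ` S \<subseteq> X" using S(3) \<psi>_in by blast
  obtain k U where k: "k \<in> test_functions X" "open U" "\<psi> ` S \<subseteq> U" "U \<subseteq> X" "\<And>z. z \<in> U \<Longrightarrow> k z = 1"
    by (rule smooth_cutoff[OF op(1) cC CX]) blast
  have out: "\<eta> (\<Phi> z) = 0 \<and> dir_deriv v \<eta> (\<Phi> z) = 0" if "z \<in> X" "z \<notin> U" for z v
  proof -
    have "\<phi> z \<notin> S" using that k(3) \<psi>\<phi>[of z] by force
    then show ?thesis using ab[OF that(1)] S(4) o by auto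
  qed
  define m where "m z = l z * k z" for z
  have sk: "smooth k" using k(1) by (auto simp: test_functions_iff)
  have mt: "m \<in> test_functions X"
  proof -
    obtain T where "compact T" "T \<subseteq> X" "\<forall>z. z \<notin> T \<longrightarrow> k z = 0" using k(1) by (auto simp: test_functions_iff)
    then show ?thesis unfolding test_functions_iff m_def using smooth_mult[OF l sk] by auto
  qed
  have mU: "m z = l z" "dir_deriv v m z = dir_deriv v l z" if "z \<in> U" for z v
  proof -
    show "m z = l z" using k(5)[OF that] by (simp add: m_def)
    have "(l has_derivative (\<lambda>h. Re h * dx l z + Im h * dy l z)) (at z)" by (rule smooth_has_derivative[OF l])
    then have "(m has_derivative (\<lambda>h. Re h * dx l z + Im h * dy l z)) (at z)"
      by (rule has_derivative_transform_within_open[OF _ k(2) that]) (simp add: m_def k(5))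
    then show "dir_deriv v m z = dir_deriv v l z"
      using dir_deriv_eq dir_deriv_eq[OF smooth_has_derivative[OF l], of v z] by metis
  qed
  note mo = test_zero_outside[OF mt]
  have e1: "F (\<Phi> z) * G z * m z = ind X z * ((F (\<Phi> z) * l z) * G z)" if "F = dx \<eta> \<or> F = dy \<eta>" for F G z
  proof -
    consider "z \<notin> X" | "z \<in> U" | "z \<in> X" "z \<notin> U" by blast
    then show ?thesis
    proof cases
      case 3
      then have "F (\<Phi> z) = 0" using out that by blast
      then show ?thesis by simp
    qed (use mo mU k(4) in auto)
  qed
  have e2: "\<eta> (\<Phi> z) * G z * dir_deriv v m z = ind X z * (\<eta> (\<Phi> z) * (G z * dir_deriv v l z))" for G z v
  proof -
    consider "z \<notin> X" | "z \<in> U" | "z \<in> X" "z \<notin> U" by blast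
    then show ?thesis
    proof cases
      case 3
      then have "\<eta> (\<Phi> z) = 0" using out by blast
      then show ?thesis by simp
    qed (use mo mU k(4) in auto)
  qed
  note ch = W12_chain[OF op(1) S(1) a a_cont b b_cont]
  have cc: "continuous_on X (comp2 \<eta> a b)"
    by (intro comp2_continuous_on smooth_continuous_on S a_cont b_cont)
  have "(LBINT z. dx \<eta> (\<Phi> z) * J z * m z)
      = - (LBINT z. \<eta> (\<Phi> z) * b2 z * dx m z) + (LBINT z. \<eta> (\<Phi> z) * b1 z * dy m z)"
    using jac_ibp[OF op(1) ch cc b mt] by (simp add: comp2_def J_def algebra_simps)
  then show ?A unfolding e2 by (subst (asm) e1) auto
  have "(LBINT z. - (dy \<eta> (\<Phi> z) * J z * m z))
      = - (LBINT z. \<eta> (\<Phi> z) * a2 z * dx m z) + (LBINT z. \<eta> (\<Phi> z) * a1 z * dy m z)"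
    using jac_ibp[OF op(1) ch cc a mt] by (simp add: comp2_def J_def algebra_simps)
  then show ?B unfolding e2 by (subst (asm) e1) auto
qed

lemma grad_small:
  "AE z\<in>X in lborel. (a1 z)\<^sup>2 \<le> K * J z" "AE z\<in>X in lborel. (a2 z)\<^sup>2 \<le> K * J z"
  "AE z\<in>X in lborel. (b1 z)\<^sup>2 \<le> K * J z" "AE z\<in>X in lborel. (b2 z)\<^sup>2 \<le> K * J z"
proof -
  have sm: "x1 \<le> k \<and> x2 \<le> k \<and> x3 \<le> k \<and> x4 \<le> k"
    if "x1 + x2 + x3 + x4 \<le> k" "x1 \<ge> 0" "x2 \<ge> 0" "x3 \<ge> 0" "x4 \<ge> 0" for x1 x2 x3 x4 k :: real
    using that by linarith
  have "AE z\<in>X in lborel. (a1 z)\<^sup>2 \<le> K * J z \<and> (a2 z)\<^sup>2 \<le> K * J z \<and> (b1 z)\<^sup>2 \<le> K * J z \<and> (b2 z)\<^sup>2 \<le> K * J z"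
    using distortion unfolding J_def
    by eventually_elim (intro impI sm zero_le_power2, blast)
  then show "AE z\<in>X in lborel. (a1 z)\<^sup>2 \<le> K * J z" "AE z\<in>X in lborel. (a2 z)\<^sup>2 \<le> K * J z"
    "AE z\<in>X in lborel. (b1 z)\<^sup>2 \<le> K * J z" "AE z\<in>X in lborel. (b2 z)\<^sup>2 \<le> K * J z"
    by (eventually_elim, blast)+
qed

lemma grad_J_0:
  "AE z\<in>X in lborel. J z = 0 \<longrightarrow> a1 z = 0" "AE z\<in>X in lborel. J z = 0 \<longrightarrow> a2 z = 0"
  "AE z\<in>X in lborel. J z = 0 \<longrightarrow> b1 z = 0" "AE z\<in>X in lborel. J z = 0 \<longrightarrow> b2 z = 0"
  using small_at_J_0 by (eventually_elim, blast)+

lemma p_cont: "continuous_on X' p" and q_cont: "continuous_on X' q"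
proof -
  have "continuous_on X' (\<lambda>w. Re (\<psi> w))" "continuous_on X' (\<lambda>w. Im (\<psi> w))"
    by (intro continuous_intros \<psi>_cont)+
  moreover have "continuous_on X' p \<longleftrightarrow> continuous_on X' (\<lambda>w. Re (\<psi> w))" "continuous_on X' q \<longleftrightarrow> continuous_on X' (\<lambda>w. Im (\<psi> w))"
    by (intro continuous_on_cong refl; simp add: p_def q_def)+
  ultimately show "continuous_on X' p" "continuous_on X' q" by auto
qed

text \<open>The inverse is weakly differentiable because integrating by parts on \<open>X\<close> against the
  coordinate functions only involves the cofactors of \<open>D\<phi>\<close>.\<close>

lemma inverse_W12:
  "W12 X' p (pull b2) (\<lambda>w. - pull a2 w)" "W12 X' q (\<lambda>w. - pull b1 w) (pull a1)"
proof -
  have P: "Lploc 2 X' (pull a1)" "Lploc 2 X' (pull a2)" "Lploc 2 X' (pull b1)" "Lploc 2 X' (pull b2)"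
    by (rule pull_L2[OF borel_grad(1) grad_small(1)] pull_L2[OF borel_grad(2) grad_small(2)]
        pull_L2[OF borel_grad(3) grad_small(3)] pull_L2[OF borel_grad(4) grad_small(4)])+
  have m: "Lploc p' U (\<lambda>w. - f w)" if "Lploc p' U f" for p' U and f :: "complex \<Rightarrow> real"
    unfolding Lploc_def using Lploc_borel[OF that]
    by (intro conjI allI impI Lp_uminus borel_compact Lploc_Lp[OF that]) auto
  have Lpq: "Lploc 1 X' p" "Lploc 1 X' q"
    by (rule Lploc_continuous; use p_cont q_cont in simp)+
  have main: "(LBINT w. p w * dx \<eta> w) = - (LBINT w. pull b2 w * \<eta> w)"
    "(LBINT w. p w * dy \<eta> w) = - (LBINT w. - pull a2 w * \<eta> w)"
    "(LBINT w. q w * dx \<eta> w) = - (LBINT w. - pull b1 w * \<eta> w)"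
    "(LBINT w. q w * dy \<eta> w) = - (LBINT w. pull a1 w * \<eta> w)"
    if \<eta>: "\<eta> \<in> test_functions X'" for \<eta>
  proof -
    have s: "smooth \<eta>" using \<eta> by (auto simp: test_functions_iff)
    have [measurable]: "\<eta> \<in> Borel" "dx \<eta> \<in> Borel" "dy \<eta> \<in> Borel"
      by (intro smooth_borel smooth_dx smooth_dy s)+
    have z: "\<forall>w. w \<notin> X' \<longrightarrow> \<eta> w = 0" using test_zero_outside[OF \<eta>] by blast
    have lhs: "(LBINT w. r w * F w) = (LBINT z. ind X z * ((F (\<Phi> z) * l z) * J z))"
      if [measurable]: "r \<in> Borel" "F \<in> Borel"
        and r: "\<And>z. z \<in> X \<Longrightarrow> r (\<Phi> z) = l z" and F: "\<And>w. w \<notin> X' \<Longrightarrow> F w = 0" for r F l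
    proof -
      have "(LBINT w. r w * F w) = (LBINT w. ind X' w * (F w * r w))"
        by (rule Bochner_Integration.integral_cong[OF refl]) (use F in \<open>auto simp: indicator_def\<close>)
      also have "\<dots> = (LBINT z. ind X z * ((F (\<Phi> z) * r (\<Phi> z)) * J z))"
        by (rule cv_integral(1)[symmetric]) measurable
      also have "\<dots> = (LBINT z. ind X z * ((F (\<Phi> z) * l z) * J z))"
        by (rule Bochner_Integration.integral_cong[OF refl]) (use r in \<open>auto simp: indicator_def\<close>)
      finally show ?thesis .
    qed
    note zo = test_zero_outside(2)[OF \<eta>]
    note pi = pull_integral[OF _ _ z]
    show "(LBINT w. p w * dx \<eta> w) = - (LBINT w. pull b2 w * \<eta> w)"
      unfolding lhs[of p "dx \<eta>" Re, OF _ _ pq_\<Phi>(1) zo, simplified] jacobian_test(1)[OF \<eta> smooth_Re]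
      using pi[OF borel_grad(4) _ grad_J_0(4)] by simp
    show "(LBINT w. p w * dy \<eta> w) = - (LBINT w. - pull a2 w * \<eta> w)"
      unfolding lhs[of p "dy \<eta>" Re, OF _ _ pq_\<Phi>(1) zo, simplified] jacobian_test(2)[OF \<eta> smooth_Re]
      using pi[OF borel_grad(2) _ grad_J_0(2)] by simp
    show "(LBINT w. q w * dx \<eta> w) = - (LBINT w. - pull b1 w * \<eta> w)"
      unfolding lhs[of q "dx \<eta>" Im, OF _ _ pq_\<Phi>(2) zo, simplified] jacobian_test(1)[OF \<eta> smooth_Im]
      using pi[OF borel_grad(3) _ grad_J_0(3)] by simp
    show "(LBINT w. q w * dy \<eta> w) = - (LBINT w. pull a1 w * \<eta> w)"
      unfolding lhs[of q "dy \<eta>" Im, OF _ _ pq_\<Phi>(2) zo, simplified] jacobian_test(2)[OF \<eta> smooth_Im]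
      using pi[OF borel_grad(1) _ grad_J_0(1)] by simp
  qed
  show "W12 X' p (pull b2) (\<lambda>w. - pull a2 w)" "W12 X' q (\<lambda>w. - pull b1 w) (pull a1)"
    unfolding W12_def wgrad_def by (intro conjI ballI m P Lpq Lploc_2_1 main; assumption)+
qed

text \<open>The inverse satisfies the change of variables as well, with Jacobian I. Since 1 / 0 = 0,
  I vanishes at the images of points with J = 0, and so these points form a null set.\<close>

lemma J_pos: "AE z\<in>X in lborel. J z > 0"
proof -
  define I where "I w = pull b2 w * pull a1 w - - pull a2 w * - pull b1 w" for w
  have I: "I w = ind X' w * (1 / J (Complex (p w) (q w)))" for w
  proof -
    let ?z = "Complex (p w) (q w)"
    have "I w = ind X' w * (J ?z / (J ?z * J ?z))"
      by (simp add: I_def pull_def J_def indicator_def diff_divide_distrib mult.commute)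
    then show ?thesis by simp
  qed
  \<comment> \<open>\<open>ennreal\<close> sends negative numbers to 0, so the measure J dz does not
    charge {J < 0}; after the push-forward its image is a null set of X'.\<close>
  have neg: "AE w\<in>X' in lborel. J (Complex (p w) (q w)) \<ge> 0"
  proof -
    define u where "u w = (ind {w. J (Complex (p w) (q w)) < 0} w :: ennreal)" for w
    have [measurable]: "(\<lambda>w. J (Complex (p w) (q w))) \<in> Borel"
      by (rule measurable_compose[OF borel_\<Psi> borel_J])
    have [measurable]: "u \<in> Borel" unfolding u_def by measurable
    have "(NNINT w. ind X' w * u w) = (NNINT z. ind X z * (u (\<Phi> z) * ennreal (J z)))"
      by (rule cv_nn[symmetric]) measurable
    also have "\<dots> = (\<integral>\<^sup>+z. 0 \<partial>(lborel :: complex measure))"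
    proof (rule nn_integral_cong)
      fix z
      show "ind X z * (u (\<Phi> z) * ennreal (J z)) = 0"
      proof (cases "z \<in> X")
        case True
        then show ?thesis using pq_\<Phi>[OF True] by (cases "J z < 0") (auto simp: u_def ennreal_neg)
      qed simp
    qed
    finally have "(NNINT w. ind X' w * u w) = 0" by simp
    then have "AE w in lborel. ind X' w * u w = 0"
      by (subst (asm) nn_integral_0_iff_AE) auto
    then show ?thesis by eventually_elim (auto simp: u_def indicator_def split: if_splits)
  qed
  have cv': "change_var X' X (\<lambda>w. Complex (p w) (q w)) I"
    unfolding I_def[abs_def]
  proof (rule change_var_W12[OF homeomorphism_symD[OF homeo] op(2,1) inverse_W12 pq])
    show "AE w\<in>X' in lborel. pull b2 w * pull a1 w - - pull a2 w * - pull b1 w \<ge> 0"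
      unfolding I[unfolded I_def] using neg by eventually_elim simp
  qed
  define u where "u z = (ind {z. J z = 0} z :: ennreal)" for z
  have [measurable]: "u \<in> Borel" unfolding u_def by measurable
  have "(NNINT z. ind X z * u z) = (NNINT w. ind X' w * (u (Complex (p w) (q w)) * ennreal (I w)))"
    using cv'[unfolded change_var_def, THEN bspec, of u] by simp
  also have "\<dots> = (\<integral>\<^sup>+w. 0 \<partial>(lborel :: complex measure))"
    by (rule nn_integral_cong) (auto simp: u_def I indicator_def)
  finally have "(NNINT z. ind X z * u z) = 0" by simp
  then have "AE z in lborel. ind X z * u z = 0"
    by (subst (asm) nn_integral_0_iff_AE) auto
  then show ?thesis
    using J_nonneg by eventually_elim (auto simp: u_def indicator_def split: if_splits)
qed

text \<open>It makes f \<circ> \<phi> independent of the representative of f. The preimage has J dz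
  measure zero, and J > 0 makes it a null set.\<close>

lemma null_preimage:
  assumes "AE w\<in>X' in lborel. P w"
  shows "AE z\<in>X in lborel. P (\<Phi> z)"
proof -
  obtain N where N: "N \<in> null_sets lborel" "{w \<in> space lborel. \<not> (w \<in> X' \<longrightarrow> P w)} \<subseteq> N"
    using assms by (auto simp: eventually_ae_filter)
  have [measurable]: "N \<in> sets borel" using N(1) by auto
  have [measurable]: "(\<lambda>z. ind N (\<Phi> z) :: ennreal) \<in> Borel"
    by (rule measurable_compose[OF borel_\<Phi>]) measurable
  have "(NNINT z. ind X z * (ind N (\<Phi> z) * ennreal (J z))) = (NNINT w. ind X' w * ind N w)"
    by (rule cv_nn) measurable
  also have "\<dots> \<le> (NNINT w. ind N w)" by (rule nn_integral_mono) (auto simp: indicator_def)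
  also have "\<dots> = 0" using N(1) by auto
  finally have "(NNINT z. ind X z * (ind N (\<Phi> z) * ennreal (J z))) = 0" by simp
  then have "AE z in lborel. ind X z * (ind N (\<Phi> z) * ennreal (J z)) = 0"
    by (subst (asm) nn_integral_0_iff_AE) auto
  then show ?thesis
    using J_pos
  proof eventually_elim
    case (elim z)
    show ?case
    proof
      assume z: "z \<in> X"
      then have "\<Phi> z \<notin> N" using elim by (auto simp: indicator_def split: if_splits)
      moreover have "\<Phi> z \<in> X'" using \<phi>_in[OF z] ab[OF z] by simp
      ultimately show "P (\<Phi> z)" using N(2) by auto
    qed
  qed
qed

end

section \<open>Closedness of the weak gradient\<close>

lemma nn_integral_affine:
  fixes f :: "complex \<Rightarrow> ennreal"
  assumes [measurable]: "f \<in> Borel" and c: "c \<noteq> 0"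
  shows "(NNINT x. f x) = ennreal (c\<^sup>2) * (NNINT x. f (t + c *\<^sub>R x))"
proof -
  have "(NNINT x. f x) = (\<integral>\<^sup>+x. f x \<partial>density (distr lborel borel (\<lambda>x. t + c *\<^sub>R x)) (\<lambda>_. \<bar>c\<bar> ^ DIM(complex)))"
    using lborel_affine[OF c, of t] by simp
  also have "\<dots> = ennreal (c\<^sup>2) * (NNINT x. f (t + c *\<^sub>R x))"
    by (subst nn_integral_density) (auto simp: nn_integral_distr nn_integral_cmult)
  finally show ?thesis .
qed

text \<open>Integrate the derivative along the segment from q to p. The point on the segment is
  substituted for p if t > 1/2 and for q if t <= 1/2, so the scale factor is at least 1/2 and costs
  at most 4; with |p - q| <= 2 r this gives 8 r.\<close>

lemma poincare_smooth:
  assumes F: "smooth F" and r: "r > 0"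
  shows "(NNINT p. NNINT q. ind (cball z0 r) p * ind (cball z0 r) q * ennreal \<bar>F p - F q\<bar>)
    \<le> ennreal (8 * r) * emeasure lborel (cball z0 r) * (NNINT z. ind (cball z0 r) z * ennreal (\<bar>dx F z\<bar> + \<bar>dy F z\<bar>))"
proof -
  let ?B = "cball z0 r"
  define g where "g z = \<bar>dx F z\<bar> + \<bar>dy F z\<bar>" for z
  have cg: "continuous_on S g" for S
    unfolding g_def by (intro continuous_intros smooth_continuous_on smooth_dx smooth_dy F)
  have [measurable]: "g \<in> Borel" by (rule borel_measurable_continuous_onI[OF cg])
  have [measurable]: "F \<in> Borel" by (rule smooth_borel[OF F])
  have [measurable]: "?B \<in> sets borel" by simp
  define I where "I = (NNINT z. ind ?B z * ennreal (g z))"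
  have pt: "ennreal \<bar>F p - F q\<bar> \<le> (NNINT t. ind {0..1} t * ennreal (2 * r * g (q + t *\<^sub>R (p - q))))"
    if "p \<in> ?B" "q \<in> ?B" for p q
  proof -
    let ?\<gamma> = "\<lambda>t. q + t *\<^sub>R (p - q)"
    have n: "norm (p - q) \<le> 2 * r"
      using that norm_triangle_ineq4[of "p - z0" "q - z0"] by (simp add: dist_norm norm_minus_commute)
    have d: "((\<lambda>t. F (?\<gamma> t)) has_vector_derivative (Re (p - q) * dx F (?\<gamma> t) + Im (p - q) * dy F (?\<gamma> t))) (at t within {0..1})" for t
    proof -
      have "(?\<gamma> has_derivative (\<lambda>h. h *\<^sub>R (p - q))) (at t within {0..1})"
        by (auto intro!: derivative_eq_intros)
      from has_derivative_compose[OF this smooth_has_derivative[OF F]]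
      show ?thesis by (simp add: has_vector_derivative_def algebra_simps)
    qed
    have cd: "continuous_on {0..1} (\<lambda>t. Re (p - q) * dx F (?\<gamma> t) + Im (p - q) * dy F (?\<gamma> t))"
      by (intro continuous_intros continuous_on_compose2[OF smooth_continuous_on[OF smooth_dx[OF F], of UNIV]]
          continuous_on_compose2[OF smooth_continuous_on[OF smooth_dy[OF F], of UNIV]]) auto
    have bound: "\<bar>Re (p - q) * dx F z + Im (p - q) * dy F z\<bar> \<le> 2 * r * g z" for z
    proof -
      have "\<bar>Re (p - q) * dx F z + Im (p - q) * dy F z\<bar> \<le> \<bar>Re (p - q)\<bar> * \<bar>dx F z\<bar> + \<bar>Im (p - q)\<bar> * \<bar>dy F z\<bar>"
        by (metis abs_mult abs_triangle_ineq)
      also have "\<dots> \<le> (2 * r) * \<bar>dx F z\<bar> + (2 * r) * \<bar>dy F z\<bar>"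
        using n abs_Re_le_cmod[of "p - q"] abs_Im_le_cmod[of "p - q"] by (intro add_mono mult_right_mono) linarith+
      finally show ?thesis by (simp add: g_def distrib_left)
    qed
    have e: "F p - F q = (LBINT t. ind {0..1} t *\<^sub>R (Re (p - q) * dx F (?\<gamma> t) + Im (p - q) * dy F (?\<gamma> t)))"
      using integral_FTC_Icc[OF _ d cd] by simp
    have "ennreal \<bar>F p - F q\<bar> \<le> (NNINT t. ennreal (norm (ind {0..1} t *\<^sub>R (Re (p - q) * dx F (?\<gamma> t) + Im (p - q) * dy F (?\<gamma> t)))))"
      unfolding e real_norm_def[symmetric]
      by (rule integral_norm_bound_ennreal) (rule borel_integrable_compact[OF compact_Icc cd])
    also have "\<dots> \<le> (NNINT t. ind {0..1} t * ennreal (2 * r * g (?\<gamma> t)))"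
      by (rule nn_integral_mono) (auto simp: indicator_def intro!: ennreal_leI bound[simplified])
    finally show ?thesis .
  qed
  define H where "H t p q = ind {0..1::real} t * (ind ?B p * ind ?B q * ennreal (2 * r * g (q + t *\<^sub>R (p - q))))" for t p q
  have H1[measurable]: "(\<lambda>x. H (fst (snd x)) (fst x) (snd (snd x))) \<in> borel_measurable (borel \<Otimes>\<^sub>M (borel \<Otimes>\<^sub>M borel))"
    unfolding H_def by measurable
  have "(NNINT p. NNINT q. ind ?B p * ind ?B q * ennreal \<bar>F p - F q\<bar>)
      \<le> (NNINT p. NNINT q. NNINT t. H t p q)"
  proof (intro nn_integral_mono)
    fix p q :: complex
    show "ind ?B p * ind ?B q * ennreal \<bar>F p - F q\<bar> \<le> (NNINT t. H t p q)"
    proof (cases "p \<in> ?B \<and> q \<in> ?B")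
      case True
      then show ?thesis using pt[of p q] by (simp add: H_def)
    qed auto
  qed
  also have "\<dots> = (NNINT p. NNINT t. NNINT q. H t p q)"
    by (intro nn_integral_cong lborel_pair.Fubini') (simp add: H_def, measurable)
  also have "\<dots> = (NNINT t. NNINT p. NNINT q. H t p q)"
    by (rule lborel_pair.Fubini') (simp add: H_def, measurable)
  also have "\<dots> \<le> (NNINT t. (ennreal (8 * r) * emeasure lborel ?B * I) * ind {0..1::real} t)"
  proof (rule nn_integral_mono)
    fix t :: real
    have one: "(NNINT y. ind ?B y * ennreal (2 * r * g (s *\<^sub>R x + c *\<^sub>R y))) \<le> ennreal (8 * r) * I"
      if c: "c \<ge> 1 / 2" "s \<ge> 0" "s + c = 1" and x: "x \<in> ?B" for c s x
    proof -
      have "(NNINT y. ind ?B y * ennreal (2 * r * g (s *\<^sub>R x + c *\<^sub>R y)))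
          \<le> (NNINT y. ennreal (2 * r) * (ind ?B (s *\<^sub>R x + c *\<^sub>R y) * ennreal (g (s *\<^sub>R x + c *\<^sub>R y))))"
      proof (rule nn_integral_mono)
        fix y
        show "ind ?B y * ennreal (2 * r * g (s *\<^sub>R x + c *\<^sub>R y))
            \<le> ennreal (2 * r) * (ind ?B (s *\<^sub>R x + c *\<^sub>R y) * ennreal (g (s *\<^sub>R x + c *\<^sub>R y)))"
        proof (cases "y \<in> ?B")
          case True
          have "s *\<^sub>R x + c *\<^sub>R y \<in> ?B"
            using convex_cball[of z0 r] x True c unfolding convex_def by auto
          then show ?thesis using True r by (simp add: ennreal_mult g_def)
        qed simp
      qed
      also have "\<dots> = ennreal (2 * r) * (NNINT y. ind ?B (s *\<^sub>R x + c *\<^sub>R y) * ennreal (g (s *\<^sub>R x + c *\<^sub>R y)))"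
        by (rule nn_integral_cmult) measurable
      also have "\<dots> \<le> ennreal (2 * r) * (4 * I)"
      proof (rule mult_left_mono)
        have I: "I = ennreal (c\<^sup>2) * (NNINT y. ind ?B (s *\<^sub>R x + c *\<^sub>R y) * ennreal (g (s *\<^sub>R x + c *\<^sub>R y)))"
          unfolding I_def using c by (intro nn_integral_affine) auto
        have c4: "4 * ennreal (c\<^sup>2) \<ge> 1"
        proof -
          have "(1 / 2)\<^sup>2 \<le> c\<^sup>2" using c by (intro power_mono) auto
          then have "ennreal 1 \<le> ennreal (4 * c\<^sup>2)" by (intro ennreal_leI) (simp add: power2_eq_square)
          then show ?thesis by (simp add: ennreal_mult)
        qed
        show "(NNINT y. ind ?B (s *\<^sub>R x + c *\<^sub>R y) * ennreal (g (s *\<^sub>R x + c *\<^sub>R y))) \<le> 4 * I"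
          unfolding I mult.assoc[symmetric] using mult_right_mono[OF c4 zero_le] by simp
      qed simp
      also have "\<dots> = ennreal (8 * r) * I"
        using r by (simp flip: mult.assoc ennreal_numeral ennreal_mult)
      finally show ?thesis .
    qed
    show "(NNINT p. NNINT q. H t p q) \<le> (ennreal (8 * r) * emeasure lborel ?B * I) * ind {0..1} t"
    proof (cases "t \<in> {0..1}")
      case True
      have fin: "(NNINT x. ind ?B x * (ennreal (8 * r) * I)) = ennreal (8 * r) * emeasure lborel ?B * I"
        by (subst nn_integral_multc) (auto simp: ac_simps)
      show ?thesis
      proof (cases "t \<le> 1 / 2")
        case le: True
        have "(NNINT p. NNINT q. H t p q)
            = (NNINT p. ind ?B p * (NNINT q. ind ?B q * ennreal (2 * r * g (t *\<^sub>R p + (1 - t) *\<^sub>R q))))"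
          using True by (intro nn_integral_cong, subst nn_integral_cmult[symmetric])
            (auto intro!: nn_integral_cong simp: H_def algebra_simps)
        also have "\<dots> \<le> (NNINT x. ind ?B x * (ennreal (8 * r) * I))"
        proof (rule nn_integral_mono)
          fix p show "ind ?B p * (NNINT q. ind ?B q * ennreal (2 * r * g (t *\<^sub>R p + (1 - t) *\<^sub>R q)))
              \<le> ind ?B p * (ennreal (8 * r) * I)"
            using one[of "1 - t" t p] le True by (cases "p \<in> ?B") auto
        qed
        finally show ?thesis using True fin by simp
      next
        case gt: False
        have "(NNINT p. NNINT q. H t p q) = (NNINT q. NNINT p. H t p q)"
          by (rule lborel_pair.Fubini') (simp add: H_def, measurable)
        also have "\<dots> = (NNINT q. ind ?B q * (NNINT p. ind ?B p * ennreal (2 * r * g ((1 - t) *\<^sub>R q + t *\<^sub>R p))))"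
          using True by (intro nn_integral_cong, subst nn_integral_cmult[symmetric])
            (auto intro!: nn_integral_cong simp: H_def algebra_simps)
        also have "\<dots> \<le> (NNINT x. ind ?B x * (ennreal (8 * r) * I))"
        proof (rule nn_integral_mono)
          fix q show "ind ?B q * (NNINT p. ind ?B p * ennreal (2 * r * g ((1 - t) *\<^sub>R q + t *\<^sub>R p)))
              \<le> ind ?B q * (ennreal (8 * r) * I)"
            using one[of t "1 - t" q] gt True by (cases "q \<in> ?B") auto
        qed
        finally show ?thesis using True fin by simp
      qed
    qed (simp add: H_def)
  qed
  also have "\<dots> = ennreal (8 * r) * emeasure lborel ?B * I"
    by (subst nn_integral_cmult_indicator) auto
  finally show ?thesis by (simp add: I_def g_def)
qed

text \<open>A double integral instead of the deviation from a mean value: it makes sense for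
  functions not known to be integrable, such as the pointwise limit in
  \<open>wgrad_closure\<close>.\<close>

definition osc :: "complex set \<Rightarrow> (complex \<Rightarrow> real) \<Rightarrow> ennreal" where
  "osc B h = (NNINT p. NNINT q. ind B p * ind B q * ennreal \<bar>h p - h q\<bar>)"

lemma pnorm_1: "pnorm 1 (\<lambda>z. ind B z * f z) = (NNINT z. ind B z * ennreal \<bar>f z\<bar>)"
  unfolding pnorm_def by (rule nn_integral_cong) (auto simp: indicator_def)

lemma osc_le_add:
  assumes [measurable]: "u \<in> Borel" "v \<in> Borel" "B \<in> sets borel"
  shows "osc B u \<le> osc B v + 2 * emeasure lborel B * pnorm 1 (\<lambda>z. ind B z * (u z - v z))"
proof -
  let ?i = "\<lambda>p q. ind B p * ind B q :: ennreal"
  let ?d = "\<lambda>z. ennreal \<bar>u z - v z\<bar>"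
  let ?N = "pnorm 1 (\<lambda>z. ind B z * (u z - v z))"
  have "osc B u \<le> (NNINT p. NNINT q. ?i p q * ennreal \<bar>v p - v q\<bar> + (?i p q * ?d p + ?i p q * ?d q))"
    unfolding osc_def
  proof (intro nn_integral_mono)
    fix p q
    have "\<bar>u p - u q\<bar> \<le> \<bar>v p - v q\<bar> + (\<bar>u p - v p\<bar> + \<bar>u q - v q\<bar>)" by linarith
    then have "ennreal \<bar>u p - u q\<bar> \<le> ennreal (\<bar>v p - v q\<bar> + (\<bar>u p - v p\<bar> + \<bar>u q - v q\<bar>))" by (rule ennreal_leI)
    also have "\<dots> = ennreal \<bar>v p - v q\<bar> + (?d p + ?d q)" by (simp add: ennreal_plus)
    finally have "ennreal \<bar>u p - u q\<bar> \<le> ennreal \<bar>v p - v q\<bar> + (?d p + ?d q)" .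
    then have "?i p q * ennreal \<bar>u p - u q\<bar> \<le> ?i p q * (ennreal \<bar>v p - v q\<bar> + (?d p + ?d q))"
      by (rule mult_left_mono) simp
    then show "?i p q * ennreal \<bar>u p - u q\<bar> \<le> ?i p q * ennreal \<bar>v p - v q\<bar> + (?i p q * ?d p + ?i p q * ?d q)"
      by (simp only: distrib_left)
  qed
  also have "\<dots> = osc B v + ((NNINT p. NNINT q. ?i p q * ?d p) + (NNINT p. NNINT q. ?i p q * ?d q))"
    unfolding osc_def by (simp add: nn_integral_add)
  also have "(NNINT p. NNINT q. ?i p q * ?d p) = (NNINT p. (ind B p * ?d p) * emeasure lborel B)"
  proof (rule nn_integral_cong)
    fix p
    have "(NNINT q. ?i p q * ?d p) = (NNINT q. (ind B p * ?d p) * ind B q)"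
      by (simp add: ac_simps)
    then show "(NNINT q. ?i p q * ?d p) = (ind B p * ?d p) * emeasure lborel B"
      by (simp add: nn_integral_cmult)
  qed
  also have "\<dots> = emeasure lborel B * ?N"
    unfolding pnorm_1 by (subst nn_integral_multc) (auto simp: mult.commute)
  also have "(NNINT p. NNINT q. ?i p q * ?d q) = (NNINT p. ind B p * ?N)"
    unfolding pnorm_1 by (intro nn_integral_cong, subst nn_integral_cmult[symmetric]) (auto simp: ac_simps)
  also have "\<dots> = emeasure lborel B * ?N" by (subst nn_integral_multc) auto
  finally show ?thesis by (simp add: mult.assoc mult_2 distrib_right)
qed

lemma poincare:
  assumes X: "open X" and w: "wgrad X h g k" and B: "cball z0 r \<subseteq> X" "r > 0"
  shows "osc (cball z0 r) h \<le> ennreal (8 * r) * emeasure lborel (cball z0 r) *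
    (pnorm 1 (\<lambda>z. ind (cball z0 r) z * g z) + pnorm 1 (\<lambda>z. ind (cball z0 r) z * k z))"
proof -
  let ?B = "cball z0 r"
  define m where "m = emeasure lborel ?B"
  define c where "c = ennreal (8 * r) * m"
  have mfin: "m < \<infinity>" unfolding m_def by (rule emeasure_lborel_cball_finite)
  then have cfin: "c < \<infinity>" by (simp add: c_def ennreal_mult_less_top)
  define N where "N f = pnorm 1 (\<lambda>z. ind ?B z * f z)" for f
  note L = wgrad_Lploc[OF w]
  note bor [measurable] = L[THEN Lploc_borel]
  have [measurable]: "?B \<in> sets borel" by simp
  obtain F where F: "\<And>n. smooth (F n)" "plim 1 ?B F h" "plim 1 ?B (\<lambda>n. dx (F n)) g" "plim 1 ?B (\<lambda>n. dy (F n)) k"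
    using wgrad_approx[OF X w compact_cball B(1)] unfolding sym_smooth_def by blast
  note [measurable] = smooth_borel[OF F(1)] smooth_borel[OF smooth_dx[OF F(1)]] smooth_borel[OF smooth_dy[OF F(1)]]
  have tri: "N u \<le> N v + N (\<lambda>z. u z - v z)"
    if [measurable]: "u \<in> Borel" "v \<in> Borel" for u v
  proof -
    have "N u \<le> (NNINT z. ind ?B z * ennreal \<bar>v z\<bar> + ind ?B z * ennreal \<bar>u z - v z\<bar>)"
      unfolding N_def pnorm_1 distrib_left[symmetric]
    proof (intro nn_integral_mono mult_left_mono)
      fix z
      have "ennreal \<bar>u z\<bar> \<le> ennreal (\<bar>v z\<bar> + \<bar>u z - v z\<bar>)" by (rule ennreal_leI) linarith
      then show "ennreal \<bar>u z\<bar> \<le> ennreal \<bar>v z\<bar> + ennreal \<bar>u z - v z\<bar>" by (simp add: ennreal_plus)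
    qed simp
    also have "\<dots> = N v + N (\<lambda>z. u z - v z)"
      unfolding N_def pnorm_1 by (rule nn_integral_add) measurable
    finally show ?thesis .
  qed
  define e where "e n = c * (N (\<lambda>z. dx (F n) z - g z) + N (\<lambda>z. dy (F n) z - k z)) + 2 * m * N (\<lambda>z. F n z - h z)" for n
  have le: "osc ?B h \<le> c * (N g + N k) + e n" for n
  proof -
    have "osc ?B h \<le> osc ?B (F n) + 2 * m * N (\<lambda>z. h z - F n z)"
      unfolding m_def N_def by (rule osc_le_add) measurable
    also have "N (\<lambda>z. h z - F n z) = N (\<lambda>z. F n z - h z)"
      unfolding N_def pnorm_1 by (simp add: abs_minus_commute)
    also have "osc ?B (F n) \<le> c * (NNINT z. ind ?B z * ennreal (\<bar>dx (F n) z\<bar> + \<bar>dy (F n) z\<bar>))"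
      unfolding osc_def c_def m_def by (rule poincare_smooth[OF F(1) B(2)])
    also have "(NNINT z. ind ?B z * ennreal (\<bar>dx (F n) z\<bar> + \<bar>dy (F n) z\<bar>)) = N (dx (F n)) + N (dy (F n))"
      unfolding N_def pnorm_1 by (subst nn_integral_add[symmetric]) (auto simp: distrib_left)
    also have "\<dots> \<le> (N g + N (\<lambda>z. dx (F n) z - g z)) + (N k + N (\<lambda>z. dy (F n) z - k z))"
      by (intro add_mono tri) measurable
    finally have "osc ?B h \<le> c * ((N g + N (\<lambda>z. dx (F n) z - g z)) + (N k + N (\<lambda>z. dy (F n) z - k z))) + 2 * m * N (\<lambda>z. F n z - h z)"
      by (simp add: add_right_mono mult_left_mono)
    then show ?thesis by (simp add: e_def distrib_left ac_simps)
  qed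
  have "e \<longlonglongrightarrow> c * (0 + 0) + (2 * m) * 0"
    unfolding e_def N_def using F(2-4) cfin mfin
    by (intro tendsto_add ennreal_tendsto_cmult) (auto simp: plim_def ennreal_mult_less_top)
  then have "(\<lambda>n. c * (N g + N k) + e n) \<longlonglongrightarrow> c * (N g + N k) + 0"
    by (intro tendsto_add tendsto_const) simp
  then have "osc ?B h \<le> c * (N g + N k) + 0"
    by (rule LIMSEQ_le_const) (use le in auto)
  then show ?thesis by (simp add: c_def m_def N_def)
qed

text \<open>Fatou's lemma in each of the two variables; integrability of the limit is not
  involved.\<close>

lemma osc_Fatou:
  assumes [measurable]: "\<And>m. v m \<in> Borel" "u \<in> Borel" "B \<in> sets borel"
    and lim: "AE z\<in>B in lborel. (\<lambda>m. v m z) \<longlonglongrightarrow> u z"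
  shows "osc B u \<le> liminf (\<lambda>m. osc B (v m))"
proof -
  let ?f = "\<lambda>u p q. ind B p * ind B q * ennreal \<bar>u p - u q\<bar>"
  have inner: "(NNINT q. ?f u p q) \<le> liminf (\<lambda>m. NNINT q. ?f (v m) p q)"
    if p: "p \<in> B \<longrightarrow> (\<lambda>m. v m p) \<longlonglongrightarrow> u p" for p
  proof -
    have "(NNINT q. ?f u p q) \<le> (NNINT q. liminf (\<lambda>m. ?f (v m) p q))"
    proof (rule nn_integral_mono_AE)
      show "AE q in lborel. ?f u p q \<le> liminf (\<lambda>m. ?f (v m) p q)"
        using lim
      proof eventually_elim
        case (elim q)
        show ?case
        proof (cases "p \<in> B \<and> q \<in> B")
          case True
          then have "(\<lambda>m. ?f (v m) p q) \<longlonglongrightarrow> ?f u p q"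
            using p elim by (auto intro!: tendsto_intros)
          then show ?thesis by (simp add: lim_imp_Liminf)
        qed (auto simp: indicator_def)
      qed
    qed
    also have "\<dots> \<le> liminf (\<lambda>m. NNINT q. ?f (v m) p q)"
      by (rule nn_integral_liminf) measurable
    finally show ?thesis .
  qed
  have "osc B u \<le> (NNINT p. liminf (\<lambda>m. NNINT q. ?f (v m) p q))"
    unfolding osc_def
  proof (rule nn_integral_mono_AE)
    show "AE p in lborel. (NNINT q. ?f u p q) \<le> liminf (\<lambda>m. NNINT q. ?f (v m) p q)"
      using lim by eventually_elim (rule inner)
  qed
  also have "\<dots> \<le> liminf (\<lambda>m. osc B (v m))"
    unfolding osc_def by (rule nn_integral_liminf) measurable
  finally show ?thesis .
qed

lemma wgrad_diff:
  assumes w: "wgrad X f g h" "wgrad X f' g' h'"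
  shows "wgrad X (\<lambda>z. f z - f' z) (\<lambda>z. g z - g' z) (\<lambda>z. h z - h' z)"
proof -
  note L = wgrad_Lploc[OF w(1)] wgrad_Lploc[OF w(2)]
  have d: "(LBINT z. (u z - v z) * k z) = (LBINT z. u z * k z) - (LBINT z. v z * k z)"
    if "integrable lborel (\<lambda>z. u z * k z)" "integrable lborel (\<lambda>z. v z * k z)" for u v k :: "complex \<Rightarrow> real"
    using that by (simp add: left_diff_distrib)
  show ?thesis
    unfolding wgrad_def
    by (auto intro!: Lploc_diff L simp only: d test_integrable_test[OF L(1)] test_integrable_test[OF L(2)] test_integrable_test[OF L(3)]
        test_integrable_test[OF L(4)] test_integrable_test[OF L(5)] test_integrable_test[OF L(6)] wgrad_ibp[OF w(1)] wgrad_ibp[OF w(2)])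
qed

text \<open>Small oscillation says that e n is close to a constant, and convergence to 0 almost
  everywhere forces this constant to 0. The bounded truncations \<open>m n\<close> make the argument
  quantitative, since dominated convergence applies to them.\<close>

lemma osc_small_imp_pnorm_small:
  assumes [measurable]: "\<And>n. e n \<in> Borel"
    and lim: "AE z\<in>cball z0 r in lborel. (\<lambda>n. e n z) \<longlonglongrightarrow> 0"
    and r: "r > 0" and osc: "(\<lambda>n. osc (cball z0 r) (e n)) \<longlonglongrightarrow> 0"
  shows "(\<lambda>n. pnorm 1 (\<lambda>z. ind (cball z0 r) z * e n z)) \<longlonglongrightarrow> 0"
proof -
  let ?B = "cball z0 r :: complex set"
  have [measurable]: "?B \<in> sets borel" by simp
  define b where "b = emeasure lborel ?B"
  have bfin: "b < \<infinity>" unfolding b_def by (rule emeasure_lborel_cball_finite)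
  have b0: "b > 0"
  proof -
    have "0 < measure lborel ?B" using content_cball_pos[OF r] by simp
    then show ?thesis unfolding b_def measure_def by (simp add: enn2real_positive_iff)
  qed
  define N where "N n = pnorm 1 (\<lambda>z. ind ?B z * e n z)" for n
  define m where "m n z = min 1 \<bar>e n z\<bar>" for n z
  have [measurable]: "m n \<in> Borel" for n unfolding m_def by measurable
  have m01: "0 \<le> m n z" "m n z \<le> 1" for n z by (auto simp: m_def)
  define s where "s n = (NNINT z. ind ?B z * ennreal (1 - m n z))" for n
  define \<mu> where "\<mu> n = (NNINT z. ind ?B z * ennreal (m n z))" for n
  have lims: "AE z\<in>?B in lborel. (\<lambda>n. m n z) \<longlonglongrightarrow> 0"
    using lim
  proof eventually_elim
    case (elim z)
    have "(\<lambda>n. min 1 \<bar>e n z\<bar>) \<longlonglongrightarrow> min 1 \<bar>0\<bar>" if "(\<lambda>n. e n z) \<longlonglongrightarrow> 0"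
      by (intro tendsto_intros that)
    then show ?case using elim by (simp add: m_def)
  qed
  have s: "s \<longlonglongrightarrow> b"
  proof -
    have "s \<longlonglongrightarrow> (NNINT z. ind ?B z)"
      unfolding s_def
    proof (rule nn_integral_dominated_convergence[where w = "ind ?B"])
      show "AE z in lborel. (\<lambda>n. ind ?B z * ennreal (1 - m n z)) \<longlonglongrightarrow> ind ?B z"
        using lims
      proof eventually_elim
        case (elim z)
        have "(\<lambda>n. ennreal (1 - m n z)) \<longlonglongrightarrow> ennreal (1 - 0)" if "(\<lambda>n. m n z) \<longlonglongrightarrow> 0"
          by (intro tendsto_ennrealI tendsto_intros that)
        then show ?case using elim by (cases "z \<in> ?B") auto
      qed
      show "AE z in lborel. ind ?B z * ennreal (1 - m j z) \<le> ind ?B z" for j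
        using m01[of j] by (intro AE_I2) (auto simp: indicator_def ennreal_le_1)
    qed (use bfin in \<open>simp_all add: b_def\<close>)
    then show ?thesis by (simp add: b_def)
  qed
  have \<mu>: "\<mu> \<longlonglongrightarrow> 0"
  proof -
    have "\<mu> \<longlonglongrightarrow> integral\<^sup>N lborel (\<lambda>z::complex. 0)"
      unfolding \<mu>_def
    proof (rule nn_integral_dominated_convergence[where w = "ind ?B"])
      show "AE z in lborel. (\<lambda>n. ind ?B z * ennreal (m n z)) \<longlonglongrightarrow> 0"
        using lims
      proof eventually_elim
        case (elim z)
        have "(\<lambda>n. ennreal (m n z)) \<longlonglongrightarrow> ennreal 0" if "(\<lambda>n. m n z) \<longlonglongrightarrow> 0"
          by (intro tendsto_ennrealI that)
        then show ?case using elim by (cases "z \<in> ?B") auto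
      qed
      show "AE z in lborel. ind ?B z * ennreal (m j z) \<le> ind ?B z" for j
        using m01[of j] by (intro AE_I2) (auto simp: indicator_def ennreal_le_1)
    qed (use bfin in \<open>simp_all add: b_def\<close>)
    then show ?thesis by simp
  qed
  let ?i = "\<lambda>p q. ind ?B p * ind ?B q :: ennreal"
  \<comment> \<open>Compare the value at p with that at q: where |e n q| < 1 the truncation equals
    |e n q| and the triangle inequality suffices; elsewhere 1 - m n q = 0.\<close>
  have key: "N n * s n \<le> osc ?B (e n) + b * \<mu> n" for n
  proof -
    have "N n * s n = (NNINT p. NNINT q. (ind ?B p * ennreal \<bar>e n p\<bar>) * (ind ?B q * ennreal (1 - m n q)))"
      unfolding N_def s_def pnorm_1 by (simp add: nn_integral_cmult nn_integral_multc)
    also have "\<dots> \<le> (NNINT p. NNINT q. ?i p q * ennreal \<bar>e n p - e n q\<bar> + ind ?B p * (ind ?B q * ennreal (m n q)))"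
    proof (intro nn_integral_mono)
      fix p q
      have "\<bar>e n p\<bar> * (1 - m n q) \<le> \<bar>e n p - e n q\<bar> + m n q"
      proof (cases "\<bar>e n q\<bar> \<ge> 1")
        case True
        then show ?thesis by (simp add: m_def)
      next
        case False
        have "\<bar>e n p\<bar> * (1 - m n q) \<le> \<bar>e n p\<bar> * 1" using m01 by (intro mult_left_mono) auto
        also have "\<dots> \<le> \<bar>e n p - e n q\<bar> + m n q" using False by (simp add: m_def)
        finally show ?thesis .
      qed
      then have "ennreal (\<bar>e n p\<bar> * (1 - m n q)) \<le> ennreal (\<bar>e n p - e n q\<bar> + m n q)" by (rule ennreal_leI)
      then have "ennreal \<bar>e n p\<bar> * ennreal (1 - m n q) \<le> ennreal \<bar>e n p - e n q\<bar> + ennreal (m n q)"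
        using m01[of n q] by (simp add: ennreal_mult' ennreal_plus)
      then show "(ind ?B p * ennreal \<bar>e n p\<bar>) * (ind ?B q * ennreal (1 - m n q))
          \<le> ?i p q * ennreal \<bar>e n p - e n q\<bar> + ind ?B p * (ind ?B q * ennreal (m n q))"
        by (simp add: indicator_def)
    qed
    also have "\<dots> = osc ?B (e n) + (NNINT p. ind ?B p * \<mu> n)"
      unfolding osc_def \<mu>_def by (simp add: nn_integral_add nn_integral_cmult)
    also have "(NNINT p. ind ?B p * \<mu> n) = b * \<mu> n"
      unfolding b_def by (subst nn_integral_multc) auto
    finally show ?thesis .
  qed
  have t: "(\<lambda>n. osc ?B (e n) + b * \<mu> n) \<longlonglongrightarrow> 0"
  proof -
    have "(\<lambda>n. osc ?B (e n) + b * \<mu> n) \<longlonglongrightarrow> 0 + b * 0"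
      using bfin by (intro tendsto_add osc ennreal_tendsto_cmult \<mu>) auto
    then show ?thesis by simp
  qed
  \<comment> \<open>As s tends to b, it eventually exceeds half of b and can be divided out of the
    estimate \<open>key\<close>.\<close>
  define \<delta> where "\<delta> = enn2real b / 2"
  have \<delta>: "\<delta> > 0" "ennreal \<delta> < b"
  proof -
    have bb: "b = ennreal (enn2real b)" using bfin by simp
    then have "enn2real b > 0" using b0 bfin by (simp add: enn2real_positive_iff)
    then show "\<delta> > 0" "ennreal \<delta> < b" unfolding \<delta>_def by (simp, subst (2) bb, simp add: ennreal_less_iff)
  qed
  have "N \<longlonglongrightarrow> 0"
  proof (rule tendsto_sandwich[of "\<lambda>_. 0" _ _ "\<lambda>n. ennreal (1 / \<delta>) * (osc ?B (e n) + b * \<mu> n)"])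
    show "\<forall>\<^sub>F n in sequentially. N n \<le> ennreal (1 / \<delta>) * (osc ?B (e n) + b * \<mu> n)"
      using order_tendstoD(1)[OF s \<delta>(2)]
    proof eventually_elim
      case (elim n)
      have "N n = ennreal (1 / \<delta>) * (N n * ennreal \<delta>)"
      proof -
        have "ennreal (1 / \<delta>) * (N n * ennreal \<delta>) = N n * (ennreal (1 / \<delta>) * ennreal \<delta>)" by (simp add: ac_simps)
        also have "ennreal (1 / \<delta>) * ennreal \<delta> = 1" using \<delta>(1) by (simp flip: ennreal_mult)
        finally show ?thesis by simp
      qed
      also have "\<dots> \<le> ennreal (1 / \<delta>) * (N n * s n)"
        using elim by (intro mult_left_mono) auto
      also have "\<dots> \<le> ennreal (1 / \<delta>) * (osc ?B (e n) + b * \<mu> n)"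
        by (intro mult_left_mono key) simp
      finally show ?case .
    qed
    have "(\<lambda>n. ennreal (1 / \<delta>) * (osc ?B (e n) + b * \<mu> n)) \<longlonglongrightarrow> ennreal (1 / \<delta>) * 0"
      by (rule ennreal_tendsto_cmult[OF _ t]) simp
    then show "(\<lambda>n. ennreal (1 / \<delta>) * (osc ?B (e n) + b * \<mu> n)) \<longlonglongrightarrow> 0" by simp
  qed simp_all
  then show ?thesis unfolding N_def .
qed

lemma pnorm_1_Un:
  assumes [measurable]: "u \<in> Borel" "C \<in> sets borel" "D \<in> sets borel"
  shows "pnorm 1 (\<lambda>z. ind (C \<union> D) z * u z) \<le> pnorm 1 (\<lambda>z. ind C z * u z) + pnorm 1 (\<lambda>z. ind D z * u z)"
  unfolding pnorm_1 by (subst nn_integral_add[symmetric]) (auto intro!: nn_integral_mono simp: indicator_def)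

lemma pnorm_1_tendsto_compact:
  assumes X: "open X" and [measurable]: "\<And>n. e n \<in> Borel"
    and balls: "\<And>z0 r. r > 0 \<Longrightarrow> cball z0 r \<subseteq> X \<Longrightarrow> (\<lambda>n. pnorm 1 (\<lambda>z. ind (cball z0 r) z * e n z)) \<longlonglongrightarrow> 0"
    and C: "compact C" "C \<subseteq> X"
  shows "(\<lambda>n. pnorm 1 (\<lambda>z. ind C z * e n z)) \<longlonglongrightarrow> 0"
proof -
  define P where "P S \<longleftrightarrow> S \<in> sets borel \<and> (\<lambda>n. pnorm 1 (\<lambda>z. ind S z * e n z)) \<longlonglongrightarrow> 0" for S :: "complex set"
  have sub: "(\<lambda>n. pnorm 1 (\<lambda>z. ind S z * e n z)) \<longlonglongrightarrow> 0" if "P T" "S \<subseteq> T" for S T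
  proof (rule tendsto_sandwich[of "\<lambda>_. 0" _ _ "\<lambda>n. pnorm 1 (\<lambda>z. ind T z * e n z)"])
    show "\<forall>\<^sub>F n in sequentially. pnorm 1 (\<lambda>z. ind S z * e n z) \<le> pnorm 1 (\<lambda>z. ind T z * e n z)"
      using that(2) by (intro always_eventually allI pnorm_mono) (auto simp: indicator_def)
  qed (use that(1) in \<open>auto simp: P_def\<close>)
  have Un: "P (S \<union> T)" if "P S" "P T" for S T
    unfolding P_def
  proof
    have [measurable]: "S \<in> sets borel" "T \<in> sets borel" using that by (auto simp: P_def)
    show "S \<union> T \<in> sets borel" by simp
    have "(\<lambda>n. pnorm 1 (\<lambda>z. ind S z * e n z) + pnorm 1 (\<lambda>z. ind T z * e n z)) \<longlonglongrightarrow> 0 + 0"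
      using that unfolding P_def by (intro tendsto_add) blast+
    then have l: "(\<lambda>n. pnorm 1 (\<lambda>z. ind S z * e n z) + pnorm 1 (\<lambda>z. ind T z * e n z)) \<longlonglongrightarrow> 0" by simp
    show "(\<lambda>n. pnorm 1 (\<lambda>z. ind (S \<union> T) z * e n z)) \<longlonglongrightarrow> 0"
      by (rule tendsto_sandwich[OF _ _ tendsto_const l])
        (intro always_eventually allI pnorm_1_Un zero_le; measurable)+
  qed
  have fin: "P (\<Union>z\<in>F. cball z (r z))" if "finite F" "\<And>z. z \<in> F \<Longrightarrow> P (cball z (r z))" for F and r :: "complex \<Rightarrow> real"
    using that
  proof (induction F rule: finite_induct)
    case empty
    show ?case unfolding P_def by (simp add: pnorm_def)
  next
    case (insert x F)
    then show ?case using Un[of "cball x (r x)"] by simp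
  qed
  have "\<exists>r>0. cball z r \<subseteq> X" if "z \<in> C" for z
    using X C(2) that open_contains_cball by blast
  then obtain r where r: "\<And>z. z \<in> C \<Longrightarrow> r z > 0 \<and> cball z (r z) \<subseteq> X" by metis
  obtain F where F: "F \<subseteq> C" "finite F" "C \<subseteq> (\<Union>z\<in>F. ball z (r z))"
    by (rule compactE_image[OF C(1), of C "\<lambda>z. ball z (r z)"]) (use r in auto)
  have "P (\<Union>z\<in>F. cball z (r z))"
    by (rule fin[OF F(2)]) (use r F(1) balls in \<open>auto simp: P_def\<close>)
  then show ?thesis
    by (rule sub) (use F(3) ball_subset_cball in blast)
qed

lemma Lp_plim:
  assumes C: "C \<in> sets borel" and u: "plim 1 C u v" "\<And>n. Lp 1 C (u n)"
  shows "Lp 1 C v"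
proof -
  note b = plim_borel[OF u(1)] plim_borel'[OF u(1)]
  note [measurable] = b C
  have "\<forall>\<^sub>F n in sequentially. pnorm 1 (\<lambda>z. ind C z * (u n z - v z)) < 1"
    using u(1) unfolding plim_def by (intro order_tendstoD(2)) auto
  then obtain n where n: "pnorm 1 (\<lambda>z. ind C z * (u n z - v z)) < 1"
    by (auto simp: eventually_sequentially)
  have d: "Lp 1 C (\<lambda>z. u n z - v z)"
    unfolding Lp_def using order_less_trans[OF n ennreal_one_less_top] by simp
  have "Lp 1 C (\<lambda>z. u n z - (u n z - v z))" by (rule Lp_diff[OF _ C u(2) d]) simp
  then show ?thesis by simp
qed

text \<open>No control on the limit function itself is assumed: Poincare's inequality turns the
  convergence of the gradients into that of the functions.\<close>

lemma wgrad_closure: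
  assumes X: "open X" and w: "\<And>n. wgrad X (h n) (g n) (k n)"
    and h': "h' \<in> Borel" "AE z\<in>X in lborel. (\<lambda>n. h n z) \<longlonglongrightarrow> h' z"
    and gk: "\<And>C. compact C \<Longrightarrow> C \<subseteq> X \<Longrightarrow> plim 1 C g g'" "\<And>C. compact C \<Longrightarrow> C \<subseteq> X \<Longrightarrow> plim 1 C k k'"
    and L: "Lploc 1 X g'" "Lploc 1 X k'"
  shows "wgrad X h' g' k'"
proof -
  note bor = wgrad_Lploc[OF w, THEN Lploc_borel] L[THEN Lploc_borel] h'(1)
  note [measurable] = bor
  have ball: "(\<lambda>n. pnorm 1 (\<lambda>z. ind (cball z0 r) z * (h n z - h' z))) \<longlonglongrightarrow> 0"
    if B: "r > 0" "cball z0 r \<subseteq> X" for z0 r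
  proof (rule osc_small_imp_pnorm_small)
    show "AE z\<in>cball z0 r in lborel. (\<lambda>n. h n z - h' z) \<longlonglongrightarrow> 0"
      using h'(2) by eventually_elim (use B(2) LIM_zero in blast)
    let ?B = "cball z0 r"
    have [measurable]: "?B \<in> sets borel" by simp
    define c where "c = ennreal (8 * r) * emeasure lborel ?B"
    have cfin: "c < \<infinity>"
      unfolding c_def by (simp add: ennreal_mult_less_top emeasure_lborel_cball_finite[unfolded infinity_ennreal_def])
    define G where "G n = pnorm 1 (\<lambda>z. ind ?B z * (g n z - g' z))" for n
    define H where "H n = pnorm 1 (\<lambda>z. ind ?B z * (k n z - k' z))" for n
    have GH: "G \<longlonglongrightarrow> 0" "H \<longlonglongrightarrow> 0"
      using gk[OF compact_cball B(2)] unfolding plim_def G_def[abs_def] H_def[abs_def] by blast+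
    have two: "pnorm 1 (\<lambda>z. ind ?B z * (u z - v z))
        \<le> 2 * pnorm 1 (\<lambda>z. ind ?B z * (u z - x z)) + 2 * pnorm 1 (\<lambda>z. ind ?B z * (v z - x z))"
      if [measurable]: "u \<in> Borel" "v \<in> Borel" "x \<in> Borel" for u v x
    proof -
      have "pnorm 1 (\<lambda>z. ind ?B z * (u z - v z))
          = pnorm 1 (\<lambda>z. ind ?B z * (u z - x z) + (-1) * (ind ?B z * (v z - x z)))"
        by (simp add: algebra_simps)
      also have "\<dots> \<le> 2 * pnorm 1 (\<lambda>z. ind ?B z * (u z - x z)) + 2 * pnorm 1 (\<lambda>z. (-1) * (ind ?B z * (v z - x z)))"
        by (rule pnorm_add_le) auto
      also have "pnorm 1 (\<lambda>z. (-1) * (ind ?B z * (v z - x z))) = pnorm 1 (\<lambda>z. ind ?B z * (v z - x z))"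
        by (subst pnorm_cmult) auto
      finally show ?thesis .
    qed
    \<comment> \<open>For fixed n, Poincare's inequality bounds the oscillation of h n - h m by the
      gradients; Fatou's lemma lets m tend to infinity and replaces h m by the limit.\<close>
    have le: "osc ?B (\<lambda>z. h n z - h' z) \<le> c * (2 * G n + 2 * H n)" for n
    proof -
      have "osc ?B (\<lambda>z. h n z - h' z) \<le> liminf (\<lambda>m. osc ?B (\<lambda>z. h n z - h m z))"
      proof (rule osc_Fatou)
        show "AE z\<in>?B in lborel. (\<lambda>m. h n z - h m z) \<longlonglongrightarrow> h n z - h' z"
          using h'(2) by eventually_elim (use B(2) tendsto_diff[OF tendsto_const] in blast)
      qed measurable
      also have "\<dots> \<le> liminf (\<lambda>m. c * ((2 * G n + 2 * G m) + (2 * H n + 2 * H m)))"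
      proof (rule Liminf_mono, intro always_eventually allI)
        fix m
        have "osc ?B (\<lambda>z. h n z - h m z) \<le> c * (pnorm 1 (\<lambda>z. ind ?B z * (g n z - g m z)) + pnorm 1 (\<lambda>z. ind ?B z * (k n z - k m z)))"
          unfolding c_def by (rule poincare[OF X wgrad_diff[OF w w] B(2,1)])
        also have "\<dots> \<le> c * ((2 * G n + 2 * G m) + (2 * H n + 2 * H m))"
          unfolding G_def H_def by (intro mult_left_mono add_mono two) auto
        finally show "osc ?B (\<lambda>z. h n z - h m z) \<le> c * ((2 * G n + 2 * G m) + (2 * H n + 2 * H m))" .
      qed
      also have "\<dots> = c * ((2 * G n + 2 * 0) + (2 * H n + 2 * 0))"
        using cfin by (intro lim_imp_Liminf ennreal_tendsto_cmult tendsto_add tendsto_const GH) auto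
      finally show ?thesis by simp
    qed
    have "(\<lambda>n. c * (2 * G n + 2 * H n)) \<longlonglongrightarrow> c * (2 * 0 + 2 * 0)"
      using cfin by (intro ennreal_tendsto_cmult tendsto_add GH) auto
    then have t: "(\<lambda>n. c * (2 * G n + 2 * H n)) \<longlonglongrightarrow> 0" by simp
    show "(\<lambda>n. osc ?B (\<lambda>z. h n z - h' z)) \<longlonglongrightarrow> 0"
      by (rule tendsto_sandwich[OF _ _ tendsto_const t]) (use le in auto)
  qed (use B in simp_all)
  have p: "plim 1 C h h'" if "compact C" "C \<subseteq> X" for C
    unfolding plim_def using pnorm_1_tendsto_compact[OF X _ ball that] by simp
  have Lh: "Lploc 1 X h'"
    unfolding Lploc_def
  proof (intro conjI allI impI h'(1), elim conjE)
    fix C assume C: "compact C" "C \<subseteq> X"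
    show "Lp 1 C h'"
      by (rule Lp_plim[OF borel_compact[OF C(1)] p[OF C]]) (rule Lploc_Lp[OF wgrad_Lploc(1)[OF w] C])
  qed
  show ?thesis
    unfolding wgrad_def
  proof (intro conjI ballI Lh L)
    fix \<eta> assume \<eta>: "\<eta> \<in> test_functions X"
    then obtain S where s: "smooth \<eta>" and S: "compact S" "S \<subseteq> X" "\<forall>z. z \<notin> S \<longrightarrow> \<eta> z = 0"
      by (auto simp: test_functions_iff)
    have S': "\<forall>z. z \<notin> S \<longrightarrow> dir_deriv v \<eta> z = 0" for v
      using dir_deriv_eq_0_outside[OF compact_imp_closed[OF S(1)] S(3)] by blast
    have ct: "continuous_on S \<eta>" "continuous_on S (dir_deriv v \<eta>)" for v
      by (intro smooth_continuous_on smooth_dir_deriv s)+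
    have bt: "\<eta> \<in> Borel" "dir_deriv v \<eta> \<in> Borel" for v
      by (intro smooth_borel smooth_dir_deriv s)+
    note lim = plim_test_integral[OF S(1) ct(1) bt(1) S(3)] plim_test_integral[OF S(1) ct(2) bt(2) S']
    note Lw = Lploc_Lp[OF wgrad_Lploc(1)[OF w] S(1,2)] Lploc_Lp[OF wgrad_Lploc(2)[OF w] S(1,2)] Lploc_Lp[OF wgrad_Lploc(3)[OF w] S(1,2)]
    note L' = Lploc_Lp[OF Lh S(1,2)] Lploc_Lp[OF L(1) S(1,2)] Lploc_Lp[OF L(2) S(1,2)]
    note l1 = lim(2)[OF p[OF S(1,2)] Lw(1) L'(1)]
    show "(LBINT z. h' z * dx \<eta> z) = - (LBINT z. g' z * \<eta> z)"
      using l1[of 1] tendsto_minus[OF lim(1)[OF gk(1)[OF S(1,2)] Lw(2) L'(2)]]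
      unfolding wgrad_ibp[OF w \<eta>] by (rule LIMSEQ_unique)
    show "(LBINT z. h' z * dy \<eta> z) = - (LBINT z. k' z * \<eta> z)"
      using l1[of \<i>] tendsto_minus[OF lim(1)[OF gk(2)[OF S(1,2)] Lw(3) L'(3)]]
      unfolding wgrad_ibp[OF w \<eta>] by (rule LIMSEQ_unique)
  qed
qed

lemma wgrad_local:
  assumes X: "open X" and b: "f \<in> Borel" "g \<in> Borel" "h \<in> Borel"
    and loc: "\<And>C. compact C \<Longrightarrow> C \<subseteq> X \<Longrightarrow> \<exists>U. C \<subseteq> U \<and> U \<subseteq> X \<and> wgrad U f g h"
  shows "wgrad X f g h"
proof -
  have "Lploc 1 X f" "Lploc 1 X g" "Lploc 1 X h"
    unfolding Lploc_def using b
    by (intro conjI allI impI; use loc wgrad_Lploc Lploc_Lp in metis)+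
  moreover have "(LBINT z. f z * dx \<eta> z) = - (LBINT z. g z * \<eta> z) \<and>
      (LBINT z. f z * dy \<eta> z) = - (LBINT z. h z * \<eta> z)" if \<eta>: "\<eta> \<in> test_functions X" for \<eta>
  proof -
    obtain S where s: "smooth \<eta>" and S: "compact S" "S \<subseteq> X" "\<forall>z. z \<notin> S \<longrightarrow> \<eta> z = 0"
      using \<eta> by (auto simp: test_functions_iff)
    obtain U where U: "S \<subseteq> U" "U \<subseteq> X" "wgrad U f g h" using loc[OF S(1,2)] by blast
    have "\<eta> \<in> test_functions U" using s S U(1) by (auto simp: test_functions_iff)
    then show ?thesis using wgrad_ibp[OF U(3)] by blast
  qed
  ultimately show ?thesis unfolding wgrad_def by blast
qed

lemma plim_2_1:
  assumes C: "compact C" and "plim 2 C u v" "Lp 2 C v"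
  shows "plim 1 C u v"
  using plim_mult[OF borel_compact[OF C] assms(2,3), of "\<lambda>_ _. 1" "\<lambda>_. 1"] plim_const[of "\<lambda>_. 1" 2 C]
    Lp_bounded[OF C, of "\<lambda>_. 1" 1 2] by simp

lemma plim_AE_subseq:
  assumes C: "compact C" and u: "plim 1 C u v" "\<And>n. Lp 1 C (u n)"
  obtains r :: "nat \<Rightarrow> nat" where "strict_mono r" "AE z\<in>C in lborel. (\<lambda>n. u (r n) z) \<longlonglongrightarrow> v z"
proof -
  note Lv = Lp_plim[OF borel_compact[OF C] u]
  have iu: "integrable lborel (\<lambda>z. ind C z * u n z)" for n
    using u(2) Lp1_integrable[OF borel_compact[OF C]] by blast
  have iv: "integrable lborel (\<lambda>z. ind C z * v z)"
    using Lv Lp1_integrable[OF borel_compact[OF C]] by blast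
  define e where "e n z = ind C z * (u n z - v z)" for n z
  have ie: "integrable lborel (e n)" for n
    unfolding e_def right_diff_distrib by (intro Bochner_Integration.integrable_diff iu iv)
  have "(\<lambda>n. NNINT z. ennreal (norm (e n z))) \<longlonglongrightarrow> 0"
    using u(1) unfolding plim_def pnorm_def e_def by simp
  then have "(\<lambda>n. ennreal (LBINT z. norm (e n z))) \<longlonglongrightarrow> ennreal 0"
    by (subst nn_integral_eq_integral[symmetric]) (auto intro: ie integrable_norm)
  then have "(\<lambda>n. LBINT z. norm (e n z)) \<longlonglongrightarrow> 0"
    by (subst (asm) tendsto_ennreal_iff) auto
  then obtain r where r: "strict_mono r" "AE z in lborel. (\<lambda>n. e (r n) z) \<longlonglongrightarrow> 0"
    using tendsto_L1_AE_subseq[of lborel e, OF ie] by blast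
  show ?thesis
  proof (rule that[OF r(1)])
    show "AE z\<in>C in lborel. (\<lambda>n. u (r n) z) \<longlonglongrightarrow> v z"
      using r(2) by eventually_elim (auto simp: e_def LIM_zero_iff)
  qed
qed

section \<open>Composition of Sobolev functions with a quasiconformal homeomorphism\<close>

context qc_homeo
begin

text \<open>Quasi-invariance of the Dirichlet integral: the squares of c and d are at most K J, and
  J dz becomes Lebesgue measure on X'. The factor 2 comes from (x + y)^2 <= 2 x^2 + 2 y^2.\<close>

lemma comp_estimate:
  assumes [measurable]: "u \<in> Borel" "v \<in> Borel" "D \<in> sets borel"
    and c: "AE z\<in>X in lborel. (c z)\<^sup>2 \<le> K * J z" and d: "AE z\<in>X in lborel. (d z)\<^sup>2 \<le> K * J z"
    and C: "C \<subseteq> X" "\<And>z. z \<in> C \<Longrightarrow> \<Phi> z \<in> D" and D: "D \<subseteq> X'"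
  shows "pnorm 2 (\<lambda>z. ind C z * (comp2 u a b z * c z + comp2 v a b z * d z))
    \<le> ennreal (2 * K) * (pnorm 2 (\<lambda>w. ind D w * u w) + pnorm 2 (\<lambda>w. ind D w * v w))"
proof -
  define U where "U w = ennreal (2 * K) * (ennreal (\<bar>ind D w * u w\<bar>\<^sup>2) + ennreal (\<bar>ind D w * v w\<bar>\<^sup>2))" for w
  have [measurable]: "U \<in> Borel" unfolding U_def by measurable
  have "pnorm 2 (\<lambda>z. ind C z * (comp2 u a b z * c z + comp2 v a b z * d z)) \<le> (NNINT z. ind X z * (U (\<Phi> z) * ennreal (J z)))"
    unfolding pnorm_def
  proof (rule nn_integral_mono_AE)
    show "AE z in lborel. ennreal (\<bar>ind C z * (comp2 u a b z * c z + comp2 v a b z * d z)\<bar>\<^sup>2) \<le> ind X z * (U (\<Phi> z) * ennreal (J z))"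
      using c d J_nonneg
    proof eventually_elim
      case (elim z)
      show ?case
      proof (cases "z \<in> C")
        case True
        then have z: "z \<in> X" "\<Phi> z \<in> D" using C by auto
        let ?u = "u (\<Phi> z)" and ?v = "v (\<Phi> z)"
        have "(?u * c z + ?v * d z)\<^sup>2 \<le> 2 * (?u * c z)\<^sup>2 + 2 * (?v * d z)\<^sup>2"
          using abs_power_add_le[of 2 "?u * c z" "?v * d z"] by simp
        also have "\<dots> = 2 * (?u\<^sup>2 * (c z)\<^sup>2) + 2 * (?v\<^sup>2 * (d z)\<^sup>2)" by (simp add: power_mult_distrib)
        also have "\<dots> \<le> 2 * (?u\<^sup>2 * (K * J z)) + 2 * (?v\<^sup>2 * (K * J z))"
          using elim z by (intro add_mono mult_left_mono) auto
        also have "\<dots> = 2 * K * (?u\<^sup>2 + ?v\<^sup>2) * J z" by (simp add: algebra_simps)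
        finally have "ennreal ((?u * c z + ?v * d z)\<^sup>2) \<le> ennreal (2 * K * (?u\<^sup>2 + ?v\<^sup>2) * J z)" by (rule ennreal_leI)
        also have "\<dots> = ennreal (2 * K) * (ennreal (?u\<^sup>2) + ennreal (?v\<^sup>2)) * ennreal (J z)"
          using K elim z by (simp add: ennreal_mult ennreal_plus)
        finally show ?thesis using True z by (simp add: comp2_def U_def)
      qed simp
    qed
  qed
  also have "\<dots> = (NNINT w. ind X' w * U w)" by (rule cv_nn) measurable
  also have "\<dots> \<le> (NNINT w. U w)" by (rule nn_integral_mono) (auto simp: indicator_def)
  also have "\<dots> = ennreal (2 * K) * (pnorm 2 (\<lambda>w. ind D w * u w) + pnorm 2 (\<lambda>w. ind D w * v w))"
    unfolding U_def pnorm_def by (subst nn_integral_cmult, measurable, subst nn_integral_add, measurable)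
  finally show ?thesis .
qed

lemma compact_image:
  assumes "compact C" "C \<subseteq> X"
  shows "compact (\<phi> ` C)" "\<phi> ` C \<subseteq> X'"
  using assms \<phi>_in by (auto intro: compact_continuous_image continuous_on_subset[OF \<phi>_cont])

lemma comp_Lploc:
  assumes u: "Lploc 2 X' u" and v: "Lploc 2 X' v" and [measurable]: "c \<in> Borel" "d \<in> Borel"
    and cd: "AE z\<in>X in lborel. (c z)\<^sup>2 \<le> K * J z" "AE z\<in>X in lborel. (d z)\<^sup>2 \<le> K * J z"
  shows "Lploc 2 X (\<lambda>z. comp2 u a b z * c z + comp2 v a b z * d z)"
proof -
  note bor = Lploc_borel[OF u] Lploc_borel[OF v]
  note [measurable] = comp2_borel[OF bor(1) borel_ab] comp2_borel[OF bor(2) borel_ab]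
  show ?thesis
    unfolding Lploc_def Lp_def
  proof (intro conjI allI impI, measurable, elim conjE)
    fix C assume C: "compact C" "C \<subseteq> X"
    note D = compact_image[OF C]
    have "pnorm 2 (\<lambda>z. ind C z * (comp2 u a b z * c z + comp2 v a b z * d z))
        \<le> ennreal (2 * K) * (pnorm 2 (\<lambda>w. ind (\<phi> ` C) w * u w) + pnorm 2 (\<lambda>w. ind (\<phi> ` C) w * v w))"
    proof (rule comp_estimate[OF bor borel_compact[OF D(1)] cd C(2) _ D(2)])
      show "\<Phi> z \<in> \<phi> ` C" if "z \<in> C" for z using that C(2) ab[of z] by (metis imageI subsetD)
    qed
    also have "\<dots> < \<infinity>"
      using Lploc_Lp[OF u D] Lploc_Lp[OF v D] by (auto simp: Lp_def ennreal_mult_less_top)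
    finally show "pnorm 2 (\<lambda>z. ind C z * (comp2 u a b z * c z + comp2 v a b z * d z)) < \<infinity>" .
  qed
qed

lemma comp_plim:
  assumes u: "plim 2 D u u'" and v: "plim 2 D v v'" and [measurable]: "c \<in> Borel" "d \<in> Borel"
    and cd: "AE z\<in>X in lborel. (c z)\<^sup>2 \<le> K * J z" "AE z\<in>X in lborel. (d z)\<^sup>2 \<le> K * J z"
    and C: "C \<subseteq> X" "\<And>z. z \<in> C \<Longrightarrow> \<Phi> z \<in> D" and D: "D \<in> sets borel" "D \<subseteq> X'"
  shows "plim 2 C (\<lambda>n z. comp2 (u n) a b z * c z + comp2 (v n) a b z * d z) (\<lambda>z. comp2 u' a b z * c z + comp2 v' a b z * d z)"
proof -
  note bor = plim_borel[OF u] plim_borel'[OF u] plim_borel[OF v] plim_borel'[OF v]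
  note [measurable] = comp2_borel[OF bor(1) borel_ab] comp2_borel[OF bor(2) borel_ab] comp2_borel[OF bor(3) borel_ab] comp2_borel[OF bor(4) borel_ab] bor
  define R where "R n = ennreal (2 * K) * (pnorm 2 (\<lambda>w. ind D w * (u n w - u' w)) + pnorm 2 (\<lambda>w. ind D w * (v n w - v' w)))" for n
  have "R \<longlonglongrightarrow> ennreal (2 * K) * (0 + 0)"
    unfolding R_def using u v unfolding plim_def by (intro ennreal_tendsto_cmult tendsto_add) auto
  then have R: "R \<longlonglongrightarrow> 0" by simp
  have "(\<lambda>n. pnorm 2 (\<lambda>z. ind C z * ((comp2 (u n) a b z * c z + comp2 (v n) a b z * d z) - (comp2 u' a b z * c z + comp2 v' a b z * d z)))) \<longlonglongrightarrow> 0"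
  proof (rule tendsto_sandwich[OF _ _ tendsto_const R]; intro always_eventually allI zero_le)
    fix n
    have "pnorm 2 (\<lambda>z. ind C z * (comp2 (\<lambda>w. u n w - u' w) a b z * c z + comp2 (\<lambda>w. v n w - v' w) a b z * d z)) \<le> R n"
      unfolding R_def by (rule comp_estimate[OF _ _ D(1) cd C D(2)]) measurable
    then show "pnorm 2 (\<lambda>z. ind C z * ((comp2 (u n) a b z * c z + comp2 (v n) a b z * d z) - (comp2 u' a b z * c z + comp2 v' a b z * d z))) \<le> R n"
      by (simp add: comp2_def algebra_simps)
  qed
  then show ?thesis unfolding plim_def by auto
qed

text \<open>Mollify f on \<phi>(D). Smooth functions obey the chain rule, their gradients converge
  in L2 after composition by \<open>comp_plim\<close>, and a subsequence that converges almost
  everywhere still does so by \<open>null_preimage\<close>. This is all that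
  \<open>wgrad_closure\<close> asks for.\<close>

lemma comp_W12:
  assumes f: "W12 X' f f1 f2"
  shows "W12 X (comp2 f a b) (\<lambda>z. comp2 f1 a b z * a1 z + comp2 f2 a b z * b1 z) (\<lambda>z. comp2 f1 a b z * a2 z + comp2 f2 a b z * b2 z)"
    (is "W12 X _ ?g ?h")
proof -
  note L = f[unfolded W12_def]
  have wf: "wgrad X' f f1 f2" and L1: "Lploc 2 X' f1" and L2: "Lploc 2 X' f2" using L by auto
  have G: "Lploc 2 X ?g" "Lploc 2 X ?h"
    by (rule comp_Lploc[OF L1 L2 borel_grad(1,3) grad_small(1,3)] comp_Lploc[OF L1 L2 borel_grad(2,4) grad_small(2,4)])+
  have fb: "f \<in> Borel" using wgrad_Lploc(1)[OF wf] by (rule Lploc_borel)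
  have "wgrad X (comp2 f a b) ?g ?h"
  proof (rule wgrad_local[OF op(1) comp2_borel[OF fb borel_ab] Lploc_borel[OF G(1)] Lploc_borel[OF G(2)]])
    fix C assume C: "compact C" "C \<subseteq> X"
    obtain d D where D0: "d > 0" "compact D" "D \<subseteq> X" "\<And>z w. z \<in> C \<Longrightarrow> dist z w < d \<Longrightarrow> w \<in> D" "C \<subseteq> interior D"
      by (rule compact_nbhd[OF C(1) op(1) C(2)]) blast
    note D = D0(2,3,5)
    have ID: "interior D \<subseteq> X" using interior_subset D(2) by blast
    note E = compact_image[OF D(1,2)]
    obtain F where F: "\<And>n. sym_smooth (F n)" "plim 1 (\<phi> ` D) F f"
      "plim 2 (\<phi> ` D) (\<lambda>n. dx (F n)) f1" "plim 2 (\<phi> ` D) (\<lambda>n. dy (F n)) f2"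
      using wgrad_approx[OF op(2) wf E] L1 L2 by blast
    have s: "smooth (F n)" for n using F(1) by (simp add: sym_smooth_def)
    obtain r :: "nat \<Rightarrow> nat" where r: "strict_mono r" "AE w in lborel. w \<in> \<phi> ` D \<longrightarrow> (\<lambda>n. F (r n) w) \<longlonglongrightarrow> f w"
      by (rule plim_AE_subseq[OF E(1) F(2) Lp_smooth[OF s E(1)]]) simp
    have sub: "plim 2 S (\<lambda>n. U (r n)) V" if "plim 2 S U V" for S U V
      using that LIMSEQ_subseq_LIMSEQ[OF _ r(1)] unfolding plim_def comp_def by blast
    have lim: "AE z\<in>X in lborel. (\<Phi> z \<in> \<phi> ` D \<longrightarrow> (\<lambda>n. F (r n) (\<Phi> z)) \<longlonglongrightarrow> f (\<Phi> z))"
      by (rule null_preimage) (use r(2) in eventually_elim, blast)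
    have pl: "plim 2 D (\<lambda>n z. comp2 (dx (F (r n))) a b z * c z + comp2 (dy (F (r n))) a b z * d z)
        (\<lambda>z. comp2 f1 a b z * c z + comp2 f2 a b z * d z)"
      if "c \<in> Borel" "d \<in> Borel"
        "AE z\<in>X in lborel. (c z)\<^sup>2 \<le> K * J z" "AE z\<in>X in lborel. (d z)\<^sup>2 \<le> K * J z" for c d
    proof (rule comp_plim[OF sub[OF F(3)] sub[OF F(4)] that D(2) _ borel_compact[OF E(1)] E(2)])
      show "\<Phi> z \<in> \<phi> ` D" if "z \<in> D" for z using that D(2) ab[of z] by (metis imageI subsetD)
    qed
    have p1: "plim 1 S U V" if "plim 2 D U V" "Lploc 2 X V" "compact S" "S \<subseteq> interior D" for S U V
    proof (rule plim_2_1[OF that(3)])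
      show "plim 2 S U V" by (rule plim_subset[OF that(1)]) (use that(4) interior_subset in blast)
      show "Lp 2 S V" by (rule Lploc_Lp[OF that(2,3)]) (use that(4) ID in blast)
    qed
    have "wgrad (interior D) (comp2 f a b) ?g ?h"
    proof (rule wgrad_closure[OF open_interior wgrad_subset[OF wgrad_chain[OF op(1) s wg(1) a_cont wg(2) b_cont] ID] comp2_borel[OF fb borel_ab]])
      show "AE z in lborel. z \<in> interior D \<longrightarrow> (\<lambda>n. comp2 (F (r n)) a b z) \<longlonglongrightarrow> comp2 f a b z"
        using lim
      proof eventually_elim
        case (elim z)
        show ?case
        proof
          assume "z \<in> interior D"
          then have "z \<in> D" "z \<in> X" using interior_subset ID by blast+
          then show "(\<lambda>n. comp2 (F (r n)) a b z) \<longlonglongrightarrow> comp2 f a b z"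
            using elim ab[of z] unfolding comp2_def by (metis imageI)
        qed
      qed
      show "plim 1 S (\<lambda>n z. comp2 (dx (F (r n))) a b z * a1 z + comp2 (dy (F (r n))) a b z * b1 z) ?g"
        if "compact S" "S \<subseteq> interior D" for S
        by (rule p1[OF pl[OF borel_grad(1,3) grad_small(1,3)] G(1) that])
      show "plim 1 S (\<lambda>n z. comp2 (dx (F (r n))) a b z * a2 z + comp2 (dy (F (r n))) a b z * b2 z) ?h"
        if "compact S" "S \<subseteq> interior D" for S
        by (rule p1[OF pl[OF borel_grad(2,4) grad_small(2,4)] G(2) that])
      show "Lploc 1 (interior D) ?g" "Lploc 1 (interior D) ?h"
        using Lploc_subset[OF Lploc_2_1[OF G(1)] ID] Lploc_subset[OF Lploc_2_1[OF G(2)] ID] by blast+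
    qed
    then show "\<exists>U. C \<subseteq> U \<and> U \<subseteq> X \<and> wgrad U (comp2 f a b) ?g ?h" using D(3) ID by blast
  qed
  then show ?thesis unfolding W12_def using G by blast
qed

end

section \<open>Borel representatives\<close>

text \<open>The spaces are defined through completed measures; the analysis takes place with Borel functions
  on \<open>lborel\<close> that agree with the given ones almost everywhere.\<close>

definition borel_rep :: "complex set \<Rightarrow> (complex \<Rightarrow> real) \<Rightarrow> (complex \<Rightarrow> real) \<Rightarrow> bool" where
  "borel_rep X f f' \<longleftrightarrow> f' \<in> Borel \<and> (AE z\<in>X in lborel. f z = f' z)"

lemma borel_measurable_lebesgue_cong:
  fixes f g :: "complex \<Rightarrow> real"
  assumes g: "g \<in> Borel" and eq: "AE z in lborel. f z = g z"
  shows "f \<in> borel_measurable lebesgue"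
proof (rule measurableI)
  fix A :: "real set" assume A: "A \<in> sets borel"
  have B: "g -` A \<inter> space lebesgue \<in> sets lebesgue"
    using measurable_sets[OF measurable_completion[of g lborel borel] A] g by simp
  show "f -` A \<inter> space lebesgue \<in> sets lebesgue"
  proof (rule completion.in_sets_AE[OF _ B])
    show "AE z in lebesgue. z \<in> g -` A \<inter> space lebesgue \<longleftrightarrow> z \<in> f -` A \<inter> space lebesgue"
      unfolding AE_completion_iff using eq by eventually_elim simp
  qed simp
qed simp

lemma set_integral_borel_rep:
  assumes r: "borel_rep X f f'" and S: "S \<in> sets borel" "S \<subseteq> X"
  shows "(LINT z:S|lebesgue. f z) = (LBINT z. ind S z * f' z)"
    and "set_integrable lebesgue S f \<longleftrightarrow> integrable lborel (\<lambda>z. ind S z * f' z)"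
proof -
  have [measurable]: "f' \<in> Borel" "S \<in> sets borel" using r S by (auto simp: borel_rep_def)
  have b: "(\<lambda>z. ind S z * f' z) \<in> Borel" by measurable
  have eq: "AE z in lborel. ind S z *\<^sub>R f z = ind S z * f' z"
    using r[unfolded borel_rep_def, THEN conjunct2] by eventually_elim (use S(2) in \<open>auto simp: indicator_def\<close>)
  note m = borel_measurable_lebesgue_cong[OF b eq]
  have m': "(\<lambda>z. ind S z * f' z) \<in> borel_measurable lebesgue"
    by (rule measurable_completion) simp
  have eq': "AE z in lebesgue. ind S z *\<^sub>R f z = ind S z * f' z"
    using eq unfolding AE_completion_iff .
  show "(LINT z:S|lebesgue. f z) = (LBINT z. ind S z * f' z)"
    unfolding set_lebesgue_integral_def using integral_cong_AE[OF m m' eq'] b by (simp add: integral_completion)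
  show "set_integrable lebesgue S f \<longleftrightarrow> integrable lborel (\<lambda>z. ind S z * f' z)"
    unfolding set_integrable_def using integrable_cong_AE[OF m m' eq'] b by (simp add: integrable_completion)
qed

lemma borel_rep_exists:
  assumes X: "open X" and f: "(\<lambda>z. ind X z * f z) \<in> borel_measurable lebesgue"
  shows "\<exists>f'. borel_rep X f f'"
proof -
  obtain f' where f': "f' \<in> borel_measurable lborel" "AE z in lborel. ind X z * f z = f' z"
    using completion_ex_borel_measurable_real[OF f] by blast
  have "AE z\<in>X in lborel. f z = f' z"
    using f'(2) by eventually_elim (auto simp: indicator_def)
  then show ?thesis using f'(1) by (auto simp: borel_rep_def)
qed

text \<open>Local integrability yields measurability on compact subsets only; an exhaustion of X by
  compact sets extends it and provides the Borel representative.\<close>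

lemma locally_integrable_borel_rep:
  assumes X: "open X"
  shows "locally_integrable X f \<longleftrightarrow> (\<exists>f'. borel_rep X f f' \<and> Lploc 1 X f')"
    and "borel_rep X f f' \<Longrightarrow> locally_integrable X f \<longleftrightarrow> Lploc 1 X f'"
proof -
  show *: "locally_integrable X f \<longleftrightarrow> Lploc 1 X f'" if r: "borel_rep X f f'" for f'
  proof -
    have "set_integrable lebesgue C f \<longleftrightarrow> Lp 1 C f'" if "compact C" "C \<subseteq> X" for C
      using set_integral_borel_rep(2)[OF r borel_compact[OF that(1)] that(2)] Lp1_integrable[OF borel_compact[OF that(1)]] r
      unfolding borel_rep_def by blast
    then show ?thesis
      unfolding locally_integrable_def Lploc_def using r unfolding borel_rep_def by blast
  qed
  have "\<exists>f'. borel_rep X f f'" if l: "locally_integrable X f"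
  proof (rule borel_rep_exists[OF X])
    obtain C where C: "\<And>n. compact (C n)" "\<And>n. C n \<subseteq> X" "\<And>n. C n \<subseteq> interior (C (Suc n))" "\<Union>(range C) = X"
      by (rule open_Union_compact_subsets[OF X]) blast
    have inc: "C n \<subseteq> C m" if "n \<le> m" for n m
      by (rule lift_Suc_mono_le[OF _ that]) (use C(3) interior_subset in blast)
    show "(\<lambda>z. ind X z * f z) \<in> borel_measurable lebesgue"
    proof (rule borel_measurable_LIMSEQ_real)
      show "(\<lambda>z. ind (C n) z * f z) \<in> borel_measurable lebesgue" for n
        using l C(1,2) unfolding locally_integrable_def set_integrable_def by (auto dest!: spec[of _ "C n"])
      show "(\<lambda>n. ind (C n) z * f z) \<longlonglongrightarrow> ind X z * f z" for z
      proof (cases "z \<in> X")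
        case True
        then obtain N where N: "z \<in> C N" using C(4) by blast
        then have "\<forall>\<^sub>F n in sequentially. ind (C n) z * f z = ind X z * f z"
          unfolding eventually_sequentially
        proof (intro exI[of _ N] allI impI)
          fix n assume "N \<le> n"
          then have "z \<in> C n" using inc N by blast
          then show "ind (C n) z * f z = ind X z * f z" using True by simp
        qed
        then show ?thesis by (rule tendsto_eventually)
      next
        case False
        then have "z \<notin> C n" for n using C(2) by blast
        then show ?thesis using False by simp
      qed
    qed
  qed
  then show "locally_integrable X f \<longleftrightarrow> (\<exists>f'. borel_rep X f f' \<and> Lploc 1 X f')"
    using * by blast
qed

lemma borel_rep_Lploc_exists:
  assumes "open X" "locally_integrable X f"
  obtains f' where "borel_rep X f f'" "Lploc 1 X f'"
  using locally_integrable_borel_rep(1)[OF assms(1)] assms(2) by blast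

lemma is_weak_gradient_borel_rep:
  fixes G :: "complex \<Rightarrow> real^2"
  assumes X: "open X" and f: "borel_rep X f f'" and g: "borel_rep X (\<lambda>z. G z $ 1) g" and h: "borel_rep X (\<lambda>z. G z $ 2) h"
  shows "locally_integrable X f \<and> is_weak_gradient X f G \<longleftrightarrow> wgrad X f' g h"
proof -
  have int: "(LINT z:X|lebesgue. u z * k z) = (LBINT z. u' z * k z)"
    if u: "borel_rep X u u'" and k: "k \<in> Borel" "\<And>z. z \<notin> X \<Longrightarrow> k z = 0" for u u' k
  proof -
    have "borel_rep X (\<lambda>z. u z * k z) (\<lambda>z. u' z * k z)"
      using u k(1) unfolding borel_rep_def by auto
    then have "(LINT z:X|lebesgue. u z * k z) = (LBINT z. ind X z * (u' z * k z))"
      by (rule set_integral_borel_rep(1)) (use X in auto)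
    also have "\<dots> = (LBINT z. u' z * k z)"
      by (rule integral_indicator_absorb) (use k(2) in blast)
    finally show ?thesis .
  qed
  have t: "\<eta> \<in> Borel" "dir_deriv v \<eta> \<in> Borel" if "\<eta> \<in> test_functions X" for \<eta> v
    using that by (auto simp: test_functions_iff intro!: smooth_borel smooth_dir_deriv)
  have i: "(\<forall>\<eta>\<in>test_functions X.
        (LINT z:X|lebesgue. f z * dir_deriv 1 \<eta> z) = - (LINT z:X|lebesgue. G z $ 1 * \<eta> z) \<and>
        (LINT z:X|lebesgue. f z * dir_deriv \<i> \<eta> z) = - (LINT z:X|lebesgue. G z $ 2 * \<eta> z)) \<longleftrightarrow>
      (\<forall>\<eta>\<in>test_functions X.
       (LBINT z. f' z * dx \<eta> z) = - (LBINT z. g z * \<eta> z) \<and>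
       (LBINT z. f' z * dy \<eta> z) = - (LBINT z. h z * \<eta> z))"
    using int[OF f t(2)] int[OF g t(1)] int[OF h t(1)] test_zero_outside by (intro ball_cong refl) simp
  show ?thesis
    unfolding is_weak_gradient_def wgrad_def i forall_2 locally_integrable_borel_rep(2)[OF X f]
      locally_integrable_borel_rep(2)[OF X g] locally_integrable_borel_rep(2)[OF X h] by blast
qed

lemma weakly_differentiable_borel_rep:
  assumes X: "open X" and w: "weakly_differentiable X f" and f: "borel_rep X f f'"
  obtains g h where "wgrad X f' g h" "borel_rep X (\<lambda>z. weak_gradient X f z $ 1) g" "borel_rep X (\<lambda>z. weak_gradient X f z $ 2) h"
proof -
  have l: "locally_integrable X f" and G: "is_weak_gradient X f (weak_gradient X f)"
    using w someI_ex[of "is_weak_gradient X f"] unfolding weakly_differentiable_def weak_gradient_def by auto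
  then have "locally_integrable X (\<lambda>z. weak_gradient X f z $ i)" for i unfolding is_weak_gradient_def by blast
  then obtain g h where gh: "borel_rep X (\<lambda>z. weak_gradient X f z $ 1) g" "borel_rep X (\<lambda>z. weak_gradient X f z $ 2) h"
    using borel_rep_Lploc_exists[OF X] by metis
  then show ?thesis using is_weak_gradient_borel_rep[OF X f gh] l G that by blast
qed

text \<open>\<open>weak_gradient\<close> is chosen by \<open>SOME\<close>; by
  \<open>wgrad_unique\<close> the choice agrees almost everywhere with any Borel weak gradient at
  hand, which may therefore be used to compute seminorms.\<close>

lemma weak_gradient_borel_rep:
  assumes X: "open X" and f: "borel_rep X f f'" and w: "wgrad X f' g h"
  shows "weakly_differentiable X f"
    and "borel_rep X (\<lambda>z. weak_gradient X f z $ 1) g" "borel_rep X (\<lambda>z. weak_gradient X f z $ 2) h"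
proof -
  note L = wgrad_Lploc[OF w]
  define G :: "complex \<Rightarrow> real^2" where "G z = vector [g z, h z]" for z
  have "borel_rep X (\<lambda>z. G z $ 1) g" "borel_rep X (\<lambda>z. G z $ 2) h"
    using L Lploc_borel by (auto simp: borel_rep_def G_def)
  then show wd: "weakly_differentiable X f"
    unfolding weakly_differentiable_def using is_weak_gradient_borel_rep[OF X f] w by blast
  obtain g' h' where gh: "wgrad X f' g' h'" "borel_rep X (\<lambda>z. weak_gradient X f z $ 1) g'" "borel_rep X (\<lambda>z. weak_gradient X f z $ 2) h'"
    by (rule weakly_differentiable_borel_rep[OF X wd f])
  have eq: "AE z\<in>X in lborel. g z = g' z \<and> h z = h' z"
    by (rule wgrad_unique[OF X w gh(1)]) simp
  have r: "borel_rep X u v" if "borel_rep X u v'" "AE z\<in>X in lborel. v z = v' z" "v \<in> Borel" for u v v'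
    using that(3) unfolding borel_rep_def
  proof
    show "AE z\<in>X in lborel. u z = v z"
      using that(1)[unfolded borel_rep_def, THEN conjunct2] that(2) by eventually_elim simp
  qed
  show "borel_rep X (\<lambda>z. weak_gradient X f z $ 1) g"
    by (rule r[OF gh(2) AE_mp[OF eq] Lploc_borel[OF L(2)]]) simp
  show "borel_rep X (\<lambda>z. weak_gradient X f z $ 2) h"
    by (rule r[OF gh(3) AE_mp[OF eq] Lploc_borel[OF L(3)]]) simp
qed

section \<open>The matrix field and its quadratic form\<close>

lemma norm_vec2: "(norm (v :: real^2))\<^sup>2 = (v $ 1)\<^sup>2 + (v $ 2)\<^sup>2"
  unfolding power2_norm_eq_inner by (simp add: inner_vec_def sum_2 power2_eq_square)

definition qform :: "real \<Rightarrow> real \<Rightarrow> real \<Rightarrow> real \<Rightarrow> real \<Rightarrow> real" where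
  "qform \<alpha> \<beta> \<gamma> x y = \<alpha> * x\<^sup>2 + 2 * \<beta> * x * y + \<gamma> * y\<^sup>2"

lemma qform_matrix:
  fixes M :: "real^2^2"
  assumes "M $ 2 $ 1 = M $ 1 $ 2"
  shows "(M *v v) \<bullet> v = qform (M $ 1 $ 1) (M $ 1 $ 2) (M $ 2 $ 2) (v $ 1) (v $ 2)"
  using assms by (simp add: inner_vec_def matrix_vector_mult_def sum_2 qform_def power2_eq_square algebra_simps)

lemma AE_lebesgue_on_borel:
  assumes "S \<in> sets borel"
  shows "(AE z in lebesgue_on S. P z) \<longleftrightarrow> (AE z in lborel. z \<in> (S::complex set) \<longrightarrow> P z)"
  using assms by (subst AE_restrict_space_iff) (auto simp: AE_completion_iff)

text \<open>The quantifier over x and y sits inside the almost-everywhere statement, so that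
  ellipticity can be applied to gradients, which depend on z.\<close>

locale matrix_field =
  fixes X :: "complex set" and A :: "complex \<Rightarrow> real^2^2" and \<alpha> \<beta> \<gamma> :: "complex \<Rightarrow> real" and k :: real
  assumes op: "open X"
    and sym: "\<And>z. z \<in> X \<Longrightarrow> A z $ 2 $ 1 = A z $ 1 $ 2"
    and rep: "borel_rep X (\<lambda>z. A z $ 1 $ 1) \<alpha>" "borel_rep X (\<lambda>z. A z $ 1 $ 2) \<beta>" "borel_rep X (\<lambda>z. A z $ 2 $ 2) \<gamma>"
    and det: "AE z\<in>X in lborel. \<alpha> z * \<gamma> z - \<beta> z * \<beta> z = 1"
    and k: "k \<ge> 1"
    and elliptic: "AE z\<in>X in lborel. (\<forall>x y.
      (x\<^sup>2 + y\<^sup>2) / k \<le> qform (\<alpha> z) (\<beta> z) (\<gamma> z) x y \<and> qform (\<alpha> z) (\<beta> z) (\<gamma> z) x y \<le> k * (x\<^sup>2 + y\<^sup>2))"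

lemma M22_matrix_field:
  assumes X: "open X" and A: "A \<in> M22 X"
  obtains \<alpha> \<beta> \<gamma> k where "matrix_field X A \<alpha> \<beta> \<gamma> k"
proof -
  have [measurable]: "X \<in> sets borel" using X by auto
  have sym: "A z $ 2 $ 1 = A z $ 1 $ 2" if "z \<in> X" for z
  proof -
    have "transpose (A z) = A z" using A that by (auto simp: M22_def)
    then have "transpose (A z) $ 1 $ 2 = A z $ 1 $ 2" by simp
    then show ?thesis by (simp add: transpose_def)
  qed
  have "\<exists>f'. borel_rep X (\<lambda>z. A z $ i $ j) f'" for i j
  proof (rule borel_rep_exists[OF X])
    have m: "(\<lambda>z. A z $ i $ j) \<in> borel_measurable (lebesgue_on X)" using A by (simp add: M22_def)
    show "(\<lambda>z. ind X z * (A z $ i $ j)) \<in> borel_measurable lebesgue"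
      using m by (subst (asm) borel_measurable_restrict_space_iff) auto
  qed
  then obtain \<alpha> \<beta> \<gamma> where r: "borel_rep X (\<lambda>z. A z $ 1 $ 1) \<alpha>" "borel_rep X (\<lambda>z. A z $ 1 $ 2) \<beta>" "borel_rep X (\<lambda>z. A z $ 2 $ 2) \<gamma>"
    by metis
  note r' = r[unfolded borel_rep_def, THEN conjunct2]
  have "\<exists>k\<ge>1. AE z in lebesgue_on X. \<forall>\<xi>. 1 / k * (norm \<xi>)\<^sup>2 \<le> (A z *v \<xi>) \<bullet> \<xi> \<and> (A z *v \<xi>) \<bullet> \<xi> \<le> k * (norm \<xi>)\<^sup>2"
    and d: "AE z in lebesgue_on X. det (A z) = 1"
    using A by (auto simp: M22_def)
  then obtain k where k: "k \<ge> 1" "AE z in lebesgue_on X. \<forall>\<xi>. 1 / k * (norm \<xi>)\<^sup>2 \<le> (A z *v \<xi>) \<bullet> \<xi> \<and> (A z *v \<xi>) \<bullet> \<xi> \<le> k * (norm \<xi>)\<^sup>2"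
    by blast
  have "matrix_field X A \<alpha> \<beta> \<gamma> k"
  proof
    show "AE z\<in>X in lborel. \<alpha> z * \<gamma> z - \<beta> z * \<beta> z = 1"
      using d r' unfolding AE_lebesgue_on_borel[OF \<open>X \<in> sets borel\<close>]
      by eventually_elim (auto simp: det_2 sym)
    show "AE z\<in>X in lborel. (\<forall>x y.
      (x\<^sup>2 + y\<^sup>2) / k \<le> qform (\<alpha> z) (\<beta> z) (\<gamma> z) x y \<and> qform (\<alpha> z) (\<beta> z) (\<gamma> z) x y \<le> k * (x\<^sup>2 + y\<^sup>2))"
      using k(2) r' unfolding AE_lebesgue_on_borel[OF \<open>X \<in> sets borel\<close>]
    proof eventually_elim
      case (elim z)
      show ?case
      proof (intro impI allI)
        fix x y assume z: "z \<in> X"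
        have "1 / k * (norm (vector [x, y] :: real^2))\<^sup>2 \<le> (A z *v vector [x, y]) \<bullet> vector [x, y] \<and>
            (A z *v vector [x, y]) \<bullet> vector [x, y] \<le> k * (norm (vector [x, y] :: real^2))\<^sup>2"
          using elim(1) z by blast
        then show "(x\<^sup>2 + y\<^sup>2) / k \<le> qform (\<alpha> z) (\<beta> z) (\<gamma> z) x y \<and> qform (\<alpha> z) (\<beta> z) (\<gamma> z) x y \<le> k * (x\<^sup>2 + y\<^sup>2)"
          using elim(2-4) z by (simp add: norm_vec2 qform_matrix sym)
      qed
    qed
  qed (use sym r k X in auto)
  then show ?thesis by (rule that)
qed

context matrix_field
begin

lemma borel_coeff [measurable]: "\<alpha> \<in> Borel" "\<beta> \<in> Borel" "\<gamma> \<in> Borel" "X \<in> sets borel"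
  using rep op by (auto simp: borel_rep_def)

lemma L12A_borel_rep:
  assumes f: "borel_rep X f f'" and w: "wgrad X f' g h"
  shows "f \<in> L12A A X \<longleftrightarrow> integrable lborel (\<lambda>z. ind X z * qform (\<alpha> z) (\<beta> z) (\<gamma> z) (g z) (h z))"
    and "L12A_seminorm A X f = sqrt (LBINT z. ind X z * qform (\<alpha> z) (\<beta> z) (\<gamma> z) (g z) (h z))"
proof -
  note wg = weak_gradient_borel_rep[OF op f w]
  have [measurable]: "g \<in> Borel" "h \<in> Borel" using wg(2,3) by (auto simp: borel_rep_def)
  have "borel_rep X (\<lambda>z. (A z *v weak_gradient X f z) \<bullet> weak_gradient X f z) (\<lambda>z. qform (\<alpha> z) (\<beta> z) (\<gamma> z) (g z) (h z))"
    unfolding borel_rep_def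
  proof
    show "(\<lambda>z. qform (\<alpha> z) (\<beta> z) (\<gamma> z) (g z) (h z)) \<in> Borel" unfolding qform_def by measurable
    show "AE z\<in>X in lborel. (A z *v weak_gradient X f z) \<bullet> weak_gradient X f z = qform (\<alpha> z) (\<beta> z) (\<gamma> z) (g z) (h z)"
      using rep[unfolded borel_rep_def, THEN conjunct2] wg(2,3)[unfolded borel_rep_def, THEN conjunct2]
      by eventually_elim (auto simp: qform_matrix sym)
  qed
  note r = set_integral_borel_rep[OF this borel_coeff(4) order_refl]
  show "f \<in> L12A A X \<longleftrightarrow> integrable lborel (\<lambda>z. ind X z * qform (\<alpha> z) (\<beta> z) (\<gamma> z) (g z) (h z))"
    using wg(1) r(2) by (simp add: L12A_def)
  show "L12A_seminorm A X f = sqrt (LBINT z. ind X z * qform (\<alpha> z) (\<beta> z) (\<gamma> z) (g z) (h z))"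
    using r(1) by (simp add: L12A_seminorm_def)
qed

end

lemma norm_gradient_borel_rep:
  assumes X: "open X" and f: "borel_rep X f f'" and w: "wgrad X f' g h"
  shows "borel_rep X (\<lambda>z. (norm (weak_gradient X f z))\<^sup>2) (\<lambda>z. (g z)\<^sup>2 + (h z)\<^sup>2)"
proof -
  note wg = weak_gradient_borel_rep(2,3)[OF X f w]
  have [measurable]: "g \<in> Borel" "h \<in> Borel" using wg by (auto simp: borel_rep_def)
  have "AE z\<in>X in lborel. (norm (weak_gradient X f z))\<^sup>2 = (g z)\<^sup>2 + (h z)\<^sup>2"
    using wg[unfolded borel_rep_def, THEN conjunct2] by eventually_elim (auto simp: norm_vec2)
  then show ?thesis unfolding borel_rep_def by simp
qed

lemma L12_borel_rep:
  assumes X: "open X" and f: "borel_rep X f f'" and w: "wgrad X f' g h"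
  shows "f \<in> L12 X \<longleftrightarrow> integrable lborel (\<lambda>z. ind X z * ((g z)\<^sup>2 + (h z)\<^sup>2))"
    and "L12_seminorm X f = sqrt (LBINT z. ind X z * ((g z)\<^sup>2 + (h z)\<^sup>2))"
proof -
  note r = set_integral_borel_rep[OF norm_gradient_borel_rep[OF X f w] borel_open[OF X] order_refl]
  show "f \<in> L12 X \<longleftrightarrow> integrable lborel (\<lambda>z. ind X z * ((g z)\<^sup>2 + (h z)\<^sup>2))"
    using weak_gradient_borel_rep(1)[OF X f w] r(2) by (simp add: L12_def)
  show "L12_seminorm X f = sqrt (LBINT z. ind X z * ((g z)\<^sup>2 + (h z)\<^sup>2))"
    using r(1) by (simp add: L12_seminorm_def)
qed

lemma integrable_sum_squares:
  fixes g h :: "complex \<Rightarrow> real"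
  assumes [measurable]: "g \<in> Borel" "h \<in> Borel" "S \<in> sets borel"
  shows "integrable lborel (\<lambda>z. ind S z * ((g z)\<^sup>2 + (h z)\<^sup>2)) \<longleftrightarrow> Lp 2 S g \<and> Lp 2 S h"
proof
  assume i: "integrable lborel (\<lambda>z. ind S z * ((g z)\<^sup>2 + (h z)\<^sup>2))"
  have "integrable lborel (\<lambda>z. ind S z * (g z)\<^sup>2)" "integrable lborel (\<lambda>z. ind S z * (h z)\<^sup>2)"
    by (rule Bochner_Integration.integrable_bound[OF i]; simp add: indicator_def)+
  then show "Lp 2 S g \<and> Lp 2 S h" by (simp add: Lp2_integrable)
next
  assume "Lp 2 S g \<and> Lp 2 S h"
  then show "integrable lborel (\<lambda>z. ind S z * ((g z)\<^sup>2 + (h z)\<^sup>2))"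
    by (simp add: Lp2_integrable distrib_left)
qed

lemma W12_loc_borel_rep:
  assumes X: "open X" and f: "borel_rep X f f'" and w: "wgrad X f' g h"
  shows "f \<in> W12_loc X \<longleftrightarrow> Lploc 2 X f' \<and> W12 X f' g h"
proof -
  note L = wgrad_Lploc[OF w, THEN Lploc_borel]
  have "borel_rep X (\<lambda>z. (f z)\<^sup>2) (\<lambda>z. (f' z)\<^sup>2)" using f by (auto simp: borel_rep_def)
  note r = set_integral_borel_rep(2)[OF this borel_compact] set_integral_borel_rep(2)[OF norm_gradient_borel_rep[OF X f w] borel_compact]
  have "set_integrable lebesgue C (\<lambda>z. (f z)\<^sup>2) \<longleftrightarrow> Lp 2 C f'"
    "set_integrable lebesgue C (\<lambda>z. (norm (weak_gradient X f z))\<^sup>2) \<longleftrightarrow> Lp 2 C g \<and> Lp 2 C h"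
    if "compact C" "C \<subseteq> X" for C
    using r[OF that] Lp2_integrable[OF borel_compact[OF that(1)], of f'] L integrable_sum_squares[OF L(2,3) borel_compact[OF that(1)]]
    by auto
  then show ?thesis
    unfolding W12_loc_def W12_def Lploc_def using weak_gradient_borel_rep(1)[OF X f w] w L by auto
qed

text \<open>The Beltrami equation is the linear system \<open>D\<phi> A = cof(D\<phi>)\<close>: the second row of the differential
  is determined by the first.\<close>

lemma beltrami_iff:
  fixes \<alpha> \<beta> \<gamma> p q r s :: real
  assumes det: "\<alpha> * \<gamma> - \<beta> * \<beta> = 1" and tr: "\<alpha> + \<gamma> \<ge> 0"
  shows "1 / 2 * (Complex p r + \<i> * Complex q s)
      = (of_real \<gamma> - of_real \<alpha> - 2 * \<i> * of_real \<beta>) / of_real ((1 + \<alpha>) * (1 + \<gamma>) - \<beta> * \<beta>) * (1 / 2 * (Complex p r - \<i> * Complex q s))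
    \<longleftrightarrow> s = \<alpha> * p + \<beta> * q \<and> r = - (\<beta> * p + \<gamma> * q)"
    (is "?B \<longleftrightarrow> ?L")
proof -
  let ?D = "2 + \<alpha> + \<gamma>"
  have D: "(1 + \<alpha>) * (1 + \<gamma>) - \<beta> * \<beta> = ?D" using det by (simp add: algebra_simps)
  have D0: "?D \<noteq> 0" using tr by simp
  have e: "(1 / 2 * x = c / d * (1 / 2 * y)) \<longleftrightarrow> (d * x = c * y)" if "d \<noteq> 0" for x y c d :: complex
    using that by (simp add: field_simps)
  have "?B \<longleftrightarrow> of_real ?D * (Complex p r + \<i> * Complex q s) = (of_real \<gamma> - of_real \<alpha> - 2 * \<i> * of_real \<beta>) * (Complex p r - \<i> * Complex q s)"
    unfolding D using D0 by (intro e) (simp only: of_real_eq_0_iff not_False_eq_True)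
  also have "\<dots> \<longleftrightarrow> ?D * (p - s) = (\<gamma> - \<alpha>) * (p + s) + 2 * \<beta> * (r - q) \<and> ?D * (r + q) = (\<gamma> - \<alpha>) * (r - q) - 2 * \<beta> * (p + s)"
    by (simp add: complex_eq_iff algebra_simps)
  also have "\<dots> \<longleftrightarrow> ?L"
  proof
    assume e: "?D * (p - s) = (\<gamma> - \<alpha>) * (p + s) + 2 * \<beta> * (r - q) \<and> ?D * (r + q) = (\<gamma> - \<alpha>) * (r - q) - 2 * \<beta> * (p + s)"
    \<comment> \<open>X and Y measure how far the two linear equations fail. They solve a
      homogeneous system whose determinant is \<open>?D\<close>, hence both are 0.\<close>
    define X where "X = s - (\<alpha> * p + \<beta> * q)"
    define Y where "Y = r + (\<beta> * p + \<gamma> * q)"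
    have "2 * ((1 + \<gamma>) * X + \<beta> * Y)
        = ((\<gamma> - \<alpha>) * (p + s) + 2 * \<beta> * (r - q) - ?D * (p - s)) - 2 * p * (\<alpha> * \<gamma> - \<beta> * \<beta> - 1)"
      by (simp add: X_def Y_def algebra_simps)
    then have 1: "(1 + \<gamma>) * X + \<beta> * Y = 0" unfolding det conjunct1[OF e] by simp
    have "2 * ((1 + \<alpha>) * Y + \<beta> * X)
        = (?D * (r + q) - ((\<gamma> - \<alpha>) * (r - q) - 2 * \<beta> * (p + s))) + 2 * q * (\<alpha> * \<gamma> - \<beta> * \<beta> - 1)"
      by (simp add: X_def Y_def algebra_simps)
    then have 2: "(1 + \<alpha>) * Y + \<beta> * X = 0" unfolding det conjunct2[OF e] by simp
    have "?D * X = (1 + \<alpha>) * ((1 + \<gamma>) * X + \<beta> * Y) - \<beta> * ((1 + \<alpha>) * Y + \<beta> * X)"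
      unfolding D[symmetric] by (simp add: algebra_simps)
    then have X: "X = 0" using 1 2 D0 by simp
    have "?D * Y = (1 + \<gamma>) * ((1 + \<alpha>) * Y + \<beta> * X) - \<beta> * ((1 + \<gamma>) * X + \<beta> * Y)"
      unfolding D[symmetric] by (simp add: algebra_simps)
    then have "Y = 0" using 1 2 D0 by simp
    then show ?L using X by (simp add: X_def Y_def)
  next
    assume L: ?L
    note L' = conjunct1[OF L] conjunct2[OF L]
    have det': "\<beta> * \<beta> = \<alpha> * \<gamma> - 1" using det by simp
    have "?D * (p - s) - ((\<gamma> - \<alpha>) * (p + s) + 2 * \<beta> * (r - q)) = 2 * (p + \<alpha> * p - s * (1 + \<gamma>) - \<beta> * (r - q))"
      by (simp add: algebra_simps)
    also have "p + \<alpha> * p - s * (1 + \<gamma>) - \<beta> * (r - q) = p - \<alpha> * \<gamma> * p + (\<beta> * \<beta>) * p"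
      unfolding L' by (simp add: algebra_simps)
    also have "\<dots> = 0" unfolding det' by (simp add: algebra_simps)
    finally have 1: "?D * (p - s) = (\<gamma> - \<alpha>) * (p + s) + 2 * \<beta> * (r - q)" by simp
    have "?D * (r + q) - ((\<gamma> - \<alpha>) * (r - q) - 2 * \<beta> * (p + s)) = 2 * (r + \<alpha> * r + q + \<gamma> * q + \<beta> * (p + s))"
      by (simp add: algebra_simps)
    also have "r + \<alpha> * r + q + \<gamma> * q + \<beta> * (p + s) = q - \<alpha> * \<gamma> * q + (\<beta> * \<beta>) * q"
      unfolding L' by (simp add: algebra_simps)
    also have "\<dots> = 0" unfolding det' by (simp add: algebra_simps)
    finally show "?D * (p - s) = (\<gamma> - \<alpha>) * (p + s) + 2 * \<beta> * (r - q) \<and> ?D * (r + q) = (\<gamma> - \<alpha>) * (r - q) - 2 * \<beta> * (p + s)"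
      using 1 by simp
  qed
  finally show ?thesis .
qed

text \<open>By the two equations the second row of the differential is A applied to the first,
  rotated by a right angle. As det A = 1, the rows are orthogonal with respect to A, and both have
  squared A-length equal to the Jacobian.\<close>

lemma beltrami_qform:
  fixes \<alpha> \<beta> \<gamma> p q r s x y :: real
  assumes det: "\<alpha> * \<gamma> - \<beta> * \<beta> = 1" and L: "s = \<alpha> * p + \<beta> * q" "r = - (\<beta> * p + \<gamma> * q)"
  shows "qform \<alpha> \<beta> \<gamma> (x * p + y * r) (x * q + y * s) = (x\<^sup>2 + y\<^sup>2) * (p * s - q * r)"
proof -
  have det': "\<alpha> * \<gamma> = 1 + \<beta> * \<beta>" using det by simp
  have 1: "qform \<alpha> \<beta> \<gamma> p q = p * s - q * r" unfolding L qform_def by (simp add: power2_eq_square algebra_simps)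
  have m: "\<alpha> * r + \<beta> * s = - q" "\<beta> * r + \<gamma> * s = p"
  proof -
    have "\<alpha> * r + \<beta> * s = - (\<alpha> * \<gamma>) * q + \<beta> * \<beta> * q" unfolding L by (simp add: algebra_simps)
    then show "\<alpha> * r + \<beta> * s = - q" unfolding det' by (simp add: algebra_simps)
    have "\<beta> * r + \<gamma> * s = (\<alpha> * \<gamma>) * p - \<beta> * \<beta> * p" unfolding L by (simp add: algebra_simps)
    then show "\<beta> * r + \<gamma> * s = p" unfolding det' by (simp add: algebra_simps)
  qed
  have "qform \<alpha> \<beta> \<gamma> r s = r * (\<alpha> * r + \<beta> * s) + s * (\<beta> * r + \<gamma> * s)" by (simp add: qform_def power2_eq_square algebra_simps)
  then have 2: "qform \<alpha> \<beta> \<gamma> r s = p * s - q * r" unfolding m by simp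
  have "qform \<alpha> \<beta> \<gamma> (x * p + y * r) (x * q + y * s)
      = x\<^sup>2 * qform \<alpha> \<beta> \<gamma> p q + y\<^sup>2 * qform \<alpha> \<beta> \<gamma> r s + 2 * x * y * (p * (\<alpha> * r + \<beta> * s) + q * (\<beta> * r + \<gamma> * s))"
    by (simp add: qform_def power2_eq_square algebra_simps)
  then show ?thesis unfolding 1 2 m by (simp add: algebra_simps)
qed

context matrix_field
begin

lemma trace_nonneg: "AE z\<in>X in lborel. \<alpha> z + \<gamma> z \<ge> 0"
  using elliptic
proof eventually_elim
  case (elim z)
  show ?case
  proof
    assume "z \<in> X"
    then have "(1\<^sup>2 + 0\<^sup>2) / k \<le> qform (\<alpha> z) (\<beta> z) (\<gamma> z) 1 0" "(0\<^sup>2 + 1\<^sup>2) / k \<le> qform (\<alpha> z) (\<beta> z) (\<gamma> z) 0 1"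
      using elim by blast+
    then have "1 / k \<le> \<alpha> z" "1 / k \<le> \<gamma> z" by (simp_all add: qform_def)
    moreover have "1 / k \<ge> 0" using k by (intro divide_nonneg_nonneg) auto
    ultimately show "\<alpha> z + \<gamma> z \<ge> 0" by linarith
  qed
qed

lemma AE_beltrami_iff:
  assumes a: "borel_rep X (\<lambda>z. weak_differential X \<phi> z $ 1 $ 1) a1" "borel_rep X (\<lambda>z. weak_differential X \<phi> z $ 1 $ 2) a2"
    and b: "borel_rep X (\<lambda>z. weak_differential X \<phi> z $ 2 $ 1) b1" "borel_rep X (\<lambda>z. weak_differential X \<phi> z $ 2 $ 2) b2"
  shows "(AE z in lebesgue_on X. weak_dzbar X \<phi> z = complex_dilatation A z * weak_dz X \<phi> z) \<longleftrightarrow>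
    (AE z\<in>X in lborel. b2 z = \<alpha> z * a1 z + \<beta> z * a2 z \<and> b1 z = - (\<beta> z * a1 z + \<gamma> z * a2 z))"
proof -
  note r = rep[unfolded borel_rep_def, THEN conjunct2] a[unfolded borel_rep_def, THEN conjunct2] b[unfolded borel_rep_def, THEN conjunct2]
  have eq: "AE z\<in>X in lborel. (weak_dzbar X \<phi> z = complex_dilatation A z * weak_dz X \<phi> z \<longleftrightarrow>
      b2 z = \<alpha> z * a1 z + \<beta> z * a2 z \<and> b1 z = - (\<beta> z * a1 z + \<gamma> z * a2 z))"
    using r det trace_nonneg
  proof eventually_elim
    case (elim z)
    show ?case
    proof
      assume z: "z \<in> X"
      have d: "Determinants.det (mat 1 + A z) = (1 + \<alpha> z) * (1 + \<gamma> z) - \<beta> z * \<beta> z"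
        using elim z by (simp add: det_2 mat_def sym)
      have dz: "weak_dx X \<phi> z = Complex (a1 z) (b1 z)" "weak_dy X \<phi> z = Complex (a2 z) (b2 z)"
        using elim z by (simp_all add: weak_dx_def weak_dy_def)
      have A: "A z $ 1 $ 1 = \<alpha> z" "A z $ 1 $ 2 = \<beta> z" "A z $ 2 $ 2 = \<gamma> z" using elim z by simp_all
      have det: "\<alpha> z * \<gamma> z - \<beta> z * \<beta> z = 1" and tr: "\<alpha> z + \<gamma> z \<ge> 0" using elim z by simp_all
      show "weak_dzbar X \<phi> z = complex_dilatation A z * weak_dz X \<phi> z \<longleftrightarrow>
          b2 z = \<alpha> z * a1 z + \<beta> z * a2 z \<and> b1 z = - (\<beta> z * a1 z + \<gamma> z * a2 z)"
        unfolding weak_dzbar_def weak_dz_def complex_dilatation_def d dz A by (rule beltrami_iff[OF det tr])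
    qed
  qed
  show ?thesis
    unfolding AE_lebesgue_on_borel[OF borel_coeff(4)]
  proof
    assume "AE z\<in>X in lborel. weak_dzbar X \<phi> z = complex_dilatation A z * weak_dz X \<phi> z"
    then show "AE z\<in>X in lborel. b2 z = \<alpha> z * a1 z + \<beta> z * a2 z \<and> b1 z = - (\<beta> z * a1 z + \<gamma> z * a2 z)"
      using eq by eventually_elim blast
  next
    assume "AE z\<in>X in lborel. b2 z = \<alpha> z * a1 z + \<beta> z * a2 z \<and> b1 z = - (\<beta> z * a1 z + \<gamma> z * a2 z)"
    then show "AE z\<in>X in lborel. weak_dzbar X \<phi> z = complex_dilatation A z * weak_dz X \<phi> z"
      using eq by eventually_elim blast
  qed
qed

end

section \<open>From the Beltrami equation to the isometry\<close>

lemma continuous_borel_rep: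
  assumes "open X" "continuous_on X f"
  shows "borel_rep X f (\<lambda>z. ind X z * f z)"
  using borel_measurable_continuous_on_indicator[of X f] assms by (simp add: borel_rep_def)

lemma A_quasiconformal_imp_induces_isometry:
  assumes X: "open X" "open X'" and A: "A \<in> M22 X" and homeo: "homeomorphism X X' \<phi> \<psi>"
    and qc: "A_quasiconformal A X X' \<phi>"
  shows "induces_isometry A X X' \<phi>"
proof -
  obtain \<alpha> \<beta> \<gamma> k where "matrix_field X A \<alpha> \<beta> \<gamma> k" using M22_matrix_field[OF X(1) A] .
  then interpret A: matrix_field X A \<alpha> \<beta> \<gamma> k .
  have \<phi>c: "continuous_on X (\<lambda>z. Re (\<phi> z))" "continuous_on X (\<lambda>z. Im (\<phi> z))"
    using homeo by (auto simp: homeomorphism_def intro!: continuous_intros)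
  define a where "a z = ind X z * Re (\<phi> z)" for z
  define b where "b z = ind X z * Im (\<phi> z)" for z
  have ra: "borel_rep X (\<lambda>z. Re (\<phi> z)) a" and rb: "borel_rep X (\<lambda>z. Im (\<phi> z)) b"
    unfolding a_def b_def by (intro continuous_borel_rep X \<phi>c)+
  have W: "(\<lambda>z. Re (\<phi> z)) \<in> W12_loc X" "(\<lambda>z. Im (\<phi> z)) \<in> W12_loc X"
    using qc by (auto simp: A_quasiconformal_def quasiconformal_def K_quasiconformal_def)
  then have wd: "weakly_differentiable X (\<lambda>z. Re (\<phi> z))" "weakly_differentiable X (\<lambda>z. Im (\<phi> z))"
    by (auto simp: W12_loc_def)
  obtain a1 a2 where wa: "wgrad X a a1 a2" "borel_rep X (\<lambda>z. weak_differential X \<phi> z $ 1 $ 1) a1" "borel_rep X (\<lambda>z. weak_differential X \<phi> z $ 1 $ 2) a2"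
    using weakly_differentiable_borel_rep[OF X(1) wd(1) ra] by (auto simp: weak_differential_def)
  obtain b1 b2 where wb: "wgrad X b b1 b2" "borel_rep X (\<lambda>z. weak_differential X \<phi> z $ 2 $ 1) b1" "borel_rep X (\<lambda>z. weak_differential X \<phi> z $ 2 $ 2) b2"
    using weakly_differentiable_borel_rep[OF X(1) wd(2) rb] by (auto simp: weak_differential_def)
  have Wa: "W12 X a a1 a2" and Wb: "W12 X b b1 b2"
    using W12_loc_borel_rep[OF X(1) ra wa(1)] W12_loc_borel_rep[OF X(1) rb wb(1)] W by auto
  have bel: "AE z\<in>X in lborel. b2 z = \<alpha> z * a1 z + \<beta> z * a2 z \<and> b1 z = - (\<beta> z * a1 z + \<gamma> z * a2 z)"
    using qc A.AE_beltrami_iff[OF wa(2,3) wb(2,3)] by (simp add: A_quasiconformal_def)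
  have qf: "AE z\<in>X in lborel. (\<forall>x y. qform (\<alpha> z) (\<beta> z) (\<gamma> z) (x * a1 z + y * b1 z) (x * a2 z + y * b2 z)
      = (x\<^sup>2 + y\<^sup>2) * (a1 z * b2 z - a2 z * b1 z))"
    using bel A.det by eventually_elim (simp add: beltrami_qform)
  \<comment> \<open>The squared A-length of each row is the Jacobian, so ellipticity bounds its
    squared Euclidean length by k times the Jacobian; two rows give 2 k. The sign of the Jacobian is
    part of the result.\<close>
  have dist: "AE z\<in>X in lborel. (a1 z)\<^sup>2 + (a2 z)\<^sup>2 + (b1 z)\<^sup>2 + (b2 z)\<^sup>2 \<le> (2 * k) * (a1 z * b2 z - a2 z * b1 z)"
    using qf A.elliptic
  proof eventually_elim
    case (elim z)
    show ?case
    proof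
      assume z: "z \<in> X"
      let ?J = "a1 z * b2 z - a2 z * b1 z"
      have e: "(x\<^sup>2 + y\<^sup>2) / k \<le> qform (\<alpha> z) (\<beta> z) (\<gamma> z) x y" for x y using elim z by blast
      have q: "qform (\<alpha> z) (\<beta> z) (\<gamma> z) (x * a1 z + y * b1 z) (x * a2 z + y * b2 z) = (x\<^sup>2 + y\<^sup>2) * ?J" for x y
        using elim z by blast
      have "((a1 z)\<^sup>2 + (a2 z)\<^sup>2) / k \<le> ?J" "((b1 z)\<^sup>2 + (b2 z)\<^sup>2) / k \<le> ?J"
        using e[of "a1 z" "a2 z"] q[of 1 0] e[of "b1 z" "b2 z"] q[of 0 1] by simp_all
      then have "(a1 z)\<^sup>2 + (a2 z)\<^sup>2 \<le> ?J * k" "(b1 z)\<^sup>2 + (b2 z)\<^sup>2 \<le> ?J * k"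
        using A.k by (simp_all add: pos_divide_le_eq)
      then show "(a1 z)\<^sup>2 + (a2 z)\<^sup>2 + (b1 z)\<^sup>2 + (b2 z)\<^sup>2 \<le> (2 * k) * ?J"
        by (simp add: mult.commute[of ?J])
    qed
  qed
  interpret qc_homeo X X' \<phi> \<psi> a a1 a2 b b1 b2 "2 * k"
    by standard (use homeo X Wa Wb dist A.k in \<open>auto simp: a_def b_def\<close>)
  show ?thesis
    unfolding induces_isometry_def
  proof
    fix f assume f: "f \<in> L12 X'"
    then have wf: "weakly_differentiable X' f" by (simp add: L12_def)
    then obtain f' where f': "borel_rep X' f f'"
      using borel_rep_Lploc_exists[OF X(2)] unfolding weakly_differentiable_def by blast
    obtain f1 f2 where w: "wgrad X' f' f1 f2" using weakly_differentiable_borel_rep[OF X(2) wf f'] by blast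
    note L = wgrad_Lploc[OF w, THEN Lploc_borel]
    note [measurable] = L
    note sn = L12_borel_rep[OF X(2) f' w]
    have "Lp 2 X' f1 \<and> Lp 2 X' f2"
      using f sn(1) integrable_sum_squares[OF L(2,3) borel_X(2)] by simp
    then have "Lp 2 C f1 \<and> Lp 2 C f2" if "C \<subseteq> X'" for C using Lp_subset[OF _ that] by simp
    then have "W12 X' f' f1 f2"
      unfolding W12_def Lploc_def using w L(2,3) by simp
    note cw = comp_W12[OF this, unfolded W12_def, THEN conjunct1]
    \<comment> \<open>The representative f' differs from f on a null set, whose preimage has to be
      null as well.\<close>
    have "AE z\<in>X in lborel. f (\<Phi> z) = f' (\<Phi> z)"
      using f' unfolding borel_rep_def by (intro null_preimage) blast
    then have rc: "borel_rep X (f \<circ> \<phi>) (comp2 f' a b)"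
      unfolding borel_rep_def using comp2_borel[OF L(1) borel_ab] by (auto simp: comp2_def ab)
    define g where "g z = comp2 f1 a b z * a1 z + comp2 f2 a b z * b1 z" for z
    define h where "h z = comp2 f1 a b z * a2 z + comp2 f2 a b z * b2 z" for z
    have [measurable]: "g \<in> Borel" "h \<in> Borel"
      using wgrad_Lploc(2,3)[OF cw, THEN Lploc_borel] by (simp_all add: g_def[abs_def] h_def[abs_def])
    note sc = A.L12A_borel_rep[OF rc cw, folded g_def h_def]
    have eq: "AE z in lborel. ind X z * qform (\<alpha> z) (\<beta> z) (\<gamma> z) (g z) (h z) = ind X z * (((f1 (\<Phi> z))\<^sup>2 + (f2 (\<Phi> z))\<^sup>2) * J z)"
      using qf by eventually_elim (auto simp: g_def h_def comp2_def J_def indicator_def)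
    have m: "(\<lambda>z. ind X z * qform (\<alpha> z) (\<beta> z) (\<gamma> z) (g z) (h z)) \<in> borel_measurable lborel"
      unfolding qform_def by measurable
    have m': "(\<lambda>z. ind X z * (((f1 (\<Phi> z))\<^sup>2 + (f2 (\<Phi> z))\<^sup>2) * J z)) \<in> borel_measurable lborel"
      using measurable_compose[OF borel_\<Phi> L(2)] measurable_compose[OF borel_\<Phi> L(3)] by measurable
    have c: "(\<lambda>w. (f1 w)\<^sup>2 + (f2 w)\<^sup>2) \<in> Borel" by measurable
    show "f \<circ> \<phi> \<in> L12A A X \<and> L12A_seminorm A X (f \<circ> \<phi>) = L12_seminorm X' f"
      using f unfolding sn sc integrable_cong_AE[OF m m' eq] integral_cong_AE[OF m m' eq] cv_integral[OF c] by simp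
  qed
qed

section \<open>Isometric homeomorphisms\<close>

lemma AE_local:
  assumes "\<And>z. z \<in> X \<Longrightarrow> \<exists>U. open U \<and> z \<in> U \<and> (AE w\<in>U in M. P w)"
  shows "AE z in M. z \<in> (X :: complex set) \<longrightarrow> P z"
proof -
  define F where "F = {U. open U \<and> (AE w\<in>U in M. P w)}"
  obtain F' where F': "F' \<subseteq> F" "countable F'" "\<Union>F' = \<Union>F"
    using Lindelof[of F] by (auto simp: F_def)
  have c: "AE w in M. \<forall>U\<in>F'. w \<in> U \<longrightarrow> P w"
    unfolding AE_ball_countable[OF F'(2)] using F'(1) by (auto simp: F_def)
  have "\<exists>U\<in>F'. z \<in> U" if "z \<in> X" for z
    using assms[OF that] F'(3) by (auto simp: F_def)
  then show ?thesis using c by (auto elim: eventually_mono)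
qed

lemma wgrad_cong:
  assumes X: "open X" and w: "wgrad X f g h" and b: "f' \<in> Borel" "g' \<in> Borel" "h' \<in> Borel"
    and eq: "AE z\<in>X in lborel. f z = f' z \<and> g z = g' z \<and> h z = h' z"
  shows "wgrad X f' g' h'"
proof -
  note L = wgrad_Lploc[OF w]
  note [measurable] = L[THEN Lploc_borel] b
  have e: "AE z\<in>X in lborel. f z = f' z" "AE z\<in>X in lborel. g z = g' z" "AE z\<in>X in lborel. h z = h' z"
    using eq by (eventually_elim, simp)+
  have int: "(LBINT z. u z * k z) = (LBINT z. u' z * k z)"
    if "AE z\<in>X in lborel. u z = u' z" "\<forall>z. z \<notin> X \<longrightarrow> k z = 0"
      and [measurable]: "u \<in> Borel" "u' \<in> Borel" "k \<in> Borel" for u u' k :: "complex \<Rightarrow> real"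
  proof (rule integral_cong_AE)
    show "AE z in lborel. u z * k z = u' z * k z"
      using that(1)
    proof eventually_elim
      case (elim z)
      then show ?case using that(2) by (cases "z \<in> X") auto
    qed
  qed measurable
  show ?thesis
    unfolding wgrad_def
  proof (intro conjI ballI)
    show "Lploc 1 X f'" "Lploc 1 X g'" "Lploc 1 X h'"
      by (rule Lploc_cong[OF L(1) b(1) e(1)] Lploc_cong[OF L(2) b(2) e(2)] Lploc_cong[OF L(3) b(3) e(3)])+
    fix \<eta> assume \<eta>: "\<eta> \<in> test_functions X"
    then have s: "smooth \<eta>" by (auto simp: test_functions_iff)
    note [measurable] = smooth_borel[OF s] smooth_borel[OF smooth_dx[OF s]] smooth_borel[OF smooth_dy[OF s]]
    have z: "\<forall>z. z \<notin> X \<longrightarrow> \<eta> z = 0" "\<forall>z. z \<notin> X \<longrightarrow> dir_deriv v \<eta> z = 0" for v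
      using test_zero_outside[OF \<eta>] by blast+
    note B = L[THEN Lploc_borel]
    note i = int[OF e(1) z(2) B(1) b(1) smooth_borel[OF smooth_dir_deriv[OF s]]] int[OF e(2) z(1) B(2) b(2) smooth_borel[OF s]]
      int[OF e(3) z(1) B(3) b(3) smooth_borel[OF s]]
    show "(LBINT z. f' z * dx \<eta> z) = - (LBINT z. g' z * \<eta> z)"
      "(LBINT z. f' z * dy \<eta> z) = - (LBINT z. h' z * \<eta> z)"
      using wgrad_ibp[OF w \<eta>] unfolding i by blast+
  qed
qed

text \<open>Gradients found along an exhaustion agree almost everywhere by uniqueness. At almost
  every point of X their sequence is eventually constant, so its pointwise limit is one Borel
  gradient for all of X.\<close>

lemma W12_glue:
  assumes X: "open X" and f: "f \<in> Borel"
    and loc: "\<And>C. compact C \<Longrightarrow> C \<subseteq> X \<Longrightarrow> \<exists>U g h. C \<subseteq> U \<and> W12 U f g h"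
  obtains g h where "W12 X f g h"
proof -
  obtain C where C: "\<And>n. compact (C n)" "\<And>n. C n \<subseteq> X" "\<And>n. C n \<subseteq> interior (C (Suc n))" "\<Union>(range C) = X"
    "\<And>K. \<lbrakk>compact K; K \<subseteq> X\<rbrakk> \<Longrightarrow> \<exists>N. \<forall>n\<ge>N. K \<subseteq> C n"
    by (rule open_Union_compact_subsets[OF X]) blast
  have inc: "C n \<subseteq> C m" if "n \<le> m" for n m
    by (rule lift_Suc_mono_le[OF _ that]) (use C(3) interior_subset in blast)
  define V where "V n = interior (C n)" for n
  have V: "open (V n)" "V n \<subseteq> C n" for n by (auto simp: V_def interior_subset)
  have "\<forall>n. \<exists>g h. W12 (C n) f g h" using loc[OF C(1,2)] W12_subset by metis
  then obtain g h where gh: "\<And>n. W12 (C n) f (g n) (h n)" by metis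
  have w: "wgrad (V n) f (g m) (h m)" if "n \<le> m" for n m
    using gh[of m] wgrad_subset[of "C m" f "g m" "h m" "V n"] V(2)[of n] inc[OF that] by (auto simp: W12_def)
  have bor [measurable]: "g n \<in> Borel" "h n \<in> Borel" for n
    using wgrad_Lploc(2,3)[OF w[OF order_refl], THEN Lploc_borel] by auto
  define g' where "g' z = lim (\<lambda>n. g n z)" for z
  define h' where "h' z = lim (\<lambda>n. h n z)" for z
  have b': "g' \<in> Borel" "h' \<in> Borel"
    unfolding g'_def h'_def by (rule borel_measurable_lim_metric; measurable)+
  have eq: "AE z in lborel. z \<in> V n \<longrightarrow> g n z = g' z \<and> h n z = h' z" for n
  proof -
    have "AE z in lborel. \<forall>m. n \<le> m \<longrightarrow> (z \<in> V n \<longrightarrow> g n z = g m z \<and> h n z = h m z)"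
      unfolding AE_all_countable
    proof
      fix m
      have "AE z in lborel. z \<in> V n \<longrightarrow> g n z = g m z \<and> h n z = h m z" if "n \<le> m"
        by (rule wgrad_unique[OF V(1) w[OF order_refl] w[OF that]]) simp
      then show "AE z in lborel. n \<le> m \<longrightarrow> (z \<in> V n \<longrightarrow> g n z = g m z \<and> h n z = h m z)"
        by (cases "n \<le> m") auto
    qed
    then show ?thesis
    proof eventually_elim
      case (elim z)
      show ?case
      proof
        assume z: "z \<in> V n"
        have "(\<lambda>m. g m z) \<longlonglongrightarrow> g n z" "(\<lambda>m. h m z) \<longlonglongrightarrow> h n z"
          by (rule tendsto_eventually, unfold eventually_sequentially, rule exI[of _ n], use elim z in simp)+
        then show "g n z = g' z \<and> h n z = h' z" by (simp add: g'_def h'_def limI)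
      qed
    qed
  qed
  have W: "W12 (V n) f g' h'" for n
  proof -
    have "wgrad (V n) f g' h'"
      by (rule wgrad_cong[OF V(1) w[OF order_refl] f b']) (use eq[of n] in \<open>eventually_elim, simp\<close>)
    moreover have "Lploc 2 (V n) (g n)" "Lploc 2 (V n) (h n)"
      using gh[of n] Lploc_subset[OF _ V(2)] by (auto simp: W12_def)
    moreover have "AE z in lborel. z \<in> V n \<longrightarrow> g n z = g' z" "AE z in lborel. z \<in> V n \<longrightarrow> h n z = h' z"
      using eq[of n] by (eventually_elim, simp)+
    ultimately have "Lploc 2 (V n) g'" "Lploc 2 (V n) h'" "wgrad (V n) f g' h'"
      using Lploc_cong[OF _ b'(1)] Lploc_cong[OF _ b'(2)] by blast+
    then show ?thesis by (simp add: W12_def)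
  qed
  have cov: "\<exists>N. K \<subseteq> V N" if "compact K" "K \<subseteq> X" for K
    using C(5)[OF that] C(3) unfolding V_def by blast
  have Vo: "V n \<subseteq> X" for n using V(2) C(2) by blast
  have "wgrad X f g' h'"
    by (rule wgrad_local[OF X f b']) (use cov W Vo W12_def in metis)
  moreover have "Lploc 2 X g'" "Lploc 2 X h'"
    unfolding Lploc_def using cov W b' by (auto simp: W12_def dest!: Lploc_Lp)
  ultimately show ?thesis using that unfolding W12_def by blast
qed

text \<open>As \<phi> is injective, every Borel subset of X is the preimage of a Borel subset of X',
  so equal push-forwards force equal densities.\<close>

lemma change_var_unique:
  assumes homeo: "homeomorphism X X' \<phi> \<psi>" and X: "open X" "open X'"
    and \<Phi>: "\<And>z. z \<in> X \<Longrightarrow> \<Phi> z = \<phi> z"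
    and bor [measurable]: "p \<in> Borel" "q \<in> Borel"
    and cv: "change_var X X' \<Phi> p" "change_var X X' \<Phi> q"
    and pos: "AE z\<in>X in lborel. p z \<ge> 0 \<and> q z \<ge> 0"
  shows "AE z\<in>X in lborel. p z = q z"
proof -
  have [measurable]: "X \<in> sets borel" "X' \<in> sets borel" using X by auto
  define P where "P f z = (ind X z * ennreal (f z))" for f :: "complex \<Rightarrow> real" and z
  have [measurable]: "P p \<in> borel_measurable lborel" "P q \<in> borel_measurable lborel" unfolding P_def[abs_def] by measurable
  have "density lborel (P p) = density lborel (P q)"
  proof (rule measure_eqI)
    fix E assume "E \<in> sets (density lborel (P p))"
    then have [measurable]: "E \<in> sets borel" by simp
    \<comment> \<open>The indicator of \<phi>(E \<inter> X), expressed through \<psi> so that it is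
      visibly Borel.\<close>
    define u where "u w = (ind X' w * ind E (ind X' w *\<^sub>R \<psi> w) :: ennreal)" for w
    have "(\<lambda>w. ind X' w *\<^sub>R \<psi> w) \<in> Borel"
      using homeo by (intro borel_measurable_continuous_on_indicator) (auto simp: homeomorphism_def)
    then have "(\<lambda>w. ind E (ind X' w *\<^sub>R \<psi> w) :: ennreal) \<in> Borel"
      by (rule measurable_compose) measurable
    then have u: "u \<in> Borel" unfolding u_def[abs_def] by measurable
    have e: "emeasure (density lborel (P f)) E = (NNINT w. ind X' w * u w)"
      if cv: "change_var X X' \<Phi> f" and [measurable]: "f \<in> Borel" for f
    proof -
      have "emeasure (density lborel (P f)) E = (NNINT z. ind X z * (u (\<Phi> z) * ennreal (f z)))"
        using homeo by (subst emeasure_density) (auto simp: P_def[abs_def] u_def \<Phi> homeomorphism_def indicator_def intro!: nn_integral_cong)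
      also have "\<dots> = (NNINT w. ind X' w * u w)" using cv u unfolding change_var_def by blast
      finally show ?thesis .
    qed
    show "emeasure (density lborel (P p)) E = emeasure (density lborel (P q)) E"
      unfolding e[OF cv(1) bor(1)] e[OF cv(2) bor(2)] ..
  qed simp
  then have "AE z in lborel. P p z = P q z"
    by (intro sigma_finite_measure.density_unique[OF lborel.sigma_finite_measure_axioms]) auto
  then show ?thesis
    using pos by eventually_elim (auto simp: P_def)
qed

lemma test_functions_mult:
  assumes "f \<in> test_functions X" "smooth g"
  shows "(\<lambda>z. g z * f z) \<in> test_functions X"
proof -
  obtain S where S: "smooth f" "compact S" "S \<subseteq> X" "\<forall>z. z \<notin> S \<longrightarrow> f z = 0"
    using assms(1) by (auto simp: test_functions_iff)
  then show ?thesis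
    unfolding test_functions_iff using smooth_mult[OF assms(2) S(1)] by (intro conjI exI[of _ S]) auto
qed

lemma Lp_test:
  assumes \<eta>: "\<eta> \<in> test_functions U" and "p > 0"
  shows "Lp p X \<eta>" "Lp p X (dir_deriv v \<eta>)"
proof -
  obtain S where S: "smooth \<eta>" "compact S" "S \<subseteq> U" "\<forall>z. z \<notin> S \<longrightarrow> \<eta> z = 0"
    using \<eta> by (auto simp: test_functions_iff)
  have z: "\<forall>z. z \<notin> S \<longrightarrow> dir_deriv v \<eta> z = 0"
    using dir_deriv_eq_0_outside[OF compact_imp_closed[OF S(2)] S(4)] by blast
  have *: "Lp p X f" if "smooth f" "\<forall>z. z \<notin> S \<longrightarrow> f z = 0" for f
  proof -
    note L = Lp_smooth[OF that(1) S(2) assms(2)]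
    have "pnorm p (\<lambda>z. ind X z * f z) \<le> pnorm p (\<lambda>z. ind S z * f z)"
      by (rule pnorm_mono) (use that(2) in \<open>auto simp: indicator_def\<close>)
    also have "\<dots> < \<infinity>" using L unfolding Lp_def by blast
    finally show ?thesis using L unfolding Lp_def by blast
  qed
  show "Lp p X \<eta>" "Lp p X (dir_deriv v \<eta>)"
    by (rule *[OF S(1,4)] *[OF smooth_dir_deriv[OF S(1)] z])+
qed

locale isometric_homeo = matrix_field X A \<alpha> \<beta> \<gamma> k for X A \<alpha> \<beta> \<gamma> k +
  fixes X' :: "complex set" and \<phi> \<psi> :: "complex \<Rightarrow> complex"
  assumes op': "open X'" and homeo: "homeomorphism X X' \<phi> \<psi>" and iso: "induces_isometry A X X' \<phi>"
begin

definition a :: "complex \<Rightarrow> real" where "a z = ind X z * Re (\<phi> z)"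
definition b :: "complex \<Rightarrow> real" where "b z = ind X z * Im (\<phi> z)"

abbreviation \<Phi> :: "complex \<Rightarrow> complex" where "\<Phi> z \<equiv> Complex (a z) (b z)"

lemma \<Phi>: "z \<in> X \<Longrightarrow> \<Phi> z = \<phi> z" by (simp add: a_def b_def)

lemma \<phi>_cont: "continuous_on X \<phi>" and \<phi>_im: "\<phi> ` X = X'"
  using homeo by (auto simp: homeomorphism_def)

lemma ab_rep: "borel_rep X (\<lambda>z. Re (\<phi> z)) a" "borel_rep X (\<lambda>z. Im (\<phi> z)) b"
  unfolding a_def[abs_def] b_def[abs_def] by (intro continuous_borel_rep op continuous_intros \<phi>_cont)+

lemma borel_ab [measurable]: "a \<in> Borel" "b \<in> Borel"
  using ab_rep by (auto simp: borel_rep_def)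

lemma borel_\<Phi> [measurable]: "\<Phi> \<in> Borel"
  unfolding Complex_eq by measurable

lemma a_cont: "continuous_on X a" and b_cont: "continuous_on X b"
proof -
  have "continuous_on X (\<lambda>z. Re (\<phi> z))" "continuous_on X (\<lambda>z. Im (\<phi> z))"
    by (intro continuous_intros \<phi>_cont)+
  moreover have "continuous_on X a \<longleftrightarrow> continuous_on X (\<lambda>z. Re (\<phi> z))" "continuous_on X b \<longleftrightarrow> continuous_on X (\<lambda>z. Im (\<phi> z))"
    by (intro continuous_on_cong refl; simp add: a_def b_def)+
  ultimately show "continuous_on X a" "continuous_on X b" by auto
qed

lemma comp_rep:
  assumes "f \<in> Borel"
  shows "borel_rep X (f \<circ> \<phi>) (comp2 f a b)"
  unfolding borel_rep_def using comp2_borel[OF assms borel_ab] \<Phi> by (simp add: comp2_def)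

text \<open>The isometry in Borel form, where any weak gradient of the composite may be used. Test
  functions have finite Dirichlet integral and hence lie in \<open>L12\<close>.\<close>

lemma isometry_test:
  assumes f: "f \<in> test_functions X'"
  shows "\<exists>g h. wgrad X (comp2 f a b) g h"
    and "wgrad X (comp2 f a b) g h \<Longrightarrow> integrable lborel (\<lambda>z. ind X z * qform (\<alpha> z) (\<beta> z) (\<gamma> z) (g z) (h z))"
    and "wgrad X (comp2 f a b) g h \<Longrightarrow> (LBINT z. ind X z * qform (\<alpha> z) (\<beta> z) (\<gamma> z) (g z) (h z))
      = (LBINT w. ind X' w * ((dx f w)\<^sup>2 + (dy f w)\<^sup>2))"
proof -
  have s: "smooth f" using f by (auto simp: test_functions_iff)
  note bf = smooth_borel[OF s] smooth_borel[OF smooth_dx[OF s]] smooth_borel[OF smooth_dy[OF s]]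
  have r: "borel_rep X' f f" using bf by (simp add: borel_rep_def)
  have w: "wgrad X' f (dx f) (dy f)" by (rule wgrad_subset[OF wgrad_smooth[OF s]]) simp
  note L = L12_borel_rep[OF op' r w]
  have fL: "f \<in> L12 X'"
    unfolding L(1) integrable_sum_squares[OF bf(2,3) borel_open[OF op']] using Lp_test[OF f] by simp
  then have i: "f \<circ> \<phi> \<in> L12A A X" "L12A_seminorm A X (f \<circ> \<phi>) = L12_seminorm X' f"
    using bspec[OF iso[unfolded induces_isometry_def] fL] by blast+
  then have wd: "weakly_differentiable X (f \<circ> \<phi>)" by (simp add: L12A_def)
  obtain g' h' where "wgrad X (comp2 f a b) g' h'"
    by (rule weakly_differentiable_borel_rep[OF op wd comp_rep[OF bf(1)]])
  then show "\<exists>g h. wgrad X (comp2 f a b) g h" by blast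
  assume "wgrad X (comp2 f a b) g h"
  note LA = L12A_borel_rep[OF comp_rep[OF bf(1)] this]
  show "integrable lborel (\<lambda>z. ind X z * qform (\<alpha> z) (\<beta> z) (\<gamma> z) (g z) (h z))"
    using i(1) LA(1) by simp
  show "(LBINT z. ind X z * qform (\<alpha> z) (\<beta> z) (\<gamma> z) (g z) (h z))
      = (LBINT w. ind X' w * ((dx f w)\<^sup>2 + (dy f w)\<^sup>2))"
    using i(2) unfolding LA(2) L(2) by simp
qed

text \<open>A coordinate l may have infinite Dirichlet integral on X', so the isometry is tested on
  l times a cut-off, which coincides with l near a given compact set. Ellipticity makes the gradient
  square integrable, and \<open>W12_glue\<close> assembles the pieces.\<close>

lemma coordinate_W12:
  assumes l: "smooth l"
  obtains g h where "W12 X (comp2 l a b) g h"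
proof (rule W12_glue[OF op comp2_borel[OF smooth_borel[OF l] borel_ab]])
  fix C assume C: "compact C" "C \<subseteq> X"
  have cC: "compact (\<phi> ` C)" "\<phi> ` C \<subseteq> X'"
    using C \<phi>_im by (auto intro: compact_continuous_image continuous_on_subset[OF \<phi>_cont])
  obtain j U where j: "j \<in> test_functions X'" "open U" "\<phi> ` C \<subseteq> U" "U \<subseteq> X'" "\<And>w. w \<in> U \<Longrightarrow> j w = 1"
    by (rule smooth_cutoff[OF op' cC]) blast
  define f where "f w = l w * j w" for w
  have f: "f \<in> test_functions X'" unfolding f_def by (rule test_functions_mult[OF j(1) l])
  obtain g h where w: "wgrad X (comp2 f a b) g h" using isometry_test(1)[OF f] by blast
  note bor = wgrad_Lploc[OF w, THEN Lploc_borel]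
  note [measurable] = bor
  have "integrable lborel (\<lambda>z. ind X z * ((g z)\<^sup>2 + (h z)\<^sup>2))"
  proof (rule Bochner_Integration.integrable_bound)
    show "integrable lborel (\<lambda>z. k * (ind X z * qform (\<alpha> z) (\<beta> z) (\<gamma> z) (g z) (h z)))"
      by (intro integrable_mult_right isometry_test(2)[OF f w])
    show "AE z in lborel. norm (ind X z * ((g z)\<^sup>2 + (h z)\<^sup>2)) \<le> norm (k * (ind X z * qform (\<alpha> z) (\<beta> z) (\<gamma> z) (g z) (h z)))"
      using elliptic
    proof eventually_elim
      case (elim z)
      show ?case
      proof (cases "z \<in> X")
        case True
        then have "((g z)\<^sup>2 + (h z)\<^sup>2) / k \<le> qform (\<alpha> z) (\<beta> z) (\<gamma> z) (g z) (h z)" using elim by blast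
        then have "(g z)\<^sup>2 + (h z)\<^sup>2 \<le> k * qform (\<alpha> z) (\<beta> z) (\<gamma> z) (g z) (h z)" using k by (simp add: divide_le_eq mult.commute)
        then show ?thesis using True by simp
      qed simp
    qed
  qed measurable
  then have L: "Lp 2 X g" "Lp 2 X h"
    unfolding integrable_sum_squares[OF bor(2,3) borel_coeff(4)] by blast+
  define V where "V = X \<inter> \<phi> -` U"
  have V: "open V" "C \<subseteq> V" "V \<subseteq> X"
    unfolding V_def using continuous_open_preimage[OF \<phi>_cont op j(2)] C(2) j(3) by auto
  have "wgrad V (comp2 l a b) g h"
  proof (rule wgrad_cong[OF V(1) wgrad_subset[OF w V(3)] comp2_borel[OF smooth_borel[OF l] borel_ab] bor(2,3)], rule AE_I2, intro impI conjI refl)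
    fix z assume "z \<in> V"
    then have "z \<in> X" "\<phi> z \<in> U" by (auto simp: V_def)
    then show "comp2 f a b z = comp2 l a b z" by (simp add: comp2_def \<Phi> f_def j(5))
  qed
  moreover have "Lploc 2 V g" "Lploc 2 V h"
    unfolding Lploc_def using bor(2,3) Lp_subset[OF L(1) order_trans[OF _ V(3)]] Lp_subset[OF L(2) order_trans[OF _ V(3)]] by simp_all
  ultimately show "\<exists>U g h. C \<subseteq> U \<and> W12 U (comp2 l a b) g h" 
    by (intro exI[of _ V] exI[of _ g] exI[of _ h]) (simp add: W12_def V(2))
qed

end

section \<open>The matrix D\<phi> A D\<phi>^T and its push-forward\<close>

locale isometric_homeo_grad = isometric_homeo X A \<alpha> \<beta> \<gamma> k X' \<phi> \<psi> for X A \<alpha> \<beta> \<gamma> k X' \<phi> \<psi> +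
  fixes a1 a2 b1 b2 :: "complex \<Rightarrow> real"
  assumes Wa: "W12 X a a1 a2" and Wb: "W12 X b b1 b2"
begin

lemma wg: "wgrad X a a1 a2" "wgrad X b b1 b2"
  using Wa Wb by (auto simp only: W12_def)

lemma borel_grad [measurable]: "a1 \<in> Borel" "a2 \<in> Borel"
  "b1 \<in> Borel" "b2 \<in> Borel"
  using wgrad_Lploc(2,3)[OF wg(1), THEN Lploc_borel] wgrad_Lploc(2,3)[OF wg(2), THEN Lploc_borel] by auto

text \<open>The entries of D\<phi> A D\<phi>^T, where D\<phi> has the rows (a1, a2) and (b1, b2);
  \<open>N x y\<close> is the quadratic form of this matrix.\<close>

definition m11 :: "complex \<Rightarrow> real" where "m11 z = qform (\<alpha> z) (\<beta> z) (\<gamma> z) (a1 z) (a2 z)"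
definition m12 :: "complex \<Rightarrow> real" where "m12 z = b1 z * (\<alpha> z * a1 z + \<beta> z * a2 z) + b2 z * (\<beta> z * a1 z + \<gamma> z * a2 z)"
definition m22 :: "complex \<Rightarrow> real" where "m22 z = qform (\<alpha> z) (\<beta> z) (\<gamma> z) (b1 z) (b2 z)"
definition N :: "real \<Rightarrow> real \<Rightarrow> complex \<Rightarrow> real" where "N x y z = m11 z * x\<^sup>2 + 2 * m12 z * x * y + m22 z * y\<^sup>2"

lemma borel_m [measurable]: "m11 \<in> Borel" "m12 \<in> Borel" "m22 \<in> Borel"
  unfolding m11_def[abs_def] m12_def[abs_def] m22_def[abs_def] qform_def by measurable

lemma N_qform: "qform (\<alpha> z) (\<beta> z) (\<gamma> z) (x * a1 z + y * b1 z) (x * a2 z + y * b2 z) = N x y z"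
  by (simp add: N_def m11_def m12_def m22_def qform_def power2_eq_square algebra_simps)

lemma N_lower: "AE z\<in>X in lborel. (\<forall>x y. ((x * a1 z + y * b1 z)\<^sup>2 + (x * a2 z + y * b2 z)\<^sup>2) / k \<le> N x y z)"
  using elliptic
proof eventually_elim
  case (elim z)
  then show ?case using N_qform[of z] by metis
qed

lemma N_nonneg: "AE z\<in>X in lborel. (\<forall>x y. N x y z \<ge> 0)"
  using N_lower
proof eventually_elim
  case (elim z)
  have "0 \<le> ((x * a1 z + y * b1 z)\<^sup>2 + (x * a2 z + y * b2 z)\<^sup>2) / k" for x y using k by simp
  then show ?case using elim order_trans by blast
qed

lemma N_test:
  assumes f: "f \<in> test_functions X'"
  shows "integrable lborel (\<lambda>z. ind X z * N (dx f (\<Phi> z)) (dy f (\<Phi> z)) z)"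
    and "(LBINT z. ind X z * N (dx f (\<Phi> z)) (dy f (\<Phi> z)) z) = (LBINT w. ind X' w * ((dx f w)\<^sup>2 + (dy f w)\<^sup>2))"
proof -
  have "smooth f" using f by (auto simp: test_functions_iff)
  note w = wgrad_chain[OF op this wg(1) a_cont wg(2) b_cont]
  show "integrable lborel (\<lambda>z. ind X z * N (dx f (\<Phi> z)) (dy f (\<Phi> z)) z)"
    using isometry_test(2)[OF f w] unfolding N_qform by (simp add: comp2_def)
  show "(LBINT z. ind X z * N (dx f (\<Phi> z)) (dy f (\<Phi> z)) z) = (LBINT w. ind X' w * ((dx f w)\<^sup>2 + (dy f w)\<^sup>2))"
    using isometry_test(3)[OF f w] unfolding N_qform by (simp add: comp2_def)
qed

text \<open>Testing with the oscillating functions \<open>j cos\<close> and \<open>j sin\<close> of the same plane wave and adding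
  cancels the mixed terms and isolates the zero-order part \<open>j\<^sup>2 N x y\<close>.\<close>

lemma N_weighted:
  assumes j: "j \<in> test_functions X'"
  shows "integrable lborel (\<lambda>z. ind X z * ((j (\<Phi> z))\<^sup>2 * N x y z))"
    and "(LBINT z. ind X z * ((j (\<Phi> z))\<^sup>2 * N x y z)) = (x\<^sup>2 + y\<^sup>2) * (LBINT w. ind X' w * (j w)\<^sup>2)"
proof -
  define c where "c w = cos (x * Re w + y * Im w)" for w
  define s where "s w = sin (x * Re w + y * Im w)" for w
  have cs: "smooth c" "smooth s" unfolding c_def s_def by (rule smooth_cos_ridge smooth_sin_ridge)+
  have sj: "smooth j" using j by (auto simp: test_functions_iff)
  have dcs: "dir_deriv v c = (\<lambda>w. - ((x * Re v + y * Im v) * s w))" "dir_deriv v s = (\<lambda>w. (x * Re v + y * Im v) * c w)" for v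
    using dir_deriv_ridge[of cos "\<lambda>x. - sin x" v x y 0] dir_deriv_ridge[of sin cos v x y 0]
    by (auto simp: c_def[abs_def] s_def[abs_def] intro!: derivative_eq_intros)
  note C = N_test[OF test_functions_mult[OF j cs(1)]] and S = N_test[OF test_functions_mult[OF j cs(2)]] and J = N_test[OF j]
  define C' where "C' z = N (dx (\<lambda>z. c z * j z) (\<Phi> z)) (dy (\<lambda>z. c z * j z) (\<Phi> z)) z" for z
  define S' where "S' z = N (dx (\<lambda>z. s z * j z) (\<Phi> z)) (dy (\<lambda>z. s z * j z) (\<Phi> z)) z" for z
  define J' where "J' z = N (dx j (\<Phi> z)) (dy j (\<Phi> z)) z" for z
  have one: "(c w)\<^sup>2 + (s w)\<^sup>2 = 1" for w by (simp add: c_def s_def)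
  have N2: "N (p * u + t * (- (x * q))) (p * v + t * (- (y * q))) z + N (q * u + t * (x * p)) (q * v + t * (y * p)) z
      = (p\<^sup>2 + q\<^sup>2) * (N u v z + t\<^sup>2 * N x y z)" for p q t u v z
    by (simp add: N_def power2_eq_square algebra_simps)
  have d: "dx (\<lambda>z. c z * j z) w = c w * dx j w + j w * (- (x * s w))" "dy (\<lambda>z. c z * j z) w = c w * dy j w + j w * (- (y * s w))"
    "dx (\<lambda>z. s z * j z) w = s w * dx j w + j w * (x * c w)" "dy (\<lambda>z. s z * j z) w = s w * dy j w + j w * (y * c w)" for w
    by (simp_all add: dir_deriv_mult_smooth[OF cs(1) sj] dir_deriv_mult_smooth[OF cs(2) sj] dcs)
  have eq: "C' z + S' z - J' z = (j (\<Phi> z))\<^sup>2 * N x y z" for z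
    unfolding C'_def S'_def J'_def d N2 one by simp
  have eqW: "(dx (\<lambda>z. c z * j z) w)\<^sup>2 + (dy (\<lambda>z. c z * j z) w)\<^sup>2 + ((dx (\<lambda>z. s z * j z) w)\<^sup>2 + (dy (\<lambda>z. s z * j z) w)\<^sup>2)
      - ((dx j w)\<^sup>2 + (dy j w)\<^sup>2) = (x\<^sup>2 + y\<^sup>2) * (j w)\<^sup>2" for w
  proof -
    have "(dx (\<lambda>z. c z * j z) w)\<^sup>2 + (dy (\<lambda>z. c z * j z) w)\<^sup>2 + ((dx (\<lambda>z. s z * j z) w)\<^sup>2 + (dy (\<lambda>z. s z * j z) w)\<^sup>2)
      = ((c w)\<^sup>2 + (s w)\<^sup>2) * ((dx j w)\<^sup>2 + (dy j w)\<^sup>2 + (x\<^sup>2 + y\<^sup>2) * (j w)\<^sup>2)"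
      unfolding d by (simp add: power2_eq_square algebra_simps)
    then show ?thesis unfolding one by simp
  qed
  note int = C(1)[folded C'_def] S(1)[folded S'_def] J(1)[folded J'_def]
  have e1: "ind X z * ((j (\<Phi> z))\<^sup>2 * N x y z) = ind X z * C' z + ind X z * S' z - ind X z * J' z" for z
    unfolding eq[symmetric] by (simp add: algebra_simps)
  show "integrable lborel (\<lambda>z. ind X z * ((j (\<Phi> z))\<^sup>2 * N x y z))"
    unfolding e1 using int by simp
  have iW: "integrable lborel (\<lambda>w. ind X' w * ((dx f w)\<^sup>2 + (dy f w)\<^sup>2))" if f: "f \<in> test_functions X'" for f
    using Lp_test(2)[OF f] f
    by (subst integrable_sum_squares) (auto simp: test_functions_iff intro: smooth_borel smooth_dir_deriv borel_open op')
  note iw = iW[OF test_functions_mult[OF j cs(1)]] iW[OF test_functions_mult[OF j cs(2)]] iW[OF j]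
  have "(LBINT z. ind X z * ((j (\<Phi> z))\<^sup>2 * N x y z))
      = (LBINT w. ind X' w * ((dx (\<lambda>z. c z * j z) w)\<^sup>2 + (dy (\<lambda>z. c z * j z) w)\<^sup>2)
        + ind X' w * ((dx (\<lambda>z. s z * j z) w)\<^sup>2 + (dy (\<lambda>z. s z * j z) w)\<^sup>2)
        - ind X' w * ((dx j w)\<^sup>2 + (dy j w)\<^sup>2))"
    unfolding e1 using int iw C(2)[folded C'_def] S(2)[folded S'_def] J(2)[folded J'_def] by simp
  also have "\<dots> = (LBINT w. (x\<^sup>2 + y\<^sup>2) * (ind X' w * (j w)\<^sup>2))"
  proof (rule Bochner_Integration.integral_cong[OF refl])
    fix w show "ind X' w * ((dx (\<lambda>z. c z * j z) w)\<^sup>2 + (dy (\<lambda>z. c z * j z) w)\<^sup>2)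
        + ind X' w * ((dx (\<lambda>z. s z * j z) w)\<^sup>2 + (dy (\<lambda>z. s z * j z) w)\<^sup>2)
        - ind X' w * ((dx j w)\<^sup>2 + (dy j w)\<^sup>2) = (x\<^sup>2 + y\<^sup>2) * (ind X' w * (j w)\<^sup>2)"
      using eqW[of w] by (cases "w \<in> X'") auto
  qed
  finally show "(LBINT z. ind X z * ((j (\<Phi> z))\<^sup>2 * N x y z)) = (x\<^sup>2 + y\<^sup>2) * (LBINT w. ind X' w * (j w)\<^sup>2)"
    by simp
qed

text \<open>The squares of cut-offs supported in shrinking neighbourhoods of K tend to its
  indicator. One fixed cut-off \<open>j0\<close>, equal to 1 on D, dominates them all.\<close>

lemma N_compact:
  assumes K: "compact K" "K \<subseteq> X'"
  shows "integrable lborel (\<lambda>z. ind X z * (ind K (\<Phi> z) * N x y z))"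
    and "(LBINT z. ind X z * (ind K (\<Phi> z) * N x y z)) = (x\<^sup>2 + y\<^sup>2) * measure lborel K"
proof -
  obtain d D where D: "d > 0" "compact D" "D \<subseteq> X'" "\<And>z w. z \<in> K \<Longrightarrow> dist z w < d \<Longrightarrow> w \<in> D" "K \<subseteq> interior D"
    by (rule compact_nbhd[OF K(1) op' K(2)]) blast
  obtain j0 U0 where j0: "j0 \<in> test_functions X'" "open U0" "D \<subseteq> U0" "U0 \<subseteq> X'" "\<And>w. w \<in> U0 \<Longrightarrow> j0 w = 1"
    by (rule smooth_cutoff[OF op' D(2,3)]) blast
  define V where "V n = (\<Union>v\<in>K. ball v (min d (1 / real (Suc n))))" for n
  have V: "open (V n)" "K \<subseteq> V n" "V n \<subseteq> D" for n
    using D(1,4) by (auto simp: V_def)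
  have "\<exists>j. j \<in> test_functions (V n) \<and> (\<forall>w\<in>K. j w = 1) \<and> (\<forall>w. 0 \<le> j w \<and> j w \<le> 1)" for n
  proof -
    obtain j U where "j \<in> test_functions (V n)" "open U" "K \<subseteq> U" "U \<subseteq> V n" "\<And>w. w \<in> U \<Longrightarrow> j w = 1" "\<And>w. 0 \<le> j w \<and> j w \<le> 1"
      by (rule smooth_cutoff[OF V(1) K(1) V(2)]) blast
    then show ?thesis by blast
  qed
  then obtain j where j: "\<And>n. j n \<in> test_functions (V n)" "\<And>n w. w \<in> K \<Longrightarrow> j n w = 1" "\<And>n w. 0 \<le> j n w \<and> j n w \<le> 1"
    by metis
  have jt: "j n \<in> test_functions X'" for n
    by (rule test_functions_mono[OF order_trans[OF V(3) D(3)] j(1)])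
  have bor: "j n \<in> Borel" "j0 \<in> Borel" for n
    using jt[of n] j0(1) by (auto simp: test_functions_iff intro: smooth_borel)
  note [measurable] = bor measurable_compose[OF borel_\<Phi> bor(1)] measurable_compose[OF borel_\<Phi> bor(2)] borel_compact[OF K(1)] borel_open[OF op']
  have [measurable]: "N x y \<in> Borel" unfolding N_def[abs_def] by measurable
  have dom: "(j n w)\<^sup>2 \<le> (j0 w)\<^sup>2" for n w
  proof (cases "w \<in> V n")
    case True
    then have "j0 w = 1" using V(3) j0(3,5) by blast
    then show ?thesis using j(3)[of n w] by (simp add: power_le_one)
  next
    case False
    then show ?thesis using test_zero_outside(1)[OF j(1)] by simp
  qed
  have lim: "(\<lambda>n. (j n w)\<^sup>2) \<longlonglongrightarrow> ind K w" for w
  proof (cases "w \<in> K")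
    case False
    then obtain e where e: "e > 0" "ball w e \<inter> K = {}"
      using compact_imp_closed[OF K(1)] by (metis Compl_iff disjoint_eq_subset_Compl open_Compl open_contains_ball)
    have "\<forall>\<^sub>F n in sequentially. 1 / real (Suc n) < e" using e(1) by real_asymp
    then have "\<forall>\<^sub>F n in sequentially. (j n w)\<^sup>2 = ind K w"
    proof eventually_elim
      case (elim n)
      have "w \<notin> V n"
      proof
        assume "w \<in> V n"
        then obtain v where "v \<in> K" "dist v w < 1 / real (Suc n)" by (auto simp: V_def)
        then have "v \<in> ball w e \<inter> K" using elim by (auto simp: dist_commute)
        then show False using e(2) by simp
      qed
      then show ?case using False test_zero_outside(1)[OF j(1)] by simp
    qed
    then show ?thesis by (rule tendsto_eventually)
  qed (simp add: j(2))
  have A: "integrable lborel (\<lambda>z. ind X z * (ind K (\<Phi> z) * N x y z))"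
    "(\<lambda>n. LBINT z. ind X z * ((j n (\<Phi> z))\<^sup>2 * N x y z)) \<longlonglongrightarrow> (LBINT z. ind X z * (ind K (\<Phi> z) * N x y z))"
  proof -
    have c: "AE z in lborel. (\<lambda>n. ind X z * ((j n (\<Phi> z))\<^sup>2 * N x y z)) \<longlonglongrightarrow> ind X z * (ind K (\<Phi> z) * N x y z)"
      by (intro AE_I2 tendsto_mult tendsto_const lim)
    have b: "AE z in lborel. norm (ind X z * ((j n (\<Phi> z))\<^sup>2 * N x y z)) \<le> ind X z * ((j0 (\<Phi> z))\<^sup>2 * N x y z)" for n
      using N_nonneg
    proof eventually_elim
      case (elim z)
      then have "N x y z \<ge> 0" if "z \<in> X" using that by blast
      then show ?case using dom[of n "\<Phi> z"] by (auto simp: indicator_def abs_mult intro: mult_right_mono)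
    qed
    have m: "(\<lambda>z. ind X z * (ind K (\<Phi> z) * N x y z)) \<in> borel_measurable lborel"
      "(\<lambda>z. ind X z * ((j n (\<Phi> z))\<^sup>2 * N x y z)) \<in> borel_measurable lborel" for n
      by measurable
    show "integrable lborel (\<lambda>z. ind X z * (ind K (\<Phi> z) * N x y z))"
      "(\<lambda>n. LBINT z. ind X z * ((j n (\<Phi> z))\<^sup>2 * N x y z)) \<longlonglongrightarrow> (LBINT z. ind X z * (ind K (\<Phi> z) * N x y z))"
      by (rule integrable_dominated_convergence[OF m N_weighted(1)[OF j0(1)] c b] integral_dominated_convergence[OF m N_weighted(1)[OF j0(1)] c b])+
  qed
  show "integrable lborel (\<lambda>z. ind X z * (ind K (\<Phi> z) * N x y z))" by (rule A(1))
  have "(\<lambda>n. LBINT w. ind X' w * (j n w)\<^sup>2) \<longlonglongrightarrow> (LBINT w. ind K w)"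
  proof (rule integral_dominated_convergence)
    have "Lp 2 X' j0" using Lp_test(1)[OF j0(1)] by simp
    then show "integrable lborel (\<lambda>w. ind X' w * (j0 w)\<^sup>2)"
      using Lp2_integrable[OF borel_open[OF op']] by blast
    show "AE w in lborel. (\<lambda>n. ind X' w * (j n w)\<^sup>2) \<longlonglongrightarrow> ind K w"
    proof (rule AE_I2)
      fix w
      have "(\<lambda>n. ind X' w * (j n w)\<^sup>2) \<longlonglongrightarrow> ind X' w * ind K w"
        by (intro tendsto_mult tendsto_const lim)
      then show "(\<lambda>n. ind X' w * (j n w)\<^sup>2) \<longlonglongrightarrow> ind K w"
        using K(2) by (cases "w \<in> K") (auto simp: subset_iff)
    qed
    show "AE w in lborel. norm (ind X' w * (j n w)\<^sup>2) \<le> ind X' w * (j0 w)\<^sup>2" for n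
      using dom[of n] by (intro AE_I2) (auto simp: indicator_def)
  qed measurable
  then have B: "(\<lambda>n. (x\<^sup>2 + y\<^sup>2) * (LBINT w. ind X' w * (j n w)\<^sup>2)) \<longlonglongrightarrow> (x\<^sup>2 + y\<^sup>2) * measure lborel K"
    using emeasure_compact_finite[OF K(1)] by (intro tendsto_mult tendsto_const) simp
  show "(LBINT z. ind X z * (ind K (\<Phi> z) * N x y z)) = (x\<^sup>2 + y\<^sup>2) * measure lborel K"
    by (rule LIMSEQ_unique[OF A(2)[unfolded N_weighted(2)[OF jt]] B])
qed

lemma N_change_var:
  assumes xy: "x\<^sup>2 + y\<^sup>2 > 0"
  shows "change_var X X' \<Phi> (\<lambda>z. N x y z / (x\<^sup>2 + y\<^sup>2))"
proof -
  let ?J = "\<lambda>z. N x y z / (x\<^sup>2 + y\<^sup>2)"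
  have [measurable]: "N x y \<in> Borel" unfolding N_def[abs_def] by measurable
  have cpt: "(NNINT z. ind X z * (ind K (\<Phi> z) * ennreal (?J z))) = emeasure lborel K"
    if K: "compact K" "K \<subseteq> X'" for K
  proof -
    have i: "integrable lborel (\<lambda>z. (ind X z * (ind K (\<Phi> z) * N x y z)) / (x\<^sup>2 + y\<^sup>2))"
      by (intro integrable_divide_zero N_compact K)
    have "(NNINT z. ind X z * (ind K (\<Phi> z) * ennreal (?J z)))
        = (NNINT z. ennreal ((ind X z * (ind K (\<Phi> z) * N x y z)) / (x\<^sup>2 + y\<^sup>2)))"
      by (rule nn_integral_cong) (auto simp: indicator_def)
    also have "\<dots> = ennreal (LBINT z. (ind X z * (ind K (\<Phi> z) * N x y z)) / (x\<^sup>2 + y\<^sup>2))"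
    proof (rule nn_integral_eq_integral[OF i])
      show "AE z in lborel. 0 \<le> (ind X z * (ind K (\<Phi> z) * N x y z)) / (x\<^sup>2 + y\<^sup>2)"
        using N_nonneg by eventually_elim (use xy in \<open>auto simp: indicator_def\<close>)
    qed
    also have "\<dots> = ennreal (measure lborel K)"
      using less_imp_neq[OF xy] by (simp add: N_compact(2)[OF K])
    also have "\<dots> = emeasure lborel K"
      using emeasure_compact_finite[OF K(1)] by (intro emeasure_eq_ennreal_measure[symmetric]) auto
    finally show ?thesis .
  qed
  show ?thesis
  proof (rule change_var_of_compact[OF borel_\<Phi> _ op op'])
    show "\<Phi> ` X \<subseteq> X'" using \<Phi> \<phi>_im by auto
    fix w assume "w \<in> X'"
    then obtain e where e: "e > 0" "cball w e \<subseteq> X'" using op' unfolding open_contains_cball by blast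
    have "(NNINT z. ind X z * (ind (ball w e) (\<Phi> z) * ennreal (?J z)))
        \<le> (NNINT z. ind X z * (ind (cball w e) (\<Phi> z) * ennreal (?J z)))"
      by (rule nn_integral_mono) (auto simp: indicator_def)
    also have "\<dots> = emeasure lborel (cball w e)" by (rule cpt[OF compact_cball e(2)])
    also have "\<dots> < \<infinity>" by (rule emeasure_lborel_cball_finite)
    finally have fin: "(NNINT z. ind X z * (ind (ball w e) (\<Phi> z) * ennreal (?J z))) < \<infinity>" .
    have sub: "ball w e \<subseteq> X'" using e(2) ball_subset_cball by blast
    show "\<exists>U. open U \<and> bounded U \<and> w \<in> U \<and> U \<subseteq> X' \<and>
        (NNINT z. ind X z * (ind U (\<Phi> z) * ennreal (?J z))) < \<infinity> \<and>
        (\<forall>K. compact K \<and> K \<subseteq> U \<longrightarrow> (NNINT z. ind X z * (ind K (\<Phi> z) * ennreal (?J z))) = emeasure lborel K)"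
    proof (intro exI[of _ "ball w e"] conjI allI impI fin sub)
      fix K assume "compact K \<and> K \<subseteq> ball w e"
      then show "(NNINT z. ind X z * (ind K (\<Phi> z) * ennreal (?J z))) = emeasure lborel K"
        using sub by (intro cpt) auto
    qed (use e in auto)
  qed measurable
qed

text \<open>All directions carry the same push-forward, so \<open>N x y = (x\<^sup>2 + y\<^sup>2) m11\<close>.\<close>

lemma conformal: "AE z\<in>X in lborel. m22 z = m11 z \<and> m12 z = 0"
proof -
  have u: "AE z\<in>X in lborel. N x y z / (x\<^sup>2 + y\<^sup>2) = N 1 0 z / (1\<^sup>2 + 0\<^sup>2)" if "x\<^sup>2 + y\<^sup>2 > 0" for x y
  proof (rule change_var_unique[OF homeo op op' \<Phi> _ _ N_change_var[OF that] N_change_var])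
    show "AE z\<in>X in lborel. N x y z / (x\<^sup>2 + y\<^sup>2) \<ge> 0 \<and> N 1 0 z / (1\<^sup>2 + 0\<^sup>2) \<ge> 0"
      using N_nonneg by eventually_elim (use that in auto)
  qed (simp_all add: N_def[abs_def])
  show ?thesis
    \<comment> \<open>The direction (0, 1) gives m22 = m11, and with it (1, 1) gives m12 =
      0.\<close>
    using u[of 0 1, simplified] u[of 1 1, simplified]
    by eventually_elim (auto simp: N_def)
qed

definition J :: "complex \<Rightarrow> real" where "J z = a1 z * b2 z - a2 z * b1 z"

lemma borel_J [measurable]: "J \<in> Borel"
  unfolding J_def[abs_def] by measurable

lemma m11_nonneg: "AE z\<in>X in lborel. m11 z \<ge> 0"
  using N_nonneg
proof eventually_elim
  case (elim z)
  show ?case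
  proof
    assume "z \<in> X"
    then have "N 1 0 z \<ge> 0" using elim by blast
    then show "m11 z \<ge> 0" by (simp add: N_def)
  qed
qed

text \<open>The determinant of D\<phi> A D\<phi>^T is J^2 since det A = 1, and it is m11^2 since the
  matrix is m11 times the identity.\<close>

lemma abs_J: "AE z\<in>X in lborel. \<bar>J z\<bar> = m11 z"
  using det conformal m11_nonneg
proof eventually_elim
  case (elim z)
  show ?case
  proof
    assume z: "z \<in> X"
    have "m11 z * m22 z - (m12 z)\<^sup>2 = (J z)\<^sup>2 * (\<alpha> z * \<gamma> z - \<beta> z * \<beta> z)"
      by (simp add: m11_def m12_def m22_def J_def qform_def power2_eq_square algebra_simps)
    then have "(J z)\<^sup>2 = (m11 z)\<^sup>2" using elim z by (simp add: power2_eq_square)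
    then have "J z = m11 z \<or> J z = - m11 z" by (simp add: power2_eq_iff)
    then show "\<bar>J z\<bar> = m11 z" using elim z by auto
  qed
qed

text \<open>On a small disc both J and m11 integrate to the area of its image: J by the degree
  formula with winding number 1, m11 by \<open>N_compact\<close>. As |J| = m11, the difference m11 -
  J is nonnegative, and its integral is 0.\<close>

lemma J_local:
  assumes o: "orientation_preserving X \<phi>" and z0: "z0 \<in> X"
  shows "\<exists>U. open U \<and> z0 \<in> U \<and> (AE z\<in>U in lborel. J z = m11 z)"
proof -
  obtain R where R: "R > 0" "cball z0 R \<subseteq> X" using op z0 unfolding open_contains_cball by blast
  obtain x0 x1 y0 y1 where xy: "x0 < x1" "y0 < y1" and Qb: "rect x0 x1 y0 y1 \<subseteq> ball z0 R"
    and zB: "z0 \<in> box (Complex x0 y0) (Complex x1 y1)"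
    by (rule open_rect_nbhd[OF open_ball, of z0 z0 R]) (use R(1) in auto)
  let ?Q = "rect x0 x1 y0 y1" and ?B = "box (Complex x0 y0) (Complex x1 y1)" and ?r = "rectpath (Complex x0 y0) (Complex x1 y1)"
  have Qc: "?Q \<subseteq> cball z0 R" using Qb ball_subset_cball by blast
  then have Q: "?Q \<subseteq> X" using R(2) by blast
  have BQ: "?B \<subseteq> ?Q" by (rule box_subset_cbox)
  note wn = winding_number_homeomorphism_rect(1,2)[OF homeo op' xy Q]
  have rQ: "path_image ?r = ?Q - ?B" using xy by (intro path_image_rectpath_cbox_minus_box) auto
  have rX: "path_image ?r \<subseteq> X" using rQ Q by blast
  have one: "winding_number (\<Phi> \<circ> ?r) w = 1" if "w \<in> \<phi> ` ?B" for w
  proof -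
    have "winding_number (\<Phi> \<circ> ?r) w = winding_number (\<phi> \<circ> ?r) w"
    proof (rule winding_number_cong)
      fix t :: real assume "0 \<le> t" "t \<le> 1"
      then have "?r t \<in> path_image ?r" by (auto simp: path_image_def)
      then show "(\<Phi> \<circ> ?r) t = (\<phi> \<circ> ?r) t" using \<Phi> rX by auto
    qed
    then show ?thesis using winding_number_orientation_rect[OF homeo op' o R xy Qc zB that] by simp
  qed
  have imr: "\<Phi> ` path_image ?r = \<phi> ` path_image ?r" using \<Phi> rX by (intro image_cong refl) auto
  obtain e where e: "e > 0" "cball z0 e \<subseteq> ?B" using zB open_box unfolding open_contains_cball by blast
  let ?D = "cball z0 e"
  have [measurable]: "?D \<in> sets borel" by simp
  define K where "K = \<phi> ` ?D"
  have DX: "?D \<subseteq> X" using e(2) BQ Q by blast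
  have K: "compact K" "K \<subseteq> \<phi> ` ?B" "K \<subseteq> X'"
    unfolding K_def using e(2) DX \<phi>_im continuous_on_subset[OF \<phi>_cont DX] by (auto intro: compact_continuous_image)
  have ind: "ind K (\<Phi> z) = (ind ?D z :: real)" if "z \<in> X" for z
  proof -
    have "inj_on \<phi> X" using homeo by (metis homeomorphism_def inj_onI)
    then have "\<phi> z \<in> K \<longleftrightarrow> z \<in> ?D" unfolding K_def by (rule inj_on_image_mem_iff[OF _ that DX])
    then show ?thesis using \<Phi>[OF that] by (simp add: indicator_def)
  qed
  have deg: "(LBINT z. ind ?Q z * (ind K (\<Phi> z) * J z)) = 1 * measure lborel K"
    unfolding J_def[abs_def]
  proof (rule degree_compact[OF op Wa a_cont Wb b_cont xy Q K(1,2) wn(2)])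
    show "\<phi> ` ?B \<inter> \<Phi> ` path_image ?r = {}" unfolding imr by (rule wn(1))
  qed (simp add: one)
  have e1: "ind ?Q z * (ind K (\<Phi> z) * J z) = ind ?D z * J z" for z
    using ind[of z] Q e(2) BQ DX by (cases "z \<in> ?Q"; cases "z \<in> ?D") (auto simp: subset_iff)
  have e2: "ind X z * (ind K (\<Phi> z) * N 1 0 z) = ind ?D z * m11 z" for z
    using ind[of z] DX by (cases "z \<in> X"; cases "z \<in> ?D") (auto simp: N_def subset_iff)
  have i1: "integrable lborel (\<lambda>z. ind ?D z * m11 z)" and v1: "(LBINT z. ind ?D z * m11 z) = measure lborel K"
    using N_compact[OF K(1,3), of 1 0] unfolding e2 by simp_all
  have v2: "(LBINT z. ind ?D z * J z) = measure lborel K" using deg unfolding e1 by simp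
  have i2: "integrable lborel (\<lambda>z. ind ?D z * J z)"
  proof (rule Bochner_Integration.integrable_bound[OF i1])
    show "AE z in lborel. norm (ind ?D z * J z) \<le> norm (ind ?D z * m11 z)"
      using abs_J by eventually_elim (use DX in \<open>auto simp: indicator_def\<close>)
  qed measurable
  define f where "f z = ind ?D z * m11 z - ind ?D z * J z" for z
  have i: "integrable lborel f" "(LBINT z. f z) = 0"
    unfolding f_def using i1 i2 v1 v2 by simp_all
  have nn: "AE z in lborel. 0 \<le> f z"
    using abs_J by eventually_elim (use DX in \<open>auto simp: f_def indicator_def\<close>)
  have "AE z in lborel. f z = 0" using integral_nonneg_eq_0_iff_AE[OF i(1) nn] i(2) by simp
  then have "AE z\<in>ball z0 e in lborel. J z = m11 z"
    by eventually_elim (auto simp: f_def indicator_def)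
  then show ?thesis using e(1) by (intro exI[of _ "ball z0 e"]) auto
qed

lemma J_eq: "orientation_preserving X \<phi> \<Longrightarrow> AE z\<in>X in lborel. J z = m11 z"
  by (rule AE_local) (rule J_local)

lemma beltrami:
  assumes "orientation_preserving X \<phi>"
  shows "AE z\<in>X in lborel. b2 z = \<alpha> z * a1 z + \<beta> z * a2 z \<and> b1 z = - (\<beta> z * a1 z + \<gamma> z * a2 z)"
  using J_eq[OF assms] conformal N_lower
proof eventually_elim
  case (elim z)
  show ?case
  proof
    assume z: "z \<in> X"
    define s where "s = \<alpha> z * a1 z + \<beta> z * a2 z"
    define t where "t = \<beta> z * a1 z + \<gamma> z * a2 z"
    have m: "m11 z = a1 z * s + a2 z * t" by (simp add: m11_def s_def t_def qform_def power2_eq_square algebra_simps)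
    have J: "a1 z * b2 z - a2 z * b1 z = m11 z" and m12: "b1 z * s + b2 z * t = 0" and m22: "m22 z = m11 z"
      using elim z by (auto simp: J_def m12_def s_def t_def)
    show "b2 z = s \<and> b1 z = - t"
    proof (cases "m11 z = 0")
      \<comment> \<open>Where m11 and m22 vanish, ellipticity makes all four derivatives
        vanish.\<close>
      case True
      have "((x * a1 z + y * b1 z)\<^sup>2 + (x * a2 z + y * b2 z)\<^sup>2) / k \<le> N x y z" for x y
        using elim z by blast
      from this[of 1 0] this[of 0 1] have "((a1 z)\<^sup>2 + (a2 z)\<^sup>2) / k \<le> 0" "((b1 z)\<^sup>2 + (b2 z)\<^sup>2) / k \<le> 0"
        using True m22 by (simp_all add: N_def)
      then have "(a1 z)\<^sup>2 + (a2 z)\<^sup>2 \<le> 0" "(b1 z)\<^sup>2 + (b2 z)\<^sup>2 \<le> 0"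
        using k by (simp_all add: divide_le_0_iff)
      then have "a1 z = 0" "a2 z = 0" "b1 z = 0" "b2 z = 0" by (simp_all add: sum_power2_le_zero_iff)
      then show ?thesis by (simp add: s_def t_def)
    next
      \<comment> \<open>J = m11 and the A-orthogonality of the rows are two linear equations for the
        second row; they are solved by Cramer's rule, with determinant m11.\<close>
      case False
      have "m11 z * (b2 z - s) = (a1 z * s + a2 z * t) * b2 z - m11 z * s" unfolding m[symmetric] by (simp add: algebra_simps)
      also have "\<dots> = (a1 z * s + a2 z * t) * b2 z - (a1 z * b2 z - a2 z * b1 z) * s" unfolding J ..
      also have "\<dots> = a2 z * (b1 z * s + b2 z * t)" by (simp add: algebra_simps)
      finally have 1: "b2 z = s" using False m12 by simp
      have "m11 z * (b1 z + t) = (a1 z * s + a2 z * t) * b1 z + m11 z * t" unfolding m[symmetric] by (simp add: algebra_simps)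
      also have "\<dots> = (a1 z * s + a2 z * t) * b1 z + (a1 z * b2 z - a2 z * b1 z) * t" unfolding J ..
      also have "\<dots> = a1 z * (b1 z * s + b2 z * t)" by (simp add: algebra_simps)
      finally have "b1 z + t = 0" using False m12 by simp
      then show ?thesis using 1 by simp
    qed
  qed
qed

text \<open>Stated with |J|, the estimate is independent of the orientation.\<close>

lemma distortion:
  "AE z\<in>X in lborel. (a1 z)\<^sup>2 + (a2 z)\<^sup>2 + (b1 z)\<^sup>2 + (b2 z)\<^sup>2 \<le> 2 * k * \<bar>J z\<bar>"
  using abs_J conformal N_lower
proof eventually_elim
  case (elim z)
  show ?case
  proof
    assume z: "z \<in> X"
    have "((x * a1 z + y * b1 z)\<^sup>2 + (x * a2 z + y * b2 z)\<^sup>2) / k \<le> N x y z" for x y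
      using elim z by blast
    from this[of 1 0] this[of 0 1] have "((a1 z)\<^sup>2 + (a2 z)\<^sup>2) / k \<le> m11 z" "((b1 z)\<^sup>2 + (b2 z)\<^sup>2) / k \<le> m11 z"
      using elim z by (simp_all add: N_def)
    then have "(a1 z)\<^sup>2 + (a2 z)\<^sup>2 \<le> m11 z * k" "(b1 z)\<^sup>2 + (b2 z)\<^sup>2 \<le> m11 z * k"
      using k by (simp_all add: pos_divide_le_eq)
    then show "(a1 z)\<^sup>2 + (a2 z)\<^sup>2 + (b1 z)\<^sup>2 + (b2 z)\<^sup>2 \<le> 2 * k * \<bar>J z\<bar>"
      using elim z by (simp add: algebra_simps)
  qed
qed

end

text \<open>The operator norm is bounded by the Hilbert-Schmidt norm, in which the distortion
  estimates are stated.\<close>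

lemma onorm_matrix_le:
  fixes M :: "real^2^2"
  shows "(onorm ((*v) M))\<^sup>2 \<le> (M $ 1 $ 1)\<^sup>2 + (M $ 1 $ 2)\<^sup>2 + (M $ 2 $ 1)\<^sup>2 + (M $ 2 $ 2)\<^sup>2"
proof -
  let ?F = "(M $ 1 $ 1)\<^sup>2 + (M $ 1 $ 2)\<^sup>2 + (M $ 2 $ 1)\<^sup>2 + (M $ 2 $ 2)\<^sup>2"
  have CS: "(p * x + q * y)\<^sup>2 \<le> (p\<^sup>2 + q\<^sup>2) * (x\<^sup>2 + y\<^sup>2)" for p q x y :: real
  proof -
    have "(p\<^sup>2 + q\<^sup>2) * (x\<^sup>2 + y\<^sup>2) - (p * x + q * y)\<^sup>2 = (p * y - q * x)\<^sup>2" by (simp add: power2_eq_square algebra_simps)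
    then show ?thesis using zero_le_power2[of "p * y - q * x"] by linarith
  qed
  have "norm (M *v v) \<le> sqrt ?F * norm v" for v
  proof -
    have "(norm (M *v v))\<^sup>2 = (M $ 1 $ 1 * v $ 1 + M $ 1 $ 2 * v $ 2)\<^sup>2 + (M $ 2 $ 1 * v $ 1 + M $ 2 $ 2 * v $ 2)\<^sup>2"
      unfolding norm_vec2 by (simp add: matrix_vector_mult_def sum_2)
    also have "\<dots> \<le> ((M $ 1 $ 1)\<^sup>2 + (M $ 1 $ 2)\<^sup>2) * ((v $ 1)\<^sup>2 + (v $ 2)\<^sup>2) + ((M $ 2 $ 1)\<^sup>2 + (M $ 2 $ 2)\<^sup>2) * ((v $ 1)\<^sup>2 + (v $ 2)\<^sup>2)"
      by (intro add_mono CS)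
    also have "\<dots> = ?F * (norm v)\<^sup>2" unfolding norm_vec2 by (simp add: algebra_simps)
    also have "\<dots> = (sqrt ?F * norm v)\<^sup>2" by (simp add: power_mult_distrib)
    finally show ?thesis by (rule power2_le_imp_le) simp
  qed
  then have "onorm ((*v) M) \<le> sqrt ?F" by (intro onorm_le)
  moreover have "0 \<le> onorm ((*v) M)"
    by (intro onorm_pos_le linear_conv_bounded_linear[THEN iffD1] matrix_vector_mul_linear)
  ultimately have "(onorm ((*v) M))\<^sup>2 \<le> (sqrt ?F)\<^sup>2" by (intro power_mono)
  then show ?thesis by simp
qed

lemma induces_isometry_imp_A_quasiconformal:
  assumes X: "open X" "open X'" and A: "A \<in> M22 X" and homeo: "homeomorphism X X' \<phi> \<psi>"
    and o: "orientation_preserving X \<phi>" and iso: "induces_isometry A X X' \<phi>"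
  shows "A_quasiconformal A X X' \<phi>"
proof -
  obtain \<alpha> \<beta> \<gamma> k where "matrix_field X A \<alpha> \<beta> \<gamma> k" using M22_matrix_field[OF X(1) A] .
  then interpret I: isometric_homeo X A \<alpha> \<beta> \<gamma> k X' \<phi> \<psi>
    using X(2) homeo iso by (simp add: isometric_homeo_def isometric_homeo_axioms_def)
  have c: "comp2 Re I.a I.b = I.a" "comp2 Im I.a I.b = I.b" by (auto simp: comp2_def)
  obtain a1 a2 b1 b2 where W: "W12 X I.a a1 a2" "W12 X I.b b1 b2"
    using I.coordinate_W12[OF smooth_Re] I.coordinate_W12[OF smooth_Im] unfolding c by metis
  interpret G: isometric_homeo_grad X A \<alpha> \<beta> \<gamma> k X' \<phi> \<psi> a1 a2 b1 b2
    by unfold_locales (rule W)+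
  have wl: "(\<lambda>z. Re (\<phi> z)) \<in> W12_loc X" "(\<lambda>z. Im (\<phi> z)) \<in> W12_loc X"
    using W12_loc_borel_rep[OF X(1) I.ab_rep(1) G.wg(1)] W12_loc_borel_rep[OF X(1) I.ab_rep(2) G.wg(2)] W
      Lploc_continuous[OF I.borel_ab(1) I.a_cont] Lploc_continuous[OF I.borel_ab(2) I.b_cont] by simp_all
  have r: "borel_rep X (\<lambda>z. weak_differential X \<phi> z $ 1 $ 1) a1" "borel_rep X (\<lambda>z. weak_differential X \<phi> z $ 1 $ 2) a2"
    "borel_rep X (\<lambda>z. weak_differential X \<phi> z $ 2 $ 1) b1" "borel_rep X (\<lambda>z. weak_differential X \<phi> z $ 2 $ 2) b2"
    using weak_gradient_borel_rep(2,3)[OF X(1) I.ab_rep(1) G.wg(1)] weak_gradient_borel_rep(2,3)[OF X(1) I.ab_rep(2) G.wg(2)]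
    by (simp_all add: weak_differential_def)
  have "AE z\<in>X in lborel. (onorm ((*v) (weak_differential X \<phi> z)))\<^sup>2 \<le> 2 * k * \<bar>Determinants.det (weak_differential X \<phi> z)\<bar>"
    using G.distortion r[unfolded borel_rep_def, THEN conjunct2]
  proof eventually_elim
    case (elim z)
    show ?case
    proof
      assume z: "z \<in> X"
      have "(onorm ((*v) (weak_differential X \<phi> z)))\<^sup>2 \<le> (a1 z)\<^sup>2 + (a2 z)\<^sup>2 + (b1 z)\<^sup>2 + (b2 z)\<^sup>2"
        using onorm_matrix_le[of "weak_differential X \<phi> z"] elim z by simp
      also have "\<dots> \<le> 2 * k * \<bar>G.J z\<bar>" using elim z by blast
      also have "G.J z = Determinants.det (weak_differential X \<phi> z)" using elim z by (simp add: G.J_def det_2)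
      finally show "(onorm ((*v) (weak_differential X \<phi> z)))\<^sup>2 \<le> 2 * k * \<bar>Determinants.det (weak_differential X \<phi> z)\<bar>" .
    qed
  qed
  then have "K_quasiconformal (2 * k) X X' \<phi>"
    unfolding K_quasiconformal_def AE_lebesgue_on_borel[OF I.borel_coeff(4)] using I.k homeo wl by auto
  then show ?thesis
    unfolding A_quasiconformal_def quasiconformal_def I.AE_beltrami_iff[OF r] using G.beltrami[OF o] by blast
qed

theorem theorem2p2:
  fixes \<Omega> \<Omega>' :: "complex set" and A :: "complex \<Rightarrow> real^2^2" and \<phi> :: "complex \<Rightarrow> complex"
  assumes "open \<Omega>" "connected \<Omega>" "\<Omega> \<noteq> {}"
    and "open \<Omega>'" "connected \<Omega>'" "\<Omega>' \<noteq> {}"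
    and "A \<in> M22 \<Omega>"
    and "\<exists>\<psi>. homeomorphism \<Omega> \<Omega>' \<phi> \<psi>"
  shows "(A_quasiconformal A \<Omega> \<Omega>' \<phi> \<longrightarrow> induces_isometry A \<Omega> \<Omega>' \<phi>) \<and>
         (orientation_preserving \<Omega> \<phi> \<and> induces_isometry A \<Omega> \<Omega>' \<phi> \<longrightarrow> A_quasiconformal A \<Omega> \<Omega>' \<phi>)"
  using A_quasiconformal_imp_induces_isometry induces_isometry_imp_A_quasiconformal assms by blast

end
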